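(* Let $0<\nu\le\frac12$ and let $\delta>0$ be fixed. Then there exist $n_0\in\mathbb N$ and $C>0$ such that for all $n\ge n_0$, every zero $z_{j,n}$ of $P_n$ outside the disks $D(0,n\delta)$ and $D(\pm n\pi i,n\delta)$ satisfies $$\left|\operatorname{Re} z_{j,n}-\frac{\nu\pi}{2}\right|\le C\epsilon_n,\qquad\text{where}\quad \epsilon_n=\frac{n^{\nu-1/2}}{(\log n)^{\nu+1/2}}.$$
   Context: $D(a,r)$ is the disk in $\mathbb C$ with center $a$ and radius $r$. Let $J_\nu$ be the Bessel function of order $\nu\ge 0$. The polynomials $P_n$ are the monic polynomials of degree $n$ that are "orthogonal with respect to $J_\nu$ on $[0,\infty)$" in the regularized sense: for $s>0$ let $P_n(\cdot;s)$ be the monic polynomial of degree $n$ with $\int_0^\infty P_n(x;s)x^jJ_\nu(x)e^{-sx}\,dx=0$ for $j=0,\dots,n-1$, and $P_n(x)=\lim_{s\to0+}P_n(x;s)$. Equivalently, with the regularized moments $$m_j=\lim_{s\to0+}\int_0^\infty x^jJ_\nu(x)e^{-sx}\,dx=2^j\,\frac{\Gamma(\frac{1+\nu+j}{2})}{\Gamma(\frac{1+\nu-j}{2})}$$ (with $1/\Gamma=0$ at the poles of $\Gamma$) and $\Delta_n=\det[m_{i+j}]_{i,j=0}^{n-1}$, the polynomial $P_n$ exists if and only if $\Delta_n\ne0$ (for $0<\nu\le\frac12$ this is the case for all $n$ large enough), and then $P_n(x)=\frac1{\Delta_n}\det M_n(x)$, where $M_n(x)$ is the $(n+1)\times(n+1)$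 matrix whose rows $i=0,\dots,n-1$ are $(m_i,m_{i+1},\dots,m_{i+n})$ and whose last row is $(1,x,\dots,x^n)$. *)

theory Defs
  imports "HOL-Analysis.Analysis" "HOL-Computational_Algebra.Polynomial"
begin

text \<open>The Bessel function of the first kind on the half-line, by its power series. Meant for
  \<open>x > 0\<close>, or \<open>x = 0\<close> and \<open>\<nu> > 0\<close>
  (for \<open>\<nu> = 0\<close> the convention \<open>0 powr 0 = 0\<close> gives the wrong value at the single point 0).\<close>
definition Bessel_J :: "real \<Rightarrow> real \<Rightarrow> real" where
  "Bessel_J \<nu> x =
     (\<Sum>k. (-1) ^ k / (fact k * Gamma (\<nu> + real k + 1)) * (x / 2) powr (2 * real k + \<nu>))"

definition monic_OP :: "real \<Rightarrow> real \<Rightarrow> nat \<Rightarrow> real poly \<Rightarrow> bool" where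
  "monic_OP \<nu> s n p \<longleftrightarrow>
     degree p = n \<and> lead_coeff p = 1 \<and>
     (\<forall>j<n. ((\<lambda>x. poly p x * x ^ j * Bessel_J \<nu> x * exp (- (s * x))) has_integral 0) {0..})"

text \<open>\<open>Bessel_OP \<nu> n P\<close>: the monic polynomial \<open>P\<^sub>n(\<sqdot>; s)\<close> is uniquely
  determined for all small \<open>s > 0\<close>, and \<open>P\<close> is its limit as \<open>s \<rightarrow> 0+\<close>.
  Such a \<open>P\<close> is unique, and it is again monic of degree \<open>n\<close>, because pointwise convergence of
  polynomials of bounded degree is convergence of the coefficients.\<close>
definition Bessel_OP :: "real \<Rightarrow> nat \<Rightarrow> real poly \<Rightarrow> bool" where
  "Bessel_OP \<nu> n P \<longleftrightarrow>
     (\<forall>\<^sub>F s in at_right 0. \<exists>!p. monic_OP \<nu> s n p) \<and>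
     (\<forall>x. ((\<lambda>s. poly (THE p. monic_OP \<nu> s n p) x) \<longlongrightarrow> poly P x) (at_right 0))"

definition zero_rate :: "real \<Rightarrow> nat \<Rightarrow> real" where
  "zero_rate \<nu> n = real n powr (\<nu> - 1/2) / ln (real n) powr (\<nu> + 1/2)"

end

theory Submission
  imports Defs "Jordan_Normal_Form.Determinant" "HOL-Complex_Analysis.Complex_Analysis"
    "HOL-Probability.Probability" "HOL-Real_Asymp.Real_Asymp"
begin

hide_const (open) module.smult

text \<open>With \<open>x = z/(\<pi>i)\<close> and \<open>X = x + i\<nu>/2\<close> the assertion becomes \<open>|Im X| \<le> C \<epsilon>\<^sub>n\<close>. The regularized moments of \<open>J\<^sub>\<nu>\<close> are those of the
  functional \<open>q \<mapsto> \<integral> q(x + i\<nu>/2) e\<^bsup>-i\<pi>\<nu> sgn(x)/2\<^esup> K\<^sub>\<nu>(\<pi>|x|) dx\<close>, whose weight takes values in a sector, so that it is coercive. Up to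
  a relative error \<open>O(1/x)\<close> this weight is the analytic continuation to \<open>Im X = \<nu>/2\<close> of \<open>|\<Gamma>(1/4 + ix)|\<^sup>2\<close>, for which the
  Meixner--Pollaczek polynomials are orthogonal. Hence \<open>P\<^sub>n\<close> is a small perturbation of a Meixner--Pollaczek polynomial,
  whose zeros are real by the Christoffel--Darboux formula; the same formula bounds \<open>Im X\<close> at a zero of the perturbed polynomial.\<close>

section \<open>Meixner--Pollaczek polynomials\<close>

text \<open>The weight |Gamma(l + ix)|^2 behaves like |x|^(2l - 1) e^(-pi |x|) and K_\<nu>(pi |x|)
  like |x|^(-1/2) e^(-pi |x|); this forces l = 1/4. After multiplication by the relative error 1/x
  the weight is dominated by a Meixner-Pollaczek weight with a parameter \<open>kappa\<close> close
  to 0, so that Parseval applies to the error as well: paired with two Meixner-Pollaczek polynomials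
  of degree about n it gives n^(-1) up to small powers, against squared norms n^(-1/2). Passing from
  coefficients on the real line to the norm on Im X = \<nu>/2 costs n^(\<nu>/2). All other losses
  are multiples of \<open>kappa\<close> = \<nu>/32; the outcome n^(3 \<nu>/4 - 1/2) lies below the
  claimed rate, and the remaining n^(\<nu>/4) pays for the logarithm. The excluded disks are the
  places where the argument degenerates: near X = 0 because of a division by X, near X = n and X =
  -n because the quadratic energy controlling the recurrence ceases to be definite. Coercivity also
  makes every Hankel determinant nonzero, so P_n exists for every n.\<close>

definition rbin :: "real => nat => real" where
 "rbin alpha k = pochhammer alpha k / fact k"

lemma rbin_0 [simp]: "rbin alpha 0 = 1"
 by (simp add: rbin_def)

lemma rbin_Suc: "rbin alpha (Suc k) = rbin alpha k * (alpha + k) / (real k + 1)"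
 by (simp add: rbin_def pochhammer_Suc add_ac)

lemma rbin_pos: "alpha > 0 ==> rbin alpha k > 0"
 by (simp add: rbin_def pochhammer_pos)

lemma rbin_nonneg: "alpha > 0 ==> rbin alpha k >= 0"
 using rbin_pos less_imp_le by blast

lemma pochhammer_fact_conv:
 fixes a b :: "'a :: field_char_0"
 shows "(\<Sum>k\<le>n. pochhammer a k / fact k * (pochhammer b (n - k) / fact (n - k)))
     = pochhammer (a + b) n / fact n"
proof -
 have "pochhammer (a + b) n = (\<Sum>k\<le>n. of_nat (n choose k) * pochhammer a k * pochhammer b (n - k))"
  by (rule pochhammer_binomial_sum)
 also have "... / fact n = (\<Sum>k\<le>n. pochhammer a k / fact k * (pochhammer b (n - k) / fact (n - k)))"
  unfolding sum_divide_distrib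
  by (intro sum.cong refl) (auto simp: binomial_fact field_simps)
 finally show ?thesis ..
qed

text \<open>Multiply (1 - t)^(-a) by (1 - t)^(-b). This exact stability under convolution is why
  \<open>rbin\<close>, rather than the power (k + 1)^(alpha - 1), carries the coefficient
  estimates.\<close>

lemma rbin_conv: "(\<Sum>k\<le>n. rbin a k * rbin b (n - k)) = rbin (a + b) n"
 unfolding rbin_def by (rule pochhammer_fact_conv)

lemma pos_convergent_bounds:
 fixes f :: "nat => real"
 assumes "f \<longlonglongrightarrow> L" "L > 0" "!!n. f n > 0"
 obtains c C where "c > 0" "C > 0" "!!n. c <= f n" "!!n. f n <= C"
proof -
 have "Bseq f" using assms(1) by (rule convergent_imp_Bseq[OF convergentI])
 then obtain C where C: "C > 0" "!!n. norm (f n) <= C" by (auto simp: Bseq_def)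
 have "(%n. inverse (f n)) \<longlonglongrightarrow> inverse L"
  using assms by (intro tendsto_intros) auto
 then have "Bseq (%n. inverse (f n))" by (rule convergent_imp_Bseq[OF convergentI])
 then obtain K where K: "K > 0" "!!n. norm (inverse (f n)) <= K" by (auto simp: Bseq_def)
 have "inverse K <= f n" for n
  using K(2)[of n] assms(3)[of n] K(1) by (simp add: field_simps)
 with C K show ?thesis
  by (intro that[of "inverse K" C]) (auto intro: order_trans[OF abs_ge_self])
qed

text \<open>By Gauss's product for Gamma, \<open>rbin alpha n\<close> divided by n^(alpha - 1) tends
  to 1 / Gamma(alpha); a positive sequence with a positive limit lies between two positive
  constants.\<close>

lemma rbin_bounds:
 assumes "alpha > 0"
 obtains c C where "c > 0" "C > 0" "!!k. c * (real k + 1) powr (alpha - 1) <= rbin alpha k"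
  "!!k. rbin alpha k <= C * (real k + 1) powr (alpha - 1)"
proof -
 define f where "f n = rbin alpha n / (real n + 1) powr (alpha - 1)" for n
 have 1: "(%n. Gamma_series' alpha n) \<longlonglongrightarrow> Gamma alpha" by (rule Gamma_series'_LIMSEQ)
 have 2: "(%n. (real n / (real n + 1)) powr (alpha - 1)) \<longlonglongrightarrow> 1"
  by real_asymp
 have 3: "(%n. (real n / (real n + 1)) powr (alpha - 1) / Gamma_series' alpha n) \<longlonglongrightarrow> 1 / Gamma alpha"
  using Gamma_real_pos[OF assms] by (intro tendsto_divide 1 2) auto
 have "f \<longlonglongrightarrow> 1 / Gamma alpha"
 proof (rule Lim_transform_eventually[OF 3])
  show "\<forall>\<^sub>F n in sequentially. (real n / (real n + 1)) powr (alpha - 1) / Gamma_series' alpha n = f n"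
   using eventually_gt_at_top[of 0]
  proof eventually_elim
   case (elim n)
   have *: "fact n = real n * fact (n - 1)" using elim by (simp add: fact_reduce)
   have **: "exp (alpha * ln n) = real n powr (alpha - 1) * n"
    using elim by (simp add: powr_def exp_diff field_simps left_diff_distrib)
   have "pochhammer alpha n > 0" using assms by (simp add: pochhammer_pos)
   then show ?case unfolding f_def Gamma_series'_def rbin_def using elim *
    by (simp add: ** powr_divide field_simps)
  qed
 qed
 moreover have "f n > 0" for n using rbin_pos[OF assms] by (simp add: f_def)
 moreover have "1 / Gamma alpha > 0" using assms by simp
 ultimately obtain c C where *: "c > 0" "C > 0" "!!n. c <= f n" "!!n. f n <= C"
  using pos_convergent_bounds by metis
 show ?thesis
 proof (rule that[OF *(1,2)])
  show "c * (real k + 1) powr (alpha - 1) <= rbin alpha k" "rbin alpha k <= C * (real k + 1) powr (alpha - 1)" for k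
   using *(3,4)[of k] by (auto simp: f_def field_simps)
 qed
qed

lemma prod_one_plus_le_exp_sum:
 fixes f :: "nat => real"
 assumes "!!i. f i >= 0"
 shows "(\<Prod>i<n. 1 + f i) <= exp (\<Sum>i<n. f i)"
proof -
 have "(\<Prod>i<n. 1 + f i) <= (\<Prod>i<n. exp (f i))"
  using assms by (intro prod_mono) (auto intro: add_nonneg_nonneg)
 then show ?thesis by (simp add: exp_sum)
qed

lemma summable_inverse_sq_shift:
 assumes "(alpha::real) > 0"
 shows "summable (%k. 1 / (alpha + real k)^2)"
proof -
 have "summable (%n. 1 / real n ^ 2)"
  using inverse_power_summable[of 2, where 'a = real] by (simp add: field_simps)
 then have "summable (%n. 1 / real (Suc n) ^ 2)" by (subst summable_Suc_iff)
 moreover have "\<forall>\<^sub>F n in sequentially. norm (1 / (alpha + real (Suc n))^2) <= 1 / real (Suc n) ^ 2"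
  using assms by (intro always_eventually allI) (auto intro!: divide_left_mono power_mono)
 ultimately have "summable (%n. 1 / (alpha + real (Suc n))^2)"
  by (rule summable_comparison_test_ev[rotated])
 then show ?thesis by (subst (asm) summable_Suc_iff)
qed

text \<open>Factor by factor: |c + j| exceeds alpha + j at most by a factor 1 + O((alpha + j)^(-2)),
  and the product of these factors converges. The constant depends on \<open>M\<close> and
  \<open>alpha\<close> only, which makes later bounds uniform in the point X.\<close>

lemma norm_pochhammer_le_rbin:
 assumes "alpha > 0" "M >= 0"
 obtains C where "C > 0"
  "!!(c::complex) j. norm c <= M ==> Re c <= alpha ==> norm (pochhammer c j / fact j) <= C * rbin alpha j"
proof -
 \<comment> \<open>The first summand covers the finitely many j \<le> \<open>M\<close>, where Re c +
   j may be negative; the second covers the contribution of Im c to |c + j| for larger j.\<close>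
 define K where "K = M * (alpha + M) + M^2"
 have K0: "K >= 0" using assms by (simp add: K_def)
 define S where "S = (\<Sum>k. K / (alpha + real k)^2)"
 have summ: "summable (%k. K / (alpha + real k)^2)"
  using summable_mult[OF summable_inverse_sq_shift[OF assms(1)], of K] by simp
 have step: "norm (c + of_nat j) <= (alpha + j) * (1 + K / (alpha + j)^2)" if "norm c <= M" "Re c <= alpha" for c :: complex and j
 proof -
  have pos: "alpha + j > 0" using assms by simp
  have "a * (1 + K / a^2) = a + K / a" if "a > 0" for a
   using that by (simp add: field_simps power2_eq_square)
  from this[OF pos] have expand: "(alpha + j) * (1 + K / (alpha + j)^2) = (alpha + j) + K / (alpha + j)" .
  show ?thesis
  proof (cases "real j <= M")
   case True
   have "M <= K / (alpha + j)"
   proof -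
    have "M * (alpha + j) <= M * (alpha + M)" using True assms by (intro mult_left_mono) auto
    also have "... <= K" by (simp add: K_def)
    finally show ?thesis using pos by (simp add: field_simps)
   qed
   moreover have "norm (c + of_nat j) <= M + j" using norm_triangle_ineq[of c "of_nat j"] that by simp
   ultimately show ?thesis unfolding expand using assms by linarith
  next
   case False
   have "\<bar>Re c\<bar> <= M" "\<bar>Im c\<bar> <= M" using that abs_Re_le_cmod[of c] abs_Im_le_cmod[of c] by linarith+
   then have "0 <= Re c + j" using False by linarith
   have "(norm (c + of_nat j))^2 = (Re c + j)^2 + (Im c)^2" by (simp add: cmod_power2)
   also have "... <= (alpha + j)^2 + M^2"
    using \<open>0 <= Re c + j\<close> that power_mono[OF \<open>\<bar>Im c\<bar> <= M\<close>, of 2] by (intro add_mono power_mono[of "Re c + j"]) auto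
   also have "... <= ((alpha + j) + M^2 / (alpha + j))^2"
   proof -
    have "2 * a * (M^2 / a) = 2 * M^2" if "a > 0" for a using that by simp
    from this[OF pos] have "2 * (alpha + j) * (M^2 / (alpha + j)) = 2 * M^2" .
    then show ?thesis unfolding power2_sum by (smt (verit) zero_le_power2)
   qed
   finally have "norm (c + of_nat j) <= (alpha + j) + M^2 / (alpha + j)"
    by (rule power2_le_imp_le) (use pos in auto)
   also have "M^2 / (alpha + j) <= K / (alpha + j)"
    using pos assms by (intro divide_right_mono) (auto simp: K_def)
   finally show ?thesis unfolding expand by simp
  qed
 qed
 have "norm (pochhammer c j / fact j) <= exp S * rbin alpha j" if c: "norm c <= M" "Re c <= alpha" for c :: complex and j
 proof -
  have "norm (pochhammer c j) = (\<Prod>i<j. norm (c + of_nat i))"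
   by (simp add: pochhammer_prod prod_norm atLeast0LessThan)
  also have "... <= (\<Prod>i<j. (alpha + i) * (1 + K / (alpha + i)^2))"
   using step[OF c] by (intro prod_mono) auto
  also have "... = pochhammer alpha j * (\<Prod>i<j. 1 + K / (alpha + i)^2)"
   by (simp add: prod.distrib pochhammer_prod atLeast0LessThan)
  also have "... <= pochhammer alpha j * exp S"
  proof (intro mult_left_mono)
   have "(\<Prod>i<j. 1 + K / (alpha + i)^2) <= exp (\<Sum>i<j. K / (alpha + i)^2)"
    using K0 by (intro prod_one_plus_le_exp_sum) auto
   also have "(\<Sum>i<j. K / (alpha + i)^2) <= S"
    unfolding S_def by (intro sum_le_suminf summ) (auto simp: K0)
   finally show "(\<Prod>i<j. 1 + K / (alpha + i)^2) <= exp S" by simp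
  qed (use assms in \<open>simp add: pochhammer_nonneg\<close>)
  finally show ?thesis by (simp add: norm_divide rbin_def field_simps)
 qed
 then show ?thesis by (intro that[of "exp S"]) auto
qed

text \<open>The coefficients of \<open>(1 - t\<sigma>)\<^sup>-\<^sup>c\<close> as a power series in \<open>\<sigma>\<close>.\<close>
definition binser :: "complex => complex => complex fps" where
 "binser t c = Abs_fps (%k. t ^ k * (pochhammer c k / fact k))"

lemma binser_nth: "fps_nth (binser t c) k = t ^ k * (pochhammer c k / fact k)"
 by (simp add: binser_def)

lemma binser_add: "binser t (c + d) = binser t c * binser t d"
proof (rule fps_ext)
 fix n
 have "fps_nth (binser t c * binser t d) n =
  (\<Sum>k\<le>n. t ^ n * (pochhammer c k / fact k * (pochhammer d (n - k) / fact (n - k))))"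
  unfolding fps_mult_nth binser_nth atLeast0AtMost
  by (intro sum.cong refl) (auto simp: power_add[symmetric] mult_ac simp flip: power_add)
 also have "... = t ^ n * (pochhammer (c + d) n / fact n)"
  unfolding sum_distrib_left[symmetric] pochhammer_fact_conv ..
 finally show "fps_nth (binser t (c + d)) n = fps_nth (binser t c * binser t d) n"
  by (simp add: binser_nth)
qed

lemma binser_0 [simp]: "binser t 0 = 1"
 by (rule fps_ext) (simp add: binser_nth pochhammer_0_left)

lemma binser_minus1: "binser t (-1) = 1 - fps_const t * fps_X"
proof (rule fps_ext)
 fix n
 have *: "pochhammer (-1::complex) n = (if n = 0 then 1 else if n = 1 then -1 else 0)" for n
 proof -
  consider "n = 0" | "n = 1" | k where "n = Suc (Suc k)" by (metis One_nat_def not0_implies_Suc)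
  then show ?thesis by cases (auto simp: pochhammer_rec)
 qed
 show "fps_nth (binser t (-1)) n = fps_nth (1 - fps_const t * fps_X) n"
  by (cases n) (auto simp: binser_nth * fps_X_def)
qed

lemma binser_pred: "binser t c = (1 - fps_const t * fps_X) * binser t (c + 1)"
 using binser_add[of t "-1" "c + 1"] by (simp add: binser_minus1)

lemma binser_pred_neg: "binser (- t) c = (1 + fps_const t * fps_X) * binser (- t) (c + 1)"
proof -
 have "fps_const (- t) = - fps_const t" by simp
 then show ?thesis using binser_pred[of "- t" c] by (simp only: mult_minus_left diff_minus_eq_add)
qed

lemma fps_const_ii: "fps_const \<i> * fps_const \<i> = - 1"
proof -
 have "fps_const \<i> * fps_const \<i> = fps_const (- 1)" by (simp only: fps_const_mult complex_i_mult_minus i_squared)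
 then show ?thesis by (simp only: fps_const_neg[symmetric] fps_const_1_eq_1)
qed

lemma binser_deriv: "fps_deriv (binser t c) = fps_const (t * c) * binser t (c + 1)"
proof (rule fps_ext)
 fix n
 have "pochhammer c (Suc n) = c * pochhammer (c + 1) n" by (rule pochhammer_rec)
 moreover have "of_nat (Suc n) / fact (Suc n) = (1 :: complex) / fact n"
  by (simp add: field_simps del: of_nat_Suc)
 ultimately have "of_nat (Suc n) * (t ^ Suc n * (pochhammer c (Suc n) / fact (Suc n)))
   = t * c * (t ^ n * (pochhammer (c + 1) n / fact n))"
  by (metis (no_types, opaque_lifting) mult.assoc mult.commute mult.left_commute power_Suc times_divide_eq_left times_divide_eq_right mult_1)
 then show "fps_nth (fps_deriv (binser t c)) n = fps_nth (fps_const (t * c) * binser t (c + 1)) n"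
  by (simp only: fps_deriv_nth Suc_eq_plus1[symmetric] binser_nth fps_mult_left_const_nth)
qed

text \<open>The generating function (1 - i s)^(-(l - iX)) (1 + i s)^(-(l + iX)) of the
  Meixner-Pollaczek polynomials with angle pi/2. As a formal power series in s it makes sense for
  every complex X, without a choice of branches.\<close>

definition mp_gen :: "real => complex => complex fps" where
 "mp_gen l X = binser \<i> (of_real l - \<i> * X) * binser (- \<i>) (of_real l + \<i> * X)"

definition mp :: "real => nat => complex => complex" where
 "mp l k X = fps_nth (mp_gen l X) k"

text \<open>The logarithmic derivative of (1 - i s)^(-c) (1 + i s)^(-d) has the denominator (1 - i
  s)(1 + i s) = 1 + s^2. Clearing it gives a differential equation with polynomial coefficients,
  that is, a three-term recurrence for the coefficients.\<close>

lemma binser_prod_ode: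
 "(1 + fps_X^2) * fps_deriv (binser \<i> c * binser (- \<i>) d)
  = (fps_const (\<i> * c - \<i> * d) - fps_const (c + d) * fps_X) * (binser \<i> c * binser (- \<i>) d)"
proof -
 let ?A = "binser \<i> (c + 1)" and ?B = "binser (-\<i>) (d + 1)"
 let ?i = "fps_const \<i>" and ?F = "binser \<i> c * binser (- \<i>) d"
 note ii = fps_const_ii
 have "fps_deriv ?F = fps_const (\<i> * c) * ?A * ((1 + ?i * fps_X) * ?B)
   + (1 - ?i * fps_X) * ?A * (fps_const (-\<i> * d) * ?B)"
  unfolding fps_deriv_mult binser_deriv
  unfolding binser_pred[of \<i> c] binser_pred_neg[of \<i> d] by (simp only: mult_ac add_ac)
 also have "... = (fps_const (\<i> * c - \<i> * d) + ?i * fps_X * fps_const (\<i> * (c + d))) * (?A * ?B)"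
 proof -
  have "fps_const (-\<i> * d) = - fps_const (\<i> * d)" by simp
  moreover have "fps_const (\<i> * c - \<i> * d) = fps_const (\<i> * c) - fps_const (\<i> * d)" by simp
  moreover have "fps_const (\<i> * (c + d)) = fps_const (\<i> * c) + fps_const (\<i> * d)" by (simp add: distrib_left)
  moreover have "a * A * ((1 + j * x) * B) + (1 - j * x) * A * (- b * B) = (a - b + j * x * (a + b)) * (A * B)"
   for a b A B j x :: "complex fps" by (simp add: algebra_simps)
  ultimately show ?thesis by (simp only:)
 qed
 also have "?i * fps_X * fps_const (\<i> * (c + d)) = - (fps_const (c + d) * fps_X)"
 proof -
  have "?i * fps_X * fps_const (\<i> * (c + d)) = (?i * ?i) * (fps_const (c + d) * fps_X)"
   by (simp only: fps_const_mult[symmetric] mult_ac)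
  then show ?thesis unfolding ii by simp
 qed
 finally have D: "fps_deriv ?F = (fps_const (\<i> * c - \<i> * d) - fps_const (c + d) * fps_X) * (?A * ?B)" by simp
 have "?F = ((1 - ?i * fps_X) * ?A) * ((1 + ?i * fps_X) * ?B)"
  unfolding binser_pred[of \<i> c] binser_pred_neg[of \<i> d] ..
 also have "... = ((1 - ?i * fps_X) * (1 + ?i * fps_X)) * (?A * ?B)" by (simp only: mult_ac)
 also have "(1 - ?i * fps_X) * (1 + ?i * fps_X) = 1 - (?i * ?i) * fps_X^2"
  by (simp add: algebra_simps power2_eq_square)
 finally have F: "?F = (1 + fps_X^2) * (?A * ?B)" by (simp add: ii)
 show ?thesis unfolding D by (subst F) (simp only: mult_ac)
qed

lemma mp_gen_ode:
 "(1 + fps_X^2) * fps_deriv (mp_gen l X) = (fps_const (2 * X) - fps_const (2 * of_real l) * fps_X) * mp_gen l X"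
proof -
 have "\<i> * (of_real l - \<i> * X) - \<i> * (of_real l + \<i> * X) = 2 * X"
  "of_real l - \<i> * X + (of_real l + \<i> * X) = 2 * of_real l" by (simp_all add: algebra_simps)
 then show ?thesis unfolding mp_gen_def using binser_prod_ode[of "of_real l - \<i> * X" "of_real l + \<i> * X"] by (simp only:)
qed

text \<open>The product is (1 + s^2)^(-d). With equal exponents the recurrence behind the
  differential equation loses its middle term and runs in steps of two.\<close>

lemma binser_sq_nth:
 "fps_nth (binser \<i> d * binser (- \<i>) d) n = (if even n then (-1) ^ (n div 2) * (pochhammer d (n div 2) / fact (n div 2)) else 0)"
proof (induction n rule: nat_less_induct)
 case (1 n)
 let ?F = "binser \<i> d * binser (- \<i>) d"
 consider "n = 0" | "n = Suc 0" | k where "n = k + 2" by (metis add_2_eq_Suc' not0_implies_Suc)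
 then show ?case
 proof cases
  case 1 then show ?thesis by (simp add: binser_nth)
 next
  case 2 then show ?thesis by (simp add: binser_nth fps_mult_nth)
 next
  case 3
  have sq: "fps_nth (fps_X^2 * f) (k + 1) = (if k = 0 then 0 else fps_nth f (k - 1))" for f :: "complex fps"
   by (cases k) (auto simp: power2_eq_square mult.assoc)
  have "fps_nth ((1 + fps_X^2) * fps_deriv f) (k + 1) = of_nat (k + 2) * fps_nth f (k + 2) + of_nat k * fps_nth f k" for f :: "complex fps"
   unfolding distrib_right fps_add_nth sq by auto
  from this[of ?F] have "fps_nth ((1 + fps_X^2) * fps_deriv ?F) (k + 1) = of_nat (k + 2) * fps_nth ?F (k + 2) + of_nat k * fps_nth ?F k" .
  moreover have "fps_nth ((fps_const a - fps_const b * fps_X) * f) (k + 1) = a * fps_nth f (k + 1) - b * fps_nth f k"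
   for a b and f :: "complex fps" by (simp add: left_diff_distrib mult.assoc)
  from this[of "\<i> * d - \<i> * d" "d + d" ?F]
  have "fps_nth ((1 + fps_X^2) * fps_deriv ?F) (k + 1) = (\<i> * d - \<i> * d) * fps_nth ?F (k + 1) - (d + d) * fps_nth ?F k"
   unfolding binser_prod_ode .
  ultimately have "of_nat (k + 2) * fps_nth ?F (k + 2) + of_nat k * fps_nth ?F k
    = (\<i> * d - \<i> * d) * fps_nth ?F (k + 1) - (d + d) * fps_nth ?F k" by (simp only:)
  moreover have "a * x = - ((b + 2 * d) * y)" if "a * x + b * y = (\<i> * d - \<i> * d) * w - (d + d) * y" for a b x y w
  proof -
  have "a * x = (a * x + b * y) - b * y" by simp
  also have "... = - ((b + 2 * d) * y)" unfolding that by (simp add: algebra_simps)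
  finally show ?thesis .
 qed
 ultimately have rec: "of_nat (k + 2) * fps_nth ?F (k + 2) = - ((of_nat k + 2 * d) * fps_nth ?F k)" by blast
  have IH: "fps_nth ?F k = (if even k then (-1) ^ (k div 2) * (pochhammer d (k div 2) / fact (k div 2)) else 0)"
   using 1 3 by auto
  have n0: "(of_nat (k + 2) :: complex) \<noteq> 0" by (subst of_nat_eq_0_iff) simp
  have "of_nat (k + 2) * fps_nth ?F (k + 2) = of_nat (k + 2) *
    (if even (k + 2) then (-1) ^ ((k + 2) div 2) * (pochhammer d ((k + 2) div 2) / fact ((k + 2) div 2)) else 0)"
  proof (cases "even k")
   case True
   then obtain j where j: "k = 2 * j" by (elim evenE)
   have "of_nat (k + 2) = 2 * (of_nat (Suc j) :: complex)" using j by simp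
   moreover have "of_nat (Suc j) * (pochhammer d (Suc j) / fact (Suc j)) = (d + of_nat j) * (pochhammer d j / fact j)"
    by (simp add: pochhammer_Suc field_simps del: of_nat_Suc)
   ultimately have "of_nat (k + 2) * ((-1) ^ (Suc j) * (pochhammer d (Suc j) / fact (Suc j)))
    = - (2 * (-1) ^ j * ((d + of_nat j) * (pochhammer d j / fact j)))"
    by (simp only: mult.assoc mult.left_commute[of "of_nat (Suc j)"] power_Suc) simp
   also have "... = - ((of_nat k + 2 * d) * ((-1) ^ j * (pochhammer d j / fact j)))"
   proof -
    have "- (2 * s * ((d + m) * p)) = - ((2 * m + 2 * d) * (s * p))" for s m p :: complex
     by (simp add: algebra_simps)
    moreover have "of_nat k = 2 * (of_nat j :: complex)" by (simp add: j)
    ultimately show ?thesis by (simp only:)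
   qed
   finally have "of_nat (k + 2) * ((-1) ^ (Suc j) * (pochhammer d (Suc j) / fact (Suc j)))
    = - ((of_nat k + 2 * d) * ((-1) ^ j * (pochhammer d j / fact j)))" .
   moreover have "(k + 2) div 2 = Suc j" "k div 2 = j" "even (k + 2)" "even k" using j by auto
   ultimately show ?thesis unfolding rec IH by (simp only: if_True)
  next
   case False
   then show ?thesis unfolding rec IH by simp
  qed
  then show ?thesis unfolding 3 mult_left_cancel[OF n0] .
 qed
qed

section \<open>Recurrence, difference equation and change of parameter\<close>

lemma mp_0 [simp]: "mp l 0 X = 1"
 by (simp add: mp_def mp_gen_def binser_nth)

lemma mp_1 [simp]: "mp l (Suc 0) X = 2 * X"
 by (simp add: mp_def mp_gen_def binser_nth fps_mult_nth algebra_simps)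

lemma mp_rec: "of_nat (k + 2) * mp l (k + 2) X = 2 * X * mp l (k + 1) X - (of_nat k + 2 * of_real l) * mp l k X"
proof -
 have sq: "fps_nth (fps_X^2 * f) (k + 1) = (if k = 0 then 0 else fps_nth f (k - 1))" for f :: "complex fps"
  by (cases k) (auto simp: power2_eq_square mult.assoc)
 have "fps_nth ((1 + fps_X^2) * fps_deriv (mp_gen l X)) (k + 1)
   = of_nat (k + 2) * mp l (k + 2) X + of_nat k * mp l k X"
  unfolding distrib_right fps_add_nth sq by (auto simp: mp_def)
 moreover have "fps_nth ((fps_const (2 * X) - fps_const (2 * of_real l) * fps_X) * mp_gen l X) (k + 1)
   = 2 * X * mp l (k + 1) X - 2 * of_real l * mp l k X"
  unfolding left_diff_distrib fps_sub_nth mp_def by (simp add: mult.assoc)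
 ultimately have "of_nat (k + 2) * mp l (k + 2) X + of_nat k * mp l k X
   = 2 * X * mp l (k + 1) X - 2 * of_real l * mp l k X" using mp_gen_ode[of l X] by simp
 then show ?thesis by (simp add: algebra_simps del: of_nat_add)
qed

text \<open>Shifting X by i or -i moves one unit between the two exponents, so the generating
  functions at X, X + i and X - i are 1 + s^2, (1 + i s)^2 and (1 - i s)^2 times one series
  \<open>?K\<close>. The combination on the left becomes 2 l F + 2 s F', whose coefficients carry
  the eigenvalue 2 (k + l). This difference operator is the source of orthogonality.\<close>

lemma mp_diffeq:
 "(of_real l - \<i> * X) * mp l k (X + \<i>) + (of_real l + \<i> * X) * mp l k (X - \<i>) = 2 * (of_nat k + of_real l) * mp l k X"
proof -
 define c d where "c = of_real l - \<i> * X" and "d = of_real l + \<i> * X"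
 let ?K = "binser \<i> (c + 1) * binser (-\<i>) (d + 1)"
 let ?i = "fps_const \<i>" and ?F = "mp_gen l X"
 note ii = fps_const_ii
 have p1: "binser \<i> c = (1 - ?i * fps_X) * binser \<i> (c + 1)" by (rule binser_pred)
 have p2: "binser \<i> (c - 1) = (1 - ?i * fps_X) * ((1 - ?i * fps_X) * binser \<i> (c + 1))"
  using binser_pred[of \<i> "c - 1"] p1 by simp
 have q1: "binser (-\<i>) d = (1 + ?i * fps_X) * binser (-\<i>) (d + 1)"
  by (rule binser_pred_neg)
 have q2: "binser (-\<i>) (d - 1) = (1 + ?i * fps_X) * ((1 + ?i * fps_X) * binser (-\<i>) (d + 1))"
  using binser_pred_neg[of \<i> "d - 1"] q1 by simp
 have F: "?F = (1 + fps_X^2) * ?K"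
 proof -
  have "?F = ((1 - ?i * fps_X) * (1 + ?i * fps_X)) * ?K"
   unfolding mp_gen_def c_def[symmetric] d_def[symmetric] p1 q1 by (simp only: mult_ac)
  also have "(1 - ?i * fps_X) * (1 + ?i * fps_X) = 1 - (?i * ?i) * fps_X^2"
   by (simp add: algebra_simps power2_eq_square)
  finally show ?thesis by (simp add: ii)
 qed
 have Fp: "mp_gen l (X + \<i>) = ((1 + ?i * fps_X)^2) * ?K"
 proof -
  have "of_real l - \<i> * (X + \<i>) = c + 1" "of_real l + \<i> * (X + \<i>) = d - 1"
   by (simp_all add: c_def d_def algebra_simps)
  then show ?thesis unfolding mp_gen_def by (simp add: q2 power2_eq_square mult_ac)
 qed
 have Fm: "mp_gen l (X - \<i>) = ((1 - ?i * fps_X)^2) * ?K"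
 proof -
  have "of_real l - \<i> * (X - \<i>) = c - 1" "of_real l + \<i> * (X - \<i>) = d + 1"
   by (simp_all add: c_def d_def algebra_simps)
  then show ?thesis unfolding mp_gen_def by (simp add: p2 power2_eq_square mult_ac)
 qed
 have D: "fps_deriv ?F = (fps_const (2 * X) - fps_const (2 * of_real l) * fps_X) * ?K"
 proof -
  have "(1 + fps_X^2) * fps_deriv ?F = (1 + fps_X^2) * ((fps_const (2 * X) - fps_const (2 * of_real l) * fps_X) * ?K)"
   unfolding mp_gen_ode by (subst F) (simp only: mult_ac)
  moreover have "(1 + fps_X^2 :: complex fps) \<noteq> 0"
  proof
   assume "(1 + fps_X^2 :: complex fps) = 0"
   then have "fps_nth (1 + fps_X^2 :: complex fps) 0 = fps_nth 0 0" by (rule arg_cong)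
   then show False by (simp add: power2_eq_square)
  qed
  ultimately show ?thesis by simp
 qed
 have sq1: "(1 + ?i * fps_X)^2 = 1 - fps_X^2 + 2 * ?i * fps_X"
 proof -
  have "(1 + ?i * fps_X)^2 = 1 + 2 * ?i * fps_X + (?i * ?i) * fps_X^2" by (simp add: algebra_simps power2_eq_square)
  then show ?thesis by (simp add: ii)
 qed
 have sq2: "(1 - ?i * fps_X)^2 = 1 - fps_X^2 - 2 * ?i * fps_X"
 proof -
  have "(1 - ?i * fps_X)^2 = 1 - 2 * ?i * fps_X + (?i * ?i) * fps_X^2" by (simp add: algebra_simps power2_eq_square)
  then show ?thesis by (simp add: ii)
 qed
 have cd: "fps_const c + fps_const d = fps_const (2 * of_real l)"
  by (simp add: c_def d_def)
 have cd2: "(fps_const c - fps_const d) * ?i = fps_const (2 * X)"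
  by (simp add: c_def d_def algebra_simps)
 have "fps_const c * mp_gen l (X + \<i>) + fps_const d * mp_gen l (X - \<i>)
   = ((fps_const c + fps_const d) * (1 - fps_X^2) + 2 * ((fps_const c - fps_const d) * ?i) * fps_X) * ?K"
  unfolding Fp Fm sq1 sq2 by (simp only: algebra_simps)
 also have "... = (fps_const (2 * of_real l) * (1 - fps_X^2) + 2 * fps_const (2 * X) * fps_X) * ?K"
  by (simp only: cd cd2)
 also have "... = fps_const (2 * of_real l) * ?F + 2 * fps_X * fps_deriv ?F"
  unfolding D by (subst F) (simp add: algebra_simps power2_eq_square)
 finally have eq: "fps_nth (fps_const c * mp_gen l (X + \<i>) + fps_const d * mp_gen l (X - \<i>)) k
   = fps_nth (fps_const (2 * of_real l) * ?F + 2 * fps_X * fps_deriv ?F) k" by simp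
 have "fps_nth (2 * fps_X * fps_deriv ?F) k = 2 * of_nat k * mp l k X"
  by (cases k) (auto simp: mp_def mult.assoc fps_numeral_nth numeral_fps_const)
 then show ?thesis using eq by (simp add: mp_def c_def d_def algebra_simps)
qed

text \<open>A new parameter and an imaginary translation only add constants to the two exponents, so
  the generating function is multiplied by a series free of x. Norms on shifted lines thereby reduce
  to the coefficients of that series.\<close>

lemma mp_connection:
 "mp l n (x + of_real eta * \<i>) = (\<Sum>k\<le>n. mp \<mu> k x *
   fps_nth (binser \<i> (of_real (l - \<mu> + eta)) * binser (-\<i>) (of_real (l - \<mu> - eta))) (n - k))"
proof -
 have *: "of_real l - \<i> * (x + of_real eta * \<i>) = (of_real \<mu> - \<i> * x) + of_real (l - \<mu> + eta)"
  "of_real l + \<i> * (x + of_real eta * \<i>) = (of_real \<mu> + \<i> * x) + of_real (l - \<mu> - eta)"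
  by (simp_all add: algebra_simps)
 have "mp_gen l (x + of_real eta * \<i>) = mp_gen \<mu> x * (binser \<i> (of_real (l - \<mu> + eta)) * binser (-\<i>) (of_real (l - \<mu> - eta)))"
  unfolding mp_gen_def * binser_add by (simp only: mult_ac)
 then show ?thesis by (simp add: mp_def fps_mult_nth atLeast0AtMost)
qed

lemma mp_cnj: "mp l k (cnj X) = cnj (mp l k X)"
proof (induction k rule: nat_less_induct)
 case (1 k)
 consider "k = 0" | "k = Suc 0" | j where "k = j + 2"
  by (metis One_nat_def add_2_eq_Suc' not0_implies_Suc)
 then show ?case
 proof cases
  case 3
  have "of_nat (j + 2) * mp l (j + 2) (cnj X) = of_nat (j + 2) * cnj (mp l (j + 2) X)"
   using arg_cong[OF mp_rec[of j l X], of cnj] mp_rec[of j l "cnj X"] 1[rule_format, of j] 1[rule_format, of "j + 1"] 3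
   by simp
  moreover have "(of_nat (j + 2) :: complex) \<noteq> 0" by (subst of_nat_eq_0_iff) simp
  ultimately show ?thesis unfolding 3 by (subst (asm) mult_left_cancel)
 qed auto
qed

lemma mp_poly:
 obtains q :: "complex poly" where "degree q = k" "lead_coeff q = 2 ^ k / fact k" "!!X. poly q X = mp l k X"
proof -
 have "\<exists>q. degree q = k \<and> lead_coeff q = 2 ^ k / fact k \<and> (\<forall>X. poly q X = mp l k X)"
 proof (induction k rule: nat_less_induct)
  case (1 k)
  consider "k = 0" | "k = Suc 0" | j where "k = j + 2"
   by (metis One_nat_def add_2_eq_Suc' not0_implies_Suc)
  then show ?case
  proof cases
   case 1 then show ?thesis by (intro exI[of _ 1]) auto
  next
   case 2 then show ?thesis by (intro exI[of _ "[:0, 2:]"]) auto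
  next
   case 3
   obtain p where p: "degree p = j" "!!X. poly p X = mp l j X"
    using 1[rule_format, of j] 3 by auto
   obtain r where r: "degree r = j + 1" "lead_coeff r = 2 ^ (j + 1) / fact (j + 1)" "!!X. poly r X = mp l (j + 1) X"
    using 1[rule_format, of "j + 1"] 3 by auto
   define a where "a = smult (2 / of_nat (j + 2)) (pCons 0 r)"
   define b where "b = smult ((of_nat j + 2 * of_real l) / of_nat (j + 2)) p"
   have n0: "(of_nat (j + 2) :: complex) \<noteq> 0" by (subst of_nat_eq_0_iff) simp
   have "r \<noteq> 0" using r(1) by auto
   then have da: "degree a = j + 2" unfolding a_def using n0 r(1) by (simp del: of_nat_add)
   have db: "degree b < degree a" unfolding da b_def using p(1) degree_smult_le[of _ p] by (simp add: le_imp_less_Suc less_Suc_eq_le order_trans)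
   have "degree (a - b) = j + 2" using degree_add_eq_left[of "-b" a] db da by simp
   moreover have "lead_coeff (a - b) = lead_coeff a"
    using lead_coeff_add_le[of "-b" a] db by simp
   moreover have "lead_coeff a = 2 ^ k / fact k"
    unfolding a_def lead_coeff_smult using \<open>r \<noteq> 0\<close> r(2) 3 by (simp add: field_simps)
   moreover have "poly (a - b) X = mp l (j + 2) X" for X
   proof -
    have "of_nat (j + 2) * poly (a - b) X = 2 * X * mp l (j + 1) X - (of_nat j + 2 * of_real l) * mp l j X"
     unfolding a_def b_def using n0 by (simp add: p(2) r(3) right_diff_distrib del: of_nat_add)
    also have "... = of_nat (j + 2) * mp l (j + 2) X" by (rule mp_rec[symmetric])
    finally show ?thesis using n0 by (subst (asm) mult_left_cancel) auto
   qed
   ultimately show ?thesis using 3 by (intro exI[of _ "a - b"]) auto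
  qed
 qed
 then show ?thesis using that by blast
qed

lemma mp_span:
 assumes "degree q < n"
 obtains c where "!!X. poly q X = (\<Sum>k<n. c k * mp l k X)"
proof -
 have "\<exists>c. \<forall>X. poly q X = (\<Sum>k<n. c k * mp l k X)"
  using assms
 proof (induction n arbitrary: q)
  case (Suc n)
  obtain p where p: "degree p = n" "lead_coeff p = 2 ^ n / fact n" "!!X. poly p X = mp l n X"
   using mp_poly by blast
  define a where "a = coeff q n / lead_coeff p"
  have pn0: "lead_coeff p \<noteq> 0" unfolding p(2) by simp
  define r where "r = q - smult a p"
  have rp: "poly q X = poly r X + a * mp l n X" for X by (simp add: r_def p(3))
  have cn: "coeff r n = 0" using pn0 by (simp add: r_def a_def p(1))
  have dr: "degree r <= n" unfolding r_def
   by (intro degree_diff_le) (use Suc.prems p(1) degree_smult_le[of a p] in auto)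
  show ?case
  proof (cases "n = 0")
   case True
   then have "r = 0" using dr cn by (metis leading_coeff_0_iff le_zero_eq)
   then show ?thesis using True rp by (intro exI[of _ "%_. a"]) simp
  next
   case False
   then have "degree r < n" using eq_zero_or_degree_less[OF dr cn] by auto
   then obtain c where c: "!!X. poly r X = (\<Sum>k<n. c k * mp l k X)" using Suc.IH by blast
   have "(\<Sum>k<n. (c(n := a)) k * mp l k X) = (\<Sum>k<n. c k * mp l k X)" for X
    by (intro sum.cong) auto
   then show ?thesis using rp c by (intro exI[of _ "c(n := a)"]) simp
  qed
 qed simp
 then show ?thesis using that by blast
qed

section \<open>Contour shifts\<close>

lemma integrable_exp_neg_abs: "integrable lborel (%x::real. exp (- \<bar>x\<bar>))"
proof -
 have 1: "set_integrable lborel {0..} (%x::real. exp (- x))"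
  using has_bochner_integral_I0i_power_exp_m'[of 0]
  by (auto simp: has_bochner_integral_iff set_integrable_def mult.commute)
 have "set_integrable lborel {..0} (%x::real. exp x)"
  using lborel_integrable_real_affine[OF 1[unfolded set_integrable_def], of "-1" 0]
  by (auto simp: set_integrable_def indicator_def mult.commute cong: if_cong)
 then have "integrable lborel (%x::real. indicator {0..} x *\<^sub>R exp (- x) + indicator {..0} x *\<^sub>R exp x)"
  using 1 by (simp add: set_integrable_def)
 then show ?thesis
  by (rule Bochner_Integration.integrable_bound) (auto simp: indicator_def split: if_splits)
qed

lemma integrable_exp_bound:
 fixes f :: "real => 'a :: {banach, second_countable_topology}"
 assumes "f \<in> borel_measurable borel" "!!x. norm (f x) <= B * exp (- \<bar>x\<bar>)"
 shows "integrable lborel f"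
proof (rule Bochner_Integration.integrable_bound[of _ "%x. B * exp (- \<bar>x\<bar>)"])
 show "AE x in lborel. norm (f x) <= norm (B * exp (- \<bar>x\<bar>))"
  using assms(2) by (intro AE_I2 order_trans[OF assms(2)]) auto
qed (use assms integrable_exp_neg_abs in auto)

lemma has_vector_derivative_Complex: "((%x. Complex x y) has_vector_derivative 1) (at x within {a..b})"
proof -
 have C: "Complex x y = of_real x + \<i> * of_real y" for x by (simp add: complex_eq_iff)
 have "((%x::real. complex_of_real x + \<i> * of_real y) has_vector_derivative (of_real 1 + 0)) (at x within {a..b})" 
  by (intro has_vector_derivative_add has_vector_derivative_const has_vector_derivative_of_real DERIV_ident)
 then show ?thesis by (simp add: C)
qed
lemma has_vector_derivative_horizontal: assumes 1: "(H has_field_derivative F (Complex x y)) (at (Complex x y))" 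
 shows "((%x. H (Complex x y)) has_vector_derivative F (Complex x y)) (at x within {a..b})"
   using field_vector_diff_chain_within[OF has_vector_derivative_Complex has_field_derivative_at_within[OF 1]] by (simp add: o_def)
lemma continuous_on_horizontal: assumes "continuous_on S F" and sub: "!!x. x \<in> {a..b} ==> Complex x y \<in> S" 
 shows "continuous_on {a..b} (%x. F (Complex x y))"
proof -
 have C: "Complex x y = of_real x + \<i> * of_real y" for x by (simp add: complex_eq_iff)
 have "continuous_on {a..b} (%x. Complex x y)" unfolding C by (intro continuous_intros)
 then show ?thesis by (rule continuous_on_compose2[OF assms(1)]) (use sub in auto)
qed

lemma segment_primitive_integral:
 assumes H: "!!z. z \<in> S ==> (H has_field_derivative F z) (at z within S)"
  and S: "open S" and ab: "a <= b" and sub: "!!x. x \<in> {a..b} ==> Complex x y \<in> S"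
  and F: "continuous_on S F"
 shows "(LBINT x:{a..b}. F (Complex x y)) = H (Complex b y) - H (Complex a y)"
proof -
 have 1: "((%x. F (Complex x y)) has_integral (H (Complex b y) - H (Complex a y))) {a..b}"
 proof (rule fundamental_theorem_of_calculus[OF ab, of "%x. H (Complex x y)"])
  fix x assume x: "x \<in> {a..b}"
  have "(H has_field_derivative F (Complex x y)) (at (Complex x y))"
   using H[OF sub[OF x]] unfolding at_within_open[OF sub[OF x] S] .
  then show "((%x. H (Complex x y)) has_vector_derivative F (Complex x y)) (at x within {a..b})"
   by (rule has_vector_derivative_horizontal)
 qed
 have 2: "set_integrable lborel {a..b} (%x. F (Complex x y))"
  by (rule borel_integrable_atLeastAtMost'[OF continuous_on_horizontal[OF F sub]])
 show ?thesis
  unfolding set_borel_integral_eq_integral(2)[OF 2] by (rule integral_unique[OF 1])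
qed

text \<open>A primitive on a convex domain replaces the contour around a rectangle: up to abscissa
  R, the difference of the horizontal integrals is the difference of the increments of the primitive
  over two vertical sides, and the side at R is exponentially small. Stating it with a closed
  segment allows shifts in both directions.\<close>

lemma half_line_shift:
 fixes F :: "complex => complex"
 assumes hol: "F holomorphic_on S" and S: "open S" "convex S"
  and seg: "!!x y. x >= r ==> y \<in> closed_segment a b ==> Complex x y \<in> S"
  and bnd: "!!x y. x >= r ==> y \<in> closed_segment a b ==> norm (F (Complex x y)) <= B * exp (- x)"
  and M: "!!y. y \<in> closed_segment a b ==> norm (F (Complex r y)) <= M"
 shows "set_integrable lborel {r..} (%x. F (Complex x a))"
  and "set_integrable lborel {r..} (%x. F (Complex x b))"
  and "norm ((LBINT x:{r..}. F (Complex x b)) - (LBINT x:{r..}. F (Complex x a))) <= M * \<bar>b - a\<bar>"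
proof -
 obtain H where H: "!!z. z \<in> S ==> (H has_field_derivative F z) (at z within S)"
  using holomorphic_convex_primitive'[OF S(2,1) hol] by blast
 have contF: "continuous_on S F" using hol by (rule holomorphic_on_imp_continuous_on)
 have C: "Complex x y = of_real x + \<i> * of_real y" for x y by (simp add: complex_eq_iff)
 have int: "set_integrable lborel {r..} (%x. F (Complex x y))" if y: "y \<in> closed_segment a b" for y
 proof -
  have cont: "continuous_on {r..} (%x. F (Complex x y))"
   unfolding C using seg[OF _ y]
   by (intro continuous_on_compose2[OF contF] continuous_intros) (auto simp: C)
  have "(%x. indicator {r..} x *\<^sub>R F (Complex x y)) \<in> borel_measurable borel"
   by (rule borel_measurable_continuous_on_indicator[OF _ cont]) auto
  \<comment> \<open>For x < 0 the bound exp(- x) is larger than exp(- |x|); since r \<le> x, the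
    factor exp(2 |r|) makes up for it.\<close>
  moreover have "norm (indicator {r..} x *\<^sub>R F (Complex x y)) <= (\<bar>B\<bar> * exp (2 * \<bar>r\<bar>)) * exp (- \<bar>x\<bar>)" for x
  proof (cases "x >= r")
   case True
   have "norm (F (Complex x y)) <= \<bar>B\<bar> * exp (- x)"
    by (rule order_trans[OF bnd[OF True y]]) (intro mult_right_mono, auto)
   also have "... <= \<bar>B\<bar> * (exp (2 * \<bar>r\<bar>) * exp (- \<bar>x\<bar>))"
    unfolding exp_add[symmetric] using True by (intro mult_left_mono) auto
   finally show ?thesis using True by (simp add: mult.assoc)
  qed auto
  ultimately show ?thesis unfolding set_integrable_def by (rule integrable_exp_bound)
 qed
 show ia: "set_integrable lborel {r..} (%x. F (Complex x a))" and ib: "set_integrable lborel {r..} (%x. F (Complex x b))"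
  by (auto intro!: int)
 have vert: "norm (H (Complex x b) - H (Complex x a)) <= K * \<bar>b - a\<bar>"
  if x: "x >= r" and K: "!!y. y \<in> closed_segment a b ==> norm (F (Complex x y)) <= K" for x K
 proof -
  let ?T = "(%y. Complex x y) ` closed_segment a b"
  have T: "?T = closed_segment (Complex x a) (Complex x b)"
   by (subst closed_segment_same_Re) (auto simp: image_iff complex_eq_iff)
  have "norm (H (Complex x b) - H (Complex x a)) <= K * norm (Complex x b - Complex x a)"
  proof (rule field_differentiable_bound[of ?T _ F])
   show "convex ?T" unfolding T by (rule convex_closed_segment)
   show "(H has_field_derivative F z) (at z within ?T)" if "z \<in> ?T" for z
    using that seg[OF x] by (intro DERIV_subset[OF H]) auto
  qed (use K in auto)
  also have "norm (Complex x b - Complex x a) = \<bar>b - a\<bar>"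
   by (simp add: cmod_def)
  finally show ?thesis .
 qed
 let ?D = "%R. (LBINT x:{r..R}. F (Complex x b)) - (LBINT x:{r..R}. F (Complex x a))"
 have lim: "(?D \<longlongrightarrow> (LBINT x:{r..}. F (Complex x b)) - (LBINT x:{r..}. F (Complex x a))) at_top"
  by (intro tendsto_diff tendsto_set_lebesgue_integral_at_top ia ib) auto
 have le: "norm (?D R) <= M * \<bar>b - a\<bar> + (B * exp (- R)) * \<bar>b - a\<bar>" if R: "R >= r" for R
 proof -
  have "?D R = (H (Complex R b) - H (Complex r b)) - (H (Complex R a) - H (Complex r a))"
   using segment_primitive_integral[OF H S(1) R _ contF, of a] segment_primitive_integral[OF H S(1) R _ contF, of b] seg
   by simp
  also have "... = (H (Complex R b) - H (Complex R a)) - (H (Complex r b) - H (Complex r a))" by simp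
  also have "norm ... <= (B * exp (- R)) * \<bar>b - a\<bar> + M * \<bar>b - a\<bar>"
   by (rule order_trans[OF norm_triangle_ineq4 add_mono]) (auto intro!: vert bnd M R)
  finally show ?thesis by simp
 qed
 show "norm ((LBINT x:{r..}. F (Complex x b)) - (LBINT x:{r..}. F (Complex x a))) <= M * \<bar>b - a\<bar>"
 proof (rule tendsto_le[OF _ _ tendsto_norm[OF lim]])
  show "((%R. M * \<bar>b - a\<bar> + (B * exp (- R)) * \<bar>b - a\<bar>) \<longlongrightarrow> M * \<bar>b - a\<bar>) at_top"
   by real_asymp
  show "\<forall>\<^sub>F R in at_top. norm (?D R) <= M * \<bar>b - a\<bar> + (B * exp (- R)) * \<bar>b - a\<bar>"
   using eventually_ge_at_top[of r] by eventually_elim (rule le)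
 qed auto
qed

text \<open>Reflecting the left part leaves integrals over right half-lines only, the form that the
  shift lemma handles.\<close>

lemma integral_split_half:
 fixes f :: "real => complex"
 assumes "integrable lborel f"
 shows "(LBINT x. f x) = (LBINT x:{r..}. f x) + (LBINT x:{-r..}. f (- x))"
proof -
 have si: "set_integrable lborel A f" if "A \<in> sets lborel" for A
  using assms that by (simp add: integrable_mult_indicator set_integrable_def)
 have U: "UNIV = {r..} \<union> {..<r}" by auto
 have "(LBINT x. f x) = (LBINT x:UNIV. f x)" by (simp add: set_lebesgue_integral_def)
 also have "... = (LBINT x:{r..}. f x) + (LBINT x:{..<r}. f x)"
  unfolding U by (rule set_integral_Un) (auto intro: si)
 also have "(LBINT x:{..<r}. f x) = (LBINT x:{-r..}. f (- x))"
 proof -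
  have m: "(%x. indicator {..<r} x *\<^sub>R f x) \<in> borel_measurable lborel"
   using si[of "{..<r}"] unfolding set_integrable_def by (intro borel_measurable_integrable) auto
  have m2: "(%x. indicator {..r} x *\<^sub>R f x) \<in> borel_measurable lborel"
   using si[of "{..r}"] unfolding set_integrable_def by (intro borel_measurable_integrable) auto
  have "(LBINT x:{..<r}. f x) = (LBINT x:{..r}. f x)"
   unfolding set_lebesgue_integral_def
  proof (rule integral_cong_AE[OF m m2])
   show "AE x in lborel. indicator {..<r} x *\<^sub>R f x = indicator {..r} x *\<^sub>R f x"
    using AE_lborel_singleton[of r] by eventually_elim (auto simp: indicator_def)
  qed
  also have "... = (LBINT x. indicator {-r..} x *\<^sub>R f (- x))"
  proof -
   have "indicator {..r} (- x) = (indicator {-r..} x :: real)" for x by (auto simp: indicator_def)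
   then show ?thesis unfolding set_lebesgue_integral_def
    using lborel_integral_real_affine[of "-1" "%x. indicator {..r} x *\<^sub>R f x" 0] by simp
  qed
  finally show ?thesis by (simp add: set_lebesgue_integral_def)
 qed
 finally show ?thesis .
qed

text \<open>Shift the half-line from abscissa r on: the vertical side left over costs at most a
  multiple of exp(- |r|), and r tends to minus infinity.\<close>

lemma full_line_shift:
 fixes F :: "complex => complex"
 assumes hol: "F holomorphic_on S" and S: "open S" "convex S"
  and seg: "!!x y. y \<in> closed_segment a b ==> Complex x y \<in> S"
  and bnd: "!!x y. y \<in> closed_segment a b ==> norm (F (Complex x y)) <= B * exp (- \<bar>x\<bar>)"
 shows "integrable lborel (%x. F (Complex x a))"
  and "integrable lborel (%x. F (Complex x b))"
  and "(LBINT x. F (Complex x b)) = (LBINT x. F (Complex x a))"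
proof -
 have contF: "continuous_on S F" using hol by (rule holomorphic_on_imp_continuous_on)
 have C: "Complex x y = of_real x + \<i> * of_real y" for x y by (simp add: complex_eq_iff)
 have int: "integrable lborel (%x. F (Complex x y))" if y: "y \<in> closed_segment a b" for y
 proof (rule integrable_exp_bound)
  have "continuous_on UNIV (%x. F (Complex x y))"
   unfolding C using seg[OF y]
   by (intro continuous_on_compose2[OF contF] continuous_intros) (auto simp: C)
  then show "(%x. F (Complex x y)) \<in> borel_measurable borel"
   by (rule borel_measurable_continuous_onI)
 qed (rule bnd[OF y])
 show i: "integrable lborel (%x. F (Complex x a))" "integrable lborel (%x. F (Complex x b))"
  by (auto intro!: int)
 have 1: "norm ((LBINT x:{r..}. F (Complex x b)) - (LBINT x:{r..}. F (Complex x a))) <= (B * exp (- \<bar>r\<bar>)) * \<bar>b - a\<bar>" for r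
 proof (rule half_line_shift(3)[OF hol S, where B = "\<bar>B\<bar> * exp (2 * \<bar>r\<bar>)"])
  fix x y assume x: "r <= x" and y: "y \<in> closed_segment a b"
  have "norm (F (Complex x y)) <= \<bar>B\<bar> * exp (- \<bar>x\<bar>)"
   by (rule order_trans[OF bnd[OF y]]) (intro mult_right_mono, auto)
  also have "... <= \<bar>B\<bar> * (exp (2 * \<bar>r\<bar>) * exp (- x))"
   unfolding exp_add[symmetric] using x by (intro mult_left_mono) auto
  finally show "norm (F (Complex x y)) <= \<bar>B\<bar> * exp (2 * \<bar>r\<bar>) * exp (- x)" by (simp add: mult.assoc)
 qed (use seg bnd in auto)
 have "((%R. (LBINT x:{-R..}. F (Complex x b)) - (LBINT x:{-R..}. F (Complex x a))) \<longlongrightarrow> 0) at_top"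
 proof (rule Lim_null_comparison)
  show "((%R. (B * exp (- \<bar>R\<bar>)) * \<bar>b - a\<bar>) \<longlongrightarrow> 0) at_top" by real_asymp
 qed (use 1[of "- _"] in auto)
 moreover have l: "((%R. (LBINT x:{-R..}. F (Complex x y))) \<longlongrightarrow> (LBINT x. F (Complex x y))) at_top"
  if "integrable lborel (%x. F (Complex x y))" for y
  unfolding set_lebesgue_integral_def
 proof (rule integral_dominated_convergence_at_top[where w = "%x. norm (F (Complex x y))"])
  show "AE x in lborel. ((%R. indicat_real {-R..} x *\<^sub>R F (Complex x y)) \<longlongrightarrow> F (Complex x y)) at_top"
  proof (intro AE_I2 tendsto_eventually)
   fix x :: real
   show "\<forall>\<^sub>F R in at_top. indicat_real {-R..} x *\<^sub>R F (Complex x y) = F (Complex x y)"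
    using eventually_ge_at_top[of "-x"] by eventually_elim auto
  qed
 qed (use that in \<open>auto simp: indicator_def intro!: always_eventually\<close>)
 ultimately have "(LBINT x. F (Complex x b)) - (LBINT x. F (Complex x a)) = 0"
  using tendsto_diff[OF l[OF i(2)] l[OF i(1)]] tendsto_unique trivial_limit_at_top_linorder by blast
 then show "(LBINT x. F (Complex x b)) = (LBINT x. F (Complex x a))" by simp
qed

section \<open>Bounds for the Gamma function\<close>

text \<open>By Gauss's product each side is a limit of products of (\<sigma> + k) / |\<sigma> + k +
  ix|, and every factor increases with \<sigma>. Decay known on one vertical line thereby passes to
  the lines on its left, and lower bounds pass to the lines on its right.\<close>

lemma cmod_Gamma_ratio_mono:
 assumes "0 < \<sigma>" "\<sigma> <= \<tau>"
 shows "cmod (Gamma (Complex \<sigma> x)) / Gamma \<sigma> <= cmod (Gamma (Complex \<tau> x)) / Gamma \<tau>"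
proof -
 define R where "R s n = cmod (Gamma_series' (Complex s x) n) / Gamma_series' s n" for s :: real and n
 have lim: "R s \<longlonglongrightarrow> cmod (Gamma (Complex s x)) / Gamma s" if "s > 0" for s
  unfolding R_def using Gamma_real_pos[OF that]
  by (intro tendsto_divide tendsto_norm Gamma_series'_LIMSEQ) auto
 have R: "R s n = (\<Prod>k<n. (s + k) / cmod (Complex (s + k) x))" if "s > 0" for s :: real and n :: nat
 proof -
  have p: "pochhammer s n > 0" using that by (simp add: pochhammer_pos)
  have "cmod (pochhammer (Complex s x) n) = (\<Prod>k<n. cmod (Complex (s + k) x))"
   unfolding pochhammer_prod atLeast0LessThan prod_norm
   by (intro prod.cong refl arg_cong[where f = cmod]) (simp add: complex_eq_iff)
  moreover have "pochhammer s n = (\<Prod>k<n. s + k)"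
   by (simp add: pochhammer_prod atLeast0LessThan)
  moreover have "cmod (fact (n - 1) * exp (Complex s x * of_real (ln (of_nat n)))) = fact (n - 1) * exp (s * ln (of_nat n))"
   by (simp add: norm_mult)
  ultimately show ?thesis
   unfolding R_def Gamma_series'_def norm_divide by (simp add: prod_dividef)
 qed
 have f: "u / cmod (Complex u x) <= v / cmod (Complex v x)" if "0 < u" "u <= v" for u v
 proof -
  have "u * cmod (Complex v x) <= v * cmod (Complex u x)"
  proof (rule power2_le_imp_le)
   have "u^2 <= v^2" using that by (intro power_mono) auto
   then have "u^2 * x^2 <= v^2 * x^2" by (intro mult_right_mono) auto
   then show "(u * cmod (Complex v x))^2 <= (v * cmod (Complex u x))^2"
    by (simp add: power_mult_distrib cmod_power2 algebra_simps)
  qed (use that in auto)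
  moreover have "cmod (Complex u x) > 0" "cmod (Complex v x) > 0" using that by (auto simp: complex_eq_iff)
  ultimately show ?thesis by (simp add: field_simps)
 qed
 show ?thesis
 proof (rule LIMSEQ_le[OF lim lim])
  show "\<exists>N. \<forall>n\<ge>N. R \<sigma> n <= R \<tau> n"
   using assms by (auto simp: R intro!: exI[of _ 0] prod_mono f)
 qed (use assms in auto)
qed

lemma cmod_Gamma_le_real: "0 < \<sigma> ==> cmod (Gamma (Complex \<sigma> x)) <= Gamma \<sigma>"
proof -
 assume s: "0 < \<sigma>"
 have "cmod (Gamma (Complex \<sigma> x)) = cmod (Gamma (Complex \<sigma> x))" ..
 have "(%n. cmod (Gamma_series' (Complex \<sigma> x) n)) \<longlonglongrightarrow> cmod (Gamma (Complex \<sigma> x))"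
  by (intro tendsto_norm Gamma_series'_LIMSEQ)
 moreover have "(%n. Gamma_series' \<sigma> n) \<longlonglongrightarrow> Gamma \<sigma>" by (rule Gamma_series'_LIMSEQ)
 moreover have "cmod (Gamma_series' (Complex \<sigma> x) n) <= Gamma_series' \<sigma> n" for n
 proof -
  have "pochhammer \<sigma> n <= cmod (pochhammer (Complex \<sigma> x) n)"
   unfolding pochhammer_prod atLeast0LessThan prod_norm[symmetric]
  proof (intro prod_mono conjI)
   show "\<sigma> + real k <= cmod (Complex \<sigma> x + of_nat k)" for k
    using complex_Re_le_cmod[of "Complex \<sigma> x + of_nat k"] by simp
  qed (use s in auto)
  then show ?thesis unfolding Gamma_series'_def norm_divide
   using s by (simp add: norm_mult frac_le pochhammer_pos)
 qed
 ultimately show ?thesis by (intro LIMSEQ_le) auto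
qed

text \<open>Reflection at a purely imaginary argument z, where Gamma(-z) is the conjugate of
  Gamma(z). This explicit value is the starting point of the decay estimates.\<close>

lemma cmod_Gamma_1_sq:
 assumes "x \<noteq> 0"
 shows "(cmod (Gamma (Complex 1 x)))^2 = pi * x / sinh (pi * x)"
proof -
 define z where "z = \<i> * of_real x"
 have z0: "z \<noteq> 0" using assms by (simp add: z_def)
 have "Gamma (z + 1) = z * Gamma z" using z0 by (intro Gamma_plus1) (auto simp: z_def complex_is_Int_iff elim!: nonpos_Ints_cases dest!: arg_cong[where f = Im])
 moreover have "z + 1 = Complex 1 x" by (simp add: z_def complex_eq_iff)
 ultimately have 1: "cmod (Gamma (Complex 1 x)) = \<bar>x\<bar> * cmod (Gamma z)" by (simp add: norm_mult z_def)
 have "cmod (Gamma (- z)) = cmod (Gamma z)"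
 proof -
  have "- z = cnj z" by (simp add: z_def)
  then show ?thesis by (metis cnj_Gamma complex_mod_cnj)
 qed
 moreover have "Gamma z * Gamma (- z) = - of_real pi / (z * sin (of_real pi * z))" by (rule Gamma_reflection_complex')
 ultimately have "(cmod (Gamma z))^2 = pi / (cmod z * cmod (sin (of_real pi * z)))"
  by (metis (no_types, opaque_lifting) abs_of_pos norm_divide norm_minus_cancel norm_mult norm_of_real pi_gt_zero power2_eq_square)
 moreover have "sin (of_real pi * z) = \<i> * of_real (sinh (pi * x))"
 proof -
  have "sin (of_real pi * z) = sin (\<i> * of_real (pi * x))" by (simp add: z_def mult_ac)
  also have "... = \<i> * sinh (of_real (pi * x))" by (simp add: sinh_conv_sin)
  also have "sinh (complex_of_real (pi * x)) = of_real (sinh (pi * x))"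
   by (simp add: sinh_field_def exp_of_real del: of_real_mult flip: of_real_minus)
  finally show ?thesis .
 qed
 ultimately have g2: "(cmod (Gamma z))^2 = pi / (\<bar>x\<bar> * \<bar>sinh (pi * x)\<bar>)" by (simp add: z_def norm_mult)
 have "(cmod (Gamma (Complex 1 x)))^2 = pi * \<bar>x\<bar> / \<bar>sinh (pi * x)\<bar>"
 proof -
  have "a^2 * (pi / (a * b)) = pi * a / b" if "a > 0" for a b :: real
   using that by (simp add: power2_eq_square)
  from this[of "\<bar>x\<bar>" "\<bar>sinh (pi * x)\<bar>"] show ?thesis
   unfolding 1 power_mult_distrib g2 using assms by simp
 qed
 also have "... = pi * x / sinh (pi * x)"
  using assms by (cases "x > 0") (auto simp: abs_if not_less mult_pos_neg sinh_real_neg_iff zero_less_mult_iff mult_less_0_iff)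
 finally show ?thesis .
qed

text \<open>On the line with real part 3 the modulus follows from real part 1 by two functional
  equations, and monotonicity of the ratio carries the decay to the left. The true rate is exp(- pi
  |x| / 2); the rate exp(- |x|) suffices for integrability and contour shifts and leaves room for
  polynomial factors.\<close>

lemma cmod_Gamma_decay:
 assumes "0 < s" "s <= 3"
 obtains B where "B > 0" "!!\<sigma> x. s <= \<sigma> ==> \<sigma> <= 3 ==> cmod (Gamma (Complex \<sigma> x)) <= B * exp (- \<bar>x\<bar>)"
proof -
 \<comment> \<open>This function times exp(- 2 x) dominates |Gamma(3 + ix)|^2 for x \<ge> 1, because
   3 < pi < 4.\<close>
 have "((%x::real. (2 + x) ^ 4 * (4 * x) * exp (2 * x) / sinh (3 * x)) \<longlongrightarrow> 0) at_top"
  by real_asymp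
 then have "\<forall>\<^sub>F x in at_top. (2 + x::real) ^ 4 * (4 * x) * exp (2 * x) / sinh (3 * x) < 1"
  by (rule order_tendstoD) auto
 then obtain X0 where X0: "!!x::real. x >= X0 ==> (2 + x) ^ 4 * (4 * x) * exp (2 * x) / sinh (3 * x) < 1"
  by (auto simp: eventually_at_top_linorder)
 define X where "X = max X0 1"
 have G3: "cmod (Gamma (Complex 3 x)) <= Gamma 3 * exp X * exp (- \<bar>x\<bar>)" for x
 proof (cases "\<bar>x\<bar> >= X")
  case False
  have "cmod (Gamma (Complex 3 x)) <= Gamma 3 * 1" using cmod_Gamma_le_real[of 3 x] by simp
  also have "... <= Gamma 3 * exp (X + - \<bar>x\<bar>)" using False by (intro mult_left_mono) auto
  finally show ?thesis unfolding exp_add by (simp add: mult.assoc)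
 next
  case True
  then have x1: "\<bar>x\<bar> >= 1" "\<bar>x\<bar> >= X0" by (auto simp: X_def)
  have x0: "x \<noteq> 0" using x1 by auto
  have ni: "Complex k x \<notin> \<int>\<^sub>\<le>\<^sub>0" for k using x0 by (auto elim!: nonpos_Ints_cases dest!: arg_cong[where f = Im])
  have "Gamma (Complex 3 x) = Complex 2 x * (Complex 1 x * Gamma (Complex 1 x))"
   using Gamma_plus1[OF ni[of 1]] Gamma_plus1[OF ni[of 2]]
   by (simp add: Complex_eq add_ac numeral_eq_Suc)
  then have "(cmod (Gamma (Complex 3 x)))^2 = (cmod (Complex 2 x))^2 * (cmod (Complex 1 x))^2 * (pi * x / sinh (pi * x))"
   by (simp add: norm_mult power_mult_distrib cmod_Gamma_1_sq[OF x0])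
  also have "pi * x / sinh (pi * x) = pi * \<bar>x\<bar> / sinh (pi * \<bar>x\<bar>)" by (auto simp: abs_if)
  also have "(cmod (Complex 2 x))^2 * (cmod (Complex 1 x))^2 * (pi * \<bar>x\<bar> / sinh (pi * \<bar>x\<bar>)) <= (2 + \<bar>x\<bar>)^2 * (2 + \<bar>x\<bar>)^2 * (pi * \<bar>x\<bar> / sinh (pi * \<bar>x\<bar>))"
   using norm_triangle_ineq[of 2 "\<i> * of_real x"] norm_triangle_ineq[of 1 "\<i> * of_real x"]
   by (intro mult_right_mono mult_mono power_mono) (auto simp: norm_mult Complex_eq)
  also have "... <= (2 + \<bar>x\<bar>)^2 * (2 + \<bar>x\<bar>)^2 * (4 * \<bar>x\<bar> / sinh (3 * \<bar>x\<bar>))"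
  proof (intro mult_left_mono frac_le)
   show "sinh (3 * \<bar>x\<bar>) <= sinh (pi * \<bar>x\<bar>)" using pi_gt3 by (simp add: mult_right_mono)
  qed (use pi_less_4 x1 in \<open>auto intro: mult_right_mono\<close>)
  also have "... = ((2 + \<bar>x\<bar>) ^ 4 * (4 * \<bar>x\<bar>) * exp (2 * \<bar>x\<bar>) / sinh (3 * \<bar>x\<bar>)) * exp (- (2 * \<bar>x\<bar>))"
  proof -
   have "a^2 * a^2 * (m / t) = (a ^ 4 * m * e / t) * inverse e" if "e \<noteq> 0" for a m e t :: real
    using that by (simp add: power4_eq_xxxx power2_eq_square)
   then show ?thesis unfolding exp_minus by simp
  qed
  also have "... <= 1 * exp (- (2 * \<bar>x\<bar>))" using X0[OF x1(2)] by (intro mult_right_mono) auto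
  also have "... = (exp (- \<bar>x\<bar>))^2" by (simp add: exp_double[symmetric])
  finally have "cmod (Gamma (Complex 3 x)) <= exp (- \<bar>x\<bar>)" by (rule power2_le_imp_le) auto
  then have "cmod (Gamma (Complex 3 x)) <= 1 * exp (- \<bar>x\<bar>)" by simp
  also have "... <= (Gamma 3 * exp X) * exp (- \<bar>x\<bar>)"
  proof (intro mult_right_mono)
   have "Gamma (3::real) = 2" using Gamma_fact[of 2, where 'a = real] by (simp add: numeral_eq_Suc)
   moreover have "exp X >= 1" by (simp add: X_def)
   then have "1 <= 2 * exp X" by linarith
   ultimately show "1 <= Gamma 3 * exp X" by (simp only:)
  qed auto
  finally show ?thesis by simp
 qed
 have "continuous_on {s..3} (Gamma :: real => real)"
  using assms by (intro continuous_on_Gamma) (auto elim!: nonpos_Ints_cases)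
 then have "bounded (Gamma ` {s..3} :: real set)"
  by (intro compact_imp_bounded compact_continuous_image) auto
 then obtain K where K: "K > 0" "!!\<sigma>. \<sigma> \<in> {s..3} ==> \<bar>Gamma \<sigma>\<bar> <= K"
  by (auto simp: bounded_pos)
 have "cmod (Gamma (Complex \<sigma> x)) <= (K * exp X) * exp (- \<bar>x\<bar>)" if "s <= \<sigma>" "\<sigma> <= 3" for \<sigma> x
 proof -
  have p: "Gamma \<sigma> > 0" using that assms by simp
  have "cmod (Gamma (Complex \<sigma> x)) <= Gamma \<sigma> * (cmod (Gamma (Complex 3 x)) / Gamma 3)"
   using cmod_Gamma_ratio_mono[of \<sigma> 3 x] that assms p by (simp add: field_simps)
  also have "... <= Gamma \<sigma> * (exp X * exp (- \<bar>x\<bar>))"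
   using G3[of x] p by (intro mult_left_mono) (auto simp: field_simps)
  also have "... <= K * (exp X * exp (- \<bar>x\<bar>))" using K(2)[of \<sigma>] that by (intro mult_right_mono) auto
  finally show ?thesis by (simp add: mult.assoc)
 qed
 with K show ?thesis by (intro that[of "K * exp X"]) auto
qed

text \<open>Multiplication by \<sigma> + ix moves to the line with real part \<sigma> + 1 \<ge> 1,
  where monotonicity compares with real part 1. The true power is |x|^(2 \<sigma> - 1), so 1/|x| is
  nearly sharp for small \<sigma>.\<close>

lemma cmod_Gamma_sq_lower:
 assumes "0 < \<sigma>" "\<sigma> <= 1"
 obtains c where "c > 0" "!!x. \<bar>x\<bar> >= 1 ==> c * exp (- pi * \<bar>x\<bar>) / \<bar>x\<bar> <= (cmod (Gamma (Complex \<sigma> x)))^2"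
proof -
 define c where "c = (Gamma (\<sigma> + 1))^2 * pi"
 have "c > 0" using assms Gamma_real_pos[of "\<sigma> + 1"] unfolding c_def by (intro mult_pos_pos zero_less_power) auto
 moreover have "c * exp (- pi * \<bar>x\<bar>) / \<bar>x\<bar> <= (cmod (Gamma (Complex \<sigma> x)))^2" if x: "\<bar>x\<bar> >= 1" for x
 proof -
  have x0: "x \<noteq> 0" using x by auto
  have ni: "Complex \<sigma> x \<notin> \<int>\<^sub>\<le>\<^sub>0" using x0 by (auto elim!: nonpos_Ints_cases dest!: arg_cong[where f = Im])
  have "Gamma (Complex (\<sigma> + 1) x) = Complex \<sigma> x * Gamma (Complex \<sigma> x)"
   using Gamma_plus1[OF ni] by (simp add: Complex_eq add_ac)
  then have 1: "(cmod (Gamma (Complex (\<sigma> + 1) x)))^2 = (\<sigma>^2 + x^2) * (cmod (Gamma (Complex \<sigma> x)))^2"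
   by (simp add: norm_mult power_mult_distrib cmod_power2)
  have g1: "Gamma (1::real) = 1" by simp
  have "cmod (Gamma (Complex 1 x)) <= cmod (Gamma (Complex (\<sigma> + 1) x)) / Gamma (\<sigma> + 1)"
   using cmod_Gamma_ratio_mono[of 1 "\<sigma> + 1" x] assms unfolding g1 by (simp del: Gamma_1)
  then have "Gamma (\<sigma> + 1) * cmod (Gamma (Complex 1 x)) <= cmod (Gamma (Complex (\<sigma> + 1) x))"
   using assms by (simp add: field_simps)
  then have "(Gamma (\<sigma> + 1) * cmod (Gamma (Complex 1 x)))^2 <= (cmod (Gamma (Complex (\<sigma> + 1) x)))^2"
   using assms by (intro power_mono) auto
  then have 2: "(Gamma (\<sigma> + 1))^2 * (pi * x / sinh (pi * x)) <= (\<sigma>^2 + x^2) * (cmod (Gamma (Complex \<sigma> x)))^2"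
   unfolding power_mult_distrib cmod_Gamma_1_sq[OF x0] 1 .
  have 3: "pi * x / sinh (pi * x) >= 2 * pi * \<bar>x\<bar> * exp (- pi * \<bar>x\<bar>)"
  proof -
   have "pi * x / sinh (pi * x) = pi * \<bar>x\<bar> / sinh (pi * \<bar>x\<bar>)" by (auto simp: abs_if)
   also have "... >= pi * \<bar>x\<bar> / (exp (pi * \<bar>x\<bar>) / 2)"
    using x by (intro divide_left_mono) (auto simp: sinh_def intro!: mult_pos_pos)
   finally show ?thesis by (simp add: exp_minus field_simps)
  qed
  have "\<sigma>^2 + x^2 <= 2 * \<bar>x\<bar>^2" using x assms
  proof -
   have "\<sigma>^2 <= \<bar>x\<bar>^2" using x assms by (intro power_mono) auto
   then show ?thesis by simp
  qed
  then have "(\<sigma>^2 + x^2) * (cmod (Gamma (Complex \<sigma> x)))^2 <= 2 * \<bar>x\<bar>^2 * (cmod (Gamma (Complex \<sigma> x)))^2"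
   by (intro mult_right_mono) auto
  moreover have "(Gamma (\<sigma> + 1))^2 * (2 * pi * \<bar>x\<bar> * exp (- pi * \<bar>x\<bar>)) <= (Gamma (\<sigma> + 1))^2 * (pi * x / sinh (pi * x))"
   using 3 by (intro mult_left_mono) auto
  ultimately have "(Gamma (\<sigma> + 1))^2 * (2 * pi * \<bar>x\<bar> * exp (- pi * \<bar>x\<bar>)) <= 2 * \<bar>x\<bar>^2 * (cmod (Gamma (Complex \<sigma> x)))^2"
   using 2 by linarith
  then have "(2 * \<bar>x\<bar>) * (c * exp (- pi * \<bar>x\<bar>)) <= (2 * \<bar>x\<bar>) * (\<bar>x\<bar> * (cmod (Gamma (Complex \<sigma> x)))^2)"
   unfolding c_def power2_eq_square by (simp only: mult_ac)
  then have "c * exp (- pi * \<bar>x\<bar>) <= \<bar>x\<bar> * (cmod (Gamma (Complex \<sigma> x)))^2"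
   using x by (subst (asm) mult_le_cancel_left_pos) auto
  moreover have "0 < \<bar>x\<bar>" using x by auto
  ultimately show ?thesis by (subst pos_divide_le_eq) (auto simp: mult.commute)
 qed
 ultimately show ?thesis using that by blast
qed

section \<open>The quotient Gamma(w) / Gamma(w + 1/2) in the right half-plane\<close>

definition gam_ratio :: "complex => complex" where
 "gam_ratio w = Gamma w * csqrt w / Gamma (w + 1/2)"

lemma csqrt_sector:
 assumes "Re s > 0"
 shows "\<bar>Im (csqrt s)\<bar> <= Re (csqrt s)" "Re (csqrt s) > 0"
proof -
 have sq: "(Re (csqrt s))^2 - (Im (csqrt s))^2 = Re s"
  using arg_cong[OF power2_csqrt[of s], of Re] by (simp add: power2_eq_square)
 have 0: "0 <= Re (csqrt s)" using csqrt_principal[of s] by auto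
 have "(Im (csqrt s))^2 <= (Re (csqrt s))^2" using sq assms by linarith
 then show "\<bar>Im (csqrt s)\<bar> <= Re (csqrt s)" using 0 by (simp add: abs_le_square_iff[symmetric])
 have "Re (csqrt s) \<noteq> 0" using sq assms by (smt (verit) zero_le_power2 zero_power2)
 then show "Re (csqrt s) > 0" using 0 by simp
qed

text \<open>Two numbers with arguments between -pi/4 and pi/4 have a nonnegative inner
  product.\<close>

lemma norm_add_sector:
 assumes "\<bar>Im p\<bar> <= Re p" "\<bar>Im q\<bar> <= Re q"
 shows "(cmod p)^2 + (cmod q)^2 <= (cmod (p + q))^2"
proof -
 have "\<bar>Im p * Im q\<bar> <= Re p * Re q"
  unfolding abs_mult using assms by (intro mult_mono) auto
 then show ?thesis unfolding cmod_power2 by (simp add: power2_eq_square algebra_simps)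
qed

text \<open>q - p = (q^2 - p^2) / (q + p), and inside the sector |q + p| \<ge> |q|. Square roots are
  thus compared through their squares.\<close>

lemma norm_diff_sector:
 assumes "\<bar>Im p\<bar> <= Re p" "\<bar>Im q\<bar> <= Re q" "q \<noteq> 0"
 shows "cmod (q - p) <= cmod (q^2 - p^2) / cmod q"
proof -
 have "(cmod q)^2 <= (cmod (p + q))^2" using norm_add_sector[OF assms(1,2)] by (smt (verit) zero_le_power2)
 then have "cmod q <= cmod (p + q)" by (rule power2_le_imp_le) auto
 then have "cmod (q - p) * cmod q <= cmod (q - p) * cmod (p + q)" by (intro mult_left_mono) auto
 also have "... = cmod (q^2 - p^2)" unfolding norm_mult[symmetric] by (simp add: power2_eq_square algebra_simps)
 finally show ?thesis using assms(3) by (simp add: field_simps)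
qed

text \<open>s + 1/2 is the arithmetic mean of s and s + 1, and the denominator is their geometric
  mean. With p and q the two square roots, the quotient minus 1 is (q - p)^2 / (2 p q), which is of
  second order since q - p = 1 / (p + q).\<close>

lemma half_step_factor_bound:
 assumes "Re s > 0"
 shows "cmod ((s + 1/2) / (csqrt s * csqrt (s + 1)) - 1) <= 1 / (4 * (cmod s)^2)"
proof -
 define p q where "p = csqrt s" and "q = csqrt (s + 1)"
 have sq: "p^2 = s" "q^2 = s + 1" by (simp_all add: p_def q_def)
 have sec: "\<bar>Im p\<bar> <= Re p" "\<bar>Im q\<bar> <= Re q" and pos: "Re p > 0" "Re q > 0"
  using csqrt_sector[of s] csqrt_sector[of "s + 1"] assms by (auto simp: p_def q_def)
 have n0: "p \<noteq> 0" "q \<noteq> 0" using pos by auto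
 have "(q - p) * (p + q) = 1" using sq by (simp add: power2_eq_square algebra_simps)
 then have m: "cmod (q - p) * cmod (p + q) = 1" by (simp flip: norm_mult)
 have e: "(s + 1/2) / (p * q) - 1 = (q - p)^2 / (2 * (p * q))"
 proof -
  have "2 * (s + 1/2) = p^2 + q^2" by (simp add: sq)
  then have "s + 1/2 = (p^2 + q^2) / 2" by (metis nonzero_mult_div_cancel_left zero_neq_numeral)
  moreover have "(p^2 + q^2) / 2 / (p * q) - 1 = (q - p)^2 / (2 * (p * q))"
   using n0 by (simp add: field_simps power2_eq_square)
  ultimately show ?thesis by (simp only:)
 qed
 have "cmod s <= cmod (s + 1)" using assms
  unfolding cmod_def by (intro real_sqrt_le_mono) (auto simp: power2_eq_square algebra_simps)
 then have "(cmod p)^2 <= (cmod q)^2" by (simp add: sq flip: norm_power)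
 then have pq: "cmod p <= cmod q" by (rule power2_le_imp_le) auto
 have "2 * (cmod p)^2 <= (cmod (p + q))^2"
  using norm_add_sector[OF sec] \<open>(cmod p)^2 <= (cmod q)^2\<close> by linarith
 then have "(cmod (q - p))^2 * (2 * (cmod p)^2) <= (cmod (q - p))^2 * (cmod (p + q))^2"
  by (intro mult_left_mono) auto
 also have "... = 1" using m by (metis power_mult_distrib power_one)
 finally have 1: "(cmod (q - p))^2 <= 1 / (2 * (cmod p)^2)" using n0 by (simp add: field_simps)
 have "cmod ((s + 1/2) / (p * q) - 1) = (cmod (q - p))^2 / (2 * (cmod p * cmod q))"
  unfolding e by (simp add: norm_divide norm_mult norm_power)
 also have "... <= (1 / (2 * (cmod p)^2)) / (2 * (cmod p * cmod p))"
  using 1 pq n0 by (intro frac_le mult_left_mono) auto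
 also have "... = 1 / (4 * (cmod s)^2)"
  by (simp add: power2_eq_square norm_mult flip: sq(1))
 finally show ?thesis by (simp add: p_def q_def)
qed

lemma not_nonpos_Ints_Re: "Re w > 0 ==> w \<notin> \<int>\<^sub>\<le>\<^sub>0"
 by (auto elim!: nonpos_Ints_cases)

lemma gam_ratio_step:
 assumes "Re w > 0"
 shows "gam_ratio w = (w + 1/2) / (csqrt w * csqrt (w + 1)) * gam_ratio (w + 1)"
proof -
 have w: "w \<noteq> 0" "w + 1/2 \<noteq> 0" "w + 1 \<noteq> 0" using assms by (auto simp: complex_eq_iff)
 have g: "Gamma (w + 1) = w * Gamma w" "Gamma (w + 1/2 + 1) = (w + 1/2) * Gamma (w + 1/2)"
  using assms by (intro Gamma_plus1 not_nonpos_Ints_Re; simp)+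
 have sq: "csqrt w * csqrt w = w" using power2_csqrt[of w] by (simp add: power2_eq_square)
 have e: "w + 1 + 1/2 = w + 1/2 + 1" by simp
 have n0: "csqrt w \<noteq> 0" "csqrt (w + 1) \<noteq> 0" using w by auto
 have "a / (p * q) * ((p * p * G) * q / (a * H)) = G * p / H" if "a \<noteq> 0" "p \<noteq> 0" "q \<noteq> 0" for a p q G H :: complex
  using that by simp
 from this[of "w + 1/2" "csqrt w" "csqrt (w + 1)" "Gamma w" "Gamma (w + 1/2)"] w n0
 show ?thesis unfolding gam_ratio_def e g sq by simp
qed

lemma gam_ratio_prod:
 assumes "Re w > 0"
 shows "gam_ratio w = (\<Prod>k<N. (w + of_nat k + 1/2) / (csqrt (w + of_nat k) * csqrt (w + of_nat k + 1))) * gam_ratio (w + of_nat N)"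
proof (induction N)
 case (Suc N)
 show ?case using gam_ratio_step[of "w + of_nat N"] assms Suc by (simp add: add_ac)
qed simp

lemma csqrt_of_real_mult:
 assumes "r > 0"
 shows "csqrt (of_real r * z) = of_real (sqrt r) * csqrt z"
proof (rule csqrt_unique)
 show "(of_real (sqrt r) * csqrt z)^2 = of_real r * z"
  using assms by (simp add: power_mult_distrib flip: of_real_power)
 show "0 < Re (of_real (sqrt r) * csqrt z) \<or> Re (of_real (sqrt r) * csqrt z) = 0 \<and> 0 <= Im (of_real (sqrt r) * csqrt z)"
  using csqrt_principal[of z] assms by auto
qed

text \<open>The factor csqrt w in \<open>gam_ratio\<close> is there to make this limit 1: in Gauss's
  product the shift by 1/2 produces sqrt N, which cancels against csqrt(w + N).\<close>

lemma gam_ratio_lim: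
 assumes "Re w > 0"
 shows "(%N. gam_ratio (w + of_nat N)) \<longlonglongrightarrow> 1"
proof -
 have ni: "w \<notin> \<int>\<^sub>\<le>\<^sub>0" "w + 1/2 \<notin> \<int>\<^sub>\<le>\<^sub>0" using assms by (auto intro!: not_nonpos_Ints_Re)
 have G0: "Gamma w \<noteq> 0" "Gamma (w + 1/2) \<noteq> 0" using ni by (auto simp: Gamma_eq_zero_iff)
 have "(%N. (Gamma w / Gamma_series' w N) * (Gamma_series' (w + 1/2) N / Gamma (w + 1/2)) * csqrt (1 + w / of_nat N))
   \<longlonglongrightarrow> (Gamma w / Gamma w) * (Gamma (w + 1/2) / Gamma (w + 1/2)) * csqrt (1 + 0)"
 proof (intro tendsto_mult tendsto_divide Gamma_series'_LIMSEQ tendsto_const G0)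
  have "(%N. 1 + w / of_nat N) \<longlonglongrightarrow> 1 + 0"
   by (intro tendsto_add tendsto_const lim_const_over_n)
  moreover have "isCont csqrt (1 + 0)" by (intro continuous_at_csqrt) auto
  ultimately show "(%N. csqrt (1 + w / of_nat N)) \<longlonglongrightarrow> csqrt (1 + 0)"
   by (rule isCont_tendsto_compose[rotated])
 qed
 then have L: "(%N. (Gamma w / Gamma_series' w N) * (Gamma_series' (w + 1/2) N / Gamma (w + 1/2)) * csqrt (1 + w / of_nat N)) \<longlonglongrightarrow> 1"
  using G0 by simp
 show ?thesis
 proof (rule Lim_transform_eventually[OF L])
  show "\<forall>\<^sub>F N in sequentially. (Gamma w / Gamma_series' w N) * (Gamma_series' (w + 1/2) N / Gamma (w + 1/2)) * csqrt (1 + w / of_nat N)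
    = gam_ratio (w + of_nat N)"
   using eventually_gt_at_top[of 0]
  proof eventually_elim
   case (elim N)
   have p0: "pochhammer w N \<noteq> 0" "pochhammer (w + 1/2) N \<noteq> 0"
    using ni by (auto simp: pochhammer_eq_0_iff)
   have g: "Gamma (w + of_nat N) = pochhammer w N * Gamma w" "Gamma (w + 1/2 + of_nat N) = pochhammer (w + 1/2) N * Gamma (w + 1/2)"
    using pochhammer_Gamma[OF ni(1), of N] pochhammer_Gamma[OF ni(2), of N] G0 by (auto simp: field_simps)
   define E where "E = exp (w * of_real (ln (real N)))"
   have sN: "exp (1/2 * of_real (ln (real N))) = (of_real (sqrt (real N)) :: complex)"
   proof -
    have "exp (1/2 * ln (real N)) = sqrt (real N)"
     using elim by (simp add: ln_sqrt[symmetric])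
    moreover have "exp (1/2 * of_real (ln (real N))) = (of_real (exp (1/2 * ln (real N))) :: complex)"
     unfolding exp_of_real[symmetric] by simp
    ultimately show ?thesis by (simp only:)
   qed
   have e2: "exp ((w + 1/2) * of_real (ln (real N))) = E * of_real (sqrt (real N))"
    by (simp only: E_def distrib_right exp_add sN)
   have cs: "csqrt (w + of_nat N) = of_real (sqrt (real N)) * csqrt (1 + w / of_nat N)"
   proof -
    have "w + of_nat N = of_real (real N) * (1 + w / of_nat N)" using elim by (simp add: field_simps)
    then show ?thesis using csqrt_of_real_mult[of "real N" "1 + w / of_nat N"] elim by simp
   qed
   have "E \<noteq> 0" "fact (N - 1) \<noteq> (0::complex)" by (auto simp: E_def)
   have "of_real (sqrt (real N)) \<noteq> (0::complex)" using elim by simp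
   have gen: "(Gw / (F * E / P)) * ((F * (E * r) / P2) / G2) * c = (P * Gw) * (r * c) / (P2 * G2)"
    if "F \<noteq> 0" "E \<noteq> 0" "P \<noteq> 0" for Gw F E P r P2 G2 c :: complex
    using that by (simp add: field_simps)
   have sh: "w + of_nat N + 1/2 = w + 1/2 + of_nat N" by simp
   have 1: "gam_ratio (w + of_nat N) = (pochhammer w N * Gamma w) * (of_real (sqrt (real N)) * csqrt (1 + w / of_nat N))
     / (pochhammer (w + 1/2) N * Gamma (w + 1/2))"
    unfolding gam_ratio_def sh g cs ..
   have 2: "Gamma_series' w N = fact (N - 1) * E / pochhammer w N"
    "Gamma_series' (w + 1/2) N = fact (N - 1) * (E * of_real (sqrt (real N))) / pochhammer (w + 1/2) N"
    unfolding Gamma_series'_def e2[symmetric] by (simp_all add: E_def)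
   show ?case unfolding 1 2 by (rule gen) (use p0 \<open>E \<noteq> 0\<close> in auto)
  qed
 qed
qed

lemma sum_inverse_sq_le:
 assumes "x >= (1::real)"
 shows "(\<Sum>k<N. 1 / ((real k)^2 + x^2)) <= 3 / x"
proof (cases N)
 case (Suc M)
 have t: "1 / ((real (Suc k))^2 + x^2) <= 2 / (real k + x) - 2 / (real (Suc k) + x)" for k
 proof -
  have p: "real k + x > 0" "real (Suc k) + x > 0" using assms by auto
  have "(real (Suc k) + x)^2 <= 2 * ((real (Suc k))^2 + x^2)"
   using zero_le_power2[of "real (Suc k) - x"] by (simp add: power2_eq_square algebra_simps)
  moreover have "(real k + x) * (real (Suc k) + x) <= (real (Suc k) + x)^2"
   unfolding power2_eq_square using p by (intro mult_right_mono) auto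
  ultimately have "(real k + x) * (real (Suc k) + x) <= 2 * ((real (Suc k))^2 + x^2)" by linarith
  then have "2 / (2 * ((real (Suc k))^2 + x^2)) <= 2 / ((real k + x) * (real (Suc k) + x))"
   using p by (intro divide_left_mono mult_pos_pos) (auto intro: add_pos_nonneg)
  also have "... = 2 / (real k + x) - 2 / (real (Suc k) + x)"
   using p by (simp add: field_simps)
  finally have "2 / (2 * ((real (Suc k))^2 + x^2)) <= 2 / (real k + x) - 2 / (real (Suc k) + x)" .
  moreover have "2 / (2 * a) = 1 / a" for a :: real by simp
  ultimately show ?thesis by (simp only:)
 qed
 have "(\<Sum>k<M. 1 / ((real (Suc k))^2 + x^2)) <= (\<Sum>k<M. 2 / (real k + x) - 2 / (real (Suc k) + x))"
  by (intro sum_mono t)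
 also have "... = 2 / x - 2 / (real M + x)"
  using sum_lessThan_telescope'[of "%k. 2 / (real k + x)" M] by simp
 also have "... <= 2 / x" using assms by simp
 finally have "(\<Sum>k<M. 1 / ((real (Suc k))^2 + x^2)) <= 2 / x" .
 moreover have "1 / x^2 <= 1 / x" using assms by (simp add: power2_eq_square field_simps)
 ultimately show ?thesis unfolding Suc sum.lessThan_Suc_shift by simp
qed (use assms in simp)

text \<open>A quantitative substitute for Stirling's formula: \<open>gam_ratio w\<close> is an
  infinite product of factors 1 + O(1 / (k^2 + x^2)) with x = |Im w|, and the errors sum to O(1/x),
  uniformly in Re w > 0.\<close>

lemma gam_ratio_bound:
 assumes "Re w > 0" "\<bar>Im w\<bar> >= 1"
 shows "cmod (gam_ratio w - 1) <= 3 / \<bar>Im w\<bar>"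
proof -
 define x where "x = \<bar>Im w\<bar>"
 have x: "x >= 1" using assms by (simp add: x_def)
 define f where "f k = (w + of_nat k + 1/2) / (csqrt (w + of_nat k) * csqrt (w + of_nat k + 1))" for k
 have fb: "cmod (f k - 1) <= 1 / 4 * (1 / ((real k)^2 + x^2))" for k
 proof -
  have "cmod (f k - 1) <= 1 / (4 * (cmod (w + of_nat k))^2)"
   unfolding f_def using assms by (intro half_step_factor_bound) auto
  also have "(real k)^2 + x^2 <= (cmod (w + of_nat k))^2"
   unfolding cmod_power2 x_def power2_abs using assms by (intro add_mono power_mono[of "real k"]) auto
  then have "1 / (4 * (cmod (w + of_nat k))^2) <= 1 / (4 * ((real k)^2 + x^2))"
  proof -
   have "0 < (real k)^2 + x^2" using x by (intro add_nonneg_pos) auto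
   then show ?thesis using \<open>(real k)^2 + x^2 <= (cmod (w + of_nat k))^2\<close> by (intro frac_le) auto
  qed
  finally show ?thesis by simp
 qed
 have pb: "cmod ((\<Prod>k<N. f k) - 1) <= 3 / x" for N
 proof -
  have "cmod ((\<Prod>k<N. 1 + (f k - 1)) - 1) <= (\<Prod>k<N. 1 + cmod (f k - 1)) - 1"
   by (rule norm_prod_minus1_le_prod_minus1)
  also have "(\<Prod>k<N. 1 + cmod (f k - 1)) <= (\<Prod>k<N. exp (cmod (f k - 1)))"
   by (intro prod_mono) (auto intro: add_nonneg_nonneg)
  also have "... = exp (\<Sum>k<N. cmod (f k - 1))" by (simp add: exp_sum)
  also have "(\<Sum>k<N. cmod (f k - 1)) <= 1 / 4 * (\<Sum>k<N. 1 / ((real k)^2 + x^2))"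
   unfolding sum_distrib_left by (intro sum_mono fb)
  also have "... <= 3 / 4 / x" using sum_inverse_sq_le[OF x, of N] by simp
  also have "exp (3 / 4 / x) - 1 <= 3 / x"
  proof -
   have "exp (- (3 / 4 / x)) >= 1 - 3 / 4 / x" using exp_ge_add_one_self[of "- (3 / 4 / x)"] by simp
   moreover have "1 - 3 / 4 / x > 0" using x by (simp add: field_simps)
   ultimately have "exp (3 / 4 / x) <= 1 / (1 - 3 / 4 / x)"
    by (simp add: exp_minus field_simps)
   also have "... = 1 + 3 / (4 * x - 3)" using x by (simp add: field_simps)
   also have "3 / (4 * x - 3) <= 3 / x" using x by (intro divide_left_mono) auto
   finally show ?thesis by simp
  qed
  finally show ?thesis by simp
 qed
 have "(%N. (\<Prod>k<N. f k)) \<longlonglongrightarrow> gam_ratio w / 1"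
 proof (rule Lim_transform_eventually[OF tendsto_divide[OF tendsto_const gam_ratio_lim[OF assms(1)]]])
  have "\<forall>\<^sub>F N in sequentially. gam_ratio (w + of_nat N) \<noteq> 0"
   by (rule tendsto_imp_eventually_ne[OF gam_ratio_lim[OF assms(1)]]) auto
  then show "\<forall>\<^sub>F N in sequentially. gam_ratio w / gam_ratio (w + of_nat N) = (\<Prod>k<N. f k)"
  proof eventually_elim
   case (elim N)
   then show ?case using gam_ratio_prod[OF assms(1), of N] by (simp add: f_def)
  qed
 qed auto
 then have "(%N. cmod ((\<Prod>k<N. f k) - 1)) \<longlonglongrightarrow> cmod (gam_ratio w - 1)"
  by (intro tendsto_intros) simp
 then show ?thesis
  unfolding x_def[symmetric] by (rule tendsto_upperbound) (auto intro!: always_eventually pb)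
qed

lemma norm_prod3_minus_1:
 fixes A B C :: complex
 assumes "cmod A <= 3 / x" "cmod B <= 3 / x" "cmod C <= 3 / x" "x >= 1"
 shows "cmod ((1 + A) * (1 + B) * (1 + C) - 1) <= 63 / x"
proof -
 define k where "k = 3 / x"
 have k: "0 <= k" "k <= 3" using assms(4) by (auto simp: k_def field_simps)
 have "(1 + A) * (1 + B) * (1 + C) - 1 = A + B + C + A * B + A * C + B * C + A * B * C"
  by (simp add: algebra_simps)
 also have "cmod ... <= cmod A + cmod B + cmod C + cmod A * cmod B + cmod A * cmod C + cmod B * cmod C + cmod A * cmod B * cmod C"
  unfolding norm_mult[symmetric] by (intro order_trans[OF norm_triangle_ineq] add_mono order_refl)
 also have "... <= k + k + k + k * k + k * k + k * k + k * k * k"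
  using assms k unfolding k_def[symmetric] by (intro add_mono mult_mono) auto
 also have "... <= k + k + k + 3 * k + 3 * k + 3 * k + 3 * 3 * k"
  using k by (intro add_mono mult_right_mono order_refl mult_mono) auto
 also have "... = 63 / x" by (simp add: k_def)
 finally show ?thesis .
qed

text \<open>Reflection evaluates Gamma(z) Gamma(1 - z), and 1 - z = w + 1/2 for the second argument
  w. The product is therefore pi / sin(pi z) times Gamma(w) / Gamma(w + 1/2), and the latter is
  \<open>gam_ratio w / csqrt w\<close>.\<close>

lemma Gamma_prod_asymp:
 assumes a: "0 <= a" "a <= 1/4" and x: "x >= 1"
 shows "cmod (Gamma (Complex a x) * Gamma (Complex (1/2 - a) (- x)) - of_real (2 * pi * exp (- pi * x) / sqrt x) * cis (pi * (a - 1/4)))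
   <= 400 * exp (- pi * x) / (x * sqrt x)"
proof -
 define z where "z = Complex a x"
 define w where "w = Complex (1/2 - a) (- x)"
 define u where "u = exp (\<i> * (of_real pi * z))"
 define p where "p = csqrt w"
 \<comment> \<open>\<open>q\<close> is the square root of -i x, the leading part of w, and
   contributes the phase -pi/4. The three relative errors are those of 1 / (1 - u^2), of
   \<open>gam_ratio w\<close> and of q / p.\<close>
 define q where "q = of_real (sqrt x) * cis (- (pi / 4))"
 have Rew: "Re w > 0" using a by (simp add: w_def)
 have w0: "w \<noteq> 0" "p \<noteq> 0" "q \<noteq> 0" using Rew x by (auto simp: p_def q_def)
 have u0: "u \<noteq> 0" by (simp add: u_def)
 have "1 - z = w + 1/2" by (simp add: z_def w_def complex_eq_iff)
 then have refl: "Gamma z * Gamma (w + 1/2) = of_real pi / sin (of_real pi * z)"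
  using Gamma_reflection_complex[of z] by simp
 have "w + 1/2 \<notin> \<int>\<^sub>\<le>\<^sub>0" using Rew by (intro not_nonpos_Ints_Re) simp
 then have "Gamma (w + 1/2) \<noteq> 0" by (simp add: Gamma_eq_zero_iff)
 then have Gw: "Gamma w = gam_ratio w * Gamma (w + 1/2) / p"
  using w0 by (simp add: gam_ratio_def p_def)
 have cu: "cmod u = exp (- pi * x)" by (simp add: u_def z_def)
 have u2: "cmod (u^2) = exp (- (2 * pi * x))"
  by (simp only: norm_power cu exp_double[symmetric]) simp
 have small: "exp (- (2 * pi * x)) < 1" using x pi_gt_zero by simp
 have u21: "1 - u^2 \<noteq> 0" using u2 small by (metis eq_iff_diff_eq_0 norm_one less_irrefl)
 have sn: "of_real pi / sin (of_real pi * z) = - 2 * of_real pi * \<i> * u * (1 / (1 - u^2))"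
 proof -
  have "sin (of_real pi * z) = (u - 1 / u) / (2 * \<i>)"
   unfolding sin_exp_eq u_def by (simp add: exp_minus field_simps)
  also have "... = - (1 - u^2) / (2 * \<i> * u)" using u0 by (simp add: field_simps power2_eq_square)
  finally have "of_real pi / sin (of_real pi * z) = of_real pi / (- (1 - u^2) / (2 * \<i> * u))" by (simp only:)
  moreover have "a / (- v / (2 * \<i> * u)) = - 2 * a * \<i> * u * (1 / v)" if "v \<noteq> 0" for a v :: complex
   using that u0 by (simp add: field_simps)
  ultimately show ?thesis using u21 by (simp only: not_False_eq_True)
 qed
 have prod: "Gamma z * Gamma w = (- 2 * of_real pi * \<i> * u / q) * ((1 + (1 / (1 - u^2) - 1)) * (1 + (gam_ratio w - 1)) * (1 + (q / p - 1)))"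
 proof -
  have "Gamma z * Gamma w = (Gamma z * Gamma (w + 1/2)) * gam_ratio w / p" by (simp add: Gw)
  also have "... = - 2 * of_real pi * \<i> * u * (1 / (1 - u^2)) * gam_ratio w / p" unfolding refl sn ..
  also have "... = (- 2 * of_real pi * \<i> * u / q) * (1 / (1 - u^2) * gam_ratio w * (q / p))"
   using w0 by simp
  finally show ?thesis by simp
 qed
 have main: "- 2 * of_real pi * \<i> * u / q = of_real (2 * pi * exp (- pi * x) / sqrt x) * cis (pi * (a - 1/4))"
 proof -
  have "u = of_real (exp (- pi * x)) * cis (pi * a)"
   by (simp add: u_def z_def exp_eq_polar cis.ctr Complex_eq algebra_simps)
  have "- \<i> = cis (- (pi / 2))" by (simp add: cis.ctr complex_eq_iff)
  moreover have "cis (- (pi / 2)) * cis (pi * a) / cis (- (pi / 4)) = cis (pi * (a - 1/4))"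
   unfolding cis_mult cis_divide by (rule arg_cong[of _ _ cis]) (simp add: algebra_simps)
  ultimately have "- \<i> * cis (pi * a) / cis (- (pi / 4)) = cis (pi * (a - 1/4))" by (simp only:)
  moreover have "- 2 * of_real pi * \<i> * (of_real E * c) / (of_real r * d) = of_real (2 * pi * E / r) * (- \<i> * c / d)"
   for E r :: real and c d :: complex by simp
  ultimately show ?thesis unfolding q_def \<open>u = of_real (exp (- pi * x)) * cis (pi * a)\<close> by (simp only:)
 qed
 have b1: "cmod (1 / (1 - u^2) - 1) <= 3 / x"
 proof -
  have e: "1 + 2 * pi * x <= exp (2 * pi * x)" by (rule exp_ge_add_one_self)
  have "1 / (1 - u^2) - 1 = u^2 / (1 - u^2)" using u21 by (simp add: field_simps)
  then have "cmod (1 / (1 - u^2) - 1) = exp (- (2 * pi * x)) / cmod (1 - u^2)" by (simp add: norm_divide u2)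
  also have "... <= exp (- (2 * pi * x)) / (1 - exp (- (2 * pi * x)))"
   using norm_triangle_ineq2[of 1 "u^2"] u2 small u21 by (intro divide_left_mono mult_pos_pos) auto
  also have "... = 1 / (exp (2 * pi * x) - 1)"
   using small by (simp add: exp_minus field_simps)
  also have "... <= 1 / (2 * pi * x)"
  proof -
   have "0 < 2 * pi * x" using x by (intro mult_pos_pos) auto
   moreover have "2 * pi * x <= exp (2 * pi * x) - 1" using e by linarith
   ultimately show ?thesis by (intro frac_le) auto
  qed
  also have "... <= 3 / x" using x pi_gt3 by (simp add: field_simps)
  finally show ?thesis .
 qed
 have b2: "cmod (gam_ratio w - 1) <= 3 / x"
  using gam_ratio_bound[OF Rew] x by (simp add: w_def)
 have b3: "cmod (q / p - 1) <= 3 / x"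
 proof -
  have sp: "\<bar>Im p\<bar> <= Re p" using csqrt_sector[OF Rew] by (simp add: p_def)
  have sq: "\<bar>Im q\<bar> <= Re q" using x by (simp add: q_def sin_45 cos_45)
  have "q^2 = of_real x * (cis (- (pi / 4)))^2" using x by (simp add: q_def power_mult_distrib flip: of_real_power)
  also have "(cis (- (pi / 4)))^2 = - \<i>" by (simp add: power2_eq_square cis_mult)
  finally have "q^2 - p^2 = - of_real (1/2 - a)" by (simp add: p_def w_def complex_eq_iff)
  then have "cmod (q^2 - p^2) = 1/2 - a" using a by (simp only: norm_minus_cancel norm_of_real)
  then have "cmod (q - p) <= (1/2 - a) / cmod q"
   using norm_diff_sector[OF sp sq w0(3)] by simp
  also have "cmod q = sqrt x" using x by (simp add: q_def norm_mult)
  also have "(1/2 - a) / sqrt x <= 1 / sqrt x" using a x by (intro divide_right_mono) auto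
  finally have d: "cmod (q - p) <= 1 / sqrt x" .
  have "x <= cmod w" using abs_Im_le_cmod[of w] x by (simp add: w_def)
  also have "cmod w = (cmod p)^2" by (simp add: p_def flip: norm_power)
  finally have pp: "sqrt x <= cmod p" by (rule real_le_lsqrt[rotated -1]) (use x in auto)
  have "cmod (q / p - 1) = cmod (q - p) / cmod p" using w0 by (simp add: norm_divide[symmetric] diff_divide_distrib)
  also have "... <= (1 / sqrt x) / sqrt x" using d pp x by (intro frac_le) auto
  also have "... = 1 / x" using x by simp
  also have "... <= 3 / x" using x by (simp add: divide_right_mono)
  finally show ?thesis .
 qed
 define mn where "mn = of_real (2 * pi * exp (- pi * x) / sqrt x) * cis (pi * (a - 1/4))"
 have "Gamma z * Gamma w - mn = mn * ((1 + (1 / (1 - u^2) - 1)) * (1 + (gam_ratio w - 1)) * (1 + (q / p - 1)) - 1)"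
  unfolding prod main mn_def by (simp only: right_diff_distrib mult_1_right)
 then have "cmod (Gamma z * Gamma w - mn) <= cmod mn * (63 / x)"
  using norm_prod3_minus_1[OF b1 b2 b3 x] by (simp only: norm_mult) (intro mult_left_mono, auto)
 also have "cmod mn = 2 * pi * exp (- pi * x) / sqrt x" unfolding mn_def norm_mult norm_of_real norm_cis using x by simp
 also have "... * (63 / x) = (126 * pi) * (exp (- pi * x) / (x * sqrt x))" by (simp add: mult_ac)
 also have "... <= 400 * (exp (- pi * x) / (x * sqrt x))"
  using x pi_approx by (intro mult_right_mono) auto
 finally show ?thesis by (simp add: z_def w_def mn_def)
qed

section \<open>Orthogonality\<close>

lemma poly_le_exp:
 fixes p :: "complex poly"
 assumes "\<epsilon> > 0"
 obtains B where "B >= 0" "!!z. cmod (poly p z) <= B * exp (\<epsilon> * cmod z)"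
proof -
 have "\<exists>B\<ge>0. \<forall>z. cmod (poly p z) <= B * exp (\<epsilon> * cmod z)" using assms
 proof (induction p arbitrary: \<epsilon>)
  case (pCons a p)
  obtain B where B: "B >= 0" "!!z. cmod (poly p z) <= B * exp (\<epsilon> / 2 * cmod z)"
   using pCons.IH[of "\<epsilon> / 2"] pCons.prems by auto
  have "cmod (poly (pCons a p) z) <= (cmod a + 2 / \<epsilon> * B) * exp (\<epsilon> * cmod z)" for z
  proof -
   have "\<epsilon> / 2 * cmod z <= exp (\<epsilon> / 2 * cmod z)" using exp_ge_add_one_self[of "\<epsilon> / 2 * cmod z"] by linarith
   then have "cmod z <= 2 / \<epsilon> * exp (\<epsilon> / 2 * cmod z)" using pCons.prems by (simp add: field_simps)
   then have "cmod z * cmod (poly p z) <= (2 / \<epsilon> * exp (\<epsilon> / 2 * cmod z)) * (B * exp (\<epsilon> / 2 * cmod z))"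
    using B pCons.prems by (intro mult_mono) auto
   also have "... = 2 / \<epsilon> * B * (exp (\<epsilon> / 2 * cmod z) * exp (\<epsilon> / 2 * cmod z))" by simp
   also have "exp (\<epsilon> / 2 * cmod z) * exp (\<epsilon> / 2 * cmod z) = exp (\<epsilon> * cmod z)" by (simp flip: exp_add)
   finally have "cmod (z * poly p z) <= 2 / \<epsilon> * B * exp (\<epsilon> * cmod z)" by (simp add: norm_mult)
   moreover have "cmod a <= cmod a * exp (\<epsilon> * cmod z)" using pCons.prems by (simp add: mult_le_cancel_left1)
   moreover have "cmod (poly (pCons a p) z) <= cmod a + cmod (z * poly p z)"
    by (simp add: norm_triangle_ineq)
   ultimately show ?thesis by (simp add: distrib_right)
  qed
  then show ?case using B(1) pCons.prems by (intro exI[of _ "cmod a + 2 / \<epsilon> * B"]) auto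
 qed auto
 then show ?thesis using that by blast
qed

definition mpw :: "real => real => real" where
 "mpw l x = (cmod (Gamma (Complex l x)))^2"

lemma mpw_nonneg [simp]: "mpw l x >= 0"
 by (simp add: mpw_def)

lemma mpw_complex: "of_real (mpw l x) = Gamma (Complex l x) * Gamma (Complex l (- x))"
proof -
 have "Gamma (Complex l (- x)) = cnj (Gamma (Complex l x))"
  by (simp add: cnj_Gamma complex_eq_iff) (simp add: complex_cnj)
 then show ?thesis by (simp add: mpw_def complex_norm_square del: of_real_power)
qed

lemma mpw_pos: "l > 0 ==> mpw l x > 0"
 by (auto simp: mpw_def Gamma_eq_zero_iff elim!: nonpos_Ints_cases dest!: arg_cong[where f = Re])

lemma mpw_bound:
 assumes "0 < l" "l <= 3"
 obtains B where "B > 0" "!!x. mpw l x <= B * exp (- (2 * \<bar>x\<bar>))"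
proof -
 obtain B where B: "B > 0" "!!\<sigma> x. l <= \<sigma> ==> \<sigma> <= 3 ==> cmod (Gamma (Complex \<sigma> x)) <= B * exp (- \<bar>x\<bar>)"
  using cmod_Gamma_decay[OF assms] by metis
 have "mpw l x <= B^2 * exp (- (2 * \<bar>x\<bar>))" for x
 proof -
  have "mpw l x <= (B * exp (- \<bar>x\<bar>))^2" unfolding mpw_def using B(2)[of l x] assms by (intro power_mono) auto
  also have "... = B^2 * exp (- (2 * \<bar>x\<bar>))" by (simp only: power_mult_distrib exp_double[symmetric]) simp
  finally show ?thesis .
 qed
 then show ?thesis using B(1) by (intro that[of "B^2"]) auto
qed

lemma continuous_on_mpw: "l > 0 ==> continuous_on UNIV (mpw l)"
 unfolding mpw_def Complex_eq
 by (intro continuous_at_imp_continuous_on ballI continuous_intros isCont_o2[OF _ isCont_Gamma])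
   (auto elim!: nonpos_Ints_cases dest!: arg_cong[where f = Re])

lemma borel_mpw [measurable]: "l > 0 ==> mpw l \<in> borel_measurable borel"
 by (intro borel_measurable_continuous_onI continuous_on_mpw)

lemma borel_poly_of_real [measurable]:
 fixes q :: "complex poly"
 shows "(%x::real. poly q (of_real x) :: complex) \<in> borel_measurable borel"
 by (intro borel_measurable_continuous_onI continuous_intros)

lemma mp_integrable:
 fixes q :: "complex poly"
 assumes "0 < l" "l <= 3"
 shows "integrable lborel (%x. poly q (of_real x) * of_real (mpw l x))"
proof -
 obtain B where B: "B > 0" "!!x. mpw l x <= B * exp (- (2 * \<bar>x\<bar>))" using mpw_bound[OF assms] by metis
 obtain K where K: "K >= 0" "!!z. cmod (poly q z) <= K * exp (1 * cmod z)" using poly_le_exp[of 1 q] by auto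
 show ?thesis
 proof (rule integrable_exp_bound)
  show "(%x. poly q (of_real x) * complex_of_real (mpw l x)) \<in> borel_measurable borel" using assms by measurable
  show "norm (poly q (of_real x) * complex_of_real (mpw l x)) <= (K * B) * exp (- \<bar>x\<bar>)" for x
  proof -
   have "norm (poly q (of_real x) * complex_of_real (mpw l x)) <= (K * exp \<bar>x\<bar>) * (B * exp (- (2 * \<bar>x\<bar>)))"
    unfolding norm_mult using B K(1) K(2)[of "of_real x"] by (intro mult_mono) auto
   also have "... = (K * B) * (exp \<bar>x\<bar> * exp (- (2 * \<bar>x\<bar>)))" by simp
   also have "exp \<bar>x\<bar> * exp (- (2 * \<bar>x\<bar>)) = exp (- \<bar>x\<bar>)" by (simp flip: exp_add)
   finally show ?thesis .
  qed
 qed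
qed

definition mpI :: "real => complex poly => complex" where
 "mpI l q = (LBINT x. poly q (of_real x) * of_real (mpw l x))"

lemma mpI_add: "0 < l ==> l <= 3 ==> mpI l (p + q) = mpI l p + mpI l q"
 unfolding mpI_def by (simp add: distrib_right Bochner_Integration.integral_add mp_integrable)

lemma mpI_smult: "mpI l (smult c p) = c * mpI l p"
 unfolding mpI_def by (simp add: mult.assoc)

lemma mpI_sum:
 assumes "0 < l" "l <= 3"
 shows "mpI l (\<Sum>i\<in>A. f i) = (\<Sum>i\<in>A. mpI l (f i))"
 by (induction A rule: infinite_finite_induct) (simp_all add: mpI_add[OF assms] mpI_def[of l 0])

text \<open>The integral of q(z) Gamma(l + iz) Gamma(l + 1 - iz) is moved from Im z = 0 to Im z =
  -1. On each of the two lines one Gamma factor is reduced by the functional equation, leaving the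
  weight times l - ix, respectively l + ix. The strip in between contains no pole.\<close>

lemma mpI_shift:
 assumes "0 < l" "l <= 1"
 shows "mpI l ([:of_real l, - \<i>:] * q) = mpI l ([:of_real l, \<i>:] * pcompose q [:- \<i>, 1:])"
proof -
 define S where "S = {z. Im z < l / 2} \<inter> {z. Im z > - 1 - l / 2}"
 define F where "F z = poly q z * (Gamma (of_real l + \<i> * z) * Gamma (of_real l + 1 - \<i> * z))" for z
 have S: "open S" "convex S"
  unfolding S_def
  by (intro open_Int open_halfspace_Im_lt open_halfspace_Im_gt, intro convex_Int convex_halfspace_Im_lt convex_halfspace_Im_gt)
 have ni: "of_real l + \<i> * z \<notin> \<int>\<^sub>\<le>\<^sub>0" "of_real l + 1 - \<i> * z \<notin> \<int>\<^sub>\<le>\<^sub>0" if "z \<in> S" for z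
  using that assms by (auto simp: S_def elim!: nonpos_Ints_cases dest!: arg_cong[where f = Re])
 have hol: "F holomorphic_on S"
  unfolding F_def using ni by (intro holomorphic_intros) auto
 obtain B where B: "B > 0" "!!\<sigma> x. l <= \<sigma> ==> \<sigma> <= 3 ==> cmod (Gamma (Complex \<sigma> x)) <= B * exp (- \<bar>x\<bar>)"
  using cmod_Gamma_decay[of l] assms by auto
 obtain K where K: "K >= 0" "!!z. cmod (poly q z) <= K * exp (1 * cmod z)" using poly_le_exp[of 1 q] by auto
 have bnd: "norm (F (Complex x y)) <= (K * exp 1 * B * B) * exp (- \<bar>x\<bar>)" if "y \<in> closed_segment 0 (-1)" for x y
 proof -
  have y: "-1 <= y" "y <= 0" using that by (auto simp: closed_segment_eq_real_ivl)
  have "cmod (poly q (Complex x y)) <= K * exp (cmod (Complex x y))" using K(2)[of "Complex x y"] by simp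
  also have "... <= K * exp (\<bar>x\<bar> + 1)" using K(1) cmod_le[of "Complex x y"] y by (intro mult_left_mono) auto
  finally have 1: "cmod (poly q (Complex x y)) <= K * exp (\<bar>x\<bar> + 1)" .
  have e: "of_real l + \<i> * Complex x y = Complex (l - y) x" "of_real l + 1 - \<i> * Complex x y = Complex (l + 1 + y) (- x)"
   by (auto simp: complex_eq_iff)
  have "norm (F (Complex x y)) <= (K * exp (\<bar>x\<bar> + 1)) * ((B * exp (- \<bar>x\<bar>)) * (B * exp (- \<bar>x\<bar>)))"
   unfolding F_def norm_mult e using 1 B(2)[of "l - y" x] B(2)[of "l + 1 + y" "-x"] y assms B(1) K(1)
   by (intro mult_mono) auto
  also have "... = (K * B * B) * (exp (\<bar>x\<bar> + 1) * (exp (- \<bar>x\<bar>) * exp (- \<bar>x\<bar>)))" by simp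
  also have "exp (\<bar>x\<bar> + 1) * (exp (- \<bar>x\<bar>) * exp (- \<bar>x\<bar>)) = exp 1 * exp (- \<bar>x\<bar>)" by (simp flip: exp_add)
  finally show ?thesis by (simp add: mult_ac)
 qed
 have seg: "Complex x y \<in> S" if "y \<in> closed_segment 0 (-1)" for x y
  using that assms by (auto simp: S_def closed_segment_eq_real_ivl)
 have "(LBINT x. F (Complex x (-1))) = (LBINT x. F (Complex x 0))"
  by (rule full_line_shift(3)[OF hol S seg bnd])
 moreover have "F (Complex x 0) = poly ([:of_real l, - \<i>:] * q) (of_real x) * of_real (mpw l x)" for x
 proof -
  have ni: "Complex l (-x) \<notin> \<int>\<^sub>\<le>\<^sub>0" using assms by (auto elim!: nonpos_Ints_cases dest!: arg_cong[where f = Re])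
  have "Gamma (of_real l + 1 - \<i> * Complex x 0) = (of_real l - \<i> * of_real x) * Gamma (Complex l (- x))"
   using Gamma_plus1[OF ni] by (simp add: Complex_eq algebra_simps)
  moreover have "of_real l + \<i> * Complex x 0 = Complex l x" "Complex x 0 = of_real x" by (auto simp: complex_eq_iff)
  ultimately have "F (Complex x 0) = poly q (of_real x) * (Gamma (Complex l x) * ((of_real l - \<i> * of_real x) * Gamma (Complex l (- x))))"
   unfolding F_def by (simp only:)
  moreover have "poly ([:of_real l, - \<i>:] * q) (of_real x) = (of_real l - \<i> * of_real x) * poly q (of_real x)"
   by (simp add: algebra_simps)
  ultimately show ?thesis unfolding mpw_complex by (simp only: mult_ac)
 qed
 moreover have "F (Complex x (-1)) = poly ([:of_real l, \<i>:] * pcompose q [:- \<i>, 1:]) (of_real x) * of_real (mpw l x)" for x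
 proof -
  have ni: "Complex l x \<notin> \<int>\<^sub>\<le>\<^sub>0" using assms by (auto elim!: nonpos_Ints_cases dest!: arg_cong[where f = Re])
  have "Gamma (of_real l + \<i> * Complex x (-1)) = (of_real l + \<i> * of_real x) * Gamma (Complex l x)"
   using Gamma_plus1[OF ni] by (simp add: Complex_eq algebra_simps)
  moreover have "of_real l + 1 - \<i> * Complex x (-1) = Complex l (- x)" "Complex x (-1) = - \<i> + of_real x" by (auto simp: complex_eq_iff)
  ultimately have "F (Complex x (-1)) = poly q (- \<i> + of_real x) * (((of_real l + \<i> * of_real x) * Gamma (Complex l x)) * Gamma (Complex l (- x)))"
   unfolding F_def by (simp only:)
  moreover have "poly ([:of_real l, \<i>:] * pcompose q [:- \<i>, 1:]) (of_real x) = (of_real l + \<i> * of_real x) * poly q (- \<i> + of_real x)"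
   by (simp add: poly_pcompose algebra_simps)
  ultimately show ?thesis unfolding mpw_complex by (simp only: mult_ac)
 qed
 ultimately show ?thesis unfolding mpI_def by simp
qed

definition mpp :: "real => nat => complex poly" where
 "mpp l k = (SOME q. degree q = k \<and> lead_coeff q = 2 ^ k / fact k \<and> (\<forall>X. poly q X = mp l k X))"

lemma mpp: "degree (mpp l k) = k" "lead_coeff (mpp l k) = 2 ^ k / fact k" "poly (mpp l k) X = mp l k X"
proof -
 have "\<exists>q. degree q = k \<and> lead_coeff q = 2 ^ k / fact k \<and> (\<forall>X. poly q X = mp l k X)"
  using mp_poly[of k l] by metis
 from someI_ex[OF this] show "degree (mpp l k) = k" "lead_coeff (mpp l k) = 2 ^ k / fact k" "poly (mpp l k) X = mp l k X"
  unfolding mpp_def by auto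
qed

text \<open>The difference operator with the eigenfunctions \<open>mpp l k\<close> is symmetric for
  the bilinear form mpI(f g), by the contour shift in the form \<open>T\<close>, and its eigenvalues
  2 (k + l) are distinct.\<close>

lemma mp_orth:
 assumes "0 < l" "l <= 1" "j \<noteq> k"
 shows "mpI l (mpp l j * mpp l k) = 0"
proof -
 let ?a = "[:of_real l, - \<i>:]" and ?b = "[:of_real l, \<i>:]"
 let ?p = "%f. pcompose f [:\<i>, 1:]" and ?m = "%f. pcompose f [:- \<i>, 1:]"
 have pm: "?m (?p f) = f" for f :: "complex poly"
  by (simp add: pcompose_assoc[symmetric] pcompose_pCons pcompose_idR)
 have A: "?a * ?p (mpp l k) + ?b * ?m (mpp l k) = smult (2 * (of_nat k + of_real l)) (mpp l k)" for k
 proof -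
  have "poly (?a * ?p (mpp l k) + ?b * ?m (mpp l k)) x = poly (smult (2 * (of_nat k + of_real l)) (mpp l k)) x" for x
   using mp_diffeq[of l x k] by (simp add: poly_pcompose mpp algebra_simps)
  then show ?thesis by (simp add: poly_eq_poly_eq_iff[symmetric] fun_eq_iff)
 qed
 have T: "mpI l (?a * (?p f * g)) = mpI l (?b * (f * ?m g))" for f g
  using mpI_shift[OF assms(1,2), of "?p f * g"] by (simp only: pcompose_mult pm)
 let ?f = "mpp l j" and ?g = "mpp l k"
 have l3: "l <= 3" using assms by simp
 have "mpI l ((?a * ?p ?f + ?b * ?m ?f) * ?g) = mpI l (?a * (?p ?f * ?g)) + mpI l (?b * (?g * ?m ?f))"
  by (subst mpI_add[OF assms(1) l3, symmetric]) (simp add: algebra_simps)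
 also have "... = mpI l (?b * (?f * ?m ?g)) + mpI l (?a * (?p ?g * ?f))" by (simp only: T)
 also have "... = mpI l (?f * (?a * ?p ?g + ?b * ?m ?g))"
  by (subst mpI_add[OF assms(1) l3, symmetric]) (simp add: algebra_simps)
 finally have "2 * (of_nat j + of_real l) * mpI l (?f * ?g) = 2 * (of_nat k + of_real l) * mpI l (?f * ?g)"
  unfolding A by (simp add: mpI_smult)
 then show ?thesis using assms(3) by auto
qed

definition mpN :: "real => real" where "mpN l = (LBINT x. mpw l x)"

lemma mpw_integrable: "0 < l ==> l <= 3 ==> integrable lborel (mpw l)"
 using integrable_Re[OF mp_integrable[of l 1]] by simp

lemma mpN_pos:
 assumes "0 < l" "l <= 3"
 shows "mpN l > 0"
proof -
 have "mpN l >= 0" unfolding mpN_def by (intro integral_nonneg_AE) auto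
 moreover have "mpN l \<noteq> 0"
 proof
  assume "mpN l = 0"
  then have "AE x in lborel. mpw l x = 0"
   unfolding mpN_def by (subst (asm) integral_nonneg_eq_0_iff_AE) (auto intro: mpw_integrable assms)
  then have "AE x in (lborel :: real measure). False"
   by (rule eventually_mono) (use mpw_pos[OF assms(1)] in \<open>metis less_irrefl\<close>)
  then show False by (simp add: eventually_False ae_filter_eq_bot_iff)
 qed
 ultimately show ?thesis by simp
qed

lemma mp_rec_poly: "smult (of_nat (k + 2)) (mpp l (k + 2)) + smult (of_nat k + 2 * of_real l) (mpp l k) = [:0, 2:] * mpp l (k + 1)"
proof -
 have "poly (smult (of_nat (k + 2)) (mpp l (k + 2)) + smult (of_nat k + 2 * of_real l) (mpp l k)) x = poly ([:0, 2:] * mpp l (k + 1)) x" for x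
  using mp_rec[of k l x] by (simp add: mpp algebra_simps del: of_nat_add)
 then show ?thesis by (simp add: poly_eq_poly_eq_iff[symmetric] fun_eq_iff)
qed

text \<open>Evaluating mpI(2 X p_j p_(j+1)) by the recurrence for either factor gives (j + 1)
  h_(j+1) = (j + 2 l) h_j for the squared norms h_j, which is the recurrence of
  \<open>rbin (2 * l)\<close>.\<close>

lemma mp_norm:
 assumes "0 < l" "l <= 1"
 shows "mpI l (mpp l k * mpp l k) = of_real (mpN l * rbin (2 * l) k)"
proof (induction k rule: nat_less_induct)
 case (1 k)
 have l3: "l <= 3" using assms by simp
 have p0: "mpp l 0 = 1" by (simp add: mpp poly_eq_poly_eq_iff[symmetric] fun_eq_iff)
 have p1: "mpp l (Suc 0) = [:0, 2:]" by (simp add: mpp poly_eq_poly_eq_iff[symmetric] fun_eq_iff)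
 note orth = mp_orth[OF assms]
 consider "k = 0" | j where "k = Suc j" by (cases k) auto
 then show ?case
 proof cases
  case 1
  then show ?thesis by (simp add: p0 mpI_def mpN_def)
 next
  case 2
  have IH: "mpI l (mpp l j * mpp l j) = of_real (mpN l * rbin (2 * l) j)" using 1 2 by auto
  have "smult (of_nat (j + 2)) (mpp l (j + 2)) * mpp l j + smult (of_nat j + 2 * of_real l) (mpp l j) * mpp l j
    = ([:0, 2:] * mpp l j) * mpp l (Suc j)"
   unfolding distrib_right[symmetric] mp_rec_poly by (simp add: mult_ac)
  from arg_cong[OF this, of "mpI l"]
  have "(of_nat j + 2 * of_real l) * of_real (mpN l * rbin (2 * l) j) = mpI l (([:0, 2:] * mpp l j) * mpp l (Suc j))"
   unfolding mpI_add[OF assms(1) l3] mult_smult_left mpI_smult IH using orth[of "j + 2" j] by simp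
  also have "mpI l (([:0, 2:] * mpp l j) * mpp l (Suc j)) = of_nat (Suc j) * mpI l (mpp l (Suc j) * mpp l (Suc j))"
  proof (cases j)
   case 0
   then show ?thesis by (simp add: p0 p1)
  next
   case (Suc i)
   have "([:0, 2:] * mpp l j) * mpp l (Suc j) = smult (of_nat (i + 2)) (mpp l (i + 2)) * mpp l (Suc j) + smult (of_nat i + 2 * of_real l) (mpp l i) * mpp l (Suc j)"
    unfolding distrib_right[symmetric] mp_rec_poly by (simp add: Suc)
   then show ?thesis
    unfolding mult_smult_left using orth[of i "Suc j"] Suc by (simp add: mpI_add[OF assms(1) l3] mpI_smult)
  qed
  finally have "of_nat (Suc j) * mpI l (mpp l (Suc j) * mpp l (Suc j)) = (of_nat j + 2 * of_real l) * of_real (mpN l * rbin (2 * l) j)" ..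
  moreover have "of_nat (Suc j) * of_real (mpN l * rbin (2 * l) (Suc j)) = (of_nat j + 2 * of_real l) * (of_real (mpN l * rbin (2 * l) j) :: complex)"
  proof -
   have "real (Suc j) * (mpN l * rbin (2 * l) (Suc j)) = (real j + 2 * l) * (mpN l * rbin (2 * l) j)"
    by (simp add: rbin_Suc field_simps)
   from arg_cong[OF this, of complex_of_real] show ?thesis by simp
  qed
  ultimately have "of_nat (Suc j) * mpI l (mpp l (Suc j) * mpp l (Suc j)) = of_nat (Suc j) * of_real (mpN l * rbin (2 * l) (Suc j))"
   by (simp only:)
  then show ?thesis unfolding 2 by (simp only: mult_left_cancel[OF of_nat_neq_0])
 qed
qed

lemma mp_parseval:
 assumes "0 < l" "l <= 1"
 shows "integrable lborel (%x. (cmod (\<Sum>k<n. c k * mp l k (of_real x)))^2 * mpw l x)"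
  and "(LBINT x. (cmod (\<Sum>k<n. c k * mp l k (of_real x)))^2 * mpw l x) = mpN l * (\<Sum>k<n. (cmod (c k))^2 * rbin (2 * l) k)"
proof -
 have l3: "l <= 3" using assms by simp
 define f where "f = (\<Sum>k<n. smult (c k) (mpp l k))"
 \<comment> \<open>On the real line \<open>g\<close> is the conjugate of \<open>f\<close>, because
   \<open>mp\<close> takes conjugate values at conjugate points; the squared modulus becomes the
   polynomial f g.\<close>
 define g where "g = (\<Sum>k<n. smult (cnj (c k)) (mpp l k))"
 have eq: "poly (f * g) (of_real x) * of_real (mpw l x) = of_real ((cmod (\<Sum>k<n. c k * mp l k (of_real x)))^2 * mpw l x)" for x
 proof -
  have "poly g (of_real x) = cnj (poly f (of_real x))"
   by (simp add: f_def g_def poly_sum mpp mp_cnj[symmetric])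
  moreover have "poly f (of_real x) = (\<Sum>k<n. c k * mp l k (of_real x))" by (simp add: f_def poly_sum mpp)
  ultimately show ?thesis by (simp add: complex_norm_square mult_ac del: of_real_power)
 qed
 show int: "integrable lborel (%x. (cmod (\<Sum>k<n. c k * mp l k (of_real x)))^2 * mpw l x)"
  using integrable_Re[OF mp_integrable[OF assms(1) l3, of "f * g"]] unfolding eq by simp
 have "of_real (LBINT x. (cmod (\<Sum>k<n. c k * mp l k (of_real x)))^2 * mpw l x) = mpI l (f * g)"
  unfolding mpI_def eq by (rule integral_complex_of_real[symmetric])
 also have "f * g = (\<Sum>j<n. \<Sum>k<n. smult (c j * cnj (c k)) (mpp l j * mpp l k))"
  unfolding f_def g_def sum_product by (simp add: mult.commute)
 also have "mpI l ... = (\<Sum>j<n. \<Sum>k<n. c j * cnj (c k) * mpI l (mpp l j * mpp l k))"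
  by (simp add: mpI_sum[OF assms(1) l3] mpI_smult)
 also have "... = (\<Sum>j<n. c j * cnj (c j) * of_real (mpN l * rbin (2 * l) j))"
 proof (rule sum.cong[OF refl])
  fix j assume j: "j \<in> {..<n}"
  have "(\<Sum>k<n. c j * cnj (c k) * mpI l (mpp l j * mpp l k)) = (\<Sum>k<n. if k = j then c j * cnj (c j) * of_real (mpN l * rbin (2 * l) j) else 0)"
   by (intro sum.cong) (auto simp: mp_orth[OF assms] mp_norm[OF assms])
  then show "(\<Sum>k<n. c j * cnj (c k) * mpI l (mpp l j * mpp l k)) = c j * cnj (c j) * of_real (mpN l * rbin (2 * l) j)"
   using j by simp
 qed
 also have "... = of_real (mpN l * (\<Sum>k<n. (cmod (c k))^2 * rbin (2 * l) k))"
  by (simp add: sum_distrib_left complex_norm_square mult_ac del: of_real_power)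
 finally show "(LBINT x. (cmod (\<Sum>k<n. c k * mp l k (of_real x)))^2 * mpw l x) = mpN l * (\<Sum>k<n. (cmod (c k))^2 * rbin (2 * l) k)"
  by (simp only: of_real_eq_iff)
qed

section \<open>Norm estimates\<close>

lemma rbin_le_powr:
 assumes "alpha > 0"
 obtains C where "C > 0" "!!k. rbin alpha k <= C * (real k + 1) powr (alpha - 1)"
 using rbin_bounds[OF assms] by metis

lemma powr_le_rbin:
 assumes "alpha > 0"
 obtains C where "C > 0" "!!k. (real k + 1) powr (alpha - 1) <= C * rbin alpha k"
proof -
 obtain c where c: "c > 0" "!!k. c * (real k + 1) powr (alpha - 1) <= rbin alpha k"
  using rbin_bounds[OF assms] by metis
 show ?thesis
 proof (rule that[of "1 / c"])
  show "(real k + 1) powr (alpha - 1) <= 1 / c * rbin alpha k" for k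
   using c by (simp add: field_simps)
 qed (use c in auto)
qed

lemma norm_binser_nth_le:
 assumes "alpha > 0" "M >= 0"
 obtains C where "C > 0"
  "!!t c k. cmod t <= 1 ==> cmod c <= M ==> Re c <= alpha ==> cmod (fps_nth (binser t c) k) <= C * rbin alpha k"
proof -
 obtain C where C: "C > 0" "!!(c::complex) j. norm c <= M ==> Re c <= alpha ==> norm (pochhammer c j / fact j) <= C * rbin alpha j"
  using norm_pochhammer_le_rbin[OF assms] by metis
 show ?thesis
 proof (rule that[OF C(1)])
  fix t c k assume *: "cmod t <= 1" "cmod c <= M" "Re c <= alpha"
  have "cmod (fps_nth (binser t c) k) = cmod t ^ k * cmod (pochhammer c k / fact k)"
   by (simp add: binser_nth norm_mult norm_power norm_divide)
  also have "... <= 1 * (C * rbin alpha k)"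
   using * C by (intro mult_mono power_le_one) auto
  finally show "cmod (fps_nth (binser t c) k) <= C * rbin alpha k" by simp
 qed
qed

lemma norm_fps_mult_nth_le:
 fixes F G :: "complex fps"
 assumes "!!k. cmod (fps_nth F k) <= A * rbin alpha k" "!!k. cmod (fps_nth G k) <= B * rbin beta k"
 shows "cmod (fps_nth (F * G) n) <= A * B * rbin (alpha + beta) n"
proof -
 have "cmod (fps_nth (F * G) n) <= (\<Sum>k\<le>n. cmod (fps_nth F k) * cmod (fps_nth G (n - k)))"
  unfolding fps_mult_nth atLeast0AtMost by (rule order_trans[OF norm_sum]) (simp add: norm_mult)
 also have "... <= (\<Sum>k\<le>n. (A * rbin alpha k) * (B * rbin beta (n - k)))"
  by (intro sum_mono mult_mono assms norm_ge_zero order_trans[OF norm_ge_zero assms(1)])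
 also have "... = A * B * (\<Sum>k\<le>n. rbin alpha k * rbin beta (n - k))"
  by (simp add: sum_distrib_left mult_ac)
 finally show ?thesis by (simp add: rbin_conv)
qed

text \<open>The even coefficients of (1 + s^2)^(-d) are of size n^(alpha - 1). Bounding the two
  factors separately would only give n^(2 alpha - 1).\<close>

lemma binser_sq_bound:
 assumes "alpha > 0" "M >= 0"
 obtains C where "C > 0"
  "!!d n. cmod d <= M ==> Re d <= alpha ==> cmod (fps_nth (binser \<i> d * binser (- \<i>) d) n) <= C * rbin alpha n"
proof -
 obtain C where C: "C > 0" "!!(c::complex) j. norm c <= M ==> Re c <= alpha ==> norm (pochhammer c j / fact j) <= C * rbin alpha j"
  using norm_pochhammer_le_rbin[OF assms] by metis
 obtain A where A: "A > 0" "!!k. rbin alpha k <= A * (real k + 1) powr (alpha - 1)" using rbin_le_powr[OF assms(1)] by metis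
 obtain B where B: "B > 0" "!!k. (real k + 1) powr (alpha - 1) <= B * rbin alpha k" using powr_le_rbin[OF assms(1)] by metis
 \<comment> \<open>The cost of replacing j + 1 by 2 j + 1 under the exponent alpha - 1; it exceeds 1
   only if alpha < 1.\<close>
 define D where "D = max 1 (2 powr (1 - alpha))"
 have D: "(real j + 1) powr (alpha - 1) <= D * (real (2 * j) + 1) powr (alpha - 1)" for j
 proof (cases "alpha >= 1")
  case True
  have "(real j + 1) powr (alpha - 1) <= 1 * (real (2 * j) + 1) powr (alpha - 1)"
   using True by (simp add: powr_mono2)
  also have "... <= D * (real (2 * j) + 1) powr (alpha - 1)"
   by (intro mult_right_mono) (auto simp: D_def)
  finally show ?thesis .
 next
  case False
  have "(real j + 1) powr (alpha - 1) <= ((real (2 * j) + 1) / 2) powr (alpha - 1)"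
   using False by (intro powr_mono2') auto
  also have "... = 2 powr (1 - alpha) * (real (2 * j) + 1) powr (alpha - 1)"
   by (simp add: powr_divide powr_diff field_simps)
  also have "... <= D * (real (2 * j) + 1) powr (alpha - 1)"
   by (intro mult_right_mono) (auto simp: D_def)
  finally show ?thesis .
 qed
 have D0: "D > 0" by (simp add: D_def)
 show ?thesis
 proof (rule that[of "C * A * D * B"])
  show "C * A * D * B > 0" using C A D0 B by simp
  fix d n assume d: "cmod d <= M" "Re d <= alpha"
  show "cmod (fps_nth (binser \<i> d * binser (- \<i>) d) n) <= C * A * D * B * rbin alpha n"
  proof (cases "even n")
   case False
   then show ?thesis using C A D0 B rbin_nonneg[OF assms(1), of n] by (simp add: binser_sq_nth)
  next
   case True
   then obtain j where j: "n = 2 * j" by (elim evenE)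
   have "cmod (fps_nth (binser \<i> d * binser (- \<i>) d) n) = cmod (pochhammer d j / fact j)"
    unfolding binser_sq_nth using j by (simp add: norm_mult norm_power norm_divide)
   also have "... <= C * rbin alpha j" by (rule C(2)[OF d])
   also have "... <= C * (A * (D * (B * rbin alpha n)))"
    using C A D0 order_trans[OF A(2)[of j] mult_left_mono[OF order_trans[OF D[of j] mult_left_mono[OF B(2)[of "2 * j"]]]]]
    by (intro mult_left_mono) (auto simp: j)
   finally show ?thesis by (simp add: mult_ac)
  qed
 qed
qed

text \<open>The common part is split off: (1 - i s)^(-c) (1 + i s)^(-d) = (1 + s^2)^(-d) (1 - i
  s)^(-(c - d)). The growth is then governed by Re d + Re(c - d) = Re c instead of Re c + Re
  d.\<close>

lemma binser_prod_bound:
 assumes "alpha > 0" "beta > 0" "M >= 0"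
 obtains C where "C > 0"
  "!!c d n. cmod d <= M ==> cmod (c - d) <= M ==> Re d <= alpha ==> Re (c - d) <= beta ==>
    cmod (fps_nth (binser \<i> c * binser (- \<i>) d) n) <= C * rbin (alpha + beta) n"
proof -
 obtain A where A: "A > 0" "!!d n. cmod d <= M ==> Re d <= alpha ==> cmod (fps_nth (binser \<i> d * binser (- \<i>) d) n) <= A * rbin alpha n"
  using binser_sq_bound[OF assms(1,3)] by metis
 obtain B where B: "B > 0" "!!t c k. cmod t <= 1 ==> cmod c <= M ==> Re c <= beta ==> cmod (fps_nth (binser t c) k) <= B * rbin beta k"
  using norm_binser_nth_le[OF assms(2,3)] by metis
 show ?thesis
 proof (rule that[of "A * B"])
  show "A * B > 0" using A B by simp
  fix c d n assume *: "cmod d <= M" "cmod (c - d) <= M" "Re d <= alpha" "Re (c - d) <= beta"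
  have "binser \<i> c * binser (- \<i>) d = (binser \<i> d * binser (- \<i>) d) * binser \<i> (c - d)"
   using binser_add[of \<i> d "c - d"] by (simp add: mult_ac)
  then show "cmod (fps_nth (binser \<i> c * binser (- \<i>) d) n) <= A * B * rbin (alpha + beta) n"
   by (simp only:) (intro norm_fps_mult_nth_le A(2) B(2), use * in auto)
 qed
qed

text \<open>The exponents are d = l + iX and c - d = -2iX, with real parts l - Im X and 2 Im X. For
  Im X > 0 their sum yields the growth n^(l + Im X - 1).\<close>

lemma mp_pointwise_bound:
 assumes "alpha > 0" "beta > 0" "M >= 0"
 obtains C where "C > 0"
  "!!X n. cmod X <= M ==> l - Im X <= alpha ==> 2 * Im X <= beta ==> cmod (mp l n X) <= C * rbin (alpha + beta) n"
proof -
 have "2 * M + \<bar>l\<bar> >= 0" using assms by simp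
 then obtain C where C: "C > 0" "!!c d n. cmod d <= 2 * M + \<bar>l\<bar> ==> cmod (c - d) <= 2 * M + \<bar>l\<bar> ==> Re d <= alpha ==> Re (c - d) <= beta ==>
    cmod (fps_nth (binser \<i> c * binser (- \<i>) d) n) <= C * rbin (alpha + beta) n"
  using binser_prod_bound[OF assms(1,2)] by metis
 show ?thesis
 proof (rule that[OF C(1)])
  fix X n assume *: "cmod X <= M" "l - Im X <= alpha" "2 * Im X <= beta"
  have "cmod (of_real l + \<i> * X) <= 2 * M + \<bar>l\<bar>"
   using norm_triangle_ineq[of "of_real l" "\<i> * X"] * assms by (simp add: norm_mult)
  moreover have "of_real l - \<i> * X - (of_real l + \<i> * X) = - 2 * \<i> * X" by simp
  ultimately show "cmod (mp l n X) <= C * rbin (alpha + beta) n"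
   unfolding mp_def mp_gen_def using * assms by (intro C) (auto simp: norm_mult)
 qed
qed

lemma sq_rbin_bound:
 assumes "alpha > 0" "beta > 0" "2 * alpha - 2 <= beta - 1"
 obtains C where "C > 0" "!!k. (rbin alpha k)^2 <= C * rbin beta k"
proof -
 obtain A where A: "A > 0" "!!k. rbin alpha k <= A * (real k + 1) powr (alpha - 1)" using rbin_le_powr[OF assms(1)] by metis
 obtain B where B: "B > 0" "!!k. (real k + 1) powr (beta - 1) <= B * rbin beta k" using powr_le_rbin[OF assms(2)] by metis
 show ?thesis
 proof (rule that[of "A^2 * B"])
  show "A^2 * B > 0" using A B by simp
  fix k
  have "(rbin alpha k)^2 <= (A * (real k + 1) powr (alpha - 1))^2"
   using A(2)[of k] rbin_nonneg[OF assms(1), of k] by (intro power_mono) auto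
  also have "... = A^2 * (real k + 1) powr (2 * alpha - 2)"
   by (simp add: power_mult_distrib powr_power)
  also have "... <= A^2 * (real k + 1) powr (beta - 1)"
   using assms(3) by (intro mult_left_mono powr_mono) auto
  also have "... <= A^2 * (B * rbin beta k)" using B by (intro mult_left_mono) auto
  finally show "(rbin alpha k)^2 <= A^2 * B * rbin beta k" by (simp add: mult.assoc)
 qed
qed

text \<open>Weighted norm of a shifted polynomial: if the connection coefficients are \<open>O(m\<^sup>a\<^sup>-\<^sup>1)\<close>
 then Parseval turns the norm into a convolution of two binomial sequences.\<close>
lemma mp_shift_norm:
 assumes "0 < \<mu>" "\<mu> <= 1" "a > 0" "b > 0" "2 * a - 2 <= b - 1"
  and K: "K >= 0" "!!m. cmod (fps_nth (binser \<i> (of_real (l - \<mu> + eta)) * binser (-\<i>) (of_real (l - \<mu> - eta))) m) <= K * rbin a m"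
 obtains C where "C > 0" "!!n. (LBINT x. (cmod (mp l n (of_real x + of_real eta * \<i>)))^2 * mpw \<mu> x) <= C * (real n + 1) powr (2 * \<mu> + b - 1)"
  and "!!n. integrable lborel (%x. (cmod (mp l n (of_real x + of_real eta * \<i>)))^2 * mpw \<mu> x)"
proof -
 define d where "d = fps_nth (binser \<i> (of_real (l - \<mu> + eta)) * binser (-\<i>) (of_real (l - \<mu> - eta)))"
 have eq: "mp l n (of_real x + of_real eta * \<i>) = (\<Sum>k<Suc n. d (n - k) * mp \<mu> k (of_real x))" for n x
  unfolding mp_connection[of l n "of_real x" eta \<mu>] d_def lessThan_Suc_atMost by (simp add: mult.commute)
 obtain A where A: "A > 0" "!!k. (rbin a k)^2 <= A * rbin b k" using sq_rbin_bound[OF assms(3-5)] by metis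
 obtain B where B: "B > 0" "!!k. rbin (2 * \<mu> + b) k <= B * (real k + 1) powr (2 * \<mu> + b - 1)"
  using rbin_le_powr[of "2 * \<mu> + b"] assms by auto
 have N: "mpN \<mu> > 0" using mpN_pos[of \<mu>] assms by simp
 show ?thesis
 proof (rule that[of "mpN \<mu> * (K^2 * A + 1) * B"])
  show "mpN \<mu> * (K^2 * A + 1) * B > 0" using N A B by (intro mult_pos_pos add_nonneg_pos) auto
  fix n
  show "integrable lborel (%x. (cmod (mp l n (of_real x + of_real eta * \<i>)))^2 * mpw \<mu> x)"
   unfolding eq by (rule mp_parseval(1)[OF assms(1,2)])
  have "(LBINT x. (cmod (mp l n (of_real x + of_real eta * \<i>)))^2 * mpw \<mu> x) = mpN \<mu> * (\<Sum>k<Suc n. (cmod (d (n - k)))^2 * rbin (2 * \<mu>) k)"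
   unfolding eq by (rule mp_parseval(2)[OF assms(1,2)])
  also have "(\<Sum>k<Suc n. (cmod (d (n - k)))^2 * rbin (2 * \<mu>) k) <= (\<Sum>k<Suc n. (K^2 * A * rbin b (n - k)) * rbin (2 * \<mu>) k)"
  proof (intro sum_mono mult_right_mono)
   fix k
   have "(cmod (d (n - k)))^2 <= (K * rbin a (n - k))^2" using K(2)[of "n - k"] by (intro power_mono) (auto simp: d_def)
   also have "... <= K^2 * (A * rbin b (n - k))" unfolding power_mult_distrib using A by (intro mult_left_mono) auto
   finally show "(cmod (d (n - k)))^2 <= K^2 * A * rbin b (n - k)" by (simp add: mult.assoc)
  qed (use assms in \<open>auto intro: rbin_nonneg\<close>)
  also have "... = K^2 * A * (\<Sum>k\<le>n. rbin (2 * \<mu>) k * rbin b (n - k))"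
   by (simp add: sum_distrib_left lessThan_Suc_atMost mult_ac)
  also have "... = K^2 * A * rbin (2 * \<mu> + b) n" by (simp add: rbin_conv)
  also have "... <= (K^2 * A + 1) * (B * (real n + 1) powr (2 * \<mu> + b - 1))"
   using A B assms by (intro mult_mono) (auto intro: rbin_nonneg)
  finally show "(LBINT x. (cmod (mp l n (of_real x + of_real eta * \<i>)))^2 * mpw \<mu> x) <= mpN \<mu> * (K^2 * A + 1) * B * (real n + 1) powr (2 * \<mu> + b - 1)"
   using N by (simp add: mult.assoc)
 qed
qed

text \<open>For small \<mu> this weight decays faster than the one with parameter 1/4 by almost
  |x|^(-1/2), and the squared norm drops from about n^(-1/2) to about n^(-1). The choice a = 1/2 +
  \<mu>, b = 2 \<mu> turns the condition 2a - 2 \<le> b - 1 into an equality.\<close>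

lemma mp_shift_norm_near:
 assumes "0 < eta" "eta <= 1/4" "0 < \<mu>" "\<mu> <= 1/4"
 obtains C where "C > 0" "!!n. (LBINT x. (cmod (mp (1/4) n (of_real x + of_real eta * \<i>)))^2 * mpw \<mu> x) <= C * (real n + 1) powr (4 * \<mu> - 1)"
  and "!!n. integrable lborel (%x. (cmod (mp (1/4) n (of_real x + of_real eta * \<i>)))^2 * mpw \<mu> x)"
proof -
 \<comment> \<open>1/2 - 2 eta + \<mu> is at least the real part 1/4 - \<mu> - eta because eta \<le>
   1/4; it is padded so that its sum with 2 eta does not depend on eta.\<close>
 have "1/2 - 2 * eta + \<mu> > 0" "2 * eta > 0" using assms by auto
 then obtain K where K: "K > 0" "!!c d n. cmod d <= 2 ==> cmod (c - d) <= 2 ==> Re d <= 1/2 - 2 * eta + \<mu> ==> Re (c - d) <= 2 * eta ==>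
    cmod (fps_nth (binser \<i> c * binser (- \<i>) d) n) <= K * rbin (1/2 - 2 * eta + \<mu> + 2 * eta) n"
  using binser_prod_bound[of "1/2 - 2 * eta + \<mu>" "2 * eta" 2] by (metis zero_le_numeral)
 have K2: "cmod (fps_nth (binser \<i> (of_real (1/4 - \<mu> + eta)) * binser (-\<i>) (of_real (1/4 - \<mu> - eta))) m) <= K * rbin (1/2 + \<mu>) m" for m
 proof -
  have "(of_real (1/4 - \<mu> + eta) - of_real (1/4 - \<mu> - eta) :: complex) = of_real (2 * eta)" by simp
  moreover have "cmod (of_real (1/4 - \<mu> - eta)) <= 2" "cmod (of_real (2 * eta)) <= 2"
   "Re (of_real (1/4 - \<mu> - eta)) <= 1/2 - 2 * eta + \<mu>" "Re (of_real (2 * eta)) <= 2 * eta"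
   using assms unfolding norm_of_real Re_complex_of_real by auto
  ultimately have "cmod (fps_nth (binser \<i> (of_real (1/4 - \<mu> + eta)) * binser (-\<i>) (of_real (1/4 - \<mu> - eta))) m) <= K * rbin (1/2 - 2 * eta + \<mu> + 2 * eta) m"
   by (intro K(2)) (simp_all only:)
  then show ?thesis by simp
 qed
 have a: "0 < 1/2 + \<mu>" "0 < 2 * \<mu>" "2 * (1/2 + \<mu>) - 2 <= 2 * \<mu> - 1" "\<mu> <= 1" "0 <= K" using assms K by auto
 show ?thesis
  by (rule mp_shift_norm[OF assms(3) a(4,1,2,3,5) K2]) (use that in auto)
qed

text \<open>With equal parameters the exponents are eta and -eta, both at most 1/4, so the
  connection coefficients are O(m^(-1/2)). Their squares sum to a logarithm, which \<open>e\<close>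
  absorbs.\<close>

lemma mp_shift_norm_full:
 assumes "0 < eta" "eta <= 1/4" "0 < e"
 obtains C where "C > 0" "!!n. (LBINT x. (cmod (mp (1/4) n (of_real x + of_real eta * \<i>)))^2 * mpw (1/4) x) <= C * (real n + 1) powr (e - 1/2)"
  and "!!n. integrable lborel (%x. (cmod (mp (1/4) n (of_real x + of_real eta * \<i>)))^2 * mpw (1/4) x)"
proof -
 obtain K where K: "K > 0" "!!t c k. cmod t <= 1 ==> cmod c <= 1 ==> Re c <= 1/4 ==> cmod (fps_nth (binser t c) k) <= K * rbin (1/4) k"
  using norm_binser_nth_le[of "1/4" 1] by auto
 have K2: "cmod (fps_nth (binser \<i> (of_real (1/4 - 1/4 + eta)) * binser (-\<i>) (of_real (1/4 - 1/4 - eta))) m) <= (K * K) * rbin (1/2) m" for m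
 proof -
  have "cmod (of_real (1/4 - 1/4 + eta)) <= 1" "cmod (of_real (1/4 - 1/4 - eta)) <= 1" using assms unfolding norm_of_real by auto
  then have "cmod (fps_nth (binser \<i> (of_real (1/4 - 1/4 + eta)) * binser (-\<i>) (of_real (1/4 - 1/4 - eta))) m) <= (K * K) * rbin (1/4 + 1/4) m"
   using assms by (intro norm_fps_mult_nth_le K(2)) (simp_all only: Re_complex_of_real, auto)
  then show ?thesis by simp
 qed
 have a: "0 < (1/4::real)" "(1/4::real) <= 1" "0 < (1/2::real)" "2 * (1/2) - 2 <= e - 1" "0 <= K * K" using assms K by auto
 show ?thesis
  by (rule mp_shift_norm[OF a(1,2,3) assms(3) a(4,5) K2]) (use that in \<open>auto simp: add_ac\<close>)
qed

text \<open>Summation is convolution with \<open>rbin 1\<close>, the constant sequence 1.\<close>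

lemma sum_rbin_le:
 assumes "alpha > 0"
 shows "(\<Sum>k<n. rbin alpha k) <= rbin (1 + alpha) n"
proof -
 have one: "rbin 1 k = 1" for k by (simp add: rbin_def pochhammer_fact[symmetric])
 have "(\<Sum>k<n. rbin alpha k) <= (\<Sum>k\<le>n. rbin alpha k)"
  using assms by (intro sum_mono2) (auto intro: rbin_nonneg)
 also have "... = (\<Sum>k\<le>n. rbin alpha k * rbin 1 (n - k))" by (simp add: one)
 finally show ?thesis by (simp add: rbin_conv add.commute)
qed

text \<open>Cauchy-Schwarz with the weights \<open>rbin (1/2)\<close> leaves the square root of the
  reproducing kernel at x. Its terms are of size k^(6 kappa - 3/2) / k^(-1/2), so their sum is of
  size n^(6 kappa).\<close>

lemma mp_eval_bound:
 assumes "0 < kappa" "kappa <= 1"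
 obtains C where "C > 0" "!!n c x. \<bar>Re x\<bar> <= 1 ==> \<bar>Im x\<bar> <= kappa ==>
  cmod (\<Sum>k<n. c k * mp (1/4) k x) <= C * (real n + 1) powr (3 * kappa) * sqrt (\<Sum>k<n. (cmod (c k))^2 * rbin (1/2) k)"
proof -
 have pos: "1/4 + kappa > 0" "2 * kappa > 0" "1/4 + kappa + 2 * kappa > 0" "6 * kappa > 0" "1 + 6 * kappa > 0" using assms by auto
 obtain C where C: "C > 0" "!!X n. cmod X <= 2 ==> 1/4 - Im X <= 1/4 + kappa ==> 2 * Im X <= 2 * kappa ==> cmod (mp (1/4) n X) <= C * rbin (1/4 + kappa + 2 * kappa) n"
  using mp_pointwise_bound[OF pos(1,2), of 2 "1/4"] by (metis zero_le_numeral)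
 obtain A where A: "A > 0" "!!k. rbin (1/4 + kappa + 2 * kappa) k <= A * (real k + 1) powr (1/4 + kappa + 2 * kappa - 1)" using rbin_le_powr[OF pos(3)] by metis
 obtain B where B: "B > 0" "!!k. (real k + 1) powr (1/2 - 1) <= B * rbin (1/2) k" using powr_le_rbin[of "1/2"] by auto
 obtain D where D: "D > 0" "!!k. (real k + 1) powr (6 * kappa - 1) <= D * rbin (6 * kappa) k" using powr_le_rbin[OF pos(4)] by metis
 obtain E where E: "E > 0" "!!k. rbin (1 + 6 * kappa) k <= E * (real k + 1) powr (1 + 6 * kappa - 1)" using rbin_le_powr[OF pos(5)] by metis
 define L where "L = (C * A)^2 * B * D * E"
 have L: "L > 0" using C A B D E by (simp add: L_def)
 show ?thesis
 proof (rule that[of "sqrt L"])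
  show "sqrt L > 0" using L by simp
  fix n c x assume x: "\<bar>Re x\<bar> <= 1" "\<bar>Im x\<bar> <= kappa"
  have r0: "rbin (1/2) k > 0" for k by (rule rbin_pos) simp
  have x2: "cmod x <= 2" using cmod_le[of x] x assms by linarith
  have t: "(cmod (mp (1/4) k x))^2 / rbin (1/2) k <= (C * A)^2 * B * D * rbin (6 * kappa) k" for k
  proof -
   have "cmod (mp (1/4) k x) <= C * rbin (1/4 + kappa + 2 * kappa) k" using x by (intro C x2) auto
   also have "... <= C * (A * (real k + 1) powr (1/4 + kappa + 2 * kappa - 1))" using C A by (intro mult_left_mono) auto
   finally have "(cmod (mp (1/4) k x))^2 <= (C * (A * (real k + 1) powr (1/4 + kappa + 2 * kappa - 1)))^2" by (intro power_mono) auto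
   also have "... = (C * A)^2 * (real k + 1) powr (6 * kappa - 3/2)"
    by (simp add: power_mult_distrib powr_power)
   also have "... = (C * A)^2 * ((real k + 1) powr (6 * kappa - 1) * (real k + 1) powr (1/2 - 1))"
    by (simp flip: powr_add)
   also have "... <= (C * A)^2 * ((D * rbin (6 * kappa) k) * (B * rbin (1/2) k))"
    using B D by (intro mult_left_mono mult_mono order_trans[OF powr_ge_zero D(2)]) auto
   finally show ?thesis using r0[of k] by (simp add: field_simps)
  qed
  have "cmod (\<Sum>k<n. c k * mp (1/4) k x) <= (\<Sum>k<n. (cmod (c k) * sqrt (rbin (1/2) k)) * (cmod (mp (1/4) k x) / sqrt (rbin (1/2) k)))"
  proof (rule order_trans[OF norm_sum], rule sum_mono)
   show "cmod (c k * mp (1/4) k x) <= (cmod (c k) * sqrt (rbin (1/2) k)) * (cmod (mp (1/4) k x) / sqrt (rbin (1/2) k))" for k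
    using r0[of k] by (simp add: norm_mult)
  qed
  also have "... <= sqrt ((\<Sum>k<n. (cmod (c k) * sqrt (rbin (1/2) k))^2) * (\<Sum>k<n. (cmod (mp (1/4) k x) / sqrt (rbin (1/2) k))^2))"
   by (rule real_le_rsqrt[OF Cauchy_Schwarz_ineq_sum])
  also have "(\<Sum>k<n. (cmod (c k) * sqrt (rbin (1/2) k))^2) = (\<Sum>k<n. (cmod (c k))^2 * rbin (1/2) k)"
   using r0 by (intro sum.cong refl) (simp add: power_mult_distrib less_imp_le)
  also have "(\<Sum>k<n. (cmod (mp (1/4) k x) / sqrt (rbin (1/2) k))^2) = (\<Sum>k<n. (cmod (mp (1/4) k x))^2 / rbin (1/2) k)"
   using r0 by (intro sum.cong refl) (simp add: power_divide less_imp_le)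
  also have "sqrt ((\<Sum>k<n. (cmod (c k))^2 * rbin (1/2) k) * ...) <= sqrt ((\<Sum>k<n. (cmod (c k))^2 * rbin (1/2) k) * (L * ((real n + 1) powr (3 * kappa))^2))"
  proof (intro real_sqrt_le_mono mult_left_mono)
   have "(\<Sum>k<n. (cmod (mp (1/4) k x))^2 / rbin (1/2) k) <= (C * A)^2 * B * D * (\<Sum>k<n. rbin (6 * kappa) k)"
    unfolding sum_distrib_left by (intro sum_mono t)
   also have "... <= (C * A)^2 * B * D * (E * (real n + 1) powr (1 + 6 * kappa - 1))"
    using B D by (intro mult_left_mono order_trans[OF sum_rbin_le[OF pos(4)] E(2)]) auto
   also have "... = L * ((real n + 1) powr (3 * kappa))^2" by (simp add: L_def powr_power)
   finally show "(\<Sum>k<n. (cmod (mp (1/4) k x))^2 / rbin (1/2) k) <= L * ((real n + 1) powr (3 * kappa))^2" .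
  next
   show "0 <= (\<Sum>k<n. (cmod (c k))^2 * rbin (1/2) k)"
    by (intro sum_nonneg mult_nonneg_nonneg) (auto intro: less_imp_le[OF r0])
  qed
  also have "... = sqrt L * (real n + 1) powr (3 * kappa) * sqrt (\<Sum>k<n. (cmod (c k))^2 * rbin (1/2) k)"
   by (simp add: real_sqrt_mult)
  finally show "cmod (\<Sum>k<n. c k * mp (1/4) k x) <= sqrt L * (real n + 1) powr (3 * kappa) * sqrt (\<Sum>k<n. (cmod (c k))^2 * rbin (1/2) k)" .
 qed
qed

text \<open>Schur's test: the weights \<open>rbin (1/2)\<close> are reproduced by the convolution with
 \<open>rbin (\<eta> + e)\<close> up to the factor \<open>n\<^sup>\<eta>\<^sup>+\<^sup>e\<close>, by Vandermonde.\<close>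
lemma mp_shift_transfer:
 assumes "0 < eta" "eta <= 1" "0 < e"
 obtains C where "C > 0" "!!n beta. (LBINT x. (cmod (\<Sum>k<n. beta k * mp (1/4) k (of_real x + of_real eta * \<i>)))^2 * mpw (1/4) x)
   <= C * (real n + 1) powr (2 * (eta + e)) * (\<Sum>k<n. (cmod (beta k))^2 * rbin (1/2) k)"
  and "!!n beta. integrable lborel (%x. (cmod (\<Sum>k<n. beta k * mp (1/4) k (of_real x + of_real eta * \<i>)))^2 * mpw (1/4) x)"
proof -
 define d where "d = fps_nth (binser \<i> (of_real (1/4 - 1/4 + eta)) * binser (-\<i>) (of_real (1/4 - 1/4 - eta)))"
 have pos: "eta + e > 0" "1 + (eta + e) > 0" "1/2 + (eta + e) > 0" "(1/2::real) > 0" using assms by auto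
 obtain K1 where K1: "K1 > 0" "!!t c k. cmod t <= 1 ==> cmod c <= 1 ==> Re c <= eta ==> cmod (fps_nth (binser t c) k) <= K1 * rbin eta k"
  using norm_binser_nth_le[of eta 1] assms by auto
 \<comment> \<open>The second factor has the exponent -eta, but the majorant \<open>rbin e\<close>
   requires a positive parameter; this is the origin of the additional power
   \<open>e\<close>.\<close>
 obtain K2 where K2: "K2 > 0" "!!t c k. cmod t <= 1 ==> cmod c <= 1 ==> Re c <= e ==> cmod (fps_nth (binser t c) k) <= K2 * rbin e k"
  using norm_binser_nth_le[of e 1] assms by auto
 define K where "K = K1 * K2"
 have K0: "K > 0" using K1 K2 by (simp add: K_def)
 have dK: "cmod (d m) <= K * rbin (eta + e) m" for m
 proof -
  have "cmod (of_real (1/4 - 1/4 + eta)) <= 1" "cmod (of_real (1/4 - 1/4 - eta)) <= 1" using assms unfolding norm_of_real by auto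
  then show ?thesis unfolding d_def K_def
   using assms by (intro norm_fps_mult_nth_le K1(2) K2(2)) (simp_all only: Re_complex_of_real, auto)
 qed
 obtain A where A: "A > 0" "!!k. rbin (1 + (eta + e)) k <= A * (real k + 1) powr (1 + (eta + e) - 1)" using rbin_le_powr[OF pos(2)] by metis
 obtain B where B: "B > 0" "!!k. rbin (1/2 + (eta + e)) k <= B * (real k + 1) powr (1/2 + (eta + e) - 1)" using rbin_le_powr[OF pos(3)] by metis
 obtain D where D: "D > 0" "!!k. (real k + 1) powr (1/2 - 1) <= D * rbin (1/2) k" using powr_le_rbin[OF pos(4)] by metis
 have N: "mpN (1/4) > 0" by (rule mpN_pos) auto
 let ?b = "rbin (eta + e)" and ?h = "rbin (1/2)"
 have b0: "?b m >= 0" for m using rbin_nonneg[OF pos(1)] .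
 have h0: "?h m >= 0" for m by (rule rbin_nonneg) simp
 define \<gamma> where "\<gamma> n beta l = (\<Sum>k | l <= k \<and> k < n. beta k * d (k - l))" for n :: nat and beta :: "nat => complex" and l
 have eq: "(\<Sum>k<n. beta k * mp (1/4) k (of_real x + of_real eta * \<i>)) = (\<Sum>l<n. \<gamma> n beta l * mp (1/4) l (of_real x))" for n beta x
 proof -
  have "(\<Sum>k<n. beta k * mp (1/4) k (of_real x + of_real eta * \<i>)) = (\<Sum>k<n. \<Sum>l\<le>k. beta k * d (k - l) * mp (1/4) l (of_real x))"
   unfolding mp_connection[of "1/4" _ "of_real x" eta "1/4"] d_def by (simp add: sum_distrib_left mult_ac)
  also have "... = (\<Sum>k<n. \<Sum>l<n. if l <= k then beta k * d (k - l) * mp (1/4) l (of_real x) else 0)"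
  proof (rule sum.cong[OF refl])
   fix k assume "k \<in> {..<n}"
   then have "{..<n} \<inter> {l. l <= k} = {..k}" by auto
   then show "(\<Sum>l\<le>k. beta k * d (k - l) * mp (1/4) l (of_real x)) = (\<Sum>l<n. if l <= k then beta k * d (k - l) * mp (1/4) l (of_real x) else 0)"
    by (simp add: sum.If_cases)
  qed
  also have "... = (\<Sum>l<n. \<Sum>k<n. if l <= k then beta k * d (k - l) * mp (1/4) l (of_real x) else 0)" by (rule sum.swap)
  also have "... = (\<Sum>l<n. \<gamma> n beta l * mp (1/4) l (of_real x))"
  proof (rule sum.cong[OF refl])
   fix l assume "l \<in> {..<n}"
   have "{..<n} \<inter> {k. l <= k} = {k. l <= k \<and> k < n}" by auto
   then show "(\<Sum>k<n. if l <= k then beta k * d (k - l) * mp (1/4) l (of_real x) else 0) = \<gamma> n beta l * mp (1/4) l (of_real x)"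
    by (simp add: sum.If_cases \<gamma>_def sum_distrib_right)
  qed
  finally show ?thesis .
 qed
 \<comment> \<open>Half of the kernel goes to each side of Cauchy-Schwarz: one sum becomes a row sum
   of the kernel, the other keeps |beta k|^2 with one full factor of it.\<close>
 have row: "(cmod (\<gamma> n beta l))^2 <= K^2 * (A * (real n + 1) powr (eta + e)) * (\<Sum>k | l <= k \<and> k < n. ?b (k - l) * (cmod (beta k))^2)" for n beta l
 proof -
  let ?S = "{k. l <= k \<and> k < n}"
  have "cmod (\<gamma> n beta l) <= (\<Sum>k\<in>?S. K * (sqrt (?b (k - l)) * (sqrt (?b (k - l)) * cmod (beta k))))"
   unfolding \<gamma>_def
  proof (rule order_trans[OF norm_sum], rule sum_mono)
   fix k
   have "cmod (beta k * d (k - l)) <= cmod (beta k) * (K * ?b (k - l))"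
    unfolding norm_mult by (intro mult_left_mono dK) auto
   also have "?b (k - l) = sqrt (?b (k - l)) * sqrt (?b (k - l))" using b0 by simp
   finally show "cmod (beta k * d (k - l)) <= K * (sqrt (?b (k - l)) * (sqrt (?b (k - l)) * cmod (beta k)))" by (simp only: mult_ac)
  qed
  then have "(cmod (\<gamma> n beta l))^2 <= (\<Sum>k\<in>?S. K * (sqrt (?b (k - l)) * (sqrt (?b (k - l)) * cmod (beta k))))^2" by (intro power_mono) auto
  also have "... = K^2 * (\<Sum>k\<in>?S. sqrt (?b (k - l)) * (sqrt (?b (k - l)) * cmod (beta k)))^2"
   by (simp only: sum_distrib_left[symmetric] power_mult_distrib)
  also have "... <= K^2 * ((\<Sum>k\<in>?S. (sqrt (?b (k - l)))^2) * (\<Sum>k\<in>?S. (sqrt (?b (k - l)) * cmod (beta k))^2))"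
   by (intro mult_left_mono Cauchy_Schwarz_ineq_sum) auto
  also have "... = K^2 * ((\<Sum>k\<in>?S. ?b (k - l)) * (\<Sum>k\<in>?S. ?b (k - l) * (cmod (beta k))^2))"
   using b0 by (simp add: power_mult_distrib)
  also have "(\<Sum>k\<in>?S. ?b (k - l)) <= A * (real n + 1) powr (eta + e)"
  proof -
   have "(\<Sum>k\<in>?S. ?b (k - l)) = (\<Sum>m<n - l. ?b m)"
    by (rule sum.reindex_bij_witness[of _ "%m. m + l" "%k. k - l"]) auto
   also have "... <= (\<Sum>m<n. ?b m)" using b0 by (intro sum_mono2) auto
   also have "... <= rbin (1 + (eta + e)) n" by (rule sum_rbin_le[OF pos(1)])
   also have "... <= A * (real n + 1) powr (eta + e)" using A(2)[of n] by simp
   finally show ?thesis .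
  qed
  finally show ?thesis using b0 by (simp add: mult_left_mono mult_right_mono sum_nonneg mult.assoc)
 qed
 have col: "(\<Sum>l\<le>k. ?b (k - l) * ?h l) <= B * D * (real k + 1) powr (eta + e) * ?h k" for k
 proof -
  have "(\<Sum>l\<le>k. ?b (k - l) * ?h l) = rbin (1/2 + (eta + e)) k" using rbin_conv[of "1/2" "eta + e" k] by (simp add: mult.commute)
  also have "... <= B * (real k + 1) powr (1/2 + (eta + e) - 1)" by (rule B(2))
  also have "... = B * ((real k + 1) powr (eta + e) * (real k + 1) powr (1/2 - 1))" by (simp flip: powr_add)
  also have "... <= B * ((real k + 1) powr (eta + e) * (D * ?h k))" using B D by (intro mult_left_mono) auto
  finally show ?thesis by (simp add: mult_ac)
 qed
 define C where "C = mpN (1/4) * (K^2 * A * (B * D))"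
 show ?thesis
 proof (rule that[of C])
  show "C > 0" using N K0 A B D by (simp add: C_def)
  fix n beta
  show "integrable lborel (%x. (cmod (\<Sum>k<n. beta k * mp (1/4) k (of_real x + of_real eta * \<i>)))^2 * mpw (1/4) x)"
   unfolding eq by (rule mp_parseval) auto
  have "(LBINT x. (cmod (\<Sum>k<n. beta k * mp (1/4) k (of_real x + of_real eta * \<i>)))^2 * mpw (1/4) x) = mpN (1/4) * (\<Sum>l<n. (cmod (\<gamma> n beta l))^2 * ?h l)"
   unfolding eq by (subst mp_parseval) auto
  also have "(\<Sum>l<n. (cmod (\<gamma> n beta l))^2 * ?h l) <= (\<Sum>l<n. (K^2 * (A * (real n + 1) powr (eta + e)) * (\<Sum>k | l <= k \<and> k < n. ?b (k - l) * (cmod (beta k))^2)) * ?h l)"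
   by (intro sum_mono mult_right_mono row h0)
  also have "... = K^2 * (A * (real n + 1) powr (eta + e)) * (\<Sum>l<n. \<Sum>k<n. if l <= k then ?b (k - l) * ?h l * (cmod (beta k))^2 else 0)"
  proof -
   have "{..<n} \<inter> {k. l <= k} = {k. l <= k \<and> k < n}" for l by auto
   then show ?thesis by (simp add: sum.If_cases sum_distrib_left sum_distrib_right mult_ac)
  qed
  also have "(\<Sum>l<n. \<Sum>k<n. if l <= k then ?b (k - l) * ?h l * (cmod (beta k))^2 else 0) = (\<Sum>k<n. \<Sum>l<n. if l <= k then ?b (k - l) * ?h l * (cmod (beta k))^2 else 0)"
   by (rule sum.swap)
  also have "... = (\<Sum>k<n. (\<Sum>l\<le>k. ?b (k - l) * ?h l) * (cmod (beta k))^2)"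
  proof (rule sum.cong[OF refl])
   fix k assume "k \<in> {..<n}"
   then have "{..<n} \<inter> {l. l <= k} = {..k}" by auto
   then show "(\<Sum>l<n. if l <= k then ?b (k - l) * ?h l * (cmod (beta k))^2 else 0) = (\<Sum>l\<le>k. ?b (k - l) * ?h l) * (cmod (beta k))^2"
    by (simp add: sum.If_cases sum_distrib_right)
  qed
  also have "... <= (\<Sum>k<n. (B * D * (real n + 1) powr (eta + e) * ?h k) * (cmod (beta k))^2)"
  proof (rule sum_mono)
   fix k assume "k \<in> {..<n}"
   then have "B * D * (real k + 1) powr (eta + e) * ?h k <= B * D * (real n + 1) powr (eta + e) * ?h k"
    using B D h0 pos by (intro mult_right_mono mult_left_mono powr_mono2) auto
   then show "(\<Sum>l\<le>k. ?b (k - l) * ?h l) * (cmod (beta k))^2 <= (B * D * (real n + 1) powr (eta + e) * ?h k) * (cmod (beta k))^2"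
    using col[of k] by (intro mult_right_mono) auto
  qed
  also have "... = B * D * (real n + 1) powr (eta + e) * (\<Sum>k<n. (cmod (beta k))^2 * ?h k)" by (simp add: sum_distrib_left mult_ac)
  finally have "(LBINT x. (cmod (\<Sum>k<n. beta k * mp (1/4) k (of_real x + of_real eta * \<i>)))^2 * mpw (1/4) x)
   <= mpN (1/4) * (K^2 * (A * (real n + 1) powr (eta + e)) * (B * D * (real n + 1) powr (eta + e) * (\<Sum>k<n. (cmod (beta k))^2 * ?h k)))"
   using N A by (simp add: mult_left_mono)
  also have "... = C * ((real n + 1) powr (eta + e) * (real n + 1) powr (eta + e)) * (\<Sum>k<n. (cmod (beta k))^2 * ?h k)"
   by (simp add: C_def mult_ac)
  also have "(real n + 1) powr (eta + e) * (real n + 1) powr (eta + e) = (real n + 1) powr (2 * (eta + e))"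
   by (simp flip: powr_add)
  finally show "(LBINT x. (cmod (\<Sum>k<n. beta k * mp (1/4) k (of_real x + of_real eta * \<i>)))^2 * mpw (1/4) x)
   <= C * (real n + 1) powr (2 * (eta + e)) * (\<Sum>k<n. (cmod (beta k))^2 * ?h k)" .
 qed
qed

section \<open>Location of zeros\<close>

lemma mp_Christoffel_Darboux:
 assumes "l > 0"
 shows "2 * (X - Y) * (\<Sum>k<Suc n. mp l k X * mp l k Y / of_real (rbin (2 * l) k))
  = of_nat (Suc n) / of_real (rbin (2 * l) n) * (mp l (Suc n) X * mp l n Y - mp l n X * mp l (Suc n) Y)"
proof (induction n)
 case 0
 then show ?case by simp
next
 case (Suc n)
 define h where "h k = (of_real (rbin (2 * l) k) :: complex)" for k
 have h0: "h k \<noteq> 0" for k using rbin_pos[of "2 * l" k] assms by (simp add: h_def)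
 have hS: "(of_nat n + 2 * of_real l) / h (Suc n) = of_nat (Suc n) / h n"
 proof -
  have "rbin (2 * l) (Suc n) * real (Suc n) = rbin (2 * l) n * (real n + 2 * l)"
   by (simp add: rbin_Suc field_simps)
  from arg_cong[OF this, of complex_of_real] have "h (Suc n) * of_nat (Suc n) = h n * (of_nat n + 2 * of_real l)"
   by (simp add: h_def)
  then show ?thesis using h0[of n] h0[of "Suc n"] by (simp add: divide_simps mult_ac)
 qed
 have r: "of_nat (Suc (Suc n)) * mp l (Suc (Suc n)) Z = 2 * Z * mp l (Suc n) Z - (of_nat n + 2 * of_real l) * mp l n Z" for Z
  using mp_rec[of n l Z] by simp
 have "of_nat (Suc (Suc n)) / h (Suc n) * (mp l (Suc (Suc n)) X * mp l (Suc n) Y - mp l (Suc n) X * mp l (Suc (Suc n)) Y)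
   = (of_nat (Suc (Suc n)) * mp l (Suc (Suc n)) X * mp l (Suc n) Y - mp l (Suc n) X * (of_nat (Suc (Suc n)) * mp l (Suc (Suc n)) Y)) / h (Suc n)"
 proof -
  have "N / H * (a * b - c * d) = (N * a * b - c * (N * d)) / H" for N H a b c d :: complex
   by (simp add: algebra_simps diff_divide_distrib)
  then show ?thesis by (simp only:)
 qed
 also have "... = 2 * (X - Y) * (mp l (Suc n) X * mp l (Suc n) Y / h (Suc n)) + (of_nat n + 2 * of_real l) / h (Suc n) * (mp l (Suc n) X * mp l n Y - mp l n X * mp l (Suc n) Y)"
  unfolding r using h0[of "Suc n"] by (simp add: field_simps)
 also have "... = 2 * (X - Y) * (mp l (Suc n) X * mp l (Suc n) Y / h (Suc n)) + 2 * (X - Y) * (\<Sum>k<Suc n. mp l k X * mp l k Y / h k)"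
  unfolding hS using Suc.IH by (simp add: h_def)
 also have "... = 2 * (X - Y) * (\<Sum>k<Suc (Suc n). mp l k X * mp l k Y / h k)"
  by (simp only: sum.lessThan_Suc[of _ "Suc n"] distrib_left add.commute)
 finally show ?case unfolding h_def ..
qed

text \<open>At a zero \<open>X\<close> of \<open>Q\<close>, write \<open>X = Y + (X - Y)\<close> inside the reproducing kernel: the second part
 is rank two by Christoffel--Darboux.\<close>
lemma zero_equation:
 fixes E :: "complex poly => complex"
 assumes l: "l > 0"
  and add: "!!p q. E (p + q) = E p + E q" and smult: "!!a p. E (smult a p) = a * E p"
  and Q: "Q = mpp l (Suc n) + (\<Sum>k<Suc n. smult (c k) (mpp l k))"
  and c: "!!k. k < Suc n ==> c k * of_real (rbin (2 * l) k) = - E (Q * mpp l k)"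
  and X: "poly Q X = 0"
 shows "mp l (Suc n) X * (X - of_nat (Suc n) / of_real (2 * rbin (2 * l) n) * E (Q * mpp l n))
  = (\<Sum>k<Suc n. E ([:0, 1:] * Q * mpp l k) / of_real (rbin (2 * l) k) * mp l k X)
   - of_nat (Suc n) / of_real (2 * rbin (2 * l) n) * E (Q * mpp l (Suc n)) * mp l n X"
proof -
 define h where "h k = (of_real (rbin (2 * l) k) :: complex)" for k
 have h0: "h k \<noteq> 0" for k using rbin_pos[of "2 * l" k] l by (simp add: h_def)
 have E0: "E 0 = 0" using smult[of 0 0] by simp
 have Esum: "E (\<Sum>i\<in>A. f i) = (\<Sum>i\<in>A. E (f i))" for A :: "nat set" and f
  by (induction A rule: infinite_finite_induct) (auto simp: E0 add)
 \<comment> \<open>The reproducing kernel at X for degrees up to n.\<close>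
 define K where "K = (\<Sum>k<Suc n. smult (mp l k X / h k) (mpp l k))"
 define g where "g = of_nat (Suc n) / (2 * h n)"
 have "smult X K = [:0, 1:] * K + (smult (g * mp l (Suc n) X) (mpp l n) - smult (g * mp l n X) (mpp l (Suc n)))"
 proof -
  have "poly (smult X K) Y = poly ([:0, 1:] * K + (smult (g * mp l (Suc n) X) (mpp l n) - smult (g * mp l n X) (mpp l (Suc n)))) Y" for Y
  proof -
   have K: "poly K Y = (\<Sum>k<Suc n. mp l k X * mp l k Y / h k)" by (simp add: K_def poly_sum mpp del: sum.lessThan_Suc)
   have "2 * ((X - Y) * poly K Y) = of_nat (Suc n) / h n * (mp l (Suc n) X * mp l n Y - mp l n X * mp l (Suc n) Y)"
    using mp_Christoffel_Darboux[OF l, of X Y n] unfolding K h_def by (simp only: mult.assoc)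
   also have "... = 2 * (g * (mp l (Suc n) X * mp l n Y - mp l n X * mp l (Suc n) Y))"
    by (simp add: g_def)
   finally have "(X - Y) * poly K Y = g * (mp l (Suc n) X * mp l n Y - mp l n X * mp l (Suc n) Y)"
    by (simp only: mult_cancel_left) simp
   then show ?thesis by (simp add: mpp algebra_simps)
  qed
  then show ?thesis by (intro iffD1[OF poly_eq_poly_eq_iff] ext)
 qed
 from arg_cong[OF this, of "%p. E (Q * p)"]
 have 1: "X * E (Q * K) = E (Q * ([:0, 1:] * K)) + (g * mp l (Suc n) X * E (Q * mpp l n) - g * mp l n X * E (Q * mpp l (Suc n)))"
  unfolding distrib_left right_diff_distrib diff_conv_add_uminus mult_smult_right mult_minus_right
  using add smult smult[of "-1"] by (simp flip: smult_minus_left)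
 have 2: "E (Q * K) = (\<Sum>k<Suc n. mp l k X / h k * E (Q * mpp l k))"
  unfolding K_def sum_distrib_left mult_smult_right by (simp only: Esum smult)
 have 3: "E (Q * ([:0, 1:] * K)) = (\<Sum>k<Suc n. E ([:0, 1:] * Q * mpp l k) / h k * mp l k X)"
 proof -
  have "Q * ([:0, 1:] * K) = (\<Sum>k<Suc n. smult (mp l k X / h k) ([:0, 1:] * Q * mpp l k))"
   unfolding K_def sum_distrib_left mult_smult_right by (intro sum.cong refl arg_cong[where f = "smult _"]) (simp only: mult_ac)
  then show ?thesis by (simp only: Esum smult) (simp add: mult_ac del: sum.lessThan_Suc)
 qed
 \<comment> \<open>The lower coefficients of \<open>Q\<close> are themselves values of
   -\<open>E\<close>, so E(Q K) is minus the lower part of \<open>Q\<close> evaluated at X. As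
   \<open>Q\<close> vanishes at X, this equals the top term \<open>mp l (Suc n) X\<close>.\<close>
 have 4: "E (Q * K) = - (\<Sum>k<Suc n. c k * mp l k X)"
  unfolding 2 sum_negf[symmetric]
 proof (rule sum.cong[OF refl])
  fix k assume "k \<in> {..<Suc n}"
  then have "E (Q * mpp l k) = - (c k * h k)" using c[of k] by (simp add: h_def)
  then show "mp l k X / h k * E (Q * mpp l k) = - (c k * mp l k X)" using h0[of k] by simp
 qed
 have "poly Q X = mp l (Suc n) X + (\<Sum>k<Suc n. c k * mp l k X)"
  unfolding Q by (simp add: poly_sum mpp del: sum.lessThan_Suc)
 then have 5: "E (Q * K) = mp l (Suc n) X" using X 4 by (simp add: add_eq_0_iff)
 have gg: "of_nat (Suc n) / of_real (2 * rbin (2 * l) n) = g" by (simp add: g_def h_def)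
 show ?thesis using 1 unfolding 3 5 gg h_def by (simp add: algebra_simps del: sum.lessThan_Suc)
qed

section \<open>An almost conserved energy for the recurrence inside its oscillatory range\<close>

lemma energy_identity:
 fixes p q :: complex and x :: real
 shows "(cmod (of_real x * p - q))^2 + (cmod p)^2 - x * Re ((of_real x * p - q) * cnj p)
  = (cmod p)^2 + (cmod q)^2 - x * Re (p * cnj q)"
 unfolding cmod_power2 by (simp add: power2_eq_square algebra_simps)

text \<open>The form |p|^2 + |q|^2 - x Re(p cnj q) is conserved by r = x p - q and is definite for
  |x| < 2. If the recurrence and x are perturbed by \<theta>, the form grows at most by a multiple
  of \<theta>; the condition \<theta> \<le> 8 turns the quadratic error term into a linear
  one.\<close>

lemma energy_step:
 fixes p q r :: complex
 assumes \<theta>: "0 <= \<theta>" "\<theta> <= 8" and x: "\<bar>x\<bar> <= 2" "\<bar>y\<bar> <= 2" "\<bar>x - y\<bar> <= \<theta>"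
  and r: "cmod (r - (of_real x * p - q)) <= \<theta> * (cmod p + cmod q)"
 shows "(cmod r)^2 + (cmod p)^2 - y * Re (r * cnj p)
  <= ((cmod p)^2 + (cmod q)^2 - x * Re (p * cnj q)) + 40 * \<theta> * ((cmod p)^2 + (cmod q)^2)"
proof -
 define v where "v = of_real x * p - q"
 define \<rho> where "\<rho> = r - v"
 define M where "M = cmod p + cmod q"
 have r': "r = v + \<rho>" by (simp add: \<rho>_def)
 have \<rho>: "cmod \<rho> <= \<theta> * M" using r by (simp add: \<rho>_def v_def M_def)
 have M0: "M >= 0" "cmod p <= M" by (auto simp: M_def)
 have "cmod v <= \<bar>x\<bar> * cmod p + cmod q"
  unfolding v_def by (rule order_trans[OF norm_triangle_ineq4]) (simp add: norm_mult)
 also have "... <= 2 * cmod p + cmod q" using x by (intro add_right_mono mult_right_mono) auto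
 also have "... <= 2 * M" by (simp add: M_def)
 finally have v: "cmod v <= 2 * M" .
 have e: "(cmod (v + \<rho>))^2 = (cmod v)^2 + 2 * Re (v * cnj \<rho>) + (cmod \<rho>)^2"
  unfolding cmod_power2 by (simp add: power2_eq_square algebra_simps)
 have "(cmod r)^2 + (cmod p)^2 - y * Re (r * cnj p) = ((cmod v)^2 + (cmod p)^2 - x * Re (v * cnj p))
   + (2 * Re (v * cnj \<rho>) + (cmod \<rho>)^2 - y * Re (\<rho> * cnj p) + (x - y) * Re (v * cnj p))"
  unfolding r' e by (simp add: algebra_simps)
 also have "(cmod v)^2 + (cmod p)^2 - x * Re (v * cnj p) = (cmod p)^2 + (cmod q)^2 - x * Re (p * cnj q)"
  unfolding v_def by (rule energy_identity)
 also have "2 * Re (v * cnj \<rho>) + (cmod \<rho>)^2 - y * Re (\<rho> * cnj p) + (x - y) * Re (v * cnj p) <= 20 * \<theta> * M^2"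
 proof -
  have m: "(2 * M) * (\<theta> * M) = 2 * (\<theta> * M^2)" "(\<theta> * M) * M = \<theta> * M^2" "\<theta> * ((2 * M) * M) = 2 * (\<theta> * M^2)"
   by (simp_all add: power2_eq_square)
  have "Re (v * cnj \<rho>) <= cmod v * cmod \<rho>" using complex_Re_le_cmod[of "v * cnj \<rho>"] by (simp add: norm_mult)
  also have "... <= (2 * M) * (\<theta> * M)" using v \<rho> M0 by (intro mult_mono) auto
  finally have 1: "Re (v * cnj \<rho>) <= 2 * (\<theta> * M^2)" unfolding m .
  have "(cmod \<rho>)^2 <= (\<theta> * M)^2" using \<rho> by (intro power_mono) auto
  also have "... = \<theta> * \<theta> * M^2" by (simp add: power2_eq_square)
  also have "... <= 8 * \<theta> * M^2" using \<theta> by (intro mult_right_mono) auto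
  finally have 2: "(cmod \<rho>)^2 <= 8 * \<theta> * M^2" .
  have "\<bar>Re (\<rho> * cnj p)\<bar> <= cmod \<rho> * cmod p" using abs_Re_le_cmod[of "\<rho> * cnj p"] by (simp add: norm_mult)
  also have "... <= (\<theta> * M) * M" using \<rho> M0 \<theta> by (intro mult_mono) auto
  finally have "\<bar>y\<bar> * \<bar>Re (\<rho> * cnj p)\<bar> <= 2 * ((\<theta> * M) * M)" using x by (intro mult_mono) auto
  then have 3: "- (y * Re (\<rho> * cnj p)) <= 2 * (\<theta> * M^2)"
   unfolding abs_mult[symmetric] m by linarith
  have "\<bar>Re (v * cnj p)\<bar> <= cmod v * cmod p" using abs_Re_le_cmod[of "v * cnj p"] by (simp add: norm_mult)
  also have "... <= (2 * M) * M" using v M0 by (intro mult_mono) auto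
  finally have "\<bar>x - y\<bar> * \<bar>Re (v * cnj p)\<bar> <= \<theta> * ((2 * M) * M)" using x \<theta> by (intro mult_mono) auto
  then have 4: "(x - y) * Re (v * cnj p) <= 2 * (\<theta> * M^2)"
   unfolding abs_mult[symmetric] m by linarith
  have "0 <= \<theta> * M^2" using \<theta> by simp
  then show ?thesis using 1 2 3 4 by linarith
 qed
 also have "20 * \<theta> * M^2 <= 40 * \<theta> * ((cmod p)^2 + (cmod q)^2)"
 proof -
  have "M^2 <= 2 * ((cmod p)^2 + (cmod q)^2)"
   using zero_le_power2[of "cmod p - cmod q"] by (simp add: M_def power2_eq_square algebra_simps)
  then have "20 * \<theta> * M^2 <= 20 * \<theta> * (2 * ((cmod p)^2 + (cmod q)^2))" using \<theta> by (intro mult_left_mono) auto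
  moreover have "20 * \<theta> * (2 * z) = 40 * \<theta> * z" for z by simp
  ultimately show ?thesis by (simp only:)
 qed
 finally show ?thesis by simp
qed

text \<open>For k from about n/4 on, the squared norms \<open>rbin (1/2) k\<close> are bounded by a
  multiple of the one at n - 1, so weighted and unweighted sums over such k can be
  exchanged.\<close>

lemma rbin_half_ratio:
 obtains C where "C > 0" "!!k n. real n <= 4 * (real k + 1) ==> n >= 1 ==> rbin (1/2) k <= C * rbin (1/2) (n - 1)"
proof -
 obtain c C where *: "c > 0" "C > 0" "!!k. c * (real k + 1) powr (1/2 - 1) <= rbin (1/2) k" "!!k. rbin (1/2) k <= C * (real k + 1) powr (1/2 - 1)"
  using rbin_bounds[of "1/2"] by auto
 show ?thesis
 proof (rule that[of "2 * C / c"])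
  show "2 * C / c > 0" using * by simp
  fix k n :: nat assume kn: "real n <= 4 * (real k + 1)" "n >= 1"
  have "(real k + 1) powr (1/2 - 1) <= (real n / 4) powr (1/2 - 1)"
   using kn by (intro powr_mono2') auto
  also have "... = 2 * real n powr (1/2 - 1)"
  proof -
   have "(4::real) powr (1/2) = 2" using powr_half_sqrt[of 4] by simp
   moreover have "(4::real) powr (1/2 - 1) = 4 powr (1/2) / 4" by (subst powr_diff) simp
   ultimately have 4: "(4::real) powr (1/2 - 1) = 1/2" by simp
   have "(real n / 4) powr (1/2 - 1) = real n powr (1/2 - 1) / 4 powr (1/2 - 1)"
    by (rule powr_divide)
   then show ?thesis unfolding 4 by simp
  qed
  finally have "rbin (1/2) k <= C * (2 * real n powr (1/2 - 1))"
   using *(2) by (intro order_trans[OF *(4)[of k]] mult_left_mono) auto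
  also have "... = 2 * C / c * (c * real n powr (1/2 - 1))" using * by simp
  also have "... <= 2 * C / c * rbin (1/2) (n - 1)"
   using *(1,2) *(3)[of "n - 1"] kn by (intro mult_left_mono) (auto simp: of_nat_diff)
  finally show "rbin (1/2) k <= 2 * C / c * rbin (1/2) (n - 1)" .
 qed
qed

text \<open>The recurrence has the coefficients 2X / (k + 1) and (k - 1/2) / (k + 1), which differ
  from 2 Re X / k and 1 by O((1 + |Im X|) / k). The imaginary part of X is thus treated as a
  perturbation.\<close>

lemma mp_bulk_energy_step:
 assumes k: "k >= 1" "\<bar>Re X\<bar> <= real k" "2 * \<bar>Im X\<bar> + 2 <= 8 * real k"
 defines "E \<equiv> %k. (cmod (mp (1/4) k X))^2 + (cmod (mp (1/4) (k - 1) X))^2 - (2 * Re X / real k) * Re (mp (1/4) k X * cnj (mp (1/4) (k - 1) X))"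
 shows "E (Suc k) <= E k + 40 * ((2 * \<bar>Im X\<bar> + 2) / real k) * ((cmod (mp (1/4) k X))^2 + (cmod (mp (1/4) (k - 1) X))^2)"
proof -
 define p q r where "p = mp (1/4) k X" and "q = mp (1/4) (k - 1) X" and "r = mp (1/4) (Suc k) X"
 define \<theta> where "\<theta> = (2 * \<bar>Im X\<bar> + 2) / real k"
 define x y where "x = 2 * Re X / real k" and "y = 2 * Re X / real (Suc k)"
 have k0: "real k > 0" using k by simp
 have \<theta>: "0 <= \<theta>" "\<theta> <= 8" using k k0 by (auto simp: \<theta>_def field_simps)
 have x2: "\<bar>x\<bar> <= 2" using k k0 by (simp add: x_def abs_mult field_simps)
 have y2: "\<bar>y\<bar> <= 2" using k k0 by (simp add: y_def abs_mult field_simps)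
 have xy_eq: "x - y = x / real (Suc k)" using k0 by (simp add: x_def y_def field_simps)
 have xk: "\<bar>x\<bar> / real (Suc k) <= 2 / real k"
  using x2 k0 by (intro frac_le) auto
 have xy: "\<bar>x - y\<bar> <= \<theta>"
 proof -
  have "\<bar>x - y\<bar> <= 2 / real k" unfolding xy_eq using xk by simp
  also have "... <= \<theta>" unfolding \<theta>_def by (intro divide_right_mono) auto
  finally show ?thesis .
 qed
 have rec: "r = (2 * X / of_nat (Suc k)) * p - ((of_nat (k - 1) + 1/2) / of_nat (Suc k)) * q"
 proof -
  have "of_nat (Suc k) * r = 2 * X * p - (of_nat (k - 1) + 2 * of_real (1/4)) * q"
   using mp_rec[of "k - 1" "1/4" X] k by (simp add: p_def q_def r_def)
  moreover have "(of_nat (Suc k) :: complex) \<noteq> 0" by (rule of_nat_neq_0)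
  ultimately have "r = (2 * X * p - (of_nat (k - 1) + 2 * of_real (1/4)) * q) / of_nat (Suc k)"
   by (metis nonzero_mult_div_cancel_left)
  then show ?thesis by (simp add: diff_divide_distrib)
 qed
 have "r - (of_real x * p - q) = (2 * X / of_nat (Suc k) - of_real x) * p + (1 - (of_nat (k - 1) + 1/2) / of_nat (Suc k)) * q"
  unfolding rec by (simp add: algebra_simps)
 also have "1 - (of_nat (k - 1) + 1/2) / of_nat (Suc k) = (of_real ((3/2) / real (Suc k)) :: complex)"
 proof -
  obtain j where j: "k = Suc j" using k by (cases k) auto
  have "of_nat (k - 1) + 1/2 = (of_nat (Suc k) - 3/2 :: complex)" by (simp add: j)
  then show ?thesis using of_nat_neq_0[of k, where 'a = complex] by (simp add: diff_divide_distrib del: of_nat_Suc)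
 qed
 also have "2 * X / of_nat (Suc k) - of_real x = \<i> * of_real (2 * Im X / real (Suc k)) - of_real (x - y)"
  by (simp add: complex_eq_iff y_def Re_divide_of_nat Im_divide_of_nat del: of_nat_Suc)
 finally have "cmod (r - (of_real x * p - q)) <= cmod (\<i> * of_real (2 * Im X / real (Suc k)) - of_real (x - y)) * cmod p + ((3/2) / real (Suc k)) * cmod q"
  by (metis (no_types, lifting) norm_mult norm_of_real norm_triangle_ineq abs_of_nonneg divide_nonneg_nonneg of_nat_0_le_iff zero_le_divide_iff zero_le_numeral)
 also have "... <= \<theta> * cmod p + \<theta> * cmod q"
 proof (intro add_mono mult_right_mono)
  have "cmod (\<i> * of_real (2 * Im X / real (Suc k)) - of_real (x - y)) <= \<bar>2 * Im X / real (Suc k)\<bar> + \<bar>x - y\<bar>"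
   by (rule order_trans[OF norm_triangle_ineq4]) (simp only: norm_mult norm_of_real norm_ii mult_1)
  also have "\<bar>2 * Im X / real (Suc k)\<bar> <= 2 * \<bar>Im X\<bar> / real k"
   using k0 by (simp add: abs_mult frac_le)
  also have "2 * \<bar>Im X\<bar> / real k + \<bar>x - y\<bar> <= 2 * \<bar>Im X\<bar> / real k + 2 / real k"
   unfolding xy_eq using xk by simp
  also have "... = \<theta>" by (simp add: \<theta>_def add_divide_distrib)
  finally show "cmod (\<i> * of_real (2 * Im X / real (Suc k)) - of_real (x - y)) <= \<theta>" by simp
  have "(3/2) / real (Suc k) <= 2 / real k" using k0 by (intro frac_le) auto
  also have "... <= \<theta>" unfolding \<theta>_def by (intro divide_right_mono) auto
  finally show "(3/2) / real (Suc k) <= \<theta>" .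
 qed auto
 finally have rb: "cmod (r - (of_real x * p - q)) <= \<theta> * (cmod p + cmod q)" by (simp add: distrib_left)
 show ?thesis
  using energy_step[OF \<theta> x2 y2 xy rb] by (simp add: E_def p_def q_def r_def x_def y_def \<theta>_def)
qed

text \<open>Each step multiplies the energy at most by 1 + A with A of order (1 + |Im X|) / n, so
  the energy at n - 1 is at most a constant times the energy at each of about 1/A preceding indices.
  Averaging over these indices shows that the last term is only a small share of the whole kernel
  sum.\<close>

lemma mp_bulk_lower:
 assumes q: "0 < q" "q < 1"
 obtains C N where "C > 0" "!!n X. n >= N ==> \<bar>Re X\<bar> <= q * real n ==>
  (cmod (mp (1/4) (n - 1) X))^2 / rbin (1/2) (n - 1) <= C * (1 + \<bar>Im X\<bar>) / real n * (\<Sum>k<n. (cmod (mp (1/4) k X))^2 / rbin (1/2) k)"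
proof -
 \<comment> \<open>For k \<ge> q' n the ratio |Re X| / k is at most r = q / q' < 1, so the energy
   dominates (1 - r) times |p_k|^2 + |p_(k-1)|^2.\<close>
 define q' where "q' = (1 + q) / 2"
 define r where "r = q / q'"
 have q': "1/2 < q'" "q' < 1" "q < q'" using q by (auto simp: q'_def)
 have r: "0 < r" "r < 1" using q q' by (auto simp: r_def)
 \<comment> \<open>The first entry makes the growth per step at most A times the energy; the second
   keeps the averaging window inside k \<ge> q' n.\<close>
 define C where "C = max (160 / (q' * (1 - r))) (2 / (1 - q'))"
 have C: "160 / (q' * (1 - r)) <= C" "2 / (1 - q') <= C" by (auto simp: C_def)
 have C160: "160 <= C * (q' * (1 - r))" using C(1) q' r by (simp add: field_simps)
 have qr: "q' * (1 - r) < 1" "q' * (1 - r) > 0"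
  using mult_strict_mono[of q' 1 "1 - r" 1] q' r by (auto intro: mult_pos_pos)
 have C1: "C >= 160"
 proof -
  have "160 <= 160 / (q' * (1 - r))" using qr by (simp add: field_simps)
  then show ?thesis using C by linarith
 qed
 obtain H where H: "H > 0" "!!k n. real n <= 4 * (real k + 1) ==> n >= 1 ==> rbin (1/2) k <= H * rbin (1/2) (n - 1)"
  using rbin_half_ratio by metis
 define L where "L = max 1 (8 * exp 1 * H / (1 - r))"
 obtain N :: nat where N: "real N >= 6 / (1 - q')" using real_arch_simple by blast
 show ?thesis
 proof (rule that[of "L * C" "max N 8"])
  show "L * C > 0" using C1 by (simp add: L_def)
  fix n X assume n: "n >= max N 8" and X: "\<bar>Re X\<bar> <= q * real n"
  define p where "p k = mp (1/4) k X" for k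
  define h where "h = rbin (1/2)"
  have h0: "h k > 0" for k unfolding h_def by (rule rbin_pos) simp
  define S where "S = (\<Sum>k<n. (cmod (p k))^2 / h k)"
  have S0: "S >= 0" unfolding S_def using h0 by (intro sum_nonneg divide_nonneg_pos) auto
  define A where "A = C * (1 + \<bar>Im X\<bar>) / real n"
  have n0: "real n >= 8" using n by simp
  have A0: "A > 0" using C1 n0 by (auto simp: A_def intro!: divide_pos_pos mult_pos_pos)
  have nq: "(1 - q') * real n >= 6"
  proof -
   have "6 / (1 - q') <= real n" using N n by simp
   then show ?thesis using q' by (simp add: field_simps)
  qed
  have goal: "(cmod (p (n - 1)))^2 / h (n - 1) <= L * (A * S)"
  proof (cases "A > 1")
   case True
   have "(cmod (p (n - 1)))^2 / h (n - 1) <= S"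
    unfolding S_def using n0 h0 by (intro member_le_sum divide_nonneg_pos) auto
   also have "... <= 1 * (A * S)" using True S0 by (simp add: mult_le_cancel_right1)
   also have "... <= L * (A * S)" using A0 S0 by (intro mult_right_mono) (auto simp: L_def)
   finally show ?thesis .
  next
   case False
   \<comment> \<open>Over at most 1/A steps the accumulated factor (1 + A)^i stays below e.\<close>
   define m where "m = nat \<lfloor>1 / A\<rfloor>"
   have iA: "1 / A >= 1" using False A0 by simp
   have m1: "real m <= 1 / A" "real m > 1 / A - 1" using iA unfolding m_def by linarith+
   have An: "A * real n = C * (1 + \<bar>Im X\<bar>)" using n0 by (simp add: A_def)
   have "A * real n >= C" unfolding An using C1 by (simp add: algebra_simps)
   then have iAn: "1 / A <= real n / C" using A0 C1 by (simp add: field_simps)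
   also have "... <= real n / (2 / (1 - q'))" using C q' n0 C1 by (intro divide_left_mono) (auto intro!: divide_pos_pos mult_pos_pos)
   also have "... = (1 - q') * real n / 2" by simp
   finally have mn: "real m <= (1 - q') * real n / 2" using m1 by linarith
   have Imn: "C * (1 + \<bar>Im X\<bar>) <= real n" using False mult_right_mono[of A 1 "real n"] unfolding An[symmetric] by simp
   define E where "E k = (cmod (p k))^2 + (cmod (p (k - 1)))^2 - (2 * Re X / real k) * Re (p k * cnj (p (k - 1)))" for k
   define N2 where "N2 k = (cmod (p k))^2 + (cmod (p (k - 1)))^2" for k
   have N20: "N2 k >= 0" for k by (simp add: N2_def)
   have cross: "\<bar>2 * Re (p k * cnj (p (k - 1)))\<bar> <= N2 k" for k
   proof -
    have "\<bar>Re (p k * cnj (p (k - 1)))\<bar> <= cmod (p k) * cmod (p (k - 1))"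
     using abs_Re_le_cmod[of "p k * cnj (p (k - 1))"] by (simp add: norm_mult)
    then show ?thesis using zero_le_power2[of "cmod (p k) - cmod (p (k - 1))"]
     unfolding N2_def power2_diff by linarith
   qed
   have ratio: "\<bar>Re X / real k\<bar> <= r" if "real k >= q' * real n" for k
   proof -
    have "q' * real n > 0" using q' n0 by simp
    then have k0: "real k > 0" using that by linarith
    have "\<bar>Re X\<bar> <= r * (q' * real n)" using X q' by (simp add: r_def)
    also have "... <= r * real k" using that r by (intro mult_left_mono) auto
    finally show ?thesis using k0 by (simp add: field_simps)
   qed
   have Ebound: "(1 - r) * N2 k <= E k" "E k <= 2 * N2 k" if "real k >= q' * real n" for k
   proof -
    have "\<bar>(Re X / real k) * (2 * Re (p k * cnj (p (k - 1))))\<bar> <= r * N2 k"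
     unfolding abs_mult[of "Re X / real k"] using ratio[OF that] cross[of k] r by (intro mult_mono) auto
    moreover have "(a / b) * (2 * c) = (2 * a / b) * c" for a b c :: real by simp
    ultimately have "\<bar>(2 * Re X / real k) * Re (p k * cnj (p (k - 1)))\<bar> <= r * N2 k" by (simp only:)
    moreover have "r * N2 k <= 1 * N2 k" using r N20 by (intro mult_right_mono) auto
    moreover have "E k = N2 k - (2 * Re X / real k) * Re (p k * cnj (p (k - 1)))" by (simp add: E_def N2_def)
    ultimately show "(1 - r) * N2 k <= E k" "E k <= 2 * N2 k" unfolding left_diff_distrib mult_1 by linarith+
   qed
   have step: "E (Suc k) <= (1 + A) * E k" if k: "real k >= q' * real n" "k < n" for k
   proof -
    have kp: "real k >= real n / 2" 
    proof -
     have "1 / 2 * real n <= q' * real n" using q' by (intro mult_right_mono) auto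
     then show ?thesis using k by linarith
    qed
    have k1: "k >= 1" using kp n0 by (cases k) auto
    have 1: "\<bar>Re X\<bar> <= real k" 
    proof -
     have "\<bar>Re X\<bar> / real k <= 1" using ratio[OF k(1)] r by simp
     then show ?thesis using k1 by (simp add: field_simps)
    qed
    have 2: "2 * \<bar>Im X\<bar> + 2 <= 8 * real k"
    proof -
     have "1 + \<bar>Im X\<bar> <= C * (1 + \<bar>Im X\<bar>)" using C1 mult_right_mono[of 1 C "1 + \<bar>Im X\<bar>"] by simp
     then show ?thesis using Imn kp by linarith
    qed
    have "E (Suc k) <= E k + 40 * ((2 * \<bar>Im X\<bar> + 2) / real k) * N2 k"
     using mp_bulk_energy_step[OF k1 1 2] by (simp add: E_def N2_def p_def)
    also have "40 * ((2 * \<bar>Im X\<bar> + 2) / real k) * N2 k <= A * E k"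
    proof -
     have "40 * ((2 * \<bar>Im X\<bar> + 2) / real k) <= 40 * ((2 * \<bar>Im X\<bar> + 2) / (q' * real n))"
      using k k1 q' n0 by (intro mult_left_mono divide_left_mono mult_pos_pos) (auto intro: order.strict_trans2[of 0 "q' * real n"])
     also have "... = (80 / q') * (1 + \<bar>Im X\<bar>) / real n" using q' n0 by (simp add: field_simps)
     also have "... <= (C * (1 - r)) * (1 + \<bar>Im X\<bar>) / real n"
      using C160 q' by (intro divide_right_mono mult_right_mono) (auto simp: field_simps)
     also have "... = A * (1 - r)" by (simp add: A_def)
     finally have "40 * ((2 * \<bar>Im X\<bar> + 2) / real k) * N2 k <= A * (1 - r) * N2 k"
      using N20 by (intro mult_right_mono) auto
     also have "... <= A * E k" using Ebound(1)[OF k(1)] A0 by (simp add: mult.assoc mult_left_mono)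
     finally show ?thesis .
    qed
    finally show ?thesis by (simp add: algebra_simps)
   qed
   have kge: "real (n - 1 - i) >= q' * real n" "real (n - 1 - i) >= real n / 2 + 1" "i < n - 1" if "i <= m" for i
   proof -
    have "real i <= (1 - q') * real n / 2" using that mn by linarith
    moreover have "(1 - q') * real n <= 1 / 2 * real n" using q' by (intro mult_right_mono) auto
    moreover have "(1 - q') * real n = real n - q' * real n" by (simp add: algebra_simps)
    ultimately have a: "real i + 1 + q' * real n <= real n" "real i + 2 + real n / 2 <= real n \<or> q' * real n >= real n / 2" "real i + 1 < real n"
     using nq n0 by linarith+
    show "i < n - 1" using a(3) by linarith
    then have e: "real (n - 1 - i) = real n - 1 - real i" by (simp add: of_nat_diff)
    show "real (n - 1 - i) >= q' * real n" unfolding e using a by linarith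
    have "real i <= (1 - q') * real n / 2" using that mn by linarith
    moreover have "(1 - q') * real n <= 1 / 2 * real n" using q' by (intro mult_right_mono) auto
    ultimately show "real (n - 1 - i) >= real n / 2 + 1" unfolding e using nq n0 by linarith
   qed
   have backw: "E (n - 1) <= (1 + A) ^ i * E (n - 1 - i)" if "i <= m" for i
    using that
   proof (induction i)
    case (Suc i)
    have "E (n - 1 - i) <= (1 + A) * E (n - 1 - Suc i)"
     using step[of "n - 1 - Suc i"] kge[OF Suc.prems] by (simp add: Suc_diff_Suc)
    then have "(1 + A) ^ i * E (n - 1 - i) <= (1 + A) ^ i * ((1 + A) * E (n - 1 - Suc i))"
     using A0 by (intro mult_left_mono) auto
    then show ?case using Suc by (simp add: mult_ac)
   qed simp
   have each: "E (n - 1) <= exp 1 * (2 * N2 (n - 1 - i))" if "i <= m" for i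
   proof -
    have "(1 + A) ^ i <= exp A ^ i" using A0 by (intro power_mono exp_ge_add_one_self) auto
    also have "... = exp (real i * A)" by (simp add: exp_of_nat_mult)
    also have "real i * A <= 1"
    proof -
     have "real i <= 1 / A" using that m1 by linarith
     then show ?thesis using A0 by (simp add: field_simps)
    qed
    finally have e: "(1 + A) ^ i <= exp 1" by simp
    have Enn: "E (n - 1 - i) >= 0" using order_trans[OF mult_nonneg_nonneg[OF _ N20] Ebound(1)[OF kge(1)[OF that]]] r by simp
    have "E (n - 1) <= (1 + A) ^ i * E (n - 1 - i)" by (rule backw[OF that])
    also have "... <= exp 1 * (2 * N2 (n - 1 - i))"
     using e Enn Ebound(2)[OF kge(1)[OF that]] by (intro mult_mono) auto
    finally show ?thesis .
   qed
   have psq: "(cmod (p k))^2 <= H * h (n - 1) * ((cmod (p k))^2 / h k)" if "real n <= 4 * (real k + 1)" for k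
   proof -
    have "h k <= H * h (n - 1)" unfolding h_def by (rule H(2)[OF that]) (use n0 in auto)
    then have "(cmod (p k))^2 / h k * h k <= (cmod (p k))^2 / h k * (H * h (n - 1))"
     using h0[of k] by (intro mult_left_mono divide_nonneg_pos) auto
    then show ?thesis using h0[of k] by (simp add: mult_ac)
   qed
   have "(real m + 1) * E (n - 1) = (\<Sum>i\<le>m. E (n - 1))" by simp
   also have "... <= (\<Sum>i\<le>m. exp 1 * (2 * N2 (n - 1 - i)))" by (intro sum_mono each) auto
   also have "... = 2 * exp 1 * ((\<Sum>i\<le>m. (cmod (p (n - 1 - i)))^2) + (\<Sum>i\<le>m. (cmod (p (n - 1 - i - 1)))^2))"
    by (simp add: N2_def sum_distrib_left sum.distrib distrib_left mult_ac)
   also have "... <= 2 * exp 1 * (H * h (n - 1) * S + H * h (n - 1) * S)"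
   proof (intro mult_left_mono add_mono)
    show "(\<Sum>i\<le>m. (cmod (p (n - 1 - i)))^2) <= H * h (n - 1) * S"
    proof -
     have "(\<Sum>i\<le>m. (cmod (p (n - 1 - i)))^2) <= (\<Sum>i\<le>m. H * h (n - 1) * ((cmod (p (n - 1 - i)))^2 / h (n - 1 - i)))"
     proof (intro sum_mono psq)
      fix i assume "i \<in> {..m}"
      then have "real (n - 1 - i) >= real n / 2 + 1" by (intro kge(2)) auto
      then show "real n <= 4 * (real (n - 1 - i) + 1)" using n0 by argo
     qed
     also have "... = H * h (n - 1) * (\<Sum>k\<in>(%i. n - 1 - i) ` {..m}. (cmod (p k))^2 / h k)"
     proof -
      have "inj_on (%i. n - 1 - i) {..m}"
      proof (rule inj_onI)
       fix i j assume "i \<in> {..m}" "j \<in> {..m}" "n - 1 - i = n - 1 - j"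
       then show "i = j" using kge(3)[of i] kge(3)[of j] by auto
      qed
      then show ?thesis by (simp only: sum.reindex sum_distrib_left o_def)
     qed
     also have "... <= H * h (n - 1) * S"
      unfolding S_def using H(1) h0 n0 by (intro mult_left_mono sum_mono2) (auto intro: divide_nonneg_pos less_imp_le mult_nonneg_nonneg)
     finally show ?thesis .
    qed
    show "(\<Sum>i\<le>m. (cmod (p (n - 1 - i - 1)))^2) <= H * h (n - 1) * S"
    proof -
     have "(\<Sum>i\<le>m. (cmod (p (n - 1 - i - 1)))^2) <= (\<Sum>i\<le>m. H * h (n - 1) * ((cmod (p (n - 1 - i - 1)))^2 / h (n - 1 - i - 1)))"
     proof (intro sum_mono psq)
      fix i assume "i \<in> {..m}"
      then have "real (n - 1 - i) >= real n / 2 + 1" by (intro kge(2)) auto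
      moreover have "real (n - 1 - i - 1) >= real (n - 1 - i) - 1" by linarith
      ultimately show "real n <= 4 * (real (n - 1 - i - 1) + 1)" using n0 by argo
     qed
     also have "... = H * h (n - 1) * (\<Sum>k\<in>(%i. n - 1 - i - 1) ` {..m}. (cmod (p k))^2 / h k)"
     proof -
      have "inj_on (%i. n - 1 - i - 1) {..m}"
      proof (rule inj_onI)
       fix i j assume "i \<in> {..m}" "j \<in> {..m}" "n - 1 - i - 1 = n - 1 - j - 1"
       then show "i = j" using kge(3)[of i] kge(3)[of j] by auto
      qed
      then show ?thesis by (simp only: sum.reindex sum_distrib_left o_def)
     qed
     also have "... <= H * h (n - 1) * S"
      unfolding S_def using H(1) h0 n0 by (intro mult_left_mono sum_mono2) (auto intro: divide_nonneg_pos less_imp_le mult_nonneg_nonneg)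
     finally show ?thesis .
    qed
   qed auto
   finally have sum: "(real m + 1) * E (n - 1) <= 4 * exp 1 * H * h (n - 1) * S" by (simp add: mult_ac)
   have En: "(1 - r) * (cmod (p (n - 1)))^2 <= E (n - 1)"
   proof -
    have "(1 - r) * (cmod (p (n - 1)))^2 <= (1 - r) * N2 (n - 1)" using r by (intro mult_left_mono) (auto simp: N2_def)
    also have "... <= E (n - 1)" using Ebound(1)[of "n - 1"] kge(1)[of 0] by simp
    finally show ?thesis .
   qed
   have "(1 / A) * ((1 - r) * (cmod (p (n - 1)))^2) <= (real m + 1) * E (n - 1)"
    using m1 En r by (intro mult_mono) auto
   also note sum
   finally have "(1 - r) * (cmod (p (n - 1)))^2 <= (4 * exp 1 * H * h (n - 1) * S) * A"
    using A0 by (simp add: field_simps)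
   then have "(cmod (p (n - 1)))^2 / h (n - 1) <= (4 * exp 1 * H / (1 - r)) * (A * S)"
    using r h0[of "n - 1"] by (simp add: field_simps)
   also have "... <= L * (A * S)"
    using A0 S0 H r by (intro mult_right_mono) (auto simp: L_def field_simps le_max_iff_disj)
   finally show ?thesis .
  qed
  then show "(cmod (mp (1/4) (n - 1) X))^2 / rbin (1/2) (n - 1) <= L * C * (1 + \<bar>Im X\<bar>) / real n * (\<Sum>k<n. (cmod (mp (1/4) k X))^2 / rbin (1/2) k)"
  proof -
   have "L * (C * t / N * S) = L * C * t / N * S" for t N S by simp
   then show ?thesis using goal unfolding p_def h_def A_def S_def by (simp only:)
  qed
 qed
qed

text \<open>Here the term 2 X p_(k+1) outweighs the other one in the recurrence, so the moduli
  increase by induction.\<close>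

lemma mp_growth_outside:
 assumes d: "d >= 0" and X: "cmod X >= (1 + d) * real n" and k: "k < n"
 shows "cmod (mp (1/4) k X) <= cmod (mp (1/4) (Suc k) X)"
 using k
proof (induction k)
 case 0
 have "1 <= (1 + d) * real n" using 0 d mult_mono[of 1 "1 + d" 1 "real n"] by simp
 then show ?case using X by (simp add: norm_mult)
next
 case (Suc k)
 define p where "p k = mp (1/4) k X" for k
 have IH: "cmod (p k) <= cmod (p (Suc k))" using Suc by (simp add: p_def)
 have "of_nat (Suc (Suc k)) * p (Suc (Suc k)) = 2 * X * p (Suc k) - (of_nat k + 2 * of_real (1/4)) * p k"
  using mp_rec[of k "1/4" X] by (simp add: p_def)
 then have "real (Suc (Suc k)) * cmod (p (Suc (Suc k))) = cmod (2 * X * p (Suc k) - (of_nat k + 2 * of_real (1/4)) * p k)"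
  by (metis norm_mult norm_of_nat)
 also have "... >= cmod (2 * X * p (Suc k)) - cmod ((of_nat k + 2 * of_real (1/4)) * p k)"
  by (rule norm_triangle_ineq2)
 also have "cmod (2 * X * p (Suc k)) = 2 * cmod X * cmod (p (Suc k))" by (simp add: norm_mult)
 also have "(of_nat k + 2 * of_real (1/4) :: complex) = of_real (real k + 1/2)" by simp
 also have "cmod (of_real (real k + 1/2) * p k) = (real k + 1/2) * cmod (p k)"
  unfolding norm_mult norm_of_real by simp
 finally have 1: "2 * cmod X * cmod (p (Suc k)) - (real k + 1/2) * cmod (p k) <= real (Suc (Suc k)) * cmod (p (Suc (Suc k)))" by simp
 have 2: "(real k + 1/2) * cmod (p k) <= (real k + 1/2) * cmod (p (Suc k))" using IH by (intro mult_left_mono) auto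
 have 3: "2 * (real (Suc k) + 1) * cmod (p (Suc k)) <= 2 * cmod X * cmod (p (Suc k))"
 proof (intro mult_right_mono mult_left_mono)
  have "real (Suc k) + 1 <= real n" using Suc.prems by simp
  also have "... <= (1 + d) * real n" using d by (simp add: mult_le_cancel_right1)
  finally show "real (Suc k) + 1 <= cmod X" using X by linarith
 qed auto
 have "real (Suc (Suc k)) * cmod (p (Suc k)) + (real k + 1/2) * cmod (p (Suc k)) <= 2 * (real (Suc k) + 1) * cmod (p (Suc k))"
  unfolding distrib_right[symmetric] by (intro mult_right_mono) auto
 then have "real (Suc (Suc k)) * cmod (p (Suc k)) <= real (Suc (Suc k)) * cmod (p (Suc (Suc k)))"
  using 1 2 3 by linarith
 then show ?case by (simp only: p_def mult_le_cancel_left_pos of_nat_0_less_iff zero_less_Suc)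
qed

text \<open>Christoffel-Darboux at X and its conjugate expresses Im X times the kernel sum S through
  p_n and p_(n-1). The assumed equation makes p_n small, and the bulk estimate bounds |p_(n-1)|^2 by
  S with a gain of order 1/n.\<close>

lemma mp_zero_location:
 assumes d: "0 < d" "d <= 1"
 obtains C \<epsilon> N where "C > 0" "\<epsilon> > 0"
  "!!n X e beta \<gamma> \<omega>. n >= N ==>
    mp (1/4) n X * (X - beta) = (\<Sum>k<n. e k * mp (1/4) k X) - \<gamma> * mp (1/4) (n - 1) X ==>
    d * real n <= cmod X ==> d * real n <= cmod (X - of_nat n) ==> d * real n <= cmod (X + of_nat n) ==>
    cmod beta <= \<epsilon> * real n ==> cmod \<gamma> <= \<epsilon> * real n ==> \<omega> >= 0 ==> \<omega> <= \<epsilon> ==>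
    (\<Sum>k<n. (cmod (e k))^2 * rbin (1/2) k) <= \<omega>^2 * real n * rbin (1/2) (n - 1) ==>
    \<bar>Im X\<bar> <= C * (\<omega> + cmod \<gamma> / real n)"
proof -
 have q: "0 < 1 - d / 2" "1 - d / 2 < 1" using d by auto
 obtain K N where K: "K > 0" "!!n X. n >= N ==> \<bar>Re X\<bar> <= (1 - d / 2) * real n ==>
  (cmod (mp (1/4) (n - 1) X))^2 / rbin (1/2) (n - 1) <= K * (1 + \<bar>Im X\<bar>) / real n * (\<Sum>k<n. (cmod (mp (1/4) k X))^2 / rbin (1/2) k)"
  by (rule mp_bulk_lower[OF q]) blast
 define C2 where "C2 = (1 + K) / d"
 have C2: "C2 > 0" using K d by (simp add: C2_def)
 \<comment> \<open>The three entries serve, in turn, the crude bound |Im X| \<le> d n / 4, the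
   exclusion of |X| \<ge> n, and the absorption of |Im X| from the right-hand side at the
   end.\<close>
 define \<epsilon> where "\<epsilon> = min (d^2 / 8) (min (1/8) (1 / (4 * C2)))"
 have eps: "\<epsilon> > 0" "\<epsilon> <= d^2 / 8" "\<epsilon> <= 1/8" "\<epsilon> <= 1 / (4 * C2)" using d C2 by (auto simp: \<epsilon>_def)
 have d2: "d^2 <= d" using d by (simp add: power2_eq_square mult_le_cancel_left1)
 show ?thesis
 proof (rule that[of "2 * C2" \<epsilon> "max N 1"])
  show "2 * C2 > 0" "\<epsilon> > 0" using C2 eps by auto
  fix n X e beta \<gamma> \<omega>
  assume n: "n >= max N 1" and eq: "mp (1/4) n X * (X - beta) = (\<Sum>k<n. e k * mp (1/4) k X) - \<gamma> * mp (1/4) (n - 1) X"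
   and X: "d * real n <= cmod X" "d * real n <= cmod (X - of_nat n)" "d * real n <= cmod (X + of_nat n)"
   and beta: "cmod beta <= \<epsilon> * real n" and \<gamma>: "cmod \<gamma> <= \<epsilon> * real n" and \<omega>: "\<omega> >= 0" "\<omega> <= \<epsilon>"
   and e: "(\<Sum>k<n. (cmod (e k))^2 * rbin (1/2) k) <= \<omega>^2 * real n * rbin (1/2) (n - 1)"
  define p where "p k = mp (1/4) k X" for k
  define h where "h k = rbin (1/2) k" for k
  have h0: "h k > 0" for k unfolding h_def by (rule rbin_pos) simp
  define S where "S = (\<Sum>k<n. (cmod (p k))^2 / h k)"
  define H where "H = h (n - 1)"
  define \<tau> where "\<tau> = \<bar>Im X\<bar>"
  define t where "t = cmod (p (n - 1)) / sqrt H"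
  have n1: "real n >= 1" using n by simp
  have H0: "H > 0" using h0 by (simp add: H_def)
  have S1: "S >= 1"
  proof -
   have "(cmod (p 0))^2 / h 0 <= S" unfolding S_def using n h0 by (intro member_le_sum divide_nonneg_pos) auto
   then show ?thesis by (simp add: p_def h_def)
  qed
  have t0: "t >= 0" and tS: "t^2 <= S"
  proof -
   show "t >= 0" using H0 by (simp add: t_def)
   have "t^2 = (cmod (p (n - 1)))^2 / h (n - 1)" using H0 by (simp add: t_def power_divide H_def)
   also have "... <= S" unfolding S_def using n h0 by (intro member_le_sum divide_nonneg_pos) auto
   finally show "t^2 <= S" .
  qed
  have pt: "cmod (p (n - 1)) = t * sqrt H" using H0 by (simp add: t_def)
  have esum: "cmod (\<Sum>k<n. e k * p k) <= \<omega> * sqrt (real n) * sqrt H * sqrt S"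
  proof -
   have "cmod (\<Sum>k<n. e k * p k) <= (\<Sum>k<n. (cmod (e k) * sqrt (h k)) * (cmod (p k) / sqrt (h k)))"
   proof (rule order_trans[OF norm_sum], rule sum_mono)
    show "cmod (e k * p k) <= (cmod (e k) * sqrt (h k)) * (cmod (p k) / sqrt (h k))" for k
     using h0[of k] by (simp add: norm_mult)
   qed
   also have "... <= sqrt ((\<Sum>k<n. (cmod (e k) * sqrt (h k))^2) * (\<Sum>k<n. (cmod (p k) / sqrt (h k))^2))"
    by (rule real_le_rsqrt[OF Cauchy_Schwarz_ineq_sum])
   also have "(\<Sum>k<n. (cmod (e k) * sqrt (h k))^2) = (\<Sum>k<n. (cmod (e k))^2 * h k)"
    using h0 by (intro sum.cong refl) (simp add: power_mult_distrib less_imp_le)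
   also have "(\<Sum>k<n. (cmod (p k) / sqrt (h k))^2) = S"
    unfolding S_def using h0 by (intro sum.cong refl) (simp add: power_divide less_imp_le)
   also have "sqrt ((\<Sum>k<n. (cmod (e k))^2 * h k) * S) <= sqrt ((\<omega>^2 * real n * H) * S)"
    using e S1 by (intro real_sqrt_le_mono mult_right_mono) (auto simp: h_def H_def)
   also have "... = \<omega> * sqrt (real n) * sqrt H * sqrt S" using \<omega> by (simp add: real_sqrt_mult)
   finally show ?thesis .
  qed
  have Xb: "cmod X / 2 <= cmod (X - beta)"
  proof -
   have "\<epsilon> * real n <= d / 2 * real n" using eps d2 d by (intro mult_right_mono) auto
   then have "cmod beta <= cmod X / 2" using beta X by linarith
   then show ?thesis using norm_triangle_ineq2[of X beta] by linarith
  qed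
  have main: "cmod (p n) * (cmod X / 2) <= \<omega> * sqrt (real n) * sqrt H * sqrt S + cmod \<gamma> * cmod (p (n - 1))"
  proof -
   have "cmod (p n) * (cmod X / 2) <= cmod (p n) * cmod (X - beta)" using Xb by (intro mult_left_mono) auto
   also have "... = cmod ((\<Sum>k<n. e k * p k) - \<gamma> * p (n - 1))" using eq unfolding p_def norm_mult[symmetric] by simp
   also have "... <= cmod (\<Sum>k<n. e k * p k) + cmod (\<gamma> * p (n - 1))" by (rule norm_triangle_ineq4)
   finally show ?thesis using esum by (simp add: norm_mult)
  qed
  have CD: "2 * \<tau> * S * H <= real n * (cmod (p n) * cmod (p (n - 1)))"
  proof -
   have nS: "n = Suc (n - 1)" using n by simp
   have "2 * (X - cnj X) * (\<Sum>k<n. p k * cnj (p k) / of_real (h k)) = of_nat n / of_real H * (p n * cnj (p (n - 1)) - p (n - 1) * cnj (p n))"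
    using mp_Christoffel_Darboux[of "1/4" X "cnj X" "n - 1"] nS by (simp add: mp_cnj p_def h_def H_def)
   moreover have sumS: "(\<Sum>k<n. p k * cnj (p k) / of_real (h k)) = of_real S"
    unfolding S_def by (simp add: complex_norm_square[symmetric] del: of_real_power)
   ultimately have "2 * (X - cnj X) * of_real S = of_nat n / of_real H * (p n * cnj (p (n - 1)) - p (n - 1) * cnj (p n))"
    by (simp only:)
   from arg_cong[OF this, of cmod]
   have "2 * cmod (X - cnj X) * S = real n / H * cmod (p n * cnj (p (n - 1)) - p (n - 1) * cnj (p n))"
    using S1 H0 unfolding norm_mult[of _ "of_real S"] norm_mult[of 2] norm_mult[of "_ / _"] norm_divide by simp
   also have "cmod (X - cnj X) = 2 * \<tau>" by (simp add: complex_diff_cnj norm_mult \<tau>_def)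
   also have "real n / H * cmod (p n * cnj (p (n - 1)) - p (n - 1) * cnj (p n)) <= real n / H * (2 * (cmod (p n) * cmod (p (n - 1))))"
    using H0 by (intro mult_left_mono order_trans[OF norm_triangle_ineq4]) (auto simp: norm_mult)
   finally have "2 * (2 * \<tau>) * S <= real n / H * (2 * (cmod (p n) * cmod (p (n - 1))))" .
   then show ?thesis using H0 by (simp add: field_simps)
  qed
  have comb: "\<tau> * S * d <= \<omega> * sqrt (real n) * sqrt S * t + cmod \<gamma> * t^2"
  proof -
   have "(2 * \<tau> * S * H) * (d * real n / 2) <= real n * (cmod (p n) * cmod (p (n - 1))) * (cmod X / 2)"
    using X(1) d n1 by (intro mult_mono[OF CD]) auto
   also have "... = real n * cmod (p (n - 1)) * (cmod (p n) * (cmod X / 2))" by simp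
   also have "... <= real n * cmod (p (n - 1)) * (\<omega> * sqrt (real n) * sqrt H * sqrt S + cmod \<gamma> * cmod (p (n - 1)))"
    using main n1 by (intro mult_left_mono) auto
   also have "... = (real n * H) * (\<omega> * sqrt (real n) * sqrt S * t + cmod \<gamma> * t^2)"
   proof -
    have "N * (t * r) * (w * r * s + g * (t * r)) = (N * (r * r)) * (w * s * t + g * t^2)" for N r w s g
     by (simp add: algebra_simps power2_eq_square)
    moreover have "sqrt H * sqrt H = H" using H0 by simp
    ultimately show ?thesis unfolding pt by (metis (no_types))
   qed
   finally have "(real n * H) * (\<tau> * S * d) <= (real n * H) * (\<omega> * sqrt (real n) * sqrt S * t + cmod \<gamma> * t^2)"
    by (simp add: mult_ac)
   then show ?thesis using n1 H0 by (subst (asm) mult_le_cancel_left_pos) auto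
  qed
  \<comment> \<open>The bound resulting from any share \<open>kappa\<close> of S that t^2 may have:
    the trivial share 1 gives a crude location of X, the share of order (1 + |Im X|) / n gives the
    final one.\<close>
  have gen: "\<tau> * d <= \<omega> * sqrt (real n) * sqrt kappa + cmod \<gamma> * kappa" if kappa: "t^2 <= kappa * S" "kappa >= 0" for kappa
  proof -
   have "t <= sqrt kappa * sqrt S" unfolding real_sqrt_mult[symmetric] using kappa by (intro real_le_rsqrt) auto
   then have "\<omega> * sqrt (real n) * sqrt S * t <= \<omega> * sqrt (real n) * sqrt S * (sqrt kappa * sqrt S)"
    using \<omega> S1 by (intro mult_left_mono) auto
   also have "... = \<omega> * sqrt (real n) * sqrt kappa * (sqrt S * sqrt S)" by (simp only: mult_ac)
   also have "sqrt S * sqrt S = S" using S1 by simp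
   finally have "\<tau> * S * d <= \<omega> * sqrt (real n) * sqrt kappa * S + cmod \<gamma> * (kappa * S)"
    using comb mult_left_mono[OF kappa(1), of "cmod \<gamma>"] by simp
   then have "S * (\<tau> * d) <= S * (\<omega> * sqrt (real n) * sqrt kappa + cmod \<gamma> * kappa)" by (simp add: algebra_simps)
   then show ?thesis using S1 by (subst (asm) mult_le_cancel_left_pos) auto
  qed
  have sn: "sqrt (real n) <= real n" using n1 by (simp add: real_le_lsqrt power2_eq_square)
  have \<tau>n: "\<tau> <= d / 4 * real n"
  proof -
   have "\<tau> * d <= \<omega> * sqrt (real n) * sqrt 1 + cmod \<gamma> * 1" by (rule gen) (use tS in auto)
   also have "... <= \<epsilon> * real n + \<epsilon> * real n" using \<omega> sn \<gamma> eps by (intro add_mono) (auto intro: mult_mono)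
   also have "... <= d^2 / 8 * real n + d^2 / 8 * real n" using eps by (intro add_mono mult_right_mono) auto
   finally have "d * \<tau> <= d * (d / 4 * real n)" by (simp add: power2_eq_square mult_ac)
   then show ?thesis using d by simp
  qed
  \<comment> \<open>As |Im X| is small against n, the distance from n and -n leaves only the bulk or
    |Re X| \<ge> n. In the latter case the moduli |p_k| increase up to k = n, and
    \<open>main\<close> would bound |p_n| by less than itself.\<close>
  have inside: "\<bar>Re X\<bar> <= (1 - d / 2) * real n"
  proof (rule ccontr)
   assume c: "\<not> \<bar>Re X\<bar> <= (1 - d / 2) * real n"
   have "cmod X >= (1 + 0) * real n"
   proof -
    have 1: "3 / 4 * d * real n <= \<bar>Re X - real n\<bar>"
     using X(2) cmod_le[of "X - of_nat n"] \<tau>n by (simp add: \<tau>_def)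
    have 2: "3 / 4 * d * real n <= \<bar>Re X + real n\<bar>"
     using X(3) cmod_le[of "X + of_nat n"] \<tau>n by (simp add: \<tau>_def)
    have 3: "0 < d * real n" using d n1 by simp
    have 4: "(1 - d / 2) * real n = real n - d * real n / 2" by (simp add: algebra_simps)
    have "real n <= \<bar>Re X\<bar>" using 1 2 3 c unfolding 4 by linarith
    then show ?thesis using abs_Re_le_cmod[of X] by simp
   qed
   then have Xn: "cmod X >= real n" by simp
   have mono: "cmod (p k) <= cmod (p (Suc k))" if "k < n" for k
    unfolding p_def using mp_growth_outside[of 0 n X k] Xn that by simp
   have le: "cmod (p k) <= cmod (p n)" if "k <= n" for k
    using that by (induction rule: inc_induct) (auto intro: order_trans mono)
   have hm: "h (n - 1) <= h k" if "k < n" for k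
   proof -
    have "k <= n - 1" using that by simp
    then show ?thesis
    proof (induction rule: dec_induct)
     case (step j)
     have "h (Suc j) = h j * (1/2 + real j) / (real j + 1)" by (simp add: h_def rbin_Suc)
     also have "... <= h j" using h0[of j] by (simp add: field_simps)
     finally show ?case using step by simp
    qed simp
   qed
   have pn1: "cmod (p n) >= 1" using le[of 0] by (simp add: p_def)
   have "S <= (\<Sum>k<n. (cmod (p n))^2 / H)"
    unfolding S_def H_def using le hm h0 by (intro sum_mono frac_le power_mono) auto
   then have SH: "S <= real n * (cmod (p n))^2 / H" by simp
   have "sqrt H * sqrt S <= sqrt (real n) * cmod (p n)"
   proof -
    have "H * S <= real n * (cmod (p n))^2" using SH H0 by (simp add: field_simps)
    then have "sqrt (H * S) <= sqrt (real n * (cmod (p n))^2)" by (rule real_sqrt_le_mono)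
    then show ?thesis by (simp add: real_sqrt_mult)
   qed
   then have "\<omega> * sqrt (real n) * (sqrt H * sqrt S) <= \<omega> * sqrt (real n) * (sqrt (real n) * cmod (p n))"
    using \<omega> by (intro mult_left_mono) auto
   also have "... = \<omega> * real n * cmod (p n)" by simp
   finally have 1: "\<omega> * sqrt (real n) * sqrt H * sqrt S <= \<omega> * real n * cmod (p n)" by (simp only: mult.assoc)
   have 2: "cmod \<gamma> * cmod (p (n - 1)) <= cmod \<gamma> * cmod (p n)" by (intro mult_left_mono le) auto
   have 3: "cmod (p n) * (real n / 2) <= cmod (p n) * (cmod X / 2)" using Xn by (intro mult_left_mono) auto
   have "cmod (p n) * (real n / 2) <= cmod (p n) * (\<omega> * real n + cmod \<gamma>)"
    using 1 2 3 main by (simp add: algebra_simps)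
   then have "real n / 2 <= \<omega> * real n + cmod \<gamma>" using pn1 by (subst (asm) mult_le_cancel_left_pos) auto
   also have "... <= 1/8 * real n + 1/8 * real n"
    using \<omega> \<gamma> eps n1 mult_right_mono[of \<epsilon> "1/8" "real n"] mult_right_mono[of \<omega> "1/8" "real n"] by (intro add_mono) linarith+
   finally show False using n1 by linarith
  qed
  define kappa where "kappa = K * (1 + \<tau>) / real n"
  have kappa0: "kappa >= 0" using K n1 by (simp add: kappa_def \<tau>_def)
  have "t^2 <= kappa * S"
  proof -
   have "t^2 = (cmod (p (n - 1)))^2 / h (n - 1)" using H0 by (simp add: t_def power_divide H_def)
   then show ?thesis using K(2)[of n X] inside n by (simp add: p_def h_def S_def kappa_def \<tau>_def)
  qed
  from gen[OF this kappa0] have "\<tau> * d <= \<omega> * sqrt (real n) * sqrt kappa + cmod \<gamma> * kappa" .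
  also have "\<omega> * sqrt (real n) * sqrt kappa = \<omega> * sqrt (K * (1 + \<tau>))"
   using n1 by (simp add: kappa_def real_sqrt_divide real_sqrt_mult)
  also have "sqrt (K * (1 + \<tau>)) <= (1 + K) * (1 + \<tau>)"
  proof (rule real_le_lsqrt)
   have "K * (1 + \<tau>) <= (1 + K) * (1 + \<tau>)" by (intro mult_right_mono) (auto simp: \<tau>_def)
   also have "... <= ((1 + K) * (1 + \<tau>))^2"
    using K mult_mono[of 1 "1 + K" 1 "1 + \<tau>"] by (simp add: power2_eq_square mult_le_cancel_left1 \<tau>_def)
   finally show "K * (1 + \<tau>) <= ((1 + K) * (1 + \<tau>))^2" .
  qed (use K in \<open>auto simp: \<tau>_def\<close>)
  also have "cmod \<gamma> * kappa <= (cmod \<gamma> / real n) * ((1 + K) * (1 + \<tau>))"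
  proof -
   have "cmod \<gamma> * kappa = (cmod \<gamma> / real n) * (K * (1 + \<tau>))" by (simp add: kappa_def)
   also have "... <= (cmod \<gamma> / real n) * ((1 + K) * (1 + \<tau>))"
    by (intro mult_left_mono mult_right_mono) (auto simp: \<tau>_def)
   finally show ?thesis .
  qed
  finally have td: "\<tau> * d <= (\<omega> + cmod \<gamma> / real n) * ((1 + K) * (1 + \<tau>))"
   using \<omega> by (simp add: distrib_right mult_left_mono)
  have "\<tau> <= C2 * (\<omega> + cmod \<gamma> / real n) * (1 + \<tau>)"
  proof -
   have "\<tau> <= w * ((1 + K) * (1 + \<tau>)) / d ==> \<tau> <= C2 * w * (1 + \<tau>)" for w by (simp add: C2_def mult_ac)
   moreover have "\<tau> <= (\<omega> + cmod \<gamma> / real n) * ((1 + K) * (1 + \<tau>)) / d" using d td by (simp only: pos_le_divide_eq)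
   ultimately show ?thesis by blast
  qed
  moreover have "C2 * (\<omega> + cmod \<gamma> / real n) <= 1 / 2"
  proof -
   have "cmod \<gamma> / real n <= \<epsilon>" using \<gamma> n1 by (simp add: field_simps)
   then have "C2 * (\<omega> + cmod \<gamma> / real n) <= C2 * (1 / (4 * C2) + 1 / (4 * C2))"
    using \<omega> eps C2 by (intro mult_left_mono add_mono) auto
   also have "... = 1 / 2" using C2 by (simp add: field_simps)
   finally show ?thesis .
  qed
  then have "C2 * (\<omega> + cmod \<gamma> / real n) * \<tau> <= 1 / 2 * \<tau>" by (intro mult_right_mono) (auto simp: \<tau>_def)
  moreover have "W * \<tau> <= 1 / 2 * \<tau> ==> \<tau> <= W * (1 + \<tau>) ==> \<tau> <= 2 * W" for W
   by (simp add: distrib_left)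
  ultimately have "\<tau> <= 2 * (C2 * (\<omega> + cmod \<gamma> / real n))" by blast
  then show "\<bar>Im X\<bar> <= 2 * C2 * (\<omega> + cmod \<gamma> / real n)" by (simp only: \<tau>_def mult.assoc)
 qed
qed

section \<open>The modified Bessel function\<close>

text \<open>\<open>bessel_K \<nu> y\<close> is the modified Bessel function \<open>K\<^sub>\<nu>(y) = \<integral>\<^sub>0\<^sup>\<infinity> e\<^sup>-\<^sup>y \<^sup>c\<^sup>o\<^sup>s\<^sup>h \<^sup>u cosh(\<nu>u) du\<close> in the variable
 \<open>s = \<surd>2 sinh(u/2)\<close>; for \<open>\<nu> \<le> 1/2\<close> the density \<open>bessel_K_dens \<nu> s\<close> is then at most 1, its value for \<open>\<nu> = 1/2\<close>.\<close>
definition bessel_K_dens :: "real => real => real" where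
 "bessel_K_dens nu s = cosh (2 * nu * arsinh (s / sqrt 2)) / sqrt (1 + s^2 / 2)"

definition bessel_K :: "real => real => real" where
 "bessel_K nu y = 1 / sqrt 2 * (LBINT s. exp (- (y * (1 + s^2))) * bessel_K_dens nu s)"

lemma arsinh_cosh: "cosh (arsinh (s / sqrt 2)) = sqrt (1 + s^2 / 2)"
proof -
 have "(cosh (arsinh (s / sqrt 2)))^2 = 1 + s^2 / 2"
  by (simp add: cosh_square_eq sinh_arsinh_real power_divide)
 then show ?thesis by (metis cosh_real_nonneg real_sqrt_unique)
qed

lemma bessel_K_dens_pos: "bessel_K_dens nu s > 0"
 unfolding bessel_K_dens_def by (intro divide_pos_pos) (auto simp: add_pos_nonneg)

text \<open>In terms of v = arsinh(s / sqrt 2) the density is cosh(2 nu v) / cosh v, and 2 nu \<le>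
  1.\<close>

lemma bessel_K_dens_le_1:
 assumes "0 < nu" "nu <= 1/2"
 shows "bessel_K_dens nu s <= 1"
proof -
 define v where "v = arsinh (s / sqrt 2)"
 have "cosh (2 * nu * v) <= cosh v"
 proof -
  have "cosh \<bar>2 * nu * v\<bar> <= cosh \<bar>v\<bar>"
  proof (subst cosh_real_nonneg_le_iff)
   show "\<bar>2 * nu * v\<bar> <= \<bar>v\<bar>" using assms mult_right_mono[of "2 * nu" 1 "\<bar>v\<bar>"] by (simp add: abs_mult)
  qed auto
  then show ?thesis by (simp add: cosh_real_abs)
 qed
 then show ?thesis unfolding bessel_K_dens_def v_def arsinh_cosh by (simp add: divide_le_eq add_pos_nonneg)
qed

lemma bessel_K_dens_ge: "1 - s^2 / 4 <= bessel_K_dens nu s"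
proof -
 define t where "t = s^2 / 2"
 have t: "t >= 0" by (simp add: t_def)
 have "sqrt (1 + t) <= 1 + t / 2" using t by (intro real_le_lsqrt) (auto simp: power2_eq_square algebra_simps)
 then have "1 / (1 + t / 2) <= 1 / sqrt (1 + t)" using t by (intro divide_left_mono) auto
 also have "... <= cosh (2 * nu * arsinh (s / sqrt 2)) / sqrt (1 + t)" using t by (intro divide_right_mono cosh_real_ge_1) auto
 also have "1 - t / 2 <= 1 / (1 + t / 2)" using t by (simp add: field_simps)
 finally show ?thesis by (simp add: bessel_K_dens_def t_def)
qed

lemma borel_bessel_K_dens [measurable]: "bessel_K_dens nu \<in> borel_measurable borel"
proof -
 have ne: "1 + x^2 / 2 \<noteq> 0" for x :: real using add_pos_nonneg[of 1 "x^2 / 2"] by simp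
 then show ?thesis unfolding bessel_K_dens_def
  by (intro borel_measurable_continuous_onI continuous_on_divide continuous_intros) (auto simp: ne)
qed

lemma gaussian_moments:
 assumes "y > 0"
 shows "has_bochner_integral lborel (%s. exp (- (y * s^2))) (sqrt (pi / y))"
  and "has_bochner_integral lborel (%s. exp (- (y * s^2)) * s^2) (sqrt (pi / y) / (2 * y))"
proof -
 define \<sigma> where "\<sigma> = sqrt (1 / (2 * y))"
 have \<sigma>: "\<sigma> > 0" "\<sigma>^2 = 1 / (2 * y)" using assms by (auto simp: \<sigma>_def)
 have nd: "normal_density 0 \<sigma> s = exp (- (y * s^2)) / sqrt (pi / y)" for s
 proof -
  have "- ((s - 0)^2) / (2 * (1 / (2 * y))) = - (y * s^2)" "2 * pi * (1 / (2 * y)) = pi / y" using assms by simp_all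
  then show ?thesis unfolding normal_density_def \<sigma>(2) by simp
 qed
 have p: "sqrt (pi / y) > 0" using assms by simp
 have e: "sqrt (pi / y) * (exp (- (y * s^2)) / sqrt (pi / y)) = exp (- (y * s^2))" for s
 proof -
  have "r * (b / r) = b" if "r > 0" for r b :: real using that by simp
  from this[OF p] show ?thesis .
 qed
 have "has_bochner_integral lborel (%s. sqrt (pi / y) * (normal_density 0 \<sigma> s * (s - 0) ^ (2 * 0))) (sqrt (pi / y) * (fact (2 * 0) / ((2 / \<sigma>^2) ^ 0 * fact 0)))"
  by (intro has_bochner_integral_mult_right normal_moment_even \<sigma>)
 then show "has_bochner_integral lborel (%s. exp (- (y * s^2))) (sqrt (pi / y))"
  unfolding nd using e by simp
 have "has_bochner_integral lborel (%s. sqrt (pi / y) * (normal_density 0 \<sigma> s * (s - 0) ^ (2 * 1))) (sqrt (pi / y) * (fact (2 * 1) / ((2 / \<sigma>^2) ^ 1 * fact 1)))"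
  by (intro has_bochner_integral_mult_right normal_moment_even \<sigma>)
 moreover have "sqrt (pi / y) * (normal_density 0 \<sigma> s * (s - 0) ^ (2 * 1)) = exp (- (y * s^2)) * s^2" for s
  unfolding nd using e[of s] by (metis diff_zero mult.assoc mult_2 one_add_one mult_1_right)
 moreover have "sqrt (pi / y) * (fact (2 * 1) / ((2 / \<sigma>^2) ^ 1 * fact 1)) = sqrt (pi / y) / (2 * y)"
  using assms by (simp add: \<sigma>(2))
 ultimately show "has_bochner_integral lborel (%s. exp (- (y * s^2)) * s^2) (sqrt (pi / y) / (2 * y))"
  by (simp only:)
qed

lemma bessel_K_integrable:
 assumes "0 < nu" "nu <= 1/2" "y > 0"
 shows "integrable lborel (%s. exp (- (y * (1 + s^2))) * bessel_K_dens nu s)"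
proof (rule Bochner_Integration.integrable_bound)
 show "integrable lborel (%s. exp (- (y * s^2)))" using gaussian_moments(1)[OF assms(3)] by (simp add: has_bochner_integral_iff)
 show "AE s in lborel. norm (exp (- (y * (1 + s^2))) * bessel_K_dens nu s) <= norm (exp (- (y * s^2)))"
 proof (rule AE_I2)
  fix s
  have "exp (- (y * (1 + s^2))) * bessel_K_dens nu s <= exp (- (y * s^2)) * 1"
   using assms bessel_K_dens_le_1[OF assms(1,2)] less_imp_le[OF bessel_K_dens_pos] by (intro mult_mono) (auto simp: algebra_simps)
  then show "norm (exp (- (y * (1 + s^2))) * bessel_K_dens nu s) <= norm (exp (- (y * s^2)))"
   using bessel_K_dens_pos[of nu s] by (simp add: abs_mult)
 qed
qed measurable

text \<open>Since cosh u = 1 + s^2, the integral is Gaussian apart from the density, which lies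
  between 1 - s^2/4 and 1. Two Gaussian moments give the leading term with relative error 1 / (8
  y).\<close>

lemma bessel_K_bounds:
 assumes "0 < nu" "nu <= 1/2" "y > 0"
 shows "bessel_K nu y <= sqrt (pi / (2 * y)) * exp (- y)"
  and "sqrt (pi / (2 * y)) * exp (- y) * (1 - 1 / (8 * y)) <= bessel_K nu y"
proof -
 note g = gaussian_moments[OF assms(3)]
 note int = bessel_K_integrable[OF assms]
 have s2: "1 / sqrt 2 * sqrt (pi / y) = sqrt (pi / (2 * y))" by (simp add: real_sqrt_divide real_sqrt_mult field_simps)
 have ex: "exp (- (y * (1 + s^2))) = exp (- y) * exp (- (y * s^2))" for s by (simp add: algebra_simps flip: exp_add)
 have "(LBINT s. exp (- (y * (1 + s^2))) * bessel_K_dens nu s) <= (LBINT s. exp (- y) * exp (- (y * s^2)))"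
 proof (rule integral_mono[OF int])
  show "integrable lborel (%s. exp (- y) * exp (- (y * s^2)))" using g by (simp add: has_bochner_integral_iff)
  show "exp (- (y * (1 + s^2))) * bessel_K_dens nu s <= exp (- y) * exp (- (y * s^2))" for s
   unfolding ex using bessel_K_dens_le_1[OF assms(1,2), of s] mult_left_mono[of "bessel_K_dens nu s" 1 "exp (- y) * exp (- (y * s^2))"] by simp
 qed
 also have "... = exp (- y) * sqrt (pi / y)" using g(1) by (simp add: has_bochner_integral_iff)
 finally have "bessel_K nu y <= 1 / sqrt 2 * (exp (- y) * sqrt (pi / y))" unfolding bessel_K_def by (intro mult_left_mono) auto
 also have "... = (1 / sqrt 2 * sqrt (pi / y)) * exp (- y)" by simp
 finally show "bessel_K nu y <= sqrt (pi / (2 * y)) * exp (- y)" unfolding s2 .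
 have h: "has_bochner_integral lborel (%s. exp (- y) * (exp (- (y * s^2)) - 1/4 * (exp (- (y * s^2)) * s^2))) (exp (- y) * (sqrt (pi / y) - 1/4 * (sqrt (pi / y) / (2 * y))))"
  by (intro has_bochner_integral_mult_right has_bochner_integral_diff g)
 then have "exp (- y) * (sqrt (pi / y) - 1/4 * (sqrt (pi / y) / (2 * y))) = (LBINT s. exp (- y) * (exp (- (y * s^2)) - 1/4 * (exp (- (y * s^2)) * s^2)))"
  by (simp add: has_bochner_integral_iff)
 also have "... <= (LBINT s. exp (- (y * (1 + s^2))) * bessel_K_dens nu s)"
 proof (rule integral_mono[OF _ int])
  show "integrable lborel (%s. exp (- y) * (exp (- (y * s^2)) - 1/4 * (exp (- (y * s^2)) * s^2)))" using h by (simp add: has_bochner_integral_iff)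
  fix s
  have "exp (- y) * (exp (- (y * s^2)) - 1/4 * (exp (- (y * s^2)) * s^2)) = (exp (- y) * exp (- (y * s^2))) * (1 - s^2 / 4)"
   by (simp add: algebra_simps)
  also have "... <= (exp (- y) * exp (- (y * s^2))) * bessel_K_dens nu s"
   by (intro mult_left_mono bessel_K_dens_ge) auto
  finally show "exp (- y) * (exp (- (y * s^2)) - 1/4 * (exp (- (y * s^2)) * s^2)) <= exp (- (y * (1 + s^2))) * bessel_K_dens nu s"
   unfolding ex .
 qed
 finally have "1 / sqrt 2 * (exp (- y) * (sqrt (pi / y) - 1/4 * (sqrt (pi / y) / (2 * y)))) <= bessel_K nu y"
  unfolding bessel_K_def by (intro mult_left_mono) auto
 moreover have "1 / sqrt 2 * (exp (- y) * (sqrt (pi / y) - 1/4 * (sqrt (pi / y) / (2 * y)))) = (1 / sqrt 2 * sqrt (pi / y)) * exp (- y) * (1 - 1 / (8 * y))"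
 proof -
  have "a * (e * (S - 1/4 * (S / (2 * y)))) = (a * S) * e * (1 - 1 / (8 * y))" for a e S
   by (simp add: algebra_simps)
  then show ?thesis .
 qed
 ultimately show "sqrt (pi / (2 * y)) * exp (- y) * (1 - 1 / (8 * y)) <= bessel_K nu y" unfolding s2 by simp
qed

lemma bessel_K_nonneg: "bessel_K nu y >= 0"
 unfolding bessel_K_def using less_imp_le[OF bessel_K_dens_pos] by (intro mult_nonneg_nonneg integral_nonneg_AE) auto

lemma bessel_K_antimono:
 assumes "0 < nu" "nu <= 1/2" "0 < y" "y <= z"
 shows "bessel_K nu z <= bessel_K nu y"
 unfolding bessel_K_def
proof (intro mult_left_mono integral_mono bessel_K_integrable)
 show "exp (- (z * (1 + s^2))) * bessel_K_dens nu s <= exp (- (y * (1 + s^2))) * bessel_K_dens nu s" for s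
  using assms less_imp_le[OF bessel_K_dens_pos] by (intro mult_right_mono) (auto intro!: mult_right_mono)
qed (use assms in auto)

lemma borel_bessel_K [measurable]: "bessel_K nu \<in> borel_measurable borel"
proof -
 have "(%y. LBINT s. exp (- (y * (1 + s^2))) * bessel_K_dens nu s) \<in> borel_measurable borel"
  by (rule lborel.borel_measurable_lebesgue_integral) measurable
 then show ?thesis unfolding bessel_K_def by simp
qed

text \<open>Substituting \<open>u = ln(t/(1-t))/2\<close> turns the Beta integral into \<open>\<integral> e\<^sup>\<nu>\<^sup>u cosh\<^sup>-\<^sup>p u du\<close>.\<close>
lemma exp_cosh_Beta:
 fixes p nu :: real
 assumes p: "p > 0" "\<bar>nu\<bar> < p"
 shows "integrable lborel (%u. exp (nu * u) * cosh u powr (- p))"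
  and "(LBINT u. exp (nu * u) * cosh u powr (- p)) = 2 powr (p - 1) * Beta ((p + nu) / 2) ((p - nu) / 2)"
proof -
 define f where "f u = exp (nu * u) * cosh u powr (- p)" for u :: real
 define g where "g t = ln (t / (1 - t)) / 2" for t :: real
 define g' where "g' t = 1 / (2 * (t * (1 - t)))" for t :: real
 define alpha beta where "alpha = (p + nu) / 2" and "beta = (p - nu) / 2"
 have ab: "alpha > 0" "beta > 0" using p by (auto simp: alpha_def beta_def)
 have fg: "f (g t) * g' t = 2 powr (p - 1) * (t powr (alpha - 1) * (1 - t) powr (beta - 1))" if t: "0 < t" "t < 1" for t
 proof -
  have e: "exp (nu * g t) = t powr (nu / 2) / (1 - t) powr (nu / 2)"
   using t by (simp add: g_def powr_def exp_diff[symmetric] ln_div right_diff_distrib diff_divide_distrib)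
  have "cosh (g t) = (sqrt (t / (1 - t)) + 1 / sqrt (t / (1 - t))) / 2"
  proof -
   have "exp (g t) = sqrt (t / (1 - t))" using t by (simp add: g_def ln_sqrt[symmetric])
   then show ?thesis by (simp only: cosh_field_def exp_minus inverse_eq_divide)
  qed
  also have "... = 1 / (2 * sqrt (t * (1 - t)))"
  proof -
   have sq: "(sqrt t)^2 + (sqrt (1 - t))^2 = 1" "sqrt t > 0" "sqrt (1 - t) > 0" using t by auto
   have "(a / b + 1 / (a / b)) / 2 = 1 / (2 * (a * b))" if "a^2 + b^2 = 1" "a > 0" "b > 0" for a b :: real
   proof -
    have "(a / b + 1 / (a / b)) / 2 = (a^2 + b^2) / (2 * (a * b))"
     using that(2,3) by (simp add: field_simps power2_eq_square)
    then show ?thesis using that(1) by simp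
   qed
   from this[OF sq] show ?thesis unfolding real_sqrt_divide real_sqrt_mult .
  qed
  finally have c: "cosh (g t) = 1 / (2 * sqrt (t * (1 - t)))" .
  have t0: "t > 0" "1 - t > 0" using t by auto
  have c2: "cosh (g t) powr (- p) = 2 powr p * (t powr (p / 2) * (1 - t) powr (p / 2))"
  proof -
   have y: "2 * sqrt (t * (1 - t)) > 0" using t0 by simp
   have "(1 / z) powr (- p) = z powr p" if "z > 0" for z :: real
    using that by (simp add: powr_def ln_div)
   from this[OF y] have "cosh (g t) powr (- p) = (2 * sqrt (t * (1 - t))) powr p" unfolding c .
   also have "... = 2 powr p * ((t * (1 - t)) powr (1/2)) powr p"
    using t0 powr_half_sqrt[of "t * (1 - t)"] by (simp add: powr_mult)
   also have "((t * (1 - t)) powr (1/2)) powr p = t powr (p / 2) * (1 - t) powr (p / 2)"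
    unfolding powr_powr using t0 by (simp add: powr_mult)
   finally show ?thesis .
  qed
  have a1: "t powr (nu / 2) * t powr (p / 2) / t = t powr (alpha - 1)"
  proof -
   have "alpha - 1 = nu / 2 + p / 2 - 1" by (simp add: alpha_def add_divide_distrib)
   then show ?thesis using t0 by (simp only: powr_diff powr_add powr_one)
  qed
  have b1: "(1 - t) powr (p / 2) / (1 - t) powr (nu / 2) / (1 - t) = (1 - t) powr (beta - 1)"
  proof -
   have "beta - 1 = p / 2 - nu / 2 - 1" by (simp add: beta_def diff_divide_distrib)
   then show ?thesis using t0 by (simp only: powr_diff powr_one)
  qed
  have "f (g t) * g' t = 2 powr p / 2 * ((t powr (nu / 2) * t powr (p / 2) / t) * ((1 - t) powr (p / 2) / (1 - t) powr (nu / 2) / (1 - t)))"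
  proof -
   have "a / v * (q * (b * w)) * (1 / (2 * (x * y))) = q / 2 * ((a * b / x) * (w / v / y))" for a v q b w x y :: real
    by (simp only: divide_inverse inverse_mult_distrib mult_1_left mult_ac)
   then show ?thesis unfolding f_def e c2 g'_def .
  qed
  then show ?thesis unfolding a1 b1 by (simp add: powr_diff)
 qed
 have B: "((%t. t powr (alpha - 1) * (1 - t) powr (beta - 1)) has_integral Beta alpha beta) {0..1}"
  by (rule has_integral_Beta_real[OF ab])
 have Bset: "set_integrable lborel {0<..<1} (%t. t powr (alpha - 1) * (1 - t) powr (beta - 1))"
  and Bval: "(LBINT t:{0<..<1}. t powr (alpha - 1) * (1 - t) powr (beta - 1)) = Beta alpha beta"
 proof -
  have "((%t. t powr (alpha - 1) * (1 - t) powr (beta - 1)) has_integral Beta alpha beta) {0<..<1}"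
   using B by (simp add: has_integral_Icc_iff_Ioo)
  then have "((%t. if t \<in> {0<..<1} then t powr (alpha - 1) * (1 - t) powr (beta - 1) else 0) has_integral Beta alpha beta) UNIV"
   by (simp only: has_integral_restrict_UNIV)
  then have hi: "((%t. indicator {0<..<1} t *\<^sub>R (t powr (alpha - 1) * (1 - t) powr (beta - 1))) has_integral Beta alpha beta) UNIV"
   by (rule has_integral_eq[rotated]) (simp add: indicator_def)
  have "integral\<^sup>N lborel (%t. indicator {0<..<1} t *\<^sub>R (t powr (alpha - 1) * (1 - t) powr (beta - 1))) = ennreal (Beta alpha beta)"
   proof (rule nn_integral_has_integral_lborel[OF _ _ hi])
   show "0 <= indicator {0<..<1} t *\<^sub>R (t powr (alpha - 1) * (1 - t) powr (beta - 1))" for t :: real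
    by (intro scaleR_nonneg_nonneg mult_nonneg_nonneg) auto
  qed measurable
  moreover have "0 <= Beta alpha beta"
   by (rule has_integral_nonneg[OF hi]) (intro scaleR_nonneg_nonneg mult_nonneg_nonneg, auto)
  ultimately have "has_bochner_integral lborel (%t. indicator {0<..<1} t *\<^sub>R (t powr (alpha - 1) * (1 - t) powr (beta - 1))) (Beta alpha beta)"
   by (intro has_bochner_integral_nn_integral AE_I2 scaleR_nonneg_nonneg mult_nonneg_nonneg) auto
  then show "set_integrable lborel {0<..<1} (%t. t powr (alpha - 1) * (1 - t) powr (beta - 1))"
   "(LBINT t:{0<..<1}. t powr (alpha - 1) * (1 - t) powr (beta - 1)) = Beta alpha beta"
   by (auto simp: has_bochner_integral_iff set_integrable_def set_lebesgue_integral_def)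
 qed
 have lim0: "((ereal \<circ> g \<circ> real_of_ereal) \<longlongrightarrow> - \<infinity>) (at_right (ereal 0))"
 proof -
  have "filterlim g at_bot (at_right 0)" unfolding g_def by real_asymp
  then show ?thesis by (simp add: ereal_tendsto_simps)
 qed
 have lim1: "((ereal \<circ> g \<circ> real_of_ereal) \<longlongrightarrow> \<infinity>) (at_left (ereal 1))"
 proof -
  have "filterlim g at_top (at_left 1)" unfolding g_def by real_asymp
  then show ?thesis by (simp add: ereal_tendsto_simps)
 qed
 have ei: "einterval (ereal 0) (ereal 1) = {0<..<1}" "einterval (- \<infinity>) \<infinity> = UNIV" by (auto simp: einterval_def)
 have si: "set_integrable lborel (einterval (ereal 0) (ereal 1)) (%t. f (g t) * g' t)"
  unfolding ei using set_integrable_mult_right[OF Bset, of "2 powr (p - 1)"]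
  by (subst set_integrable_cong[OF refl refl, of _ _ "%t. 2 powr (p - 1) * (t powr (alpha - 1) * (1 - t) powr (beta - 1))"]) (auto simp: fg)
 have deriv: "DERIV g t :> g' t" if "0 < t" "t < 1" for t
 proof -
  have "((%t. (ln t - ln (1 - t)) / 2) has_real_derivative (1 / t + 1 / (1 - t)) / 2) (at t)"
  proof -
   have "((%t. ln (1 - t)) has_real_derivative 1 / (1 - t) * (- 1)) (at t)"
    using that by (intro DERIV_chain2[OF DERIV_ln_divide]) (auto intro!: derivative_eq_intros)
   from DERIV_cdivide[OF DERIV_diff[OF DERIV_ln_divide[OF that(1)] this], of 2] show ?thesis by simp
  qed
  then have "DERIV g t :> (1 / t + 1 / (1 - t)) / 2"
   by (rule has_field_derivative_transform_within_open[where S = "{0<..<1}"]) (use that in \<open>auto simp: g_def ln_div\<close>)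
  moreover have "(1 / t + 1 / (1 - t)) / 2 = g' t" using that by (simp add: g'_def field_simps)
  ultimately show ?thesis by simp
 qed
 have cf: "isCont f u" for u unfolding f_def by (intro continuous_intros) auto
 have cg: "isCont g' t" if "0 < t" "t < 1" for t unfolding g'_def using that by (intro continuous_intros) auto
 note sub = interval_integral_substitution_nonneg[where f = f and g = g and g' = g' and a = "ereal 0" and b = "ereal 1" and A = "- \<infinity>" and B = \<infinity>]
 have "set_integrable lborel (einterval (- \<infinity>) \<infinity>) f"
  by (rule sub(1)) (use deriv cf cg lim0 lim1 si in \<open>auto simp: f_def g'_def\<close>)
 then show "integrable lborel (%u. exp (nu * u) * cosh u powr (- p))"
  unfolding ei by (simp add: set_integrable_def f_def)
 have "(LBINT u=-\<infinity>..\<infinity>. f u) = (LBINT t=ereal 0..ereal 1. f (g t) * g' t)"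
  by (rule sub(2)) (use deriv cf cg lim0 lim1 si in \<open>auto simp: f_def g'_def\<close>)
 also have "... = (LBINT t:{0<..<1}. f (g t) * g' t)"
  by (simp add: interval_lebesgue_integral_def ei)
 also have "... = (LBINT t:{0<..<1}. 2 powr (p - 1) * (t powr (alpha - 1) * (1 - t) powr (beta - 1)))"
  by (rule set_lebesgue_integral_cong) (auto simp: fg)
 also have "... = 2 powr (p - 1) * Beta alpha beta" by (simp add: Bval)
 finally show "(LBINT u. exp (nu * u) * cosh u powr (- p)) = 2 powr (p - 1) * Beta ((p + nu) / 2) ((p - nu) / 2)"
  by (simp add: interval_lebesgue_integral_def ei set_lebesgue_integral_def f_def alpha_def beta_def)
qed

section \<open>Moments of the modified Bessel function\<close>

lemma power_exp_integral:
 assumes "s > 0"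
 shows "has_bochner_integral lborel (%x. indicator {0..} x *\<^sub>R (x ^ k * exp (- (s * x)))) (fact k / s ^ (k + 1) :: real)"
proof -
 have "has_bochner_integral lborel (%x. x ^ k * exp (- x) * indicator {0..} x :: real) (fact k)"
  using has_bochner_integral_I0i_power_exp_m'[of k] by (simp add: mult.commute)
 then have "has_bochner_integral lborel (%x. (0 + s * x) ^ k * exp (- (0 + s * x)) * indicator {0..} (0 + s * x)) (fact k /\<^sub>R \<bar>s\<bar>)"
  using lborel_has_bochner_integral_real_affine_iff[of s "%x. x ^ k * exp (- x) * indicator {0..} x :: real" "fact k" 0] assms by simp
 then have "has_bochner_integral lborel (%x. (1 / s ^ k) * ((0 + s * x) ^ k * exp (- (0 + s * x)) * indicator {0..} (0 + s * x))) ((1 / s ^ k) * (fact k /\<^sub>R \<bar>s\<bar>))"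
  by (intro has_bochner_integral_mult_right)
 moreover have "(1 / s ^ k) * ((0 + s * x) ^ k * exp (- (0 + s * x)) * indicator {0..} (0 + s * x)) = indicator {0..} x *\<^sub>R (x ^ k * exp (- (s * x)))" for x
  using assms by (auto simp: indicator_def power_mult_distrib zero_le_mult_iff)
 moreover have "(1 / s ^ k) * (fact k /\<^sub>R \<bar>s\<bar>) = fact k / s ^ (k + 1)" using assms by (simp add: field_simps)
 ultimately show ?thesis by (simp only:)
qed

text \<open>The substitution s = sqrt 2 sinh(u/2) gives 1 + s^2 = cosh u and turns the density times
  ds into a constant times cosh(nu u) du, the sum of two exponentials covered by the Beta
  integral.\<close>

lemma bessel_K_dens_integral:
 assumes "0 < nu" "nu < 1" "p >= 1"
 shows "integrable lborel (%s. bessel_K_dens nu s * (1 + s^2) powr (- p))"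
  and "1 / sqrt 2 * (LBINT s. bessel_K_dens nu s * (1 + s^2) powr (- p)) = 2 powr (p - 2) * Beta ((p + nu) / 2) ((p - nu) / 2)"
proof -
 define f where "f s = bessel_K_dens nu s * (1 + s^2) powr (- p)" for s :: real
 define g where "g u = sqrt 2 * sinh (u / 2)" for u :: real
 define g' where "g' u = sqrt 2 / 2 * cosh (u / 2)" for u :: real
 have p: "p > 0" "\<bar>nu\<bar> < p" "\<bar>- nu\<bar> < p" using assms by auto
 note E = exp_cosh_Beta[OF p(1,2)] exp_cosh_Beta[OF p(1,3)]
 have cs: "cosh (nu * u) * cosh u powr (- p) = (exp (nu * u) * cosh u powr (- p) + exp (- nu * u) * cosh u powr (- p)) / 2" for u
  by (simp add: cosh_field_def algebra_simps add_divide_distrib)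
 have ci: "integrable lborel (%u. cosh (nu * u) * cosh u powr (- p))"
  unfolding cs using E(1,3) by auto
 have cv: "(LBINT u. cosh (nu * u) * cosh u powr (- p)) = 2 powr (p - 1) * Beta ((p + nu) / 2) ((p - nu) / 2)"
  unfolding cs using E by (simp add: Bochner_Integration.integral_add Beta_commute)
 have fg: "f (g u) * g' u = sqrt 2 / 2 * (cosh (nu * u) * cosh u powr (- p))" for u
 proof -
  have 1: "g u / sqrt 2 = sinh (u / 2)" by (simp add: g_def)
  have 2: "(g u)^2 = 2 * (sinh (u / 2))^2" by (simp add: g_def power_mult_distrib)
  have 3: "1 + (g u)^2 / 2 = (cosh (u / 2))^2" unfolding 2 by (simp add: cosh_square_eq)
  have 4: "1 + (g u)^2 = cosh u" unfolding 2 using cosh_double[of "u / 2"] cosh_square_eq[of "u / 2"] by simp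
  have "bessel_K_dens nu (g u) = cosh (nu * u) / cosh (u / 2)"
   unfolding bessel_K_dens_def 1 3 by (simp add: arsinh_sinh_real)
  then show ?thesis unfolding f_def 4 g'_def by simp
 qed
 have lim0: "((ereal \<circ> g \<circ> real_of_ereal) \<longlongrightarrow> - \<infinity>) (at_right (- \<infinity>))"
 proof -
  have "filterlim g at_bot at_bot" unfolding g_def by real_asymp
  then show ?thesis by (simp add: ereal_tendsto_simps)
 qed
 have lim1: "((ereal \<circ> g \<circ> real_of_ereal) \<longlongrightarrow> \<infinity>) (at_left \<infinity>)"
 proof -
  have "filterlim g at_top at_top" unfolding g_def by real_asymp
  then show ?thesis by (simp add: ereal_tendsto_simps)
 qed
 have ei: "einterval (- \<infinity>) \<infinity> = UNIV" by (auto simp: einterval_def)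
 have si: "set_integrable lborel (einterval (- \<infinity>) \<infinity>) (%u. f (g u) * g' u)"
  unfolding ei fg set_integrable_def using ci by simp
 have deriv: "DERIV g u :> g' u" for u
  unfolding g_def g'_def by (auto intro!: derivative_eq_intros)
 have sq: "1 + s^2 / 2 > 0" "1 + s^2 > 0" for s :: real by (simp_all add: add_pos_nonneg)
 have cf: "isCont f s" for s
 proof -
  have "continuous_on UNIV f" unfolding f_def bessel_K_dens_def
   by (intro continuous_intros) (use sq in \<open>auto simp: less_imp_neq[symmetric]\<close>)
  then show ?thesis by (simp add: continuous_on_eq_continuous_at)
 qed
 have cg: "isCont g' u" for u unfolding g'_def by (intro continuous_intros) auto
 have f0: "0 <= f s" "0 <= g' s" for s
  unfolding f_def g'_def using less_imp_le[OF bessel_K_dens_pos] by auto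
 note sub = interval_integral_substitution_nonneg[where f = f and g = g and g' = g' and a = "- \<infinity>" and b = \<infinity> and A = "- \<infinity>" and B = \<infinity>]
 have "set_integrable lborel (einterval (- \<infinity>) \<infinity>) f"
  by (rule sub(1)) (use deriv cf cg lim0 lim1 si f0 in auto)
 then show "integrable lborel (%s. bessel_K_dens nu s * (1 + s^2) powr (- p))"
  unfolding ei by (simp add: set_integrable_def f_def[abs_def])
 have "(LBINT s=-\<infinity>..\<infinity>. f s) = (LBINT u=-\<infinity>..\<infinity>. f (g u) * g' u)"
  by (rule sub(2)) (use deriv cf cg lim0 lim1 si f0 in auto)
 then have "(LBINT s. f s) = sqrt 2 / 2 * (2 powr (p - 1) * Beta ((p + nu) / 2) ((p - nu) / 2))"
  by (simp add: interval_lebesgue_integral_def ei set_lebesgue_integral_def fg cv)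
 then have "1 / sqrt 2 * (LBINT s. f s) = (1 / sqrt 2 * sqrt 2) * (1/2 * 2 powr (p - 1)) * Beta ((p + nu) / 2) ((p - nu) / 2)" by simp
 also have "1/2 * 2 powr (p - 1) = (2::real) powr (p - 2)" by (simp add: powr_diff)
 finally show "1 / sqrt 2 * (LBINT s. bessel_K_dens nu s * (1 + s^2) powr (- p)) = 2 powr (p - 2) * Beta ((p + nu) / 2) ((p - nu) / 2)"
  by (simp add: f_def)
qed

text \<open>Tonelli: integrating over y before s produces j! (1 + s^2)^(-(j + 1)), whose integral
  against the density is known. Nonnegativity gives integrability and value at once.\<close>

lemma bessel_K_moment_Gamma:
 assumes "0 < nu" "nu <= 1/2"
 shows "has_bochner_integral lborel (%y. indicator {0..} y *\<^sub>R (y ^ j * bessel_K nu y))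
  (2 powr (real j - 1) * (Gamma ((real j + 1 + nu) / 2) * Gamma ((real j + 1 - nu) / 2)))"
proof (rule has_bochner_integral_nn_integral)
 show "(%y. indicator {0..} y *\<^sub>R (y ^ j * bessel_K nu y)) \<in> borel_measurable lborel" by measurable
 show "AE y in lborel. 0 <= indicator {0..} y *\<^sub>R (y ^ j * bessel_K nu y)"
  by (rule AE_I2) (auto simp: indicator_def intro!: mult_nonneg_nonneg bessel_K_nonneg)
 define p where "p = real j + 1"
 define A where "A = (1 / sqrt 2 * (LBINT s. bessel_K_dens nu s * (1 + s^2) powr (- p)))"
 have A: "A = 2 powr (p - 2) * Beta ((p + nu) / 2) ((p - nu) / 2)"
  and Ai: "integrable lborel (%s. bessel_K_dens nu s * (1 + s^2) powr (- p))"
  unfolding A_def using bessel_K_dens_integral[of nu p] assms by (auto simp: p_def)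
 have G0: "Gamma ((p + nu) / 2) > 0" "Gamma ((p - nu) / 2) > 0" using assms by (auto simp: p_def intro!: Gamma_real_pos)
 show nn: "0 <= 2 powr (real j - 1) * (Gamma ((real j + 1 + nu) / 2) * Gamma ((real j + 1 - nu) / 2))"
  using G0 by (simp add: p_def)
 have val: "fact j * A = 2 powr (real j - 1) * (Gamma ((real j + 1 + nu) / 2) * Gamma ((real j + 1 - nu) / 2))"
 proof -
  have "(p + nu) / 2 + (p - nu) / 2 = real j + 1" by (simp add: p_def field_simps)
  then have "Beta ((p + nu) / 2) ((p - nu) / 2) = Gamma ((p + nu) / 2) * Gamma ((p - nu) / 2) / fact j"
   unfolding Beta_def by (simp add: Gamma_fact add.commute)
  moreover have "p - 2 = real j - 1" by (simp add: p_def)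
  ultimately show ?thesis unfolding A by (simp add: p_def)
 qed
 let ?F = "%y s. indicator {0..} y *\<^sub>R (y ^ j * exp (- ((1 + s^2) * y))) * (1 / sqrt 2 * bessel_K_dens nu s)"
 have F0: "?F y s >= 0" for y s :: real using less_imp_le[OF bessel_K_dens_pos] by (auto simp: indicator_def)
 have "(\<integral>\<^sup>+y. ennreal (indicator {0..} y *\<^sub>R (y ^ j * bessel_K nu y)) \<partial>lborel) = (\<integral>\<^sup>+y. (\<integral>\<^sup>+s. ennreal (?F y s) \<partial>lborel) \<partial>lborel)"
 proof (rule nn_integral_cong_AE, use AE_lborel_singleton[of "0::real"] in eventually_elim)
  fix y :: real assume y: "y \<noteq> 0"
  show "ennreal (indicator {0..} y *\<^sub>R (y ^ j * bessel_K nu y)) = (\<integral>\<^sup>+s. ennreal (?F y s) \<partial>lborel)"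
  proof (cases "y > 0")
   case True
   have i: "integrable lborel (%s. (y ^ j / sqrt 2) * (exp (- (y * (1 + s^2))) * bessel_K_dens nu s))"
    using bessel_K_integrable[OF assms True] by (rule integrable_mult_right)
   have eq: "?F y s = (y ^ j / sqrt 2) * (exp (- (y * (1 + s^2))) * bessel_K_dens nu s)" for s using True by (simp add: mult_ac)
   have "(\<integral>\<^sup>+s. ennreal (?F y s) \<partial>lborel) = ennreal (LBINT s. ?F y s)"
    by (rule nn_integral_eq_integral) (use i F0[of y] in \<open>auto simp only: eq intro: AE_I2\<close>)
   also have "(LBINT s. ?F y s) = indicator {0..} y *\<^sub>R (y ^ j * bessel_K nu y)"
    unfolding eq using True by (simp add: bessel_K_def)
   finally show ?thesis by simp
  next
   case False
   then show ?thesis using y by simp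
  qed
 qed
 also have "... = (\<integral>\<^sup>+s. (\<integral>\<^sup>+y. ennreal (?F y s) \<partial>lborel) \<partial>lborel)"
  by (rule lborel_pair.Fubini') measurable
 also have "... = (\<integral>\<^sup>+s. ennreal (fact j * (1 / sqrt 2) * (bessel_K_dens nu s * (1 + s^2) powr (- p))) \<partial>lborel)"
 proof (rule nn_integral_cong)
  fix s :: real
  have s: "1 + s^2 > 0" by (simp add: add_pos_nonneg)
  have h: "has_bochner_integral lborel (%y. ?F y s) (fact j / (1 + s^2) ^ (j + 1) * (1 / sqrt 2 * bessel_K_dens nu s))"
   by (intro has_bochner_integral_mult_left power_exp_integral s)
  have "(1 + s^2) powr p = (1 + s^2) ^ (j + 1)" using powr_realpow[OF s, of "j + 1"] by (simp add: p_def add.commute)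
  then have pw: "(1 + s^2) powr (- p) = 1 / (1 + s^2) ^ (j + 1)" by (simp only: powr_minus inverse_eq_divide)
  have "(\<integral>\<^sup>+y. ennreal (?F y s) \<partial>lborel) = ennreal (LBINT y. ?F y s)"
   by (rule nn_integral_eq_integral) (use h F0 in \<open>auto simp: has_bochner_integral_iff\<close>)
  also have "(LBINT y. ?F y s) = fact j * (1 / sqrt 2) * (bessel_K_dens nu s * (1 + s^2) powr (- p))"
   unfolding pw has_bochner_integral_integral_eq[OF h] by simp
  finally show "(\<integral>\<^sup>+y. ennreal (?F y s) \<partial>lborel) = ennreal (fact j * (1 / sqrt 2) * (bessel_K_dens nu s * (1 + s^2) powr (- p)))" .
 qed
 also have "... = ennreal (LBINT s. fact j * (1 / sqrt 2) * (bessel_K_dens nu s * (1 + s^2) powr (- p)))"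
  using Ai less_imp_le[OF bessel_K_dens_pos] by (intro nn_integral_eq_integral) auto
 also have "(LBINT s. fact j * (1 / sqrt 2) * (bessel_K_dens nu s * (1 + s^2) powr (- p))) = fact j * A"
  unfolding A_def by simp
 finally show "(\<integral>\<^sup>+y. ennreal (indicator {0..} y *\<^sub>R (y ^ j * bessel_K nu y)) \<partial>lborel) = ennreal (2 powr (real j - 1) * (Gamma ((real j + 1 + nu) / 2) * Gamma ((real j + 1 - nu) / 2)))"
  unfolding val .
qed

text \<open>The regularized moments 2^j Gamma((1 + nu + j)/2) / Gamma((1 + nu - j)/2), given by
  their two-step recurrence. It is in this form that the K-Bessel weight and the damped integrals
  are matched.\<close>

fun bes_mom :: "real => nat => real" where
 "bes_mom nu 0 = 1"
| "bes_mom nu (Suc 0) = nu"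
| "bes_mom nu (Suc (Suc j)) = (nu^2 - (real j + 1)^2) * bes_mom nu j"

text \<open>From j to j + 2 the cosine changes sign and the Gamma factors contribute (j + 1)^2 -
  nu^2; for j = 0 and j = 1 reflection cancels the cosine. The cosine is what the conjugate phases
  on the two half-lines add up to.\<close>

lemma bessel_K_moment:
 assumes "0 < nu" "nu <= 1/2"
 obtains M where "!!j. has_bochner_integral lborel (%y. indicator {0..} y *\<^sub>R (y ^ j * bessel_K nu y)) (M j)"
  and "!!j. 2 / pi * cos (real j * pi / 2 - nu * pi / 2) * M j = bes_mom nu j"
proof
 define M where "M j = 2 powr (real j - 1) * (Gamma ((real j + 1 + nu) / 2) * Gamma ((real j + 1 - nu) / 2))" for j
 show "has_bochner_integral lborel (%y. indicator {0..} y *\<^sub>R (y ^ j * bessel_K nu y)) (M j)" for j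
  unfolding M_def by (rule bessel_K_moment_Gamma[OF assms])
 have refl: "Gamma x * Gamma (1 - x) = pi / sin (pi * x)" for x :: real
 proof -
  have "complex_of_real (Gamma x * Gamma (1 - x)) = complex_of_real (pi / sin (pi * x))"
   using Gamma_reflection_complex[of "complex_of_real x"] Gamma_complex_of_real[of x] Gamma_complex_of_real[of "1 - x"]
   by (simp add: sin_of_real flip: of_real_mult)
  then show ?thesis by (simp only: of_real_eq_iff)
 qed
 have npi: "x \<notin> \<int>\<^sub>\<le>\<^sub>0" if "x > 0" for x :: real using that by (auto elim!: nonpos_Ints_cases)
 have np: "0 < nu * pi / 2" "nu * pi / 2 < pi / 2" using assms by auto
 have c0: "cos (nu * pi / 2) > 0" using np by (intro cos_gt_zero) auto
 have s0: "sin (nu * pi / 2) > 0" using np by (intro sin_gt_zero) auto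
 have "2 / pi * cos (real j * pi / 2 - nu * pi / 2) * M j = bes_mom nu j" for j
 proof (induction j rule: induct_nat_012)
  case 0
  have sn: "sin (pi * ((1 + nu) / 2)) = cos (nu * pi / 2)"
  proof -
   have "pi * ((1 + nu) / 2) = pi / 2 - (- (nu * pi / 2))" by (simp add: field_simps)
   then show ?thesis by (simp only: sin_cos_eq[symmetric] cos_sin_eq[symmetric] sin_diff) simp
  qed
  have e: "1 - (1 + nu) / 2 = (1 - nu) / 2" by (simp add: field_simps)
  have "M 0 = pi / (2 * cos (nu * pi / 2))"
   using refl[of "(1 + nu) / 2"] unfolding e sn M_def by (simp add: powr_minus)
  then show ?case using c0 by simp
 next
  case 1
  have g1: "Gamma ((real 1 + 1 + nu) / 2) = nu / 2 * Gamma (nu / 2)"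
   using Gamma_plus1[OF npi[of "nu / 2"]] assms by (simp add: add_divide_distrib add.commute)
  have g2: "(real 1 + 1 - nu) / 2 = 1 - nu / 2" by (simp add: field_simps)
  have "M 1 = nu / 2 * (Gamma (nu / 2) * Gamma (1 - nu / 2))"
   unfolding M_def g1 g2 by simp
  then have "M 1 = nu / 2 * (pi / sin (nu * pi / 2))" unfolding refl by (simp add: mult.commute)
  moreover have "cos (real 1 * pi / 2 - nu * pi / 2) = sin (nu * pi / 2)" by (simp add: cos_diff)
  ultimately show ?case using s0 by simp
 next
  case (ge2 j)
  have n: "(real j + 1 + nu) / 2 > 0" "(real j + 1 - nu) / 2 > 0" using assms by auto
  have g: "Gamma ((real (Suc (Suc j)) + 1 + nu) / 2) = (real j + 1 + nu) / 2 * Gamma ((real j + 1 + nu) / 2)"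
   "Gamma ((real (Suc (Suc j)) + 1 - nu) / 2) = (real j + 1 - nu) / 2 * Gamma ((real j + 1 - nu) / 2)"
  proof -
   have e: "(real (Suc (Suc j)) + 1 + nu) / 2 = (real j + 1 + nu) / 2 + 1" "(real (Suc (Suc j)) + 1 - nu) / 2 = (real j + 1 - nu) / 2 + 1"
    by (simp_all add: field_simps)
   show "Gamma ((real (Suc (Suc j)) + 1 + nu) / 2) = (real j + 1 + nu) / 2 * Gamma ((real j + 1 + nu) / 2)"
    "Gamma ((real (Suc (Suc j)) + 1 - nu) / 2) = (real j + 1 - nu) / 2 * Gamma ((real j + 1 - nu) / 2)"
    unfolding e by (rule Gamma_plus1[OF npi[OF n(1)]], rule Gamma_plus1[OF npi[OF n(2)]])
  qed
  have pw: "2 powr (real (Suc (Suc j)) - 1) = 4 * 2 powr (real j - 1)"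
   by (simp add: powr_diff powr_add)
  have e1: "4 * P * (a / 2 * G * (b / 2 * H)) = (a * b) * (P * (G * H))" for P G H a b :: real by simp
  have e2: "(real j + 1 + nu) * (real j + 1 - nu) = (real j + 1)^2 - nu^2" by (simp add: power2_eq_square algebra_simps)
  have MM: "M (Suc (Suc j)) = ((real j + 1)^2 - nu^2) * M j"
   unfolding M_def g pw e1 e2 ..
  have "real (Suc (Suc j)) * pi / 2 - nu * pi / 2 = (real j * pi / 2 - nu * pi / 2) + pi" by (simp add: field_simps)
  then have cc: "cos (real (Suc (Suc j)) * pi / 2 - nu * pi / 2) = - cos (real j * pi / 2 - nu * pi / 2)"
   by (simp only: cos_periodic_pi)
  have "q * (- c) * ((a - b) * m) = (b - a) * (q * c * m)" for q c a b m :: real by (simp add: algebra_simps)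
  then show ?case unfolding bes_mom.simps ge2(1)[symmetric] MM cc .
 qed
 then show "2 / pi * cos (real j * pi / 2 - nu * pi / 2) * M j = bes_mom nu j" for j .
qed

section \<open>Laplace transforms of the Bessel function\<close>

definition bes_coef :: "real => nat => real" where
 "bes_coef nu k = (-1) ^ k / (fact k * Gamma (nu + real k + 1))"

text \<open>J_nu(x) = (x/2)^nu G(x^2/4): the branch factor is separated from an entire function of w
  = x^2/4.\<close>

definition bes_G :: "real => real => real" where
 "bes_G nu w = (\<Sum>k. bes_coef nu k * w ^ k)"

definition bes_G' :: "real => real => real" where
 "bes_G' nu w = (\<Sum>k. diffs (bes_coef nu) k * w ^ k)"

lemma bes_coef_Suc:
 assumes "nu > 0"
 shows "bes_coef nu k = - (real k + 1) * (nu + real k + 1) * bes_coef nu (Suc k)"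
proof -
 have "Gamma (nu + real k + 1 + 1) = (nu + real k + 1) * Gamma (nu + real k + 1)"
  using assms by (intro Gamma_plus1) (auto elim!: nonpos_Ints_cases)
 moreover have "nu + real (Suc k) + 1 = nu + real k + 1 + 1" by simp
 moreover have gp: "Gamma (nu + real k + 1) > 0" "nu + real k + 1 > 0" using assms by auto
 have "t / (F * g) = - a * u * (- t / ((a * F) * (u * g)))" if "a \<noteq> 0" "u \<noteq> 0" "F \<noteq> 0" "g \<noteq> 0" for a u F g t :: real
  using that by (simp add: field_simps)
 from this[of "real k + 1" "nu + real k + 1" "fact k" "Gamma (nu + real k + 1)" "(-1) ^ k"]
 have "(- 1) ^ k / (fact k * Gamma (nu + real k + 1)) = - (real k + 1) * (nu + real k + 1) *
   (- ((-1) ^ k) / (((real k + 1) * fact k) * ((nu + real k + 1) * Gamma (nu + real k + 1))))"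
  using gp by auto
 moreover have "fact (Suc k) = (real k + 1) * fact k" "(-1::real) ^ Suc k = - ((-1) ^ k)" by (simp_all add: add.commute)
 ultimately show ?thesis unfolding bes_coef_def by (simp only:)
qed

lemma bes_coef_summable:
 assumes "nu > 0"
 shows "summable (%k. bes_coef nu k * w ^ k)"
proof (rule summable_comparison_test)
 have g: "Gamma (nu + real k + 1) >= Gamma (nu + 1) * 1" if "True" for k
 proof (induction k)
  case (Suc k)
  have "Gamma (nu + real k + 1 + 1) = (nu + real k + 1) * Gamma (nu + real k + 1)"
   using assms by (intro Gamma_plus1) (auto elim!: nonpos_Ints_cases)
  also have "... >= 1 * Gamma (nu + real k + 1)" using assms by (intro mult_right_mono) auto
  finally show ?case using Suc by (simp add: add_ac)
 qed simp
 have g1: "Gamma (nu + 1) > 0" using assms by simp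
 show "\<exists>N. \<forall>k\<ge>N. norm (bes_coef nu k * w ^ k) <= (1 / Gamma (nu + 1)) * (inverse (fact k) * \<bar>w\<bar> ^ k)"
 proof (intro exI allI impI)
  fix k
  have "norm (bes_coef nu k * w ^ k) = (1 / Gamma (nu + real k + 1)) * (inverse (fact k) * \<bar>w\<bar> ^ k)"
   using order.strict_trans2[OF g1 g[of k, simplified]] by (simp add: bes_coef_def abs_mult power_abs divide_inverse)
  also have "... <= (1 / Gamma (nu + 1)) * (inverse (fact k) * \<bar>w\<bar> ^ k)"
   using g[of k] g1 by (intro mult_right_mono divide_left_mono mult_pos_pos) auto
  finally show "norm (bes_coef nu k * w ^ k) <= (1 / Gamma (nu + 1)) * (inverse (fact k) * \<bar>w\<bar> ^ k)" .
 qed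
 show "summable (%k. (1 / Gamma (nu + 1)) * (inverse (fact k) * \<bar>w\<bar> ^ k))"
  by (intro summable_mult summable_exp)
qed

lemma bes_G_deriv:
 assumes "nu > 0"
 shows "(bes_G nu has_real_derivative bes_G' nu w) (at w)"
 unfolding bes_G_def[abs_def] bes_G'_def
 by (rule termdiffs_strong_converges_everywhere) (rule bes_coef_summable[OF assms])

text \<open>The recursion of the coefficients amounts to the differential equation w G'' + (nu + 1)
  G' + G = 0.\<close>

lemma bes_G'_deriv:
 assumes "nu > 0"
 obtains G2 where "!!w. (bes_G' nu has_real_derivative G2 w) (at w)" "!!w. w * G2 w = - (nu + 1) * bes_G' nu w - bes_G nu w"
proof -
 define c where "c = bes_coef nu"
 have s1: "summable (%k. diffs c k * w ^ k)" for w
  using termdiff_converges_all[of c] bes_coef_summable[OF assms] by (simp add: c_def)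
 have s2: "summable (%k. diffs (diffs c) k * w ^ k)" for w
  using termdiff_converges_all[of "diffs c"] s1 by simp
 define G2 where "G2 w = (\<Sum>k. diffs (diffs c) k * w ^ k)" for w
 have "(bes_G' nu has_real_derivative G2 w) (at w)" for w
  unfolding bes_G'_def[abs_def] G2_def c_def[symmetric] by (rule termdiffs_strong_converges_everywhere) (rule s1)
 moreover have "w * G2 w = - (nu + 1) * bes_G' nu w - bes_G nu w" for w
 proof -
  have 1: "(%k. w * (diffs (diffs c) k * w ^ k)) sums (w * G2 w)"
   unfolding G2_def by (intro sums_mult summable_sums s2)
  have "(%k. real k * diffs c k * w ^ k) sums (w * G2 w)"
  proof -
   have "(%k. real (Suc k) * diffs c (Suc k) * w ^ Suc k) sums (w * G2 w)"
    using 1 by (simp add: diffs_def mult_ac)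
   from sums_Suc[OF this] show ?thesis by simp
  qed
  then have "(%k. real k * diffs c k * w ^ k + (nu + 1) * (diffs c k * w ^ k) + c k * w ^ k) sums (w * G2 w + (nu + 1) * bes_G' nu w + bes_G nu w)"
   unfolding bes_G'_def bes_G_def c_def[symmetric]
   by (intro sums_add sums_mult summable_sums s1) (use bes_coef_summable[OF assms] in \<open>auto simp: c_def\<close>)
  moreover have "real k * diffs c k * w ^ k + (nu + 1) * (diffs c k * w ^ k) + c k * w ^ k = 0" for k
  proof -
   have "real k * diffs c k + (nu + 1) * diffs c k + c k = 0"
    using bes_coef_Suc[OF assms, of k] by (simp add: diffs_def c_def algebra_simps)
   then have "(real k * diffs c k + (nu + 1) * diffs c k + c k) * w ^ k = 0" by simp
   then show ?thesis by (simp add: algebra_simps)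
  qed
  ultimately have "(%k. 0) sums (w * G2 w + (nu + 1) * bes_G' nu w + bes_G nu w)" by (simp only:)
  from sums_unique2[OF this sums_zero] have "w * G2 w + (nu + 1) * bes_G' nu w + bes_G nu w = 0" .
  moreover have "a = - (nu + 1) * b - c" if "a + (nu + 1) * b + c = 0" for a b c
   using that by (simp add: algebra_simps)
  ultimately show ?thesis by blast
 qed
 ultimately show ?thesis using that by blast
qed

text \<open>The derivative of this energy is -(2 nu + 1) G'^2. It controls J_nu and its derivative
  on the whole half-line without asymptotics.\<close>

lemma bes_energy:
 assumes "nu > 0" "w >= 0"
 shows "(bes_G nu w)^2 + w * (bes_G' nu w)^2 <= (bes_G nu 0)^2"
proof -
 obtain G2 where G2: "!!w. (bes_G' nu has_real_derivative G2 w) (at w)" "!!w. w * G2 w = - (nu + 1) * bes_G' nu w - bes_G nu w"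
  using bes_G'_deriv[OF assms(1)] by metis
 define e where "e w = (bes_G nu w)^2 + w * (bes_G' nu w)^2" for w
 have "e w <= e 0"
 proof (rule DERIV_nonpos_imp_nonincreasing[OF assms(2)])
  fix x assume "0 <= x" "x <= w"
  have "(e has_real_derivative (2 * bes_G nu x * bes_G' nu x + ((bes_G' nu x)^2 + x * (2 * bes_G' nu x * G2 x)))) (at x)"
   unfolding e_def[abs_def] using bes_G_deriv[OF assms(1), of x] G2(1)[of x]
   by (auto intro!: derivative_eq_intros)
  also have "2 * bes_G nu x * bes_G' nu x + ((bes_G' nu x)^2 + x * (2 * bes_G' nu x * G2 x)) = - (2 * nu + 1) * (bes_G' nu x)^2"
  proof -
   have "x * (2 * bes_G' nu x * G2 x) = 2 * bes_G' nu x * (x * G2 x)" by simp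
   then show ?thesis unfolding G2(2) by (simp add: algebra_simps power2_eq_square)
  qed
  finally show "\<exists>y. (e has_real_derivative y) (at x) \<and> y <= 0"
   using assms by (intro exI conjI) (auto intro!: mult_nonpos_nonneg)
 qed
 then show ?thesis by (simp add: e_def)
qed

text \<open>This is x J_nu'(x) - nu J_nu(x), that is, -x J_(nu+1)(x). Together with J_nu it
  satisfies a first-order system suited to integration by parts against powers.\<close>

definition bes_L :: "real => real => real" where
 "bes_L nu x = (x / 2) powr nu * (2 * (x^2 / 4) * bes_G' nu (x^2 / 4))"

lemma Bessel_J_eq:
 assumes "nu > 0" "x >= 0"
 shows "Bessel_J nu x = (x / 2) powr nu * bes_G nu (x^2 / 4)"
proof -
 have t: "(-1) ^ k / (fact k * Gamma (nu + real k + 1)) * (x / 2) powr (2 * real k + nu) = (x / 2) powr nu * (bes_coef nu k * (x^2 / 4) ^ k)" for k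
 proof (cases "x = 0")
  case False
  then have "(x / 2) powr (2 * real k + nu) = (x / 2) powr nu * (x^2 / 4) ^ k"
   using assms powr_realpow[of "x / 2" "2 * k"] by (simp add: powr_add power_mult power_divide)
  then show ?thesis by (simp add: bes_coef_def)
 qed auto
 show ?thesis unfolding Bessel_J_def t bes_G_def
  by (rule suminf_mult) (rule bes_coef_summable[OF assms(1)])
qed

lemma bes_system:
 assumes "nu > 0" "x > 0"
 shows "\<exists>d. (Bessel_J nu has_real_derivative d) (at x) \<and> x * d = nu * Bessel_J nu x + bes_L nu x"
  and "\<exists>d. (bes_L nu has_real_derivative d) (at x) \<and> x * d = - nu * bes_L nu x - x^2 * Bessel_J nu x"
proof -
 obtain G2 where G2: "!!w. (bes_G' nu has_real_derivative G2 w) (at w)" "!!w. w * G2 w = - (nu + 1) * bes_G' nu w - bes_G nu w"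
  using bes_G'_deriv[OF assms(1)] by metis
 let ?w = "x^2 / 4" and ?p = "(x / 2) powr nu"
 have dw: "((%x. x^2 / 4) has_real_derivative x / 2) (at x)" by (auto intro!: derivative_eq_intros)
 have dp: "((%x. (x / 2) powr nu) has_real_derivative (nu / x * ?p)) (at x)"
  using assms by (auto intro!: derivative_eq_intros simp: powr_diff field_simps)
 have dG: "((%x. bes_G nu (x^2 / 4)) has_real_derivative bes_G' nu ?w * (x / 2)) (at x)"
  by (rule DERIV_chain2[OF bes_G_deriv[OF assms(1)] dw])
 have dG': "((%x. bes_G' nu (x^2 / 4)) has_real_derivative G2 ?w * (x / 2)) (at x)"
  by (rule DERIV_chain2[OF G2(1) dw])
 have "((%x. (x / 2) powr nu * bes_G nu (x^2 / 4)) has_real_derivative (nu / x * ?p) * bes_G nu ?w + bes_G' nu ?w * (x / 2) * ?p) (at x)"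
  by (rule DERIV_mult[OF dp dG, THEN DERIV_cong]) simp
 then have "(Bessel_J nu has_real_derivative (nu / x * ?p) * bes_G nu ?w + bes_G' nu ?w * (x / 2) * ?p) (at x)"
  by (rule has_field_derivative_transform_within_open[where S = "{0<..}"]) (use assms in \<open>auto simp: Bessel_J_eq\<close>)
 moreover have "x * ((nu / x * ?p) * bes_G nu ?w + bes_G' nu ?w * (x / 2) * ?p) = nu * Bessel_J nu x + bes_L nu x"
  using assms by (simp add: Bessel_J_eq bes_L_def distrib_left power2_eq_square)
 ultimately show "\<exists>d. (Bessel_J nu has_real_derivative d) (at x) \<and> x * d = nu * Bessel_J nu x + bes_L nu x" by blast
 have dm: "((%x. 2 * (x^2 / 4) * bes_G' nu (x^2 / 4)) has_real_derivative x * bes_G' nu ?w + G2 ?w * (x / 2) * (2 * ?w)) (at x)"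
 proof -
  have "((%x. 2 * (x^2 / 4)) has_real_derivative x) (at x)" by (auto intro!: derivative_eq_intros)
  from DERIV_mult[OF this dG'] show ?thesis by simp
 qed
 have "(bes_L nu has_real_derivative (nu / x * ?p) * (2 * ?w * bes_G' nu ?w) + (x * bes_G' nu ?w + G2 ?w * (x / 2) * (2 * ?w)) * ?p) (at x)"
  unfolding bes_L_def[abs_def] by (rule DERIV_mult[OF dp dm])
 moreover have "x * ((nu / x * ?p) * (2 * ?w * bes_G' nu ?w) + (x * bes_G' nu ?w + G2 ?w * (x / 2) * (2 * ?w)) * ?p) = - nu * bes_L nu x - x^2 * Bessel_J nu x"
 proof -
  have "G2 ?w * (x / 2) * (2 * ?w) = x * (?w * G2 ?w)" by simp
  also have "... = x * (- (nu + 1) * bes_G' nu ?w - bes_G nu ?w)" by (simp only: G2(2))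
  finally have e: "G2 ?w * (x / 2) * (2 * ?w) = x * (- (nu + 1) * bes_G' nu ?w - bes_G nu ?w)" .
  have "x * ((nu / x * p) * (2 * (x^2 / 4) * g) + (x * g + x * (- (nu + 1) * g - G)) * p) = - nu * (p * (2 * (x^2 / 4) * g)) - x^2 * (p * G)" for p g G
   using assms by (simp add: field_simps power2_eq_square)
  then show ?thesis unfolding e bes_L_def Bessel_J_eq[OF assms(1) less_imp_le[OF assms(2)]] .
 qed
 ultimately show "\<exists>d. (bes_L nu has_real_derivative d) (at x) \<and> x * d = - nu * bes_L nu x - x^2 * Bessel_J nu x" by blast
qed

lemma bes_bounds:
 assumes "nu > 0" "x >= 0"
 shows "\<bar>Bessel_J nu x\<bar> <= \<bar>bes_G nu 0\<bar> * (x / 2) powr nu" "\<bar>bes_L nu x\<bar> <= \<bar>bes_G nu 0\<bar> * (x / 2) powr nu * x"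
proof -
 let ?w = "x^2 / 4"
 have e: "(bes_G nu ?w)^2 + ?w * (bes_G' nu ?w)^2 <= (bes_G nu 0)^2" by (rule bes_energy) (use assms in auto)
 have "0 <= ?w * (bes_G' nu ?w)^2" by simp
 then have "(bes_G nu ?w)^2 <= (bes_G nu 0)^2" using e by linarith
 then have "\<bar>bes_G nu ?w\<bar> <= \<bar>bes_G nu 0\<bar>" by (simp add: abs_le_square_iff)
 then show "\<bar>Bessel_J nu x\<bar> <= \<bar>bes_G nu 0\<bar> * (x / 2) powr nu"
  unfolding Bessel_J_eq[OF assms] using mult_left_mono[of "\<bar>bes_G nu ?w\<bar>" "\<bar>bes_G nu 0\<bar>" "(x / 2) powr nu"]
  by (simp add: abs_mult mult.commute)
 have "(x / 2 * bes_G' nu ?w)^2 = ?w * (bes_G' nu ?w)^2" by (simp add: power_mult_distrib power_divide)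
 also have "... <= (bes_G nu 0)^2" using e zero_le_power2[of "bes_G nu ?w"] by linarith
 finally have a: "\<bar>x / 2 * bes_G' nu ?w\<bar> <= \<bar>bes_G nu 0\<bar>" by (simp only: abs_le_square_iff)
 have "bes_L nu x = ((x / 2) powr nu * x) * (x / 2 * bes_G' nu ?w)" by (simp add: bes_L_def power2_eq_square)
 then have "\<bar>bes_L nu x\<bar> = \<bar>(x / 2) powr nu * x\<bar> * \<bar>x / 2 * bes_G' nu ?w\<bar>" by (simp only: abs_mult)
 also have "\<bar>(x / 2) powr nu * x\<bar> = (x / 2) powr nu * x" using assms by simp
 finally have "\<bar>bes_L nu x\<bar> = ((x / 2) powr nu * x) * \<bar>x / 2 * bes_G' nu ?w\<bar>" .
 also have "... <= ((x / 2) powr nu * x) * \<bar>bes_G nu 0\<bar>" using a assms by (intro mult_left_mono) auto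
 finally show "\<bar>bes_L nu x\<bar> <= \<bar>bes_G nu 0\<bar> * (x / 2) powr nu * x" by (simp add: mult_ac)
qed

lemma set_borel_integrable_Bessel:
 assumes "nu > 0" "nu <= 1" "s > 0"
 shows "set_integrable lborel {0..} (%x. x ^ j * Bessel_J nu x * exp (- (s * x)))"
  and "set_integrable lborel {0..} (%x. x ^ j * bes_L nu x * exp (- (s * x)))"
proof -
 define C where "C = \<bar>bes_G nu 0\<bar>"
 have i: "integrable lborel (%x. indicator {0..} x *\<^sub>R (x ^ k * exp (- (s * x))))" for k
  using power_exp_integral[OF assms(3), of k] by (simp add: has_bochner_integral_iff)
 have b: "(x / 2) powr nu <= 1 + x" if "x >= 0" for x
 proof (cases "x / 2 <= 1")
  case True
  then have "(x / 2) powr nu <= 1" using that assms by (intro powr_le1) auto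
  then show ?thesis using that by simp
 next
  case False
  then have "(x / 2) powr nu <= (x / 2) powr 1" using assms by (intro powr_mono) auto
  then show ?thesis using that by simp
 qed
 have contG: "continuous_on A (bes_G nu)" for A
  using bes_G_deriv[OF assms(1)] by (intro continuous_at_imp_continuous_on ballI DERIV_isCont) auto
 have contG': "continuous_on A (bes_G' nu)" for A
 proof -
  obtain G2 where "!!w. (bes_G' nu has_real_derivative G2 w) (at w)" using bes_G'_deriv[OF assms(1)] by metis
  then show ?thesis by (intro continuous_at_imp_continuous_on ballI DERIV_isCont) auto
 qed
 have cJ: "continuous_on {0..} (Bessel_J nu)"
 proof -
  have "continuous_on {0..} (%x. (x / 2) powr nu * bes_G nu (x^2 / 4))"
   using assms by (intro continuous_intros continuous_on_powr' continuous_on_compose2[OF contG[of UNIV]]) auto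
  then show ?thesis by (rule continuous_on_eq) (simp add: Bessel_J_eq[OF assms(1)])
 qed
 have cL: "continuous_on {0..} (bes_L nu)"
  unfolding bes_L_def[abs_def] using assms by (intro continuous_intros continuous_on_powr' continuous_on_compose2[OF contG'[of UNIV]]) auto
 have m: "(%x. indicator {0..} x *\<^sub>R (x ^ j * f x * exp (- (s * x)))) \<in> borel_measurable lborel" if "continuous_on {0..} f" for f :: "real => real"
 proof -
  have "(%x. indicator {0..} x *\<^sub>R (x ^ j * f x * exp (- (s * x)))) \<in> borel_measurable borel"
   by (intro borel_measurable_continuous_on_indicator continuous_intros that) auto
  then show ?thesis by simp
 qed
 have bound: "set_integrable lborel {0..} (%x. x ^ j * f x * exp (- (s * x)))"
  if f: "continuous_on {0..} f" "!!x. x >= 0 ==> \<bar>f x\<bar> <= C * (1 + 2 * x + x^2)" for f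
  unfolding set_integrable_def
 proof (rule Bochner_Integration.integrable_bound[OF _ m[OF f(1)]])
  let ?g = "%x. C * (indicator {0..} x *\<^sub>R (x ^ j * exp (- (s * x)))) + 2 * C * (indicator {0..} x *\<^sub>R (x ^ (j + 1) * exp (- (s * x)))) + C * (indicator {0..} x *\<^sub>R (x ^ (j + 2) * exp (- (s * x))))"
  show "integrable lborel ?g" by (intro Bochner_Integration.integrable_add integrable_mult_right i)
  show "AE x in lborel. norm (indicator {0..} x *\<^sub>R (x ^ j * f x * exp (- (s * x)))) <= norm (?g x)"
  proof (rule AE_I2)
   fix x :: real
   show "norm (indicator {0..} x *\<^sub>R (x ^ j * f x * exp (- (s * x)))) <= norm (?g x)"
   proof (cases "x >= 0")
    case True
    have "norm (x ^ j * f x * exp (- (s * x))) = (x ^ j * exp (- (s * x))) * \<bar>f x\<bar>" using True by (simp add: abs_mult)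
    also have "... <= (x ^ j * exp (- (s * x))) * (C * (1 + 2 * x + x^2))" using True f(2)[OF True] by (intro mult_left_mono) auto
    also have "... = ?g x" using True by (simp add: algebra_simps power2_eq_square)
    also have "... <= norm (?g x)" by simp
    finally show ?thesis using True by simp
   qed simp
  qed
 qed
 show "set_integrable lborel {0..} (%x. x ^ j * Bessel_J nu x * exp (- (s * x)))"
 proof (rule bound[OF cJ])
  fix x :: real assume x: "x >= 0"
  have "\<bar>Bessel_J nu x\<bar> <= C * (x / 2) powr nu" unfolding C_def by (rule bes_bounds[OF assms(1) x])
  also have "... <= C * (1 + 2 * x + x^2)" using b[OF x] x by (intro mult_left_mono) (auto simp: C_def intro: order_trans)
  finally show "\<bar>Bessel_J nu x\<bar> <= C * (1 + 2 * x + x^2)" .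
 qed
 show "set_integrable lborel {0..} (%x. x ^ j * bes_L nu x * exp (- (s * x)))"
 proof (rule bound[OF cL])
  fix x :: real assume x: "x >= 0"
  have "\<bar>bes_L nu x\<bar> <= C * (x / 2) powr nu * x" unfolding C_def by (rule bes_bounds[OF assms(1) x])
  also have "... = C * ((x / 2) powr nu * x)" by simp
  also have "... <= C * ((1 + x) * x)" using b[OF x] x by (intro mult_left_mono mult_right_mono) (auto simp: C_def)
  also have "... <= C * (1 + 2 * x + x^2)" using x by (intro mult_left_mono) (auto simp: C_def power2_eq_square algebra_simps)
  finally show "\<bar>bes_L nu x\<bar> <= C * (1 + 2 * x + x^2)" .
 qed
qed

section \<open>Moments of the exponentially damped Bessel function\<close>

definition mom_J :: "real => nat => real => real" where
 "mom_J nu j s = (LBINT x:{0..}. x ^ j * Bessel_J nu x * exp (- (s * x)))"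

definition mom_L :: "real => nat => real => real" where
 "mom_L nu j s = (LBINT x:{0..}. x ^ j * bes_L nu x * exp (- (s * x)))"

lemma integral_deriv_0_infinity:
 fixes F f :: "real => real"
 assumes d: "!!x. x > 0 ==> (F has_real_derivative f x) (at x)"
  and c: "continuous_on {0..} F" and F0: "F 0 = 0" and lim: "(F \<longlongrightarrow> 0) at_top"
  and int: "set_integrable lborel {0..} f"
 shows "(LBINT x:{0..}. f x) = 0"
proof -
 have "((%R. LBINT x:{0..R}. f x) \<longlongrightarrow> (LBINT x:{0..}. f x)) at_top"
  by (rule tendsto_set_lebesgue_integral_at_top[OF _ int]) auto
 moreover have "\<forall>\<^sub>F R in at_top. (LBINT x:{0..R}. f x) = F R"
  using eventually_ge_at_top[of 0]
 proof eventually_elim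
  case (elim R)
  have s: "set_integrable lborel {0..R} f" by (rule set_integrable_subset[OF int]) auto
  have "(f has_integral (F R - F 0)) {0..R}"
  proof (rule fundamental_theorem_of_calculus_interior[OF elim])
   show "continuous_on {0..R} F" by (rule continuous_on_subset[OF c]) auto
   show "(F has_vector_derivative f x) (at x)" if "x \<in> {0<..<R}" for x
    using d[of x] that by (simp add: has_real_derivative_iff_has_vector_derivative)
  qed
  then show ?case by (simp add: set_borel_integral_eq_integral(2)[OF s] integral_unique F0)
 qed
 ultimately have "(F \<longlongrightarrow> (LBINT x:{0..}. f x)) at_top" by (rule Lim_transform_eventually)
 from tendsto_unique[OF trivial_limit_at_top_linorder this lim] show ?thesis .
qed

lemma norm_lebesgue_integral_le:
 fixes f :: "'a => 'b::{banach, second_countable_topology}" and g :: "'a => real"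
 assumes "integrable M g" "!!x. norm (f x) <= g x"
 shows "norm (integral\<^sup>L M f) <= integral\<^sup>L M g"
 by (rule order_trans[OF integral_norm_bound integral_mono'])
  (use assms norm_ge_zero order_trans in \<open>auto intro: order_trans[OF norm_ge_zero]\<close>)

lemma bes_continuous:
 assumes "nu > 0"
 shows "continuous_on {0..} (Bessel_J nu)" "continuous_on {0..} (bes_L nu)"
proof -
 have contG: "continuous_on UNIV (bes_G nu)"
  using bes_G_deriv[OF assms(1)] by (intro continuous_at_imp_continuous_on ballI DERIV_isCont) auto
 obtain G2 where "!!w. (bes_G' nu has_real_derivative G2 w) (at w)" using bes_G'_deriv[OF assms(1)] by metis
 then have contG': "continuous_on UNIV (bes_G' nu)" by (intro continuous_at_imp_continuous_on ballI DERIV_isCont) auto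
 have "continuous_on {0..} (%x. (x / 2) powr nu * bes_G nu (x^2 / 4))"
  using assms by (intro continuous_intros continuous_on_powr' continuous_on_compose2[OF contG]) auto
 then show "continuous_on {0..} (Bessel_J nu)" by (rule continuous_on_eq) (simp add: Bessel_J_eq[OF assms(1)])
 show "continuous_on {0..} (bes_L nu)"
  unfolding bes_L_def[abs_def] using assms by (intro continuous_intros continuous_on_powr' continuous_on_compose2[OF contG']) auto
qed

lemma bes_poly_bounds:
 assumes "nu > 0" "nu <= 1" "x >= 0"
 shows "\<bar>Bessel_J nu x\<bar> <= \<bar>bes_G nu 0\<bar> * (1 + x)" "\<bar>bes_L nu x\<bar> <= \<bar>bes_G nu 0\<bar> * (1 + x) * x"
proof -
 have b: "(x / 2) powr nu <= 1 + x"
 proof (cases "x / 2 <= 1")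
  case True
  then have "(x / 2) powr nu <= 1" using assms by (intro powr_le1) auto
  then show ?thesis using assms by simp
 next
  case False
  then have "(x / 2) powr nu <= (x / 2) powr 1" using assms by (intro powr_mono) auto
  then show ?thesis using assms by simp
 qed
 then have b': "\<bar>bes_G nu 0\<bar> * (x / 2) powr nu <= \<bar>bes_G nu 0\<bar> * (1 + x)" by (intro mult_left_mono) auto
 then show "\<bar>Bessel_J nu x\<bar> <= \<bar>bes_G nu 0\<bar> * (1 + x)" using bes_bounds(1)[OF assms(1,3)] by linarith
 have "\<bar>bes_G nu 0\<bar> * (x / 2) powr nu * x <= \<bar>bes_G nu 0\<bar> * (1 + x) * x" using b' assms(3) by (rule mult_right_mono)
 then show "\<bar>bes_L nu x\<bar> <= \<bar>bes_G nu 0\<bar> * (1 + x) * x" using bes_bounds(2)[OF assms(1,3)] by linarith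
qed

lemma power_exp_tendsto_0:
 fixes s :: real
 assumes "s > 0"
 shows "((%x. x ^ k * exp (- (s * x))) \<longlongrightarrow> 0) at_top"
proof -
 have "filterlim (%x. s * x) at_top at_top" using assms by (intro filterlim_tendsto_pos_mult_at_top[OF tendsto_const _ filterlim_ident])
 from filterlim_compose[OF tendsto_power_div_exp_0[of k] this]
 have "((%x. (s * x) ^ k / exp (s * x) * (1 / s ^ k)) \<longlongrightarrow> 0 * (1 / s ^ k)) at_top" by (intro tendsto_intros)
 moreover have "(s * x) ^ k / exp (s * x) * (1 / s ^ k) = x ^ k * exp (- (s * x))" for x
  using assms by (simp add: power_mult_distrib exp_minus divide_inverse)
 ultimately show ?thesis by simp
qed

text \<open>Integrate the derivative of x^(j+1) f(x) e^(-s x). Prescribing x f' instead of f'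
  matches the Bessel system, and the boundary point 0 only requires continuity.\<close>

lemma mom_recurrence_aux:
 fixes f g :: "real => real"
 assumes s: "s > 0" and c: "continuous_on {0..} f"
  and d: "!!x. x > 0 ==> \<exists>d. (f has_real_derivative d) (at x) \<and> x * d = g x"
  and b: "!!x. x >= 0 ==> \<bar>f x\<bar> <= C * (1 + x)^2"
  and int: "!!j. set_integrable lborel {0..} (%x. x ^ j * f x * exp (- (s * x)))"
   "set_integrable lborel {0..} (%x. x ^ j * g x * exp (- (s * x)))"
 shows "(real j + 1) * (LBINT x:{0..}. x ^ j * f x * exp (- (s * x))) + (LBINT x:{0..}. x ^ j * g x * exp (- (s * x)))
   = s * (LBINT x:{0..}. x ^ (j + 1) * f x * exp (- (s * x)))"
proof -
 let ?e = "%x. exp (- (s * x))"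
 have "(LBINT x:{0..}. ((real j + 1) * (x ^ j * f x * ?e x) + x ^ j * g x * ?e x) - s * (x ^ (j + 1) * f x * ?e x)) = 0"
 proof (rule integral_deriv_0_infinity[where F = "%x. x ^ (j + 1) * f x * ?e x"])
  fix x :: real assume x: "x > 0"
  then obtain D where D: "(f has_real_derivative D) (at x)" "x * D = g x" using d by blast
  have "((%x. x ^ (j + 1) * f x * ?e x) has_real_derivative
    ((real (j + 1) * x ^ j) * f x + D * x ^ (j + 1)) * ?e x + (?e x * (- s)) * (x ^ (j + 1) * f x)) (at x)"
  proof (intro DERIV_mult D)
   show "((%x. x ^ (j + 1)) has_real_derivative real (j + 1) * x ^ j) (at x)" using DERIV_pow[of "j + 1" x] by simp
   show "(?e has_real_derivative ?e x * - s) (at x)" by (auto intro!: derivative_eq_intros)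
  qed
  moreover have "((real (j + 1) * x ^ j) * f x + D * x ^ (j + 1)) * ?e x + (?e x * (- s)) * (x ^ (j + 1) * f x)
   = ((real j + 1) * (x ^ j * f x * ?e x) + x ^ j * g x * ?e x) - s * (x ^ (j + 1) * f x * ?e x)"
  proof -
   have "((real (j + 1) * p) * F + d * (p * x)) * e + (e * (- s)) * (p * x * F) = ((real j + 1) * (p * F * e) + p * (x * d) * e) - s * (p * x * F * e)" for p F d e
    by (simp add: algebra_simps)
   then show ?thesis unfolding D(2)[symmetric] by (simp only: power_add power_one_right)
  qed
  ultimately show "((%x. x ^ (j + 1) * f x * ?e x) has_real_derivative
   ((real j + 1) * (x ^ j * f x * ?e x) + x ^ j * g x * ?e x) - s * (x ^ (j + 1) * f x * ?e x)) (at x)" by (simp only:)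
 next
  show "continuous_on {0..} (%x. x ^ (j + 1) * f x * ?e x)" by (intro continuous_intros c)
  show "((%x. x ^ (j + 1) * f x * ?e x) \<longlongrightarrow> 0) at_top"
  proof (rule Lim_null_comparison)
   show "\<forall>\<^sub>F x in at_top. norm (x ^ (j + 1) * f x * ?e x) <= C * (x ^ (j + 1) * (1 + x)^2 * ?e x)"
    using eventually_ge_at_top[of 0]
   proof eventually_elim
    case (elim x)
    have "norm (x ^ (j + 1) * f x * ?e x) = (x ^ (j + 1) * ?e x) * \<bar>f x\<bar>" using elim by (simp add: abs_mult)
    also have "... <= (x ^ (j + 1) * ?e x) * (C * (1 + x)^2)" using elim b by (intro mult_left_mono) auto
    finally show ?case by (simp add: mult_ac)
   qed
   have "((%x. x ^ (j + 1) * ?e x + 2 * (x ^ (j + 2) * ?e x) + x ^ (j + 3) * ?e x) \<longlongrightarrow> 0 + 2 * 0 + 0) at_top"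
    by (intro tendsto_intros power_exp_tendsto_0 s)
   then have "((%x. x ^ (j + 1) * (1 + x)^2 * ?e x) \<longlongrightarrow> 0) at_top"
    by (simp add: algebra_simps power2_eq_square power3_eq_cube power_add)
   from tendsto_mult_left[OF this, of C] show "((%x. C * (x ^ (j + 1) * (1 + x)^2 * ?e x)) \<longlongrightarrow> 0) at_top" by simp
  qed
  show "set_integrable lborel {0..} (%x. ((real j + 1) * (x ^ j * f x * ?e x) + x ^ j * g x * ?e x) - s * (x ^ (j + 1) * f x * ?e x))"
   by (intro set_integral_diff(1) set_integral_add(1) set_integrable_mult_right int)
 qed simp
 also have "(LBINT x:{0..}. ((real j + 1) * (x ^ j * f x * ?e x) + x ^ j * g x * ?e x) - s * (x ^ (j + 1) * f x * ?e x))
   = (real j + 1) * (LBINT x:{0..}. x ^ j * f x * ?e x) + (LBINT x:{0..}. x ^ j * g x * ?e x) - s * (LBINT x:{0..}. x ^ (j + 1) * f x * ?e x)"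
  proof -
  have a: "set_integrable lborel {0..} (%x. (real j + 1) * (x ^ j * f x * ?e x))" "set_integrable lborel {0..} (%x. s * (x ^ (j + 1) * f x * ?e x))"
   by (intro set_integrable_mult_right int)+
  show ?thesis
   unfolding set_integral_diff(2)[OF set_integral_add(1)[OF a(1) int(2)] a(2)] set_integral_add(2)[OF a(1) int(2)] set_integral_mult_right ..
 qed
 finally show ?thesis by simp
qed

text \<open>Each equation of the first-order system gives one relation; eliminating
  \<open>mom_L\<close> leaves a recurrence that becomes that of \<open>bes_mom\<close> as s tends to
  0.\<close>

lemma mom_recurrence:
 assumes "nu > 0" "nu <= 1" "s > 0"
 shows "(1 + s^2) * mom_J nu (j + 2) s = (2 * real j + 3) * s * mom_J nu (j + 1) s - ((real j + 1)^2 - nu^2) * mom_J nu j s"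
proof -
 let ?e = "%x. exp (- (s * x))"
 note i = set_borel_integrable_Bessel[OF assms]
 have iJ: "set_integrable lborel {0..} (%x. x ^ j * (nu * Bessel_J nu x + bes_L nu x) * ?e x)" for j
  using set_integral_add(1)[OF set_integrable_mult_right[OF i(1), of nu j] i(2)[of j]] by (simp add: algebra_simps)
 have iL: "set_integrable lborel {0..} (%x. x ^ j * (- nu * bes_L nu x - x^2 * Bessel_J nu x) * ?e x)" for j
  using set_integral_diff(1)[OF set_integrable_mult_right[OF i(2), of "- nu" j] i(1)[of "j + 2"]] by (simp add: algebra_simps power2_eq_square)
 have bJ: "\<bar>Bessel_J nu x\<bar> <= \<bar>bes_G nu 0\<bar> * (1 + x)^2" "\<bar>bes_L nu x\<bar> <= \<bar>bes_G nu 0\<bar> * (1 + x)^2" if x: "x >= 0" for x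
 proof -
  have "\<bar>bes_G nu 0\<bar> * (1 + x) <= \<bar>bes_G nu 0\<bar> * (1 + x)^2" "\<bar>bes_G nu 0\<bar> * ((1 + x) * x) <= \<bar>bes_G nu 0\<bar> * (1 + x)^2"
   using x by (intro mult_left_mono; simp add: power2_eq_square algebra_simps)+
  then show "\<bar>Bessel_J nu x\<bar> <= \<bar>bes_G nu 0\<bar> * (1 + x)^2" "\<bar>bes_L nu x\<bar> <= \<bar>bes_G nu 0\<bar> * (1 + x)^2"
   using bes_poly_bounds[OF assms(1,2) x] by (simp_all add: mult.assoc)
 qed
 have r1: "(real j + 1 + nu) * mom_J nu j s + mom_L nu j s = s * mom_J nu (j + 1) s" for j
 proof -
  have "(real j + 1) * mom_J nu j s + (LBINT x:{0..}. x ^ j * (nu * Bessel_J nu x + bes_L nu x) * ?e x) = s * mom_J nu (j + 1) s"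
   unfolding mom_J_def
   by (rule mom_recurrence_aux[OF assms(3) bes_continuous(1)[OF assms(1)] bes_system(1)[OF assms(1)] bJ(1) i(1) iJ])
  also have "(LBINT x:{0..}. x ^ j * (nu * Bessel_J nu x + bes_L nu x) * ?e x) = nu * mom_J nu j s + mom_L nu j s"
   unfolding mom_J_def mom_L_def using set_integral_add(2)[OF set_integrable_mult_right[OF i(1), of nu j] i(2)[of j]] by (simp add: algebra_simps)
  finally show ?thesis by (simp add: algebra_simps)
 qed
 have r2: "(real j + 1 - nu) * mom_L nu j s = mom_J nu (j + 2) s + s * mom_L nu (j + 1) s" for j
 proof -
  have "(real j + 1) * mom_L nu j s + (LBINT x:{0..}. x ^ j * (- nu * bes_L nu x - x^2 * Bessel_J nu x) * ?e x) = s * mom_L nu (j + 1) s"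
   unfolding mom_L_def
   by (rule mom_recurrence_aux[OF assms(3) bes_continuous(2)[OF assms(1)] bes_system(2)[OF assms(1)] bJ(2) i(2) iL])
  also have "(LBINT x:{0..}. x ^ j * (- nu * bes_L nu x - x^2 * Bessel_J nu x) * ?e x) = - nu * mom_L nu j s - mom_J nu (j + 2) s"
   unfolding mom_J_def mom_L_def using set_integral_diff(2)[OF set_integrable_mult_right[OF i(2), of "- nu" j] i(1)[of "j + 2"]]
   unfolding set_integral_mult_right by (simp add: algebra_simps power2_eq_square)
  finally show ?thesis by (simp add: algebra_simps)
 qed
 have l0: "mom_L nu j s = s * mom_J nu (j + 1) s - (real j + 1 + nu) * mom_J nu j s" for j using r1[of j] by simp
 have "(1 + s * s) * c = (2 * n + 3) * s * b - ((n + 1) * (n + 1) - v * v) * a"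
  if "(n + 1 - v) * (s * b - (n + 1 + v) * a) = c + s * (s * c - (n + 1 + 1 + v) * b)" for a b c n v :: real
 proof -
  have "(1 + s * s) * c = (c + s * (s * c - (n + 1 + 1 + v) * b)) + s * ((n + 1 + 1 + v) * b)" by (simp add: algebra_simps)
  also have "... = (2 * n + 3) * s * b - ((n + 1) * (n + 1) - v * v) * a" unfolding that[symmetric] by (simp add: algebra_simps)
  finally show ?thesis .
 qed
 from this[of "real j" nu "mom_J nu (j + 1) s" "mom_J nu j s" "mom_J nu (j + 2) s"] r2[of j]
 show ?thesis unfolding l0 by (simp add: power2_eq_square add.commute)
qed

lemma mom_J_abs_le:
 assumes "nu > 0" "nu <= 1" "s > 0"
 shows "(LBINT x:{0..}. x ^ j * \<bar>Bessel_J nu x\<bar> * exp (- (s * x))) <= \<bar>bes_G nu 0\<bar> * (fact j / s ^ (j + 1) + fact (j + 1) / s ^ (j + 2))"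
  and "\<bar>mom_J nu j s\<bar> <= \<bar>bes_G nu 0\<bar> * (fact j / s ^ (j + 1) + fact (j + 1) / s ^ (j + 2))"
  and "set_integrable lborel {0..} (%x. x ^ j * \<bar>Bessel_J nu x\<bar> * exp (- (s * x)))"
proof -
 let ?g = "%x::real. \<bar>bes_G nu 0\<bar> * (indicator {0..} x *\<^sub>R (x ^ j * exp (- (s * x))) + indicator {0..} x *\<^sub>R (x ^ (j + 1) * exp (- (s * x))))"
 have h: "has_bochner_integral lborel ?g (\<bar>bes_G nu 0\<bar> * (fact j / s ^ (j + 1) + fact (j + 1) / s ^ (j + 1 + 1)))"
  by (intro has_bochner_integral_mult_right has_bochner_integral_add power_exp_integral assms)
 have i: "integrable lborel (%x. indicator {0..} x *\<^sub>R (x ^ j * Bessel_J nu x * exp (- (s * x))))"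
  using set_borel_integrable_Bessel(1)[OF assms] by (simp add: set_integrable_def)
 have e: "norm (indicator {0..} x *\<^sub>R (x ^ j * Bessel_J nu x * exp (- (s * x)))) = indicator {0..} x *\<^sub>R (x ^ j * \<bar>Bessel_J nu x\<bar> * exp (- (s * x)))" for x :: real
  by (auto simp: indicator_def abs_mult)
 show i': "set_integrable lborel {0..} (%x. x ^ j * \<bar>Bessel_J nu x\<bar> * exp (- (s * x)))"
  using integrable_norm[OF i] unfolding e set_integrable_def .
 have "(LBINT x. indicator {0..} x *\<^sub>R (x ^ j * \<bar>Bessel_J nu x\<bar> * exp (- (s * x)))) <= (LBINT x. ?g x)"
 proof (rule integral_mono)
  fix x :: real
  show "indicator {0..} x *\<^sub>R (x ^ j * \<bar>Bessel_J nu x\<bar> * exp (- (s * x))) <= ?g x"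
  proof (cases "x >= 0")
   case True
   have "(x ^ j * exp (- (s * x))) * \<bar>Bessel_J nu x\<bar> <= (x ^ j * exp (- (s * x))) * (\<bar>bes_G nu 0\<bar> * (1 + x))"
    using True bes_poly_bounds(1)[OF assms(1,2) True] by (intro mult_left_mono) auto
   then show ?thesis using True by (simp add: algebra_simps)
  qed simp
 qed (use h i' in \<open>auto simp: has_bochner_integral_iff set_integrable_def\<close>)
 also have "... = \<bar>bes_G nu 0\<bar> * (fact j / s ^ (j + 1) + fact (j + 1) / s ^ (j + 2))"
  using h by (simp add: has_bochner_integral_iff)
 finally show a: "(LBINT x:{0..}. x ^ j * \<bar>Bessel_J nu x\<bar> * exp (- (s * x))) <= \<bar>bes_G nu 0\<bar> * (fact j / s ^ (j + 1) + fact (j + 1) / s ^ (j + 2))"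
  unfolding set_lebesgue_integral_def .
 have "norm (LBINT x. indicator {0..} x *\<^sub>R (x ^ j * Bessel_J nu x * exp (- (s * x)))) <= (LBINT x. norm (indicator {0..} x *\<^sub>R (x ^ j * Bessel_J nu x * exp (- (s * x)))))"
  by (rule integral_norm_bound)
 then have "\<bar>mom_J nu j s\<bar> <= (LBINT x:{0..}. x ^ j * \<bar>Bessel_J nu x\<bar> * exp (- (s * x)))"
  unfolding e unfolding mom_J_def set_lebesgue_integral_def by (simp only: real_norm_def)
 then show "\<bar>mom_J nu j s\<bar> <= \<bar>bes_G nu 0\<bar> * (fact j / s ^ (j + 1) + fact (j + 1) / s ^ (j + 2))" using a by linarith
qed

lemma exp_Taylor_1_bound:
 fixes y :: real
 shows "\<bar>exp y - 1 - y\<bar> <= y^2 * exp \<bar>y\<bar>"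
proof -
 have "\<bar>exp y - (\<Sum>i\<le>1. y ^ i / fact i)\<bar> <= exp \<bar>y\<bar> * \<bar>y\<bar> ^ Suc 1 / fact 1"
  using Taylor_exp_field[of y 1] by simp
 then show ?thesis by (simp add: algebra_simps power2_eq_square)
qed

text \<open>Differentiation under the integral: for |h| < s/2 the second-order remainder is still
  dominated with the factor exp(- s x / 2).\<close>

lemma mom_J_deriv:
 assumes "nu > 0" "nu <= 1" "s > 0"
 shows "(mom_J nu j has_real_derivative - mom_J nu (j + 1) s) (at s)"
proof -
 define K where "K = (LBINT x:{0..}. x ^ (j + 2) * \<bar>Bessel_J nu x\<bar> * exp (- (s / 2 * x)))"
 have main: "\<bar>mom_J nu j (s + h) - mom_J nu j s + h * mom_J nu (j + 1) s\<bar> <= h^2 * K" if h: "\<bar>h\<bar> < s / 2" for h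
 proof -
  have sh: "s + h > 0" "s / 2 > 0" using h assms by linarith+
  note i = set_borel_integrable_Bessel(1)[OF assms(1,2)]
  have eq: "mom_J nu j (s + h) - mom_J nu j s + h * mom_J nu (j + 1) s =
   (LBINT x:{0..}. x ^ j * Bessel_J nu x * exp (- ((s + h) * x)) - x ^ j * Bessel_J nu x * exp (- (s * x)) + h * (x ^ (j + 1) * Bessel_J nu x * exp (- (s * x))))"
   unfolding mom_J_def
   using set_integral_add(2)[OF set_integral_diff(1)[OF i[OF sh(1), of j] i[OF assms(3), of j]] set_integrable_mult_right[OF i[OF assms(3), of "j + 1"], of h]]
    set_integral_diff(2)[OF i[OF sh(1), of j] i[OF assms(3), of j]] by (simp del: power_Suc)
  have "norm (LBINT x:{0..}. x ^ j * Bessel_J nu x * exp (- ((s + h) * x)) - x ^ j * Bessel_J nu x * exp (- (s * x)) + h * (x ^ (j + 1) * Bessel_J nu x * exp (- (s * x))))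
   <= (LBINT x:{0..}. h^2 * (x ^ (j + 2) * \<bar>Bessel_J nu x\<bar> * exp (- (s / 2 * x))))"
   unfolding set_lebesgue_integral_def
  proof (rule norm_lebesgue_integral_le)
   show "integrable lborel (%x. indicat_real {0..} x *\<^sub>R (h^2 * (x ^ (j + 2) * \<bar>Bessel_J nu x\<bar> * exp (- (s / 2 * x)))))"
    unfolding set_integrable_def[symmetric] by (intro set_integrable_mult_right mom_J_abs_le(3) sh assms)
   fix x :: real
   show "norm (indicat_real {0..} x *\<^sub>R (x ^ j * Bessel_J nu x * exp (- ((s + h) * x)) - x ^ j * Bessel_J nu x * exp (- (s * x)) + h * (x ^ (j + 1) * Bessel_J nu x * exp (- (s * x)))))
    <= indicat_real {0..} x *\<^sub>R (h^2 * (x ^ (j + 2) * \<bar>Bessel_J nu x\<bar> * exp (- (s / 2 * x))))"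
   proof (cases "x >= 0")
    case True
    have e: "exp (- ((s + h) * x)) = exp (- (s * x)) * exp (- (h * x))" by (simp add: algebra_simps flip: exp_add)
    have "x ^ j * Bessel_J nu x * exp (- ((s + h) * x)) - x ^ j * Bessel_J nu x * exp (- (s * x)) + h * (x ^ (j + 1) * Bessel_J nu x * exp (- (s * x)))
     = (x ^ j * Bessel_J nu x * exp (- (s * x))) * (exp (- (h * x)) - 1 - (- (h * x)))"
     unfolding e by (simp add: algebra_simps)
    then have "norm (x ^ j * Bessel_J nu x * exp (- ((s + h) * x)) - x ^ j * Bessel_J nu x * exp (- (s * x)) + h * (x ^ (j + 1) * Bessel_J nu x * exp (- (s * x))))
     = (x ^ j * \<bar>Bessel_J nu x\<bar> * exp (- (s * x))) * \<bar>exp (- (h * x)) - 1 - (- (h * x))\<bar>"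
     using True by (simp only: real_norm_def abs_mult) simp
    also have "... <= (x ^ j * \<bar>Bessel_J nu x\<bar> * exp (- (s * x))) * ((- (h * x))^2 * exp \<bar>- (h * x)\<bar>)"
     using True by (intro mult_left_mono exp_Taylor_1_bound) auto
    also have "... <= (x ^ j * \<bar>Bessel_J nu x\<bar> * exp (- (s * x))) * ((- (h * x))^2 * exp (s / 2 * x))"
    proof -
     have "\<bar>- (h * x)\<bar> <= s / 2 * x" using True mult_right_mono[of "\<bar>h\<bar>" "s / 2" x] h by (simp add: abs_mult)
     then show ?thesis using True by (intro mult_left_mono) auto
    qed
    also have "... = h^2 * (x ^ (j + 2) * \<bar>Bessel_J nu x\<bar> * (exp (- (s * x)) * exp (s / 2 * x)))" by (simp add: power2_eq_square)
    also have "exp (- (s * x)) * exp (s / 2 * x) = exp (- (s / 2 * x))" by (simp flip: exp_add)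
    finally show ?thesis using True by simp
   qed simp
  qed
  then show ?thesis unfolding eq K_def by simp
 qed
 show ?thesis unfolding DERIV_def
 proof (rule LIM_zero_cancel, rule Lim_null_comparison)
  show "((%h. \<bar>h\<bar> * K) \<longlongrightarrow> 0) (at 0)" by (auto intro!: tendsto_eq_intros)
  have "\<forall>\<^sub>F h in at 0. \<bar>h\<bar> < s / 2 \<and> h \<noteq> 0"
   unfolding eventually_at using assms by (intro exI[of _ "s / 2"]) (auto simp: dist_real_def)
  then show "\<forall>\<^sub>F h in at 0. norm ((mom_J nu j (s + h) - mom_J nu j s) / h - - mom_J nu (j + 1) s) <= \<bar>h\<bar> * K"
  proof eventually_elim
   case (elim h)
   then have h: "\<bar>h\<bar> > 0" by simp
   have "norm ((mom_J nu j (s + h) - mom_J nu j s) / h - - mom_J nu (j + 1) s) = \<bar>mom_J nu j (s + h) - mom_J nu j s + h * mom_J nu (j + 1) s\<bar> / \<bar>h\<bar>"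
    using elim by (simp add: add_divide_distrib flip: abs_divide)
   also have "... <= (h^2 * K) / \<bar>h\<bar>" using main elim by (intro divide_right_mono) auto
   also have "... = \<bar>h\<bar> * K" using h by (simp add: power2_eq_square field_simps)
   finally show ?case .
  qed
 qed
qed

text \<open>One positive value excludes that the transform vanishes identically. J_nu(x) is at least
  a x - k x^3 for all x \<ge> 0, and for large s the linear term prevails after integration.\<close>

lemma mom_J_0_pos:
 assumes "nu > 0" "nu <= 1"
 obtains s where "s > 0" "mom_J nu 0 s > 0"
proof -
 define g where "g = bes_G nu 0"
 have "bes_G nu 0 = bes_coef nu 0" unfolding bes_G_def using powser_zero[of "bes_coef nu"] by simp
 then have g: "g > 0" using assms by (simp add: g_def bes_coef_def Gamma_real_pos)
 have "isCont (bes_G nu) 0" using bes_G_deriv[OF assms(1)] by (rule DERIV_isCont)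
 then have "\<forall>\<^sub>F w in nhds 0. bes_G nu w > g / 2"
  unfolding continuous_at_imp_continuous_on using g
  by (intro order_tendstoD(1)[of "bes_G nu" g]) (auto simp: g_def isCont_def tendsto_nhds_iff)
 then obtain e where e: "e > 0" "!!w. \<bar>w\<bar> < e ==> bes_G nu w > g / 2"
  unfolding eventually_nhds_metric by (auto simp: dist_real_def)
 define r where "r = min 1 e"
 have r: "r > 0" "r <= 1" "r <= e" using e(1) by (auto simp: r_def)
 define a where "a = g / 4"
 \<comment> \<open>Chosen so that a x - k x^3 falls below -g (1 + x) for x \<ge> r; this is a lower
   bound of J_nu on the whole half-line.\<close>
 define k where "k = (a + g) / r^2 + g / r ^ 3"
 have a: "a > 0" and k: "k > 0" using g r by (auto simp: a_def k_def intro!: add_pos_pos)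
 have J: "a * x - k * x ^ 3 <= Bessel_J nu x" if x: "x >= 0" for x
 proof (cases "x < r")
  case True
  have "x^2 <= x * 1" unfolding power2_eq_square using True r x by (intro mult_left_mono) auto
  then have "\<bar>x^2 / 4\<bar> < e" using True r x by simp
  then have G: "bes_G nu (x^2 / 4) > g / 2" by (rule e(2))
  have "a * x - k * x ^ 3 <= (x / 2) powr 1 * (g / 2)" using x k by (simp add: a_def)
  also have "... <= (x / 2) powr nu * (g / 2)" using x True r assms g by (intro mult_right_mono powr_mono') auto
  also have "... <= (x / 2) powr nu * bes_G nu (x^2 / 4)" using G by (intro mult_left_mono) auto
  also have "... = Bessel_J nu x" using Bessel_J_eq[OF assms(1) x] by simp
  finally show ?thesis .
 next
  case False
  then have q: "1 <= x / r" using r by simp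
  have "1 <= (x / r)^2" "1 <= (x / r) ^ 3" using q by (auto intro: one_le_power)
  then have "(a + g) * x * 1 <= (a + g) * x * (x / r)^2" "g * 1 <= g * (x / r) ^ 3"
   using a g x by (intro mult_left_mono; auto)+
  moreover have "(a + g) * x * (x / r)^2 + g * (x / r) ^ 3 = k * x ^ 3"
   by (simp add: k_def power_divide algebra_simps power2_eq_square power3_eq_cube)
  ultimately have "a * x - k * x ^ 3 <= - (g * (1 + x))" by (simp add: algebra_simps)
  moreover have "- (g * (1 + x)) <= Bessel_J nu x"
   using bes_poly_bounds(1)[OF assms x] g by (auto simp: g_def abs_le_iff)
  ultimately show ?thesis by linarith
 qed
 define s where "s = 1 + 6 * k / a"
 have s: "s > 1" using a k by (simp add: s_def)
 have i: "set_integrable lborel {0..} (%x. x ^ 0 * Bessel_J nu x * exp (- (s * x)))"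
  using s by (intro set_borel_integrable_Bessel assms) auto
 have h: "has_bochner_integral lborel (%x. a * (indicator {0..} x *\<^sub>R (x ^ 1 * exp (- (s * x)))) - k * (indicator {0..} x *\<^sub>R (x ^ 3 * exp (- (s * x)))))
   (a * (fact 1 / s ^ (1 + 1)) - k * (fact 3 / s ^ (3 + 1)))"
  using s by (intro has_bochner_integral_mult_right has_bochner_integral_diff power_exp_integral) auto
 have "(LBINT x. a * (indicator {0..} x *\<^sub>R (x ^ 1 * exp (- (s * x)))) - k * (indicator {0..} x *\<^sub>R (x ^ 3 * exp (- (s * x))))) <= mom_J nu 0 s"
  unfolding mom_J_def set_lebesgue_integral_def
 proof (rule integral_mono)
  fix x :: real
  show "a * (indicator {0..} x *\<^sub>R (x ^ 1 * exp (- (s * x)))) - k * (indicator {0..} x *\<^sub>R (x ^ 3 * exp (- (s * x)))) <= indicator {0..} x *\<^sub>R (x ^ 0 * Bessel_J nu x * exp (- (s * x)))"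
  proof (cases "x >= 0")
   case True
   have "(a * x - k * x ^ 3) * exp (- (s * x)) <= Bessel_J nu x * exp (- (s * x))" using J[OF True] by (rule mult_right_mono) simp
   then show ?thesis using True by (simp add: algebra_simps)
  qed simp
 qed (use h i in \<open>auto simp: has_bochner_integral_iff set_integrable_def\<close>)
 then have le: "a / s^2 - k * (6 / s ^ 4) <= mom_J nu 0 s" using h by (simp add: has_bochner_integral_iff fact_numeral power2_eq_square)
 have "6 * k < a * s" using a k by (simp add: s_def field_simps)
 also have "... <= a * s^2" using a s by (intro mult_left_mono) (auto simp: power2_eq_square)
 finally have "6 * k / s ^ 4 < a * s^2 / s ^ 4" using s by (intro divide_strict_right_mono) auto
 moreover have "a * s^2 / s ^ 4 = a / s^2" using s by (simp add: field_simps eval_nat_numeral)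
 ultimately have "mom_J nu 0 s > 0" using le by simp
 then show ?thesis using that[of s] s by simp
qed

text \<open>The recurrence at j = 0 is a second-order differential equation for the transform.
  \<open>V\<close> is a first-order combination which again satisfies a first-order equation; growth
  forces V = 0, and what remains integrates to B / (sqrt(s^2 + 1) e^(nu arsinh s)). The fact B
  \<noteq> 0 is what matters, orthogonality being homogeneous in the moments.\<close>

lemma mom_J_closed_form:
 assumes "nu > 0" "nu <= 1"
 obtains B where "B \<noteq> 0" "!!s. s > 0 ==> mom_J nu 0 s = B / (sqrt (s^2 + 1) * exp (nu * arsinh s))"
  "!!s. s > 0 ==> (s^2 + 1) * mom_J nu 1 s = (s + nu * sqrt (s^2 + 1)) * mom_J nu 0 s"
proof -
 define r where "r s = sqrt (s^2 + 1)" for s :: real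
 have r: "r s > 0" "r s * r s = s^2 + 1" for s by (auto simp: r_def add_nonneg_pos)
 have dr: "(r has_real_derivative s / r s) (at s)" for s
 proof -
  have 1: "((%s. s^2 + 1) has_real_derivative 2 * s) (at s)" by (auto intro!: derivative_eq_intros)
  have 2: "s^2 + 1 > 0" by (simp add: add_nonneg_pos)
  have "((%s. sqrt (s^2 + 1)) has_real_derivative (inverse (sqrt (s^2 + 1)) / 2) * (2 * s)) (at s)"
   by (rule DERIV_chain2[OF DERIV_real_sqrt[OF 2] 1])
  moreover have "inverse y / 2 * (2 * s) = s / y" for y by (simp add: inverse_eq_divide)
  moreover have "r = (%s. sqrt (s^2 + 1))" by (simp add: r_def fun_eq_iff)
  ultimately show ?thesis by simp
 qed
 have da: "((%s. exp (c * arsinh s)) has_real_derivative exp (c * arsinh s) * (c / r s)) (at s)" for c s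
  using DERIV_fun_exp[OF DERIV_cmult[OF arsinh_real_has_field_derivative], of c s] by (simp add: r_def)
 have d0: "(mom_J nu 0 has_real_derivative - mom_J nu 1 s) (at s)" and d1: "(mom_J nu 1 has_real_derivative - mom_J nu 2 s) (at s)" if "s > 0" for s
  using mom_J_deriv[OF assms that, of 0] mom_J_deriv[OF assms that, of 1] by (simp_all add: numeral_2_eq_2)
 have rec: "(s^2 + 1) * mom_J nu 2 s = 3 * s * mom_J nu 1 s - (1 - nu^2) * mom_J nu 0 s" if "s > 0" for s
  using mom_recurrence[OF assms that, of 0] by (simp add: add.commute numeral_2_eq_2)
 define V where "V s = s * mom_J nu 0 s - (s^2 + 1) * mom_J nu 1 s + nu * (r s * mom_J nu 0 s)" for s
 have dV: "(V has_real_derivative nu / r s * V s) (at s)" if s: "s > 0" for s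
 proof -
  have "(V has_real_derivative (1 * mom_J nu 0 s + - mom_J nu 1 s * s) - (2 * s * mom_J nu 1 s + - mom_J nu 2 s * (s^2 + 1)) + (nu * (s / r s * mom_J nu 0 s + - mom_J nu 1 s * r s))) (at s)"
   unfolding V_def[abs_def] by (intro DERIV_add DERIV_diff DERIV_mult DERIV_cmult DERIV_ident d0 d1 dr s)
     (auto intro!: derivative_eq_intros)
  moreover have "(1 * m0 + - m1 * s) - (2 * s * m1 + - m2 * (s^2 + 1)) + (nu * (s / R * m0 + - m1 * R)) = nu / R * (s * m0 - (s^2 + 1) * m1 + nu * (R * m0))"
   if "R > 0" "R * R = s^2 + 1" "(s^2 + 1) * m2 = 3 * s * m1 - (1 - nu^2) * m0" for m0 m1 m2 R
  proof -
   have "nu / R * (s * m0 - R * R * m1 + nu * (R * m0)) = nu * (s / R * m0 - m1 * R) + nu^2 * m0"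
    using that(1) by (simp add: field_simps power2_eq_square)
   then show ?thesis unfolding that(2) using that(3) by (simp add: algebra_simps)
  qed
  from this[OF r(1,2) rec[OF s]] have "(1 * mom_J nu 0 s + - mom_J nu 1 s * s) - (2 * s * mom_J nu 1 s + - mom_J nu 2 s * (s^2 + 1)) + (nu * (s / r s * mom_J nu 0 s + - mom_J nu 1 s * r s)) = nu / r s * V s"
   unfolding V_def .
  ultimately show ?thesis by (simp only:)
 qed
 have "((%s. V s * exp ((- nu) * arsinh s)) has_real_derivative 0) (at s within {0<..})" if s: "s \<in> {0<..}" for s
 proof -
  have "((%s. V s * exp ((- nu) * arsinh s)) has_real_derivative nu / r s * V s * exp ((- nu) * arsinh s) + exp ((- nu) * arsinh s) * (- nu / r s) * V s) (at s)"
   using s by (intro DERIV_mult dV da) auto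
  moreover have "nu / r s * V s * exp ((- nu) * arsinh s) + exp ((- nu) * arsinh s) * (- nu / r s) * V s = 0" by simp
  ultimately show ?thesis by (simp only: has_field_derivative_at_within)
 qed
 then obtain c where c: "!!s. s > 0 ==> V s * exp ((- nu) * arsinh s) = c"
  using has_field_derivative_zero_constant[of "{0<..}" "%s. V s * exp ((- nu) * arsinh s)"] by auto
 define g where "g = \<bar>bes_G nu 0\<bar>"
 have Vb: "\<bar>V s\<bar> <= 12 * g" if s: "s >= 1" for s
 proof -
  have "\<bar>mom_J nu 0 s\<bar> <= g * (1 / s + 1 / s^2)" "\<bar>mom_J nu 1 s\<bar> <= g * (1 / s^2 + 2 / s ^ 3)"
   using mom_J_abs_le(2)[OF assms, of s 0] mom_J_abs_le(2)[OF assms, of s 1] s by (auto simp: g_def eval_nat_numeral)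
  moreover have "g * (1 / s + 1 / s^2) <= g * (2 / s)" "g * (1 / s^2 + 2 / s ^ 3) <= g * (3 / s^2)"
   using s by (intro mult_left_mono; simp add: g_def field_simps eval_nat_numeral)+
  ultimately have m: "\<bar>mom_J nu 0 s\<bar> <= g * (2 / s)" "\<bar>mom_J nu 1 s\<bar> <= g * (3 / s^2)" by linarith+
  have "1 <= s * s" using s mult_mono[of 1 s 1 s] by simp
  then have r2: "r s <= 2 * s" unfolding r_def using s by (intro real_le_lsqrt) (auto simp: power2_eq_square)
  have "\<bar>s * mom_J nu 0 s\<bar> <= s * (g * (2 / s))" using s m unfolding abs_mult by (intro mult_mono) auto
  moreover have "\<bar>(s^2 + 1) * mom_J nu 1 s\<bar> <= (2 * s^2) * (g * (3 / s^2))" using s m unfolding abs_mult by (intro mult_mono) auto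
  moreover have "\<bar>nu * (r s * mom_J nu 0 s)\<bar> <= 1 * ((2 * s) * (g * (2 / s)))"
   using s m r2 r(1)[of s] assms unfolding abs_mult by (intro mult_mono) auto
  moreover have "s * (g * (2 / s)) = 2 * g" "(2 * s^2) * (g * (3 / s^2)) = 6 * g" "1 * ((2 * s) * (g * (2 / s))) = 4 * g" using s by auto
  ultimately show ?thesis unfolding V_def by linarith
 qed
 \<comment> \<open>\<open>V\<close> stays bounded for s \<ge> 1 while exp(- nu arsinh s) tends to 0,
   so the constant product is 0.\<close>
 have "c = 0"
 proof -
  have "((%s::real. c) \<longlongrightarrow> 0) at_top"
  proof (rule Lim_null_comparison)
   show "\<forall>\<^sub>F s in at_top. norm c <= 12 * g * s powr (- nu)"
    using eventually_ge_at_top[of 1]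
   proof eventually_elim
    case (elim s)
    have "ln s <= arsinh s" unfolding arsinh_real_def using elim by (subst ln_le_cancel_iff) (auto simp: add_pos_nonneg)
    then have "exp ((- nu) * arsinh s) <= s powr (- nu)" using elim assms by (auto simp: powr_def)
    then have "\<bar>V s\<bar> * exp ((- nu) * arsinh s) <= 12 * g * s powr (- nu)" using Vb[OF elim] by (intro mult_mono) (auto simp: g_def)
    then show ?case using c[of s] elim by (simp add: abs_mult flip: c[of s])
   qed
   have "((%s. s powr (- nu)) \<longlongrightarrow> 0) at_top" using assms by (intro tendsto_neg_powr filterlim_ident) auto
   from tendsto_mult_left[OF this, of "12 * g"] show "((%s. 12 * g * s powr (- nu)) \<longlongrightarrow> 0) at_top" by simp
  qed
  then show ?thesis by (simp add: tendsto_const_iff)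
 qed
 then have V0: "V s = 0" if "s > 0" for s using c[OF that] by simp
 have "((%s. (r s * mom_J nu 0 s) * exp (nu * arsinh s)) has_real_derivative 0) (at s within {0<..})" if s: "s \<in> {0<..}" for s
 proof -
  have "((%s. (r s * mom_J nu 0 s) * exp (nu * arsinh s)) has_real_derivative (s / r s * mom_J nu 0 s + - mom_J nu 1 s * r s) * exp (nu * arsinh s) + exp (nu * arsinh s) * (nu / r s) * (r s * mom_J nu 0 s)) (at s)"
   using s by (intro DERIV_mult d0 dr da) auto
  moreover have "(s / R * m0 + - m1 * R) * e + e * (nu / R) * (R * m0) = e / R * (s * m0 - (R * R) * m1 + nu * (R * m0))" if "R > 0" for m0 m1 e R
   using that by (simp add: field_simps)
  then have "(s / r s * mom_J nu 0 s + - mom_J nu 1 s * r s) * exp (nu * arsinh s) + exp (nu * arsinh s) * (nu / r s) * (r s * mom_J nu 0 s) = exp (nu * arsinh s) / r s * V s"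
   using r unfolding V_def by metis
  ultimately have "((%s. (r s * mom_J nu 0 s) * exp (nu * arsinh s)) has_real_derivative 0) (at s)"
   using V0[of s] s by simp
  then show ?thesis by (rule has_field_derivative_at_within)
 qed
 then obtain B where B: "!!s. s > 0 ==> (r s * mom_J nu 0 s) * exp (nu * arsinh s) = B"
  using has_field_derivative_zero_constant[of "{0<..}" "%s. (r s * mom_J nu 0 s) * exp (nu * arsinh s)"] by auto
 obtain s1 where "s1 > 0" "mom_J nu 0 s1 > 0" using mom_J_0_pos[OF assms] .
 then have "B \<noteq> 0" using B[of s1] r(1)[of s1] by auto
 moreover have "mom_J nu 0 s = B / (sqrt (s^2 + 1) * exp (nu * arsinh s))" if "s > 0" for s
  unfolding r_def[symmetric] using B[OF that, symmetric] r(1)[of s] by simp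
 moreover have "(s^2 + 1) * mom_J nu 1 s = (s + nu * sqrt (s^2 + 1)) * mom_J nu 0 s" if "s > 0" for s
  using V0[OF that] unfolding V_def r_def by (simp add: algebra_simps)
 ultimately show ?thesis by (rule that)
qed

lemma mom_J_limit:
 assumes "nu > 0" "nu <= 1"
 obtains B where "B \<noteq> 0" "!!j. (mom_J nu j \<longlongrightarrow> B * bes_mom nu j) (at_right 0)"
proof -
 obtain B where B: "B \<noteq> 0" "!!s. s > 0 ==> mom_J nu 0 s = B / (sqrt (s^2 + 1) * exp (nu * arsinh s))"
  "!!s. s > 0 ==> (s^2 + 1) * mom_J nu 1 s = (s + nu * sqrt (s^2 + 1)) * mom_J nu 0 s"
  using mom_J_closed_form[OF assms] by metis
 have pos: "\<forall>\<^sub>F s::real in at_right 0. s > 0" by (simp add: eventually_at_right_less)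
 have ne: "s^2 + 1 \<noteq> 0" "1 + s^2 \<noteq> 0" for s :: real using zero_le_power2[of s] by linarith+
 have cont: "((%s. f s) \<longlongrightarrow> f 0) (at_right 0)" if "isCont f 0" for f :: "real => real"
  using that by (simp add: isCont_def filterlim_at_split)
 have l0: "(mom_J nu 0 \<longlongrightarrow> B * bes_mom nu 0) (at_right 0)"
 proof (rule Lim_transform_eventually)
  have "isCont (%s. B / (sqrt (s^2 + 1) * exp (nu * arsinh s))) 0" by (intro continuous_intros isCont_arsinh) auto
  from cont[OF this] show "((%s. B / (sqrt (s^2 + 1) * exp (nu * arsinh s))) \<longlongrightarrow> B * bes_mom nu 0) (at_right 0)" by simp
  show "\<forall>\<^sub>F s in at_right 0. B / (sqrt (s^2 + 1) * exp (nu * arsinh s)) = mom_J nu 0 s"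
   using pos by eventually_elim (simp add: B(2))
 qed
 have l1: "(mom_J nu (Suc 0) \<longlongrightarrow> B * bes_mom nu (Suc 0)) (at_right 0)"
 proof (rule Lim_transform_eventually)
  have "isCont (%s. (s + nu * sqrt (s^2 + 1)) / (s^2 + 1)) 0" by (intro continuous_intros) auto
  from tendsto_mult[OF cont[OF this] l0] show "((%s. (s + nu * sqrt (s^2 + 1)) / (s^2 + 1) * mom_J nu 0 s) \<longlongrightarrow> B * bes_mom nu (Suc 0)) (at_right 0)" by (simp add: mult.commute)
  show "\<forall>\<^sub>F s in at_right 0. (s + nu * sqrt (s^2 + 1)) / (s^2 + 1) * mom_J nu 0 s = mom_J nu (Suc 0) s"
   using pos by eventually_elim (use B(3) ne in \<open>simp add: divide_eq_eq mult.commute\<close>)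
 qed
 have "(mom_J nu j \<longlongrightarrow> B * bes_mom nu j) (at_right 0) \<and> (mom_J nu (Suc j) \<longlongrightarrow> B * bes_mom nu (Suc j)) (at_right 0)" for j
 proof (induction j)
  case 0
  then show ?case using l0 l1 by simp
 next
  case (Suc j)
  have "(mom_J nu (Suc (Suc j)) \<longlongrightarrow> B * bes_mom nu (Suc (Suc j))) (at_right 0)"
  proof (rule Lim_transform_eventually)
   have "((%s. ((2 * real j + 3) * s * mom_J nu (Suc j) s - ((real j + 1)^2 - nu^2) * mom_J nu j s) / (1 + s^2)) \<longlongrightarrow>
     ((2 * real j + 3) * 0 * (B * bes_mom nu (Suc j)) - ((real j + 1)^2 - nu^2) * (B * bes_mom nu j)) / (1 + 0^2)) (at_right 0)"
    by (intro tendsto_intros Suc[THEN conjunct1] Suc[THEN conjunct2]) auto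
   then show "((%s. ((2 * real j + 3) * s * mom_J nu (Suc j) s - ((real j + 1)^2 - nu^2) * mom_J nu j s) / (1 + s^2)) \<longlongrightarrow> B * bes_mom nu (Suc (Suc j))) (at_right 0)"
    by (simp add: algebra_simps)
   show "\<forall>\<^sub>F s in at_right 0. ((2 * real j + 3) * s * mom_J nu (Suc j) s - ((real j + 1)^2 - nu^2) * mom_J nu j s) / (1 + s^2) = mom_J nu (Suc (Suc j)) s"
    using pos
   proof eventually_elim
    case (elim s)
    show ?case using mom_recurrence[OF assms elim, of j] ne(2)[of s] by (simp add: divide_eq_eq mult.commute)
   qed
  qed
  then show ?case using Suc by simp
 qed
 then show ?thesis using that[OF B(1)] by blast
qed

section \<open>Limits of linear systems\<close>

text \<open>Cramer's rule: solutions are quotients of determinants, which are continuous in the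
  entries, and injectivity makes the limiting determinant nonzero. The last conclusion is an
  equivalence so that existence and uniqueness of the monic polynomial follow together.\<close>

lemma lin_sys_limit:
 fixes A :: "real => nat => nat => real"
 assumes A: "!!i j. i < n ==> j < n ==> ((%s. A s i j) \<longlongrightarrow> A0 i j) F"
  and b: "!!i. i < n ==> ((%s. b s i) \<longlongrightarrow> b0 i) F"
  and inj: "!!v. (!!i. i < n ==> (\<Sum>j<n. A0 i j * v j) = 0) ==> (\<forall>j<n. v j = 0)"
 obtains c C where "!!i. i < n ==> (\<Sum>j<n. A0 i j * c j) = b0 i"
  and "!!j. j < n ==> ((%s. C s j) \<longlongrightarrow> c j) F"
  and "\<forall>\<^sub>F s in F. \<forall>v. (\<forall>i<n. (\<Sum>j<n. A s i j * v j) = b s i) \<longleftrightarrow> (\<forall>j<n. v j = C s j)"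
proof -
 define M where "M B = Matrix.mat n n (%(i, j). B i j)" for B :: "nat => nat => real"
 define R where "R B d k = M (%i j. if j = k then d i else B i j)" for B and d :: "nat => real" and k :: nat
 define D where "D B = Determinant.det (M B)" for B
 have M [simp]: "M B \<in> carrier_mat n n" for B by (simp add: M_def)
 have Dlim: "((%s. D (B s)) \<longlongrightarrow> D B0) F" if "!!i j. i < n ==> j < n ==> ((%s. B s i j) \<longlongrightarrow> B0 i j) F" for B B0
 proof -
  have e: "D B = (\<Sum>p | p permutes {0..<n}. signof p * (\<Prod>i = 0..<n. B i (p i)))" for B
   unfolding D_def Determinant.det_def'[OF M]
  proof (intro sum.cong refl arg_cong2[where f = "(*)"] prod.cong)
   fix p i assume "p \<in> {p. p permutes {0..<n}}" "i \<in> {0..<n}"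
   then have "p i < n" "i < n" using permutes_in_image[of p "{0..<n}" i] by auto
   then show "M B $$ (i, p i) = B i (p i)" by (simp add: M_def)
  qed
  show ?thesis unfolding e
  proof (intro tendsto_sum tendsto_mult tendsto_const tendsto_prod)
   fix p i assume "p \<in> {p. p permutes {0..<n}}" "i \<in> {0..<n}"
   then have "p i < n" "i < n" using permutes_in_image[of p "{0..<n}" i] by auto
   then show "((%s. B s i (p i)) \<longlongrightarrow> B0 i (p i)) F" using that by blast
  qed
 qed
 have mv: "vec_index (M B *\<^sub>v Matrix.vec n v) i = (\<Sum>j<n. B i j * v j)" if "i < n" for B v i
  using that by (simp add: M_def scalar_prod_def lessThan_atLeast0)
 define C where "C B d k = Determinant.det (R B d k) / D B" for B d k
 have sol: "(\<forall>i<n. (\<Sum>j<n. B i j * v j) = d i) \<longleftrightarrow> (\<forall>j<n. v j = C B d j)" if D: "D B \<noteq> 0" for B d v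
 proof -
  have uni: "w k = C B d k" if w: "\<forall>i<n. (\<Sum>j<n. B i j * w j) = d i" and k: "k < n" for w k
  proof -
   have "replace_col (M B) (M B *\<^sub>v Matrix.vec n w) k = R B d k"
    using w by (intro eq_matI) (auto simp: replace_col_def R_def M_def scalar_prod_def lessThan_atLeast0)
   then have "Determinant.det (R B d k) = w k * D B"
    using cramer_lemma_mat[OF M, of "Matrix.vec n w" k B] k by (simp add: D_def)
   then show ?thesis using D by (simp add: C_def)
  qed
  obtain N where N: "N \<in> carrier_mat n n" "M B * N = 1\<^sub>m n"
   using Determinant.det_non_zero_imp_unit[OF M, of B "()"] D unfolding D_def Units_def by (auto simp: ring_mat_def)
  define w where "w i = vec_index (N *\<^sub>v Matrix.vec n d) i" for i
  have "Matrix.vec n w = N *\<^sub>v Matrix.vec n d" using N by (intro eq_vecI) (auto simp: w_def)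
  then have "M B *\<^sub>v Matrix.vec n w = Matrix.vec n d" using N assoc_mult_mat_vec[OF M N(1), of "Matrix.vec n d" B] by simp
  then have w: "\<forall>i<n. (\<Sum>j<n. B i j * w j) = d i" using mv[of _ B w] by (metis index_vec)
  have wC: "\<forall>j<n. w j = C B d j" using uni[OF w] by blast
  show ?thesis
  proof
   assume "\<forall>i<n. (\<Sum>j<n. B i j * v j) = d i" then show "\<forall>j<n. v j = C B d j" using uni by blast
  next
   assume "\<forall>j<n. v j = C B d j"
   then have "\<forall>j<n. v j = w j" using wC by simp
   then have "(\<Sum>j<n. B i j * v j) = (\<Sum>j<n. B i j * w j)" for i by (intro sum.cong) auto
   then show "\<forall>i<n. (\<Sum>j<n. B i j * v j) = d i" using w by simp
  qed
 qed
 have D0: "D A0 \<noteq> 0"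
 proof
  assume "D A0 = 0"
  then obtain v where v: "v \<in> carrier_vec n" "v \<noteq> 0\<^sub>v n" "M A0 *\<^sub>v v = 0\<^sub>v n"
   unfolding D_def using Determinant.det_0_iff_vec_prod_zero_field[OF M] by blast
  have ve: "Matrix.vec n (vec_index v) = v" using v(1) by (intro eq_vecI) auto
  have "(\<Sum>j<n. A0 i j * vec_index v j) = 0" if "i < n" for i
   using mv[OF that, of A0 "vec_index v"] unfolding ve v(3) using that by simp
  then have "\<forall>j<n. vec_index v j = 0" by (rule inj)
  then have "v = 0\<^sub>v n" using v(1) by (intro eq_vecI) auto
  then show False using v(2) by simp
 qed
 have DA: "((%s. D (A s)) \<longlongrightarrow> D A0) F" by (rule Dlim[OF A])
 show ?thesis
 proof (rule that[of "C A0 b0" "%s. C (A s) (b s)"])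
  show "(\<Sum>j<n. A0 i j * C A0 b0 j) = b0 i" if "i < n" for i using sol[OF D0, of "C A0 b0" b0] that by blast
  show "((%s. C (A s) (b s) j) \<longlongrightarrow> C A0 b0 j) F" if "j < n" for j
   unfolding C_def R_def D_def[symmetric] using A b by (intro tendsto_divide DA D0 Dlim) auto
  have "\<forall>\<^sub>F s in F. D (A s) \<noteq> 0" by (rule tendsto_imp_eventually_ne[OF DA D0])
  then show "\<forall>\<^sub>F s in F. \<forall>v. (\<forall>i<n. (\<Sum>j<n. A s i j * v j) = b s i) \<longleftrightarrow> (\<forall>j<n. v j = C (A s) (b s) j)"
   by eventually_elim (use sol in blast)
 qed
qed

section \<open>Comparison of the two functionals\<close>

definition bes_W :: "real => real => complex" where
 "bes_W nu x = cis (- (nu * pi / 2) * sgn x) * of_real (bessel_K nu (pi * \<bar>x\<bar>))"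

definition bes_Lam :: "real => complex poly => complex" where
 "bes_Lam nu q = (LBINT x. poly q (of_real x + of_real (nu / 2) * \<i>) * bes_W nu x)"

lemma borel_bes_W [measurable]: "bes_W nu \<in> borel_measurable borel"
proof -
 have "(%x::real. cis (- (nu * pi / 2) * sgn x)) \<in> borel_measurable borel"
 proof (rule measurable_compose[where g = cis])
  show "cis \<in> borel_measurable borel" by (intro borel_measurable_continuous_onI continuous_intros)
 qed measurable
 then show ?thesis unfolding bes_W_def by measurable
qed

lemma cmod_bes_W: "cmod (bes_W nu x) = bessel_K nu (pi * \<bar>x\<bar>)"
 by (simp add: bes_W_def norm_mult bessel_K_nonneg)

lemma integrable_pow_bes_W:
 assumes "0 < nu" "nu <= 1/2"
 shows "integrable lborel (%x. of_real x ^ j * bes_W nu x)"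
proof -
 define h where "h y = indicator {0..} y *\<^sub>R (y ^ j * bessel_K nu y)" for y :: real
 have h: "integrable lborel h"
  using bessel_K_moment_Gamma[OF assms, of j] unfolding h_def[abs_def] by (simp add: has_bochner_integral_iff)
 have h0: "h y >= 0" for y unfolding h_def by (auto simp: indicator_def bessel_K_nonneg)
 have i: "integrable lborel (%x. h (pi * x) + h (- pi * x))"
  using lborel_integrable_real_affine[OF h, of pi 0] lborel_integrable_real_affine[OF h, of "- pi" 0] by auto
 show ?thesis
 proof (rule Bochner_Integration.integrable_bound[OF i], measurable, rule AE_I2)
  fix x :: real
  have "cmod (of_real x ^ j * bes_W nu x) = \<bar>x\<bar> ^ j * bessel_K nu (pi * \<bar>x\<bar>)"
   by (simp add: norm_mult norm_power cmod_bes_W)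
  also have "... <= (pi * \<bar>x\<bar>) ^ j * bessel_K nu (pi * \<bar>x\<bar>)"
   using pi_gt3 mult_right_mono[of 1 pi "\<bar>x\<bar>"] by (intro mult_right_mono power_mono bessel_K_nonneg) auto
  also have "... = h (pi * \<bar>x\<bar>)" by (simp add: h_def)
  also have "... <= h (pi * x) + h (- pi * x)" using h0[of "pi * x"] h0[of "- (pi * x)"] by (cases "x >= 0") auto
  finally show "cmod (of_real x ^ j * bes_W nu x) <= norm (h (pi * x) + h (- pi * x))" using h0 by auto
 qed
qed

lemma integrable_poly_bes_W:
 assumes "0 < nu" "nu <= 1/2"
 shows "integrable lborel (%x. poly q (of_real x + c) * bes_W nu x)"
proof -
 have "integrable lborel (%x. poly r (of_real x) * bes_W nu x)" for r
  unfolding poly_altdef sum_distrib_right mult.assoc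
  by (intro Bochner_Integration.integrable_sum integrable_mult_right integrable_pow_bes_W assms)
 from this[of "pcompose q [:c, 1:]"] show ?thesis by (simp add: poly_pcompose add.commute)
qed

text \<open>The half-lines x > 0 and x < 0 contribute M_j / pi with the phase i^j e^(-i nu pi/2) and
  with its conjugate, which together give twice a cosine.\<close>

lemma bes_W_moment:
 assumes "0 < nu" "nu <= 1/2"
 shows "(LBINT x. (of_real pi * \<i> * of_real x) ^ j * bes_W nu x) = of_real (bes_mom nu j)"
proof -
 obtain M where M: "!!j. has_bochner_integral lborel (%y. indicator {0..} y *\<^sub>R (y ^ j * bessel_K nu y)) (M j)"
  "!!j. 2 / pi * cos (real j * pi / 2 - nu * pi / 2) * M j = bes_mom nu j"
  by (rule bessel_K_moment[OF assms]) blast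
 define \<theta> where "\<theta> = nu * pi / 2"
 let ?h = "%y. indicator {0..} y *\<^sub>R (y ^ j * bessel_K nu y)"
 let ?f = "%x. (of_real pi * \<i> * of_real x) ^ j * bes_W nu x"
 have "integrable lborel (%x. (of_real pi * \<i>) ^ j * (of_real x ^ j * bes_W nu x))"
  by (intro integrable_mult_right integrable_pow_bes_W assms)
 then have fi: "integrable lborel ?f" by (simp add: power_mult_distrib mult.assoc)
 have "(LBINT x. ?h x) = \<bar>pi\<bar> *\<^sub>R (LBINT x. ?h (0 + pi * x))" by (rule lborel_integral_real_affine) simp
 define hh where "hh x = ?h (pi * x)" for x
 with \<open>(LBINT x. ?h x) = \<bar>pi\<bar> *\<^sub>R (LBINT x. ?h (0 + pi * x))\<close> have hv: "(LBINT x. hh x) = M j / pi" unfolding hh_def using M(1)[of j] by (simp add: has_bochner_integral_iff eq_divide_eq mult.commute)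
 have half: "(LBINT x:{0..}. g x) = (\<sigma> ^ j * cis t) * of_real (M j / pi)"
  if gm: "g \<in> borel_measurable borel" and g: "!!x. x > 0 ==> g x = (\<sigma> * of_real (pi * x)) ^ j * (cis t * of_real (bessel_K nu (pi * x)))" for g \<sigma> t
 proof -
  have "(LBINT x:{0..}. g x) = (LBINT x. (\<sigma> ^ j * cis t) * of_real (hh x))"
   unfolding set_lebesgue_integral_def
  proof (rule integral_cong_AE)
   show "AE x in lborel. indicator {0..} x *\<^sub>R g x = (\<sigma> ^ j * cis t) * of_real (hh x)"
    using AE_lborel_singleton[of "0::real"]
   proof eventually_elim
    case (elim x)
    show ?case
    proof (cases "x > 0")
     case True
     then show ?thesis by (simp add: hh_def g power_mult_distrib)
    next
     case False
     then have "pi * x < 0" using elim by (simp add: mult_pos_neg)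
     then show ?thesis using False elim by (simp add: hh_def indicator_def)
    qed
   qed
  qed (use gm in \<open>(simp_all add: hh_def)?\<close>)
  then show ?thesis by (simp add: hv)
 qed
 have "(LBINT x. ?f x) = (LBINT x:{0..}. ?f x) + (LBINT x:{-0..}. ?f (- x))" by (rule integral_split_half[OF fi])
 also have "(LBINT x:{0..}. ?f x) = (\<i> ^ j * cis (- \<theta>)) * of_real (M j / pi)"
  by (rule half) (measurable, simp add: bes_W_def \<theta>_def mult_ac)
 also have "(LBINT x:{-0..}. ?f (- x)) = ((- \<i>) ^ j * cis \<theta>) * of_real (M j / pi)"
  unfolding minus_zero by (rule half) (measurable, simp add: bes_W_def \<theta>_def mult_ac)
 also have "\<i> ^ j = cis (real j * pi / 2)" using Complex.DeMoivre[of "pi / 2" j] by (simp only: cis_pi_half times_divide_eq_right)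
 also have "(- \<i>) ^ j = cis (- (real j * pi / 2))"
 proof -
  have "cis (- (pi / 2)) = - \<i>" by (simp add: complex_eq_iff)
  then show ?thesis using Complex.DeMoivre[of "- (pi / 2)" j] by (simp only: mult_minus_right times_divide_eq_right)
 qed
 also have "(cis (real j * pi / 2) * cis (- \<theta>)) * of_real (M j / pi) + (cis (- (real j * pi / 2)) * cis \<theta>) * of_real (M j / pi)
   = of_real (2 / pi * cos (real j * pi / 2 - \<theta>) * M j)"
 proof -
  have "of_real (2 / pi * cos a * m) = (cis a + cis (- a)) * of_real (m / pi)" for a m
   by (simp add: complex_eq_iff)
  from this[of "real j * pi / 2 - \<theta>" "M j"] show ?thesis
   unfolding cis_mult by (simp only: distrib_right minus_diff_eq add.commute[of _ \<theta>] diff_conv_add_uminus minus_add_distrib minus_minus)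
 qed
 finally show ?thesis unfolding \<theta>_def M(2) .
qed

section \<open>Size of the Meixner--Pollaczek weight compared with the Bessel weight\<close>

lemma mpw_minus [simp]: "mpw l (- x) = mpw l x"
proof -
 have "Gamma (Complex l (- x)) = cnj (Gamma (Complex l x))"
  by (simp add: cnj_Gamma complex_eq_iff) (simp add: complex_cnj)
 then show ?thesis by (simp add: mpw_def)
qed

lemma mpw_abs [simp]: "mpw l \<bar>x\<bar> = mpw l x"
 by (cases "x >= 0") auto

lemma mpw_lower_compact:
 assumes "l > 0"
 obtains m where "m > 0" "!!x. \<bar>x\<bar> <= R ==> m <= mpw l x"
proof (cases "R >= 0")
 case True
 have "continuous_on {-R..R} (mpw l)" using continuous_on_mpw[OF assms] continuous_on_subset by blast
 from continuous_attains_inf[OF _ _ this] True obtain x0 where "\<forall>x\<in>{-R..R}. mpw l x0 <= mpw l x" by auto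
 then show ?thesis using that[of "mpw l x0"] mpw_pos[OF assms, of x0] by (auto simp: abs_le_iff)
next
 case False
 then show ?thesis using that[of 1] by auto
qed

lemma mpw_asymp:
 obtains c C where "c > 0" "C > 0"
  "!!x. \<bar>x\<bar> >= 1 ==> c * mpw (1/4) x <= exp (- pi * \<bar>x\<bar>) / sqrt \<bar>x\<bar>"
  "!!x. \<bar>x\<bar> >= 1 ==> exp (- pi * \<bar>x\<bar>) / sqrt \<bar>x\<bar> <= C * mpw (1/4) x"
proof -
 obtain m where m: "m > 0" "!!x. \<bar>x\<bar> <= 100 ==> m <= mpw (1/4) x" using mpw_lower_compact[of "1/4" 100] by auto
 have a: "\<bar>mpw (1/4) x - 2 * pi * (exp (- pi * x) / sqrt x)\<bar> <= 400 * (exp (- pi * x) / sqrt x) / x" if "x >= 1" for x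
 proof -
  have "cmod (of_real (mpw (1/4) x - 2 * pi * exp (- pi * x) / sqrt x)) <= 400 * exp (- pi * x) / (x * sqrt x)"
   using Gamma_prod_asymp[of "1/4" x] that by (simp add: mpw_complex)
  then show ?thesis unfolding norm_of_real by (simp add: mult.commute)
 qed
 have E: "exp (- pi * x) / sqrt x <= 1" "exp (- pi * x) / sqrt x > 0" if "x >= 1" for x
 proof -
  have "sqrt x >= 1" "exp (- pi * x) <= 1" using that by auto
  then show "exp (- pi * x) / sqrt x <= 1" using frac_le[of 1 "exp (- pi * x)" 1 "sqrt x"] by simp
  show "exp (- pi * x) / sqrt x > 0" using that by simp
 qed
 have up: "mpw (1/4) x <= 500 * (exp (- pi * x) / sqrt x)" if x: "x >= 1" for x
 proof -
  have "400 * (exp (- pi * x) / sqrt x) / x <= 400 * (exp (- pi * x) / sqrt x) / 1"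
   using x E(2)[OF x] by (intro divide_left_mono) auto
  then have "mpw (1/4) x <= (2 * pi + 400) * (exp (- pi * x) / sqrt x)" using a[OF x] by (simp add: algebra_simps abs_le_iff)
  also have "... <= 500 * (exp (- pi * x) / sqrt x)" using E(2)[OF x] pi_less_4 by (intro mult_right_mono) auto
  finally show ?thesis .
 qed
 have lo: "exp (- pi * x) / sqrt x <= (1 + 1 / m) * mpw (1/4) x" if x: "x >= 1" for x
 \<comment> \<open>Beyond 100 the error term has the factor 400 / x < 4 < 2 pi, so the main term
   prevails; on the compact rest the weight is bounded below by positivity.\<close>
 proof (cases "x <= 100")
  case True
  have "exp (- pi * x) / sqrt x <= 1" by (rule E[OF x])
  also have "1 <= mpw (1/4) x / m" using m(2)[of x] True x m(1) by simp
  also have "... <= (1 + 1 / m) * mpw (1/4) x" by (simp add: distrib_right)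
  finally show ?thesis .
 next
  case False
  have "400 * (exp (- pi * x) / sqrt x) / x <= 400 * (exp (- pi * x) / sqrt x) / 100"
   using False E(2)[OF x] by (intro divide_left_mono) auto
  then have "(2 * pi - 4) * (exp (- pi * x) / sqrt x) <= mpw (1/4) x" using a[OF x] by (simp add: algebra_simps abs_le_iff)
  moreover have "1 * (exp (- pi * x) / sqrt x) <= (2 * pi - 4) * (exp (- pi * x) / sqrt x)" using E(2)[OF x] pi_gt3 by (intro mult_right_mono) auto
  moreover have "mpw (1/4) x <= (1 + 1 / m) * mpw (1/4) x" using m(1) by (simp add: distrib_right)
  ultimately show ?thesis by linarith
 qed
 show ?thesis
 proof (rule that[of "1/500" "1 + 1 / m"])
  fix x :: real assume x: "\<bar>x\<bar> >= 1"
  show "1/500 * mpw (1/4) x <= exp (- pi * \<bar>x\<bar>) / sqrt \<bar>x\<bar>" using up[OF x] by (simp add: mult.commute)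
  show "exp (- pi * \<bar>x\<bar>) / sqrt \<bar>x\<bar> <= (1 + 1 / m) * mpw (1/4) x" using lo[OF x] by simp
 qed (use m(1) in \<open>auto simp: add_pos_pos\<close>)
qed

text \<open>For |x| \<ge> 1 both sides are of order e^(-pi |x|) / sqrt |x|; for smaller x the left
  side is bounded while K_nu increases towards 0. At x = 0 the integral in \<open>bessel_K\<close>
  diverges and has the default value 0, hence the exception.\<close>

lemma mpw_le_bessel_K:
 assumes "0 < nu" "nu <= 1/2"
 obtains c where "c > 0" "!!x. x \<noteq> 0 ==> c * mpw (1/4) x <= bessel_K nu (pi * \<bar>x\<bar>)"
proof -
 obtain c1 where c1: "c1 > 0" "!!x. \<bar>x\<bar> >= 1 ==> c1 * mpw (1/4) x <= exp (- pi * \<bar>x\<bar>) / sqrt \<bar>x\<bar>" using mpw_asymp by metis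
 obtain B where B: "B > 0" "!!x. mpw (1/4) x <= B * exp (- (2 * \<bar>x\<bar>))" using mpw_bound[of "1/4"] by auto
 have k: "exp (- pi * x) / sqrt x / 4 <= bessel_K nu (pi * x)" if x: "x >= 1" for x
 proof -
  have px: "pi * x > 0" "pi * x >= 1" using x pi_gt3 mult_mono[of 1 pi 1 x] by auto
  have "1 / (8 * (pi * x)) <= 1/4" using px by (simp add: field_simps)
  then have 1: "1 - 1 / (8 * (pi * x)) >= 1/2" by linarith
  have "pi / (2 * (pi * x)) = (1/2) / x" by simp
  then have 2: "sqrt (pi / (2 * (pi * x))) = sqrt (1/2) / sqrt x" by (simp only: real_sqrt_divide)
  have "1/2 <= sqrt (1/2)" by (rule real_le_rsqrt) (simp add: power2_eq_square)
  then have 3: "(1/2) / sqrt x <= sqrt (pi / (2 * (pi * x)))" unfolding 2 using x by (intro divide_right_mono) auto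
  have "(1/2) / sqrt x * exp (- (pi * x)) * (1/2) <= sqrt (pi / (2 * (pi * x))) * exp (- (pi * x)) * (1 - 1 / (8 * (pi * x)))"
   using 1 3 x by (intro mult_mono) auto
  also have "... <= bessel_K nu (pi * x)" by (rule bessel_K_bounds(2)[OF assms px(1)])
  finally show ?thesis by simp
 qed
 define K1 where "K1 = bessel_K nu (pi * 1)"
 have K1: "K1 > 0" unfolding K1_def by (rule less_le_trans[OF _ k]) auto
 define c where "c = min (c1 / 4) (K1 / B)"
 have c: "c > 0" "c <= c1 / 4" "c <= K1 / B"
  unfolding c_def using c1(1) K1 B(1) by (simp_all only: min.cobounded1 min.cobounded2 min_less_iff_conj divide_pos_pos zero_less_numeral)
 show ?thesis
 proof (rule that[OF c(1)])
  fix x :: real assume x: "x \<noteq> 0"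
  show "c * mpw (1/4) x <= bessel_K nu (pi * \<bar>x\<bar>)"
  proof (cases "\<bar>x\<bar> >= 1")
   case True
   have "c * mpw (1/4) x <= c1 / 4 * mpw (1/4) x" using c(2) by (intro mult_right_mono) auto
   also have "... <= exp (- pi * \<bar>x\<bar>) / sqrt \<bar>x\<bar> / 4" using c1(2)[OF True] by simp
   also have "... <= bessel_K nu (pi * \<bar>x\<bar>)" by (rule k[OF True])
   finally show ?thesis .
  next
   case False
   have "mpw (1/4) x <= B * exp (- (2 * \<bar>x\<bar>))" by (rule B(2))
   also have "... <= B * 1" using B(1) by (intro mult_left_mono) auto
   finally have "c * mpw (1/4) x <= K1 / B * B" using c by (intro mult_mono) auto
   also have "... = K1" using B(1) by simp
   also have "... <= bessel_K nu (pi * \<bar>x\<bar>)" unfolding K1_def using False x by (intro bessel_K_antimono assms) auto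
   finally show ?thesis .
  qed
 qed
qed

text \<open>The left side is of order |x|^(-3/2) e^(-pi |x|), and e^(-pi |x|) / |x| is a lower
  bound, up to a constant, of every \<open>mpw \<mu>\<close> with these parameters. An error of
  relative size 1/x can thus be measured in a norm for which Parseval holds.\<close>

lemma mpw_decay_compare:
 assumes "0 < \<mu>" "\<mu> <= 1"
 obtains C where "C > 0" "!!x. mpw (1/4) x / (1 + \<bar>x\<bar>) <= C * mpw \<mu> x"
proof -
 obtain c1 where c1: "c1 > 0" "!!x. \<bar>x\<bar> >= 1 ==> c1 * mpw (1/4) x <= exp (- pi * \<bar>x\<bar>) / sqrt \<bar>x\<bar>" using mpw_asymp by metis
 obtain c2 where c2: "c2 > 0" "!!x. \<bar>x\<bar> >= 1 ==> c2 * exp (- pi * \<bar>x\<bar>) / \<bar>x\<bar> <= mpw \<mu> x"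
  using cmod_Gamma_sq_lower[OF assms] unfolding mpw_def by metis
 obtain m where m: "m > 0" "!!x. \<bar>x\<bar> <= 1 ==> m <= mpw \<mu> x" using mpw_lower_compact[OF assms(1), of 1] by auto
 obtain B where B: "B > 0" "!!x. mpw (1/4) x <= B * exp (- (2 * \<bar>x\<bar>))" using mpw_bound[of "1/4"] by auto
 show ?thesis
 proof (rule that[of "1 / (c1 * c2) + B / m"])
  show "1 / (c1 * c2) + B / m > 0" using c1 c2 m B by (simp add: add_pos_pos)
  fix x
  show "mpw (1/4) x / (1 + \<bar>x\<bar>) <= (1 / (c1 * c2) + B / m) * mpw \<mu> x"
  proof (cases "\<bar>x\<bar> >= 1")
   case True
   have s1: "sqrt \<bar>x\<bar> >= 1" using True by simp
   have "mpw (1/4) x <= exp (- pi * \<bar>x\<bar>) / sqrt \<bar>x\<bar> / c1" using c1(2)[OF True] by (simp only: pos_le_divide_eq[OF c1(1)] mult.commute)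
   also have "... <= exp (- pi * \<bar>x\<bar>) / 1 / c1" using s1 c1(1) by (intro divide_right_mono divide_left_mono) auto
   finally have "mpw (1/4) x / (1 + \<bar>x\<bar>) <= exp (- pi * \<bar>x\<bar>) / c1 / (1 + \<bar>x\<bar>)" by (intro divide_right_mono) auto
   also have "... <= exp (- pi * \<bar>x\<bar>) / c1 / \<bar>x\<bar>" using True c1(1) by (intro divide_left_mono) auto
   also have "... = 1 / (c1 * c2) * (c2 * exp (- pi * \<bar>x\<bar>) / \<bar>x\<bar>)" using c2(1) by simp
   also have "... <= 1 / (c1 * c2) * mpw \<mu> x" using c2(2)[OF True] c1 c2 by (intro mult_left_mono) auto
   also have "... <= (1 / (c1 * c2) + B / m) * mpw \<mu> x" using B m by (intro mult_right_mono) auto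
   finally show ?thesis .
  next
   case False
   have "mpw (1/4) x / (1 + \<bar>x\<bar>) <= mpw (1/4) x / 1" by (intro divide_left_mono) auto
   also have "... <= B * exp (- (2 * \<bar>x\<bar>))" using B(2) by simp
   also have "... <= B * 1" using B(1) by (intro mult_left_mono) auto
   also have "... = B / m * m" using m(1) by simp
   also have "... <= B / m * mpw \<mu> x" using False m(2)[of x] m(1) B(1) by (intro mult_left_mono) auto
   also have "... <= (1 / (c1 * c2) + B / m) * mpw \<mu> x" using c1 c2 by (intro mult_right_mono) auto
   finally show ?thesis .
  qed
 qed
qed

lemma integral_split_three:
 fixes f :: "real => complex"
 assumes f: "integrable lborel f"
 shows "(LBINT x. f x) = (LBINT x:{1..}. f x) + (LBINT x:{1..}. f (- x)) + (LBINT x:{-1..<1}. f (- x))"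
proof -
 have g: "integrable lborel (%x. f (- x))" using lborel_integrable_real_affine[OF f, of "-1" 0] by simp
 have si: "set_integrable lborel A (%x. f (- x))" if "A \<in> sets lborel" for A
  using g that by (simp add: integrable_mult_indicator set_integrable_def)
 have U: "{-1..} = {-1..<1} \<union> {1::real..}" by auto
 have "(LBINT x:{-1..}. f (- x)) = (LBINT x:{-1..<1}. f (- x)) + (LBINT x:{1..}. f (- x))"
  unfolding U by (rule set_integral_Un) (auto intro: si)
 then show ?thesis using integral_split_half[OF f, of 1] by simp
qed

text \<open>The Meixner-Pollaczek weight times the relative error 1/x of the approximation,
  regularized at 0.\<close>

definition bes_wt :: "real => real" where
 "bes_wt x = mpw (1/4) x / (1 + \<bar>x\<bar>)"

lemma bes_wt_nonneg [simp]: "bes_wt x >= 0" and bes_wt_minus [simp]: "bes_wt (- x) = bes_wt x"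
 by (simp_all add: bes_wt_def)

lemma borel_bes_wt [measurable]: "bes_wt \<in> borel_measurable borel"
 unfolding bes_wt_def[abs_def] using borel_mpw[of "1/4"] by measurable

lemma integrable_cmod_poly_mpw:
 assumes "0 < l" "l <= 3"
 shows "integrable lborel (%x. cmod (poly q (of_real x + c)) * mpw l x)"
 using integrable_norm[OF mp_integrable[OF assms, of "pcompose q [:c, 1:]"]]
 by (simp add: poly_pcompose norm_mult add.commute)

lemma integrable_cmod_poly_wt: "integrable lborel (%x. cmod (poly q (of_real x + c)) * bes_wt x)"
proof (rule Bochner_Integration.integrable_bound[OF integrable_cmod_poly_mpw[of "1/4" q c]])
 have "(%x::real. poly q (of_real x + c)) \<in> borel_measurable borel" by (intro borel_measurable_continuous_onI continuous_intros)
 then show "(%x. cmod (poly q (of_real x + c)) * bes_wt x) \<in> borel_measurable lborel" by measurable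
 have "bes_wt x <= mpw (1/4) x" for x unfolding bes_wt_def by (simp add: divide_le_eq distrib_left)
 then show "AE x in lborel. norm (cmod (poly q (of_real x + c)) * bes_wt x) <= norm (cmod (poly q (of_real x + c)) * mpw (1/4) x)"
  by (intro AE_I2) (simp add: mult_left_mono)
qed auto

text \<open>Away from the pole the range may start at \<sigma> = 0, which occurs as 1/4 - nu/2 for
  nu = 1/2. One functional equation, with a factor of modulus at least 1, leads back to \<sigma>
  \<ge> 1.\<close>

lemma cmod_Gamma_decay_far:
 obtains B where "B > 0" "!!\<sigma> x. 0 <= \<sigma> ==> \<sigma> <= 2 ==> \<bar>x\<bar> >= 1 ==> cmod (Gamma (Complex \<sigma> x)) <= B * exp (- \<bar>x\<bar>)"
proof -
 obtain B where B: "B > 0" "!!\<sigma> x. 1 <= \<sigma> ==> \<sigma> <= 3 ==> cmod (Gamma (Complex \<sigma> x)) <= B * exp (- \<bar>x\<bar>)"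
  using cmod_Gamma_decay[of 1] by auto
 show ?thesis
 proof (rule that[OF B(1)])
  fix \<sigma> x :: real assume a: "0 <= \<sigma>" "\<sigma> <= 2" "\<bar>x\<bar> >= 1"
  have n: "Complex \<sigma> x \<notin> \<int>\<^sub>\<le>\<^sub>0" using a(3) by (auto elim!: nonpos_Ints_cases simp: complex_eq_iff)
  have "Complex \<sigma> x + 1 = Complex (\<sigma> + 1) x" by (simp add: complex_eq_iff)
  then have "Gamma (Complex (\<sigma> + 1) x) = Complex \<sigma> x * Gamma (Complex \<sigma> x)" using Gamma_plus1[OF n] by simp
  moreover have "1 <= cmod (Complex \<sigma> x)" using a(3) abs_Im_le_cmod[of "Complex \<sigma> x"] by simp
  ultimately have "cmod (Gamma (Complex \<sigma> x)) <= cmod (Gamma (Complex (\<sigma> + 1) x))"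
   using mult_right_mono[of 1 "cmod (Complex \<sigma> x)" "cmod (Gamma (Complex \<sigma> x))"] by (simp add: norm_mult)
  also have "... <= B * exp (- \<bar>x\<bar>)" using a by (intro B(2)) auto
  finally show "cmod (Gamma (Complex \<sigma> x)) <= B * exp (- \<bar>x\<bar>)" .
 qed
qed

lemma two_sqrt2_pi: "1 <= 2 * sqrt 2 * pi"
proof -
 have "1 <= sqrt 2" by simp
 then show ?thesis using pi_gt3 mult_mono[of 1 "2 * sqrt 2" 1 pi] by linarith
qed

text \<open>On Im X = nu/2 the continued weight is Gamma(1/4 - nu/2 + ix) Gamma(1/4 + nu/2 - ix),
  with leading term 2 pi e^(-pi x) x^(-1/2) e^(-i pi nu/2) for x > 0. K_nu(pi x) starts with e^(-pi
  x) / sqrt(2 x); this explains the constant 1 / (2 sqrt 2 pi). The case of negative x follows by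
  conjugation.\<close>

lemma bes_W_Gamma_approx:
 assumes "0 < nu" "nu <= 1/2"
 obtains D where "D > 0"
  "!!x. x >= 1 ==> cmod (bes_W nu x - of_real (1 / (2 * sqrt 2 * pi)) * (Gamma (Complex (1/4 - nu/2) x) * Gamma (Complex (1/4 + nu/2) (- x)))) <= D * bes_wt x"
  "!!x. x >= 1 ==> cmod (bes_W nu (- x) - of_real (1 / (2 * sqrt 2 * pi)) * (Gamma (Complex (1/4 - nu/2) (- x)) * Gamma (Complex (1/4 + nu/2) x))) <= D * bes_wt x"
proof -
 obtain C where C: "C > 0" "!!x. \<bar>x\<bar> >= 1 ==> exp (- pi * \<bar>x\<bar>) / sqrt \<bar>x\<bar> <= C * mpw (1/4) x" using mpw_asymp by metis
 define c where "c = 1 / (2 * sqrt 2 * pi)"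
 have c: "c > 0" "c <= 1" unfolding c_def using two_sqrt2_pi by (auto simp: divide_le_eq)
 have cnj_W: "bes_W nu (- x) = cnj (bes_W nu x)" for x by (simp add: bes_W_def cis_cnj)
 have cnj_G: "Gamma (Complex a (- x)) = cnj (Gamma (Complex a x))" for a x
  by (simp add: cnj_Gamma complex_eq_iff) (simp add: complex_cnj)
 have main: "cmod (bes_W nu x - of_real c * (Gamma (Complex (1/4 - nu/2) x) * Gamma (Complex (1/4 + nu/2) (- x)))) <= (401 * (2 * C)) * bes_wt x"
  if x: "x >= 1" for x
 proof -
  define E where "E = exp (- pi * x) / sqrt x"
  have E: "E > 0" using x by (simp add: E_def)
  have px: "pi * x > 0" using x by simp
  let ?a = "1/4 - nu/2"
  have sq: "sqrt (pi / (2 * (pi * x))) * exp (- (pi * x)) = E / sqrt 2"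
   using x by (simp add: E_def real_sqrt_divide real_sqrt_mult)
  have kb: "\<bar>bessel_K nu (pi * x) - E / sqrt 2\<bar> <= E / x"
  proof -
   have "E / sqrt 2 * (1 / (8 * (pi * x))) <= E / 1 * (1 / (1 * (1 * x)))"
    using E x pi_gt3 by (intro mult_mono divide_left_mono) auto
   then have "E / sqrt 2 * (1 / (8 * (pi * x))) <= E / x" by simp
   moreover have "bessel_K nu (pi * x) <= E / sqrt 2" "E / sqrt 2 * (1 - 1 / (8 * (pi * x))) <= bessel_K nu (pi * x)"
    using bessel_K_bounds[OF assms px] unfolding sq by auto
   moreover have "E / x >= 0" using E x by simp
   ultimately show ?thesis by (simp add: right_diff_distrib abs_le_iff)
  qed
  have th: "- (nu * pi / 2) * sgn x = - (nu * pi / 2)" "pi * \<bar>x\<bar> = pi * x" using x by auto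
  have "cmod (bes_W nu x - of_real (E / sqrt 2) * cis (- (nu * pi / 2))) = cmod (of_real (bessel_K nu (pi * x) - E / sqrt 2) * cis (- (nu * pi / 2)))"
   unfolding bes_W_def th by (simp add: algebra_simps)
  also have "... = \<bar>bessel_K nu (pi * x) - E / sqrt 2\<bar>" by (simp only: norm_mult norm_of_real norm_cis mult_1_right)
  finally have 1: "cmod (bes_W nu x - of_real (E / sqrt 2) * cis (- (nu * pi / 2))) <= E / x" using kb by simp
  have a: "1/2 - ?a = 1/4 + nu/2" "pi * (?a - 1/4) = - (nu * pi / 2)" by (simp_all add: field_simps)
  have e1: "2 * pi * exp (- pi * x) / sqrt x = 2 * pi * E" by (simp add: E_def)
  have e2: "400 * exp (- pi * x) / (x * sqrt x) = 400 * (E / x)" by (simp add: E_def mult.commute)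
  have "cmod (Gamma (Complex ?a x) * Gamma (Complex (1/4 + nu/2) (- x)) - of_real (2 * pi * E) * cis (- (nu * pi / 2))) <= 400 * (E / x)"
   using Gamma_prod_asymp[of ?a x] assms x unfolding a e1 e2 by auto
  then have "c * cmod (Gamma (Complex ?a x) * Gamma (Complex (1/4 + nu/2) (- x)) - of_real (2 * pi * E) * cis (- (nu * pi / 2))) <= 1 * (400 * (E / x))"
   using c by (intro mult_mono) auto
  moreover have "cmod (of_real c * (Gamma (Complex ?a x) * Gamma (Complex (1/4 + nu/2) (- x))) - of_real (E / sqrt 2) * cis (- (nu * pi / 2)))
   = c * cmod (Gamma (Complex ?a x) * Gamma (Complex (1/4 + nu/2) (- x)) - of_real (2 * pi * E) * cis (- (nu * pi / 2)))"
  proof -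
   have ce: "E / sqrt 2 = c * (2 * pi * E)" by (simp add: c_def)
   have "of_real c * G - of_real (c * (2 * pi * E)) * w = of_real c * (G - of_real (2 * pi * E) * w)" for G w :: complex
    by (simp add: algebra_simps)
   then show ?thesis unfolding ce using c(1) by (simp add: norm_mult)
  qed
  ultimately have 2: "cmod (of_real c * (Gamma (Complex ?a x) * Gamma (Complex (1/4 + nu/2) (- x))) - of_real (E / sqrt 2) * cis (- (nu * pi / 2))) <= 400 * (E / x)" by simp
  have "cmod (bes_W nu x - of_real c * (Gamma (Complex ?a x) * Gamma (Complex (1/4 + nu/2) (- x)))) <= E / x + 400 * (E / x)"
   using norm_triangle_ineq4[of "bes_W nu x - of_real (E / sqrt 2) * cis (- (nu * pi / 2))" "of_real c * (Gamma (Complex ?a x) * Gamma (Complex (1/4 + nu/2) (- x))) - of_real (E / sqrt 2) * cis (- (nu * pi / 2))"] 1 2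
   by simp
  also have "... = 401 * (E / x)" by simp
  also have "E / x <= (2 * C) * bes_wt x"
  proof -
   have "E / x <= C * mpw (1/4) x / x" using C(2)[of x] x by (intro divide_right_mono) (auto simp: E_def)
   also have "... <= C * mpw (1/4) x / ((1 + x) / 2)" using x C(1) by (intro divide_left_mono mult_nonneg_nonneg) auto
   finally show ?thesis using x by (simp add: bes_wt_def mult_ac)
  qed
  finally show ?thesis by simp
 qed
 show ?thesis
 proof (rule that[of "401 * (2 * C)"])
  show "401 * (2 * C) > 0" using C by simp
  fix x :: real assume x: "x >= 1"
  show "cmod (bes_W nu x - of_real (1 / (2 * sqrt 2 * pi)) * (Gamma (Complex (1/4 - nu/2) x) * Gamma (Complex (1/4 + nu/2) (- x)))) <= 401 * (2 * C) * bes_wt x"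
   using main[OF x] unfolding c_def .
  have "bes_W nu (- x) - of_real c * (Gamma (Complex (1/4 - nu/2) (- x)) * Gamma (Complex (1/4 + nu/2) x))
   = cnj (bes_W nu x - of_real c * (Gamma (Complex (1/4 - nu/2) x) * Gamma (Complex (1/4 + nu/2) (- x))))"
   unfolding cnj_W cnj_G by simp
  then show "cmod (bes_W nu (- x) - of_real (1 / (2 * sqrt 2 * pi)) * (Gamma (Complex (1/4 - nu/2) (- x)) * Gamma (Complex (1/4 + nu/2) x))) <= 401 * (2 * C) * bes_wt x"
   using main[OF x] unfolding c_def by (simp only: complex_mod_cnj)
 qed
qed

text \<open>The two functionals are compared on \<open>|Re X| \<ge> 1\<close> on the line \<open>Im X = \<nu>/2\<close>; in between, where the Gamma
 weight is singular for \<open>\<nu> = 1/2\<close>, the contour is lowered to \<open>Im X = \<nu>/2 - \<kappa>\<close>.\<close>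
lemma bes_Lam_mpI:
 assumes nu: "0 < nu" "nu <= 1/2" and kap: "0 < kappa" "kappa <= nu / 2"
 obtains C where "C > 0"
  "!!q M. (!!X. \<bar>Re X\<bar> <= 1 ==> \<bar>Im X - nu / 2\<bar> <= kappa ==> cmod (poly q X) <= M) ==>
   cmod (bes_Lam nu q - of_real (1 / (2 * sqrt 2 * pi)) * mpI (1/4) q)
    <= C * ((LBINT x. cmod (poly q (of_real x + of_real (nu / 2) * \<i>)) * bes_wt x) + M)"
proof -
 define eta b c where "eta = nu / 2" and "b = nu / 2 - kappa" and "c = 1 / (2 * sqrt 2 * pi)"
 have eta: "0 < eta" "eta <= 1/4" "0 <= b" "b < eta" "eta - b = kappa" using nu kap by (auto simp: eta_def b_def)
 have c: "0 < c" "c <= 1" unfolding c_def using two_sqrt2_pi by (auto simp: divide_le_eq)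
 obtain B1 where B1: "B1 > 0" "!!\<sigma> x. 0 <= \<sigma> ==> \<sigma> <= 2 ==> \<bar>x\<bar> >= 1 ==> cmod (Gamma (Complex \<sigma> x)) <= B1 * exp (- \<bar>x\<bar>)"
  using cmod_Gamma_decay_far by metis
 obtain B where B: "B > 0" "!!\<sigma> x. kappa <= \<sigma> ==> \<sigma> <= 3 ==> cmod (Gamma (Complex \<sigma> x)) <= B * exp (- \<bar>x\<bar>)"
  using cmod_Gamma_decay[of kappa] kap nu by auto
 obtain D where D: "D > 0"
  "!!x. x >= 1 ==> cmod (bes_W nu x - of_real c * (Gamma (Complex (1/4 - eta) x) * Gamma (Complex (1/4 + eta) (- x)))) <= D * bes_wt x"
  "!!x. x >= 1 ==> cmod (bes_W nu (- x) - of_real c * (Gamma (Complex (1/4 - eta) (- x)) * Gamma (Complex (1/4 + eta) x))) <= D * bes_wt x"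
  using bes_W_Gamma_approx[OF nu] unfolding eta_def c_def by metis
 define KK where "KK = (LBINT x. cmod (bes_W nu x))"
 have iW: "integrable lborel (%x. cmod (bes_W nu x))"
  using integrable_norm[OF integrable_pow_bes_W[OF nu, of 0]] by simp
 have KK: "KK >= 0" unfolding KK_def by simp
 define C where "C = 2 * D + KK + 2 * B^2 + 2 * (B1^2 * kappa) + 1"
 show ?thesis
 proof (rule that[of C])
  show "C > 0" using D(1) KK kap by (simp add: C_def add_nonneg_pos)
  fix q M assume M0: "!!X. \<bar>Re X\<bar> <= 1 ==> \<bar>Im X - nu / 2\<bar> <= kappa ==> cmod (poly q X) <= M"
  have M: "cmod (poly q (Complex x y)) <= M" if "\<bar>x\<bar> <= 1" "b <= y" "y <= eta" for x y
   using that kap by (intro M0) (auto simp: eta_def b_def)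
  have Mnn: "M >= 0" using M[of 0 b] eta norm_ge_zero[of "poly q (Complex 0 b)"] by linarith
  define g where "g x = cmod (poly q (Complex x eta)) * bes_wt x" for x
  have Cx: "of_real x + of_real y * \<i> = Complex x y" for x y by (simp add: complex_eq_iff)
  have ig: "integrable lborel g" unfolding g_def[abs_def]
   using integrable_cmod_poly_wt[of q "of_real eta * \<i>"] unfolding Cx .
  have g0: "g x >= 0" for x by (simp add: g_def)
  have igm: "integrable lborel (%x. g (- x))" using lborel_integrable_real_affine[OF ig, of "-1" 0] by simp
  have gm: "(LBINT x. g (- x)) = (LBINT x. g x)" using lborel_integral_real_affine[of "-1" g 0] by simp
  \<comment> \<open>The integrand of \<open>mpI\<close>, continued off the real axis.\<close>
  define F where "F X = poly q X * (Gamma (of_real (1/4) + \<i> * X) * Gamma (of_real (1/4) - \<i> * X))" for X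
  have FC: "F (Complex x y) = poly q (Complex x y) * (Gamma (Complex (1/4 - y) x) * Gamma (Complex (1/4 + y) (- x)))" for x y
  proof -
   have "of_real (1/4) + \<i> * Complex x y = Complex (1/4 - y) x" "of_real (1/4) - \<i> * Complex x y = Complex (1/4 + y) (- x)"
    by (simp_all add: complex_eq_iff)
   then show ?thesis by (simp add: F_def)
  qed
  obtain Bq where Bq: "Bq >= 0" "!!z. cmod (poly q z) <= Bq * exp (1/2 * cmod z)" using poly_le_exp[of "1/2" q] by auto
  define Q where "Q = Bq * exp (1/2)"
  have Q: "Q >= 0" using Bq by (simp add: Q_def)
  have pb: "cmod (poly q (Complex x y)) <= Q * exp \<bar>x\<bar>" if "\<bar>y\<bar> <= 1" for x y
  proof -
   have "1/2 * cmod (Complex x y) <= 1/2 + \<bar>x\<bar>" using cmod_le[of "Complex x y"] that by simp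
   then have "Bq * exp (1/2 * cmod (Complex x y)) <= Bq * exp (1/2 + \<bar>x\<bar>)" using Bq(1) by (intro mult_left_mono) auto
   then show ?thesis using Bq(2)[of "Complex x y"] by (simp add: Q_def exp_add)
  qed
  have Gb: "cmod (F (Complex x y)) <= N * (K^2 * exp (- 2 * \<bar>x\<bar>))"
   if "cmod (Gamma (Complex (1/4 - y) x)) <= K * exp (- \<bar>x\<bar>)" "cmod (Gamma (Complex (1/4 + y) (- x))) <= K * exp (- \<bar>x\<bar>)"
    "cmod (poly q (Complex x y)) <= N" "K > 0" for x y K N
  proof -
   have "cmod (Gamma (Complex (1/4 - y) x)) * cmod (Gamma (Complex (1/4 + y) (- x))) <= (K * exp (- \<bar>x\<bar>)) * (K * exp (- \<bar>x\<bar>))"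
    using that by (intro mult_mono) auto
   also have "... = K^2 * exp (- 2 * \<bar>x\<bar>)" by (simp add: power2_eq_square flip: exp_add)
   finally have gg: "cmod (Gamma (Complex (1/4 - y) x)) * cmod (Gamma (Complex (1/4 + y) (- x))) <= K^2 * exp (- 2 * \<bar>x\<bar>)" .
   have "cmod (poly q (Complex x y)) * (cmod (Gamma (Complex (1/4 - y) x)) * cmod (Gamma (Complex (1/4 + y) (- x)))) <= N * (K^2 * exp (- 2 * \<bar>x\<bar>))"
    by (rule mult_mono[OF that(3) gg order_trans[OF norm_ge_zero that(3)]]) simp
   then show ?thesis unfolding FC norm_mult .
  qed
  have near: "cmod (Gamma (Complex (1/4 - y) x)) <= B * exp (- \<bar>x\<bar>)" "cmod (Gamma (Complex (1/4 + y) (- x))) <= B * exp (- \<bar>x\<bar>)"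
   if "0 <= y" "y <= b" for x y
   using B(2)[of "1/4 - y" x] B(2)[of "1/4 + y" "- x"] that eta kap by auto
  have far: "cmod (Gamma (Complex (1/4 - y) x)) <= B1 * exp (- \<bar>x\<bar>)" "cmod (Gamma (Complex (1/4 + y) (- x))) <= B1 * exp (- \<bar>x\<bar>)"
   if "b <= y" "y <= eta" "\<bar>x\<bar> >= 1" for x y
   using B1(2)[of "1/4 - y" x] B1(2)[of "1/4 + y" "- x"] that eta by auto
  have pe: "Q * exp \<bar>x\<bar> * (K^2 * exp (- 2 * \<bar>x\<bar>)) = Q * K^2 * exp (- \<bar>x\<bar>)" for x K
  proof -
   have "exp \<bar>x\<bar> * exp (- 2 * \<bar>x\<bar>) = exp (- \<bar>x\<bar>)" by (simp flip: exp_add)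
   then show ?thesis by (metis (no_types, lifting) mult.assoc mult.left_commute)
  qed
  have bnd0: "cmod (F (Complex x y)) <= Q * B^2 * exp (- \<bar>x\<bar>)" if "0 <= y" "y <= b" for x y
   using Gb[OF near[OF that] pb B(1), of x] that eta unfolding pe by auto
  have bnd1: "cmod (F (Complex x y)) <= Q * B1^2 * exp (- \<bar>x\<bar>)" if "b <= y" "y <= eta" "\<bar>x\<bar> >= 1" for x y
   using Gb[OF far[OF that] pb B1(1)] that eta unfolding pe by auto
  \<comment> \<open>Both Gamma factors are regular in this strip, and it contains the lowered line
    because b < 1/4 even for nu = 1/2.\<close>
  define S0 where "S0 = {X. Im X < 1/4 \<and> - (1/4) < Im X}"
  have "S0 = {X. Im X < 1/4} \<inter> {X. Im X > - (1/4)}" by (auto simp: S0_def)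
  then have S0: "open S0" "convex S0"
   by (simp_all only: open_Int open_halfspace_Im_lt open_halfspace_Im_gt convex_Int convex_halfspace_Im_lt convex_halfspace_Im_gt)
  have hol0: "F holomorphic_on S0"
   unfolding F_def by (intro holomorphic_intros) (auto intro!: not_nonpos_Ints_Re simp: S0_def)
  define S1 where "S1 = {X. Re X > 1/2}"
  have S1: "open S1" "convex S1" by (simp_all only: S1_def open_halfspace_Re_gt convex_halfspace_Re_gt)
  \<comment> \<open>All poles lie on the imaginary axis, so the pieces with |Re X| \<ge> 1 can be
    raised to Im X = nu/2; the left piece is treated through X -> -X.\<close>
  have holR: "F holomorphic_on S1"
   unfolding F_def by (intro holomorphic_intros) (auto elim!: nonpos_Ints_cases simp: S1_def complex_eq_iff)
  have holL: "(%X. F (- X)) holomorphic_on S1"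
   unfolding F_def by (intro holomorphic_intros) (auto elim!: nonpos_Ints_cases simp: S1_def complex_eq_iff)
  have seg0: "closed_segment 0 b = {0..b}" and seg1: "closed_segment b eta = {b..eta}" and seg2: "closed_segment (- b) (- eta) = {-eta..-b}"
   using eta by (auto simp: closed_segment_eq_real_ivl)
  note full = full_line_shift[OF hol0 S0, of 0 b "Q * B^2", unfolded seg0]
  have fint: "integrable lborel (%x. F (Complex x b))" and feq: "(LBINT x. F (Complex x b)) = (LBINT x. F (Complex x 0))"
   by (rule full; use bnd0 eta kap in \<open>auto simp: S0_def\<close>)+
  have m1: "mpI (1/4) q = (LBINT x. F (Complex x 0))"
   unfolding mpI_def FC mpw_complex by (simp add: complex_of_real_def)
  define I1 I2 where "I1 y = (LBINT x:{1..}. F (Complex x y))" and "I2 y = (LBINT x:{1..}. F (Complex (- x) y))" for y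
  have split: "mpI (1/4) q = I1 b + I2 b + (LBINT x:{-1..<1}. F (Complex (- x) b))"
   unfolding m1 feq[symmetric] I1_def I2_def by (rule integral_split_three[OF fint])
  have mid: "cmod (LBINT x:{-1..<1}. F (Complex (- x) b)) <= 2 * (M * B^2)"
  proof -
   have "cmod (LBINT x:{-1..<1::real}. F (Complex (- x) b)) <= (LBINT x:{-1..<1::real}. M * B^2)"
    unfolding set_lebesgue_integral_def
   proof (rule norm_lebesgue_integral_le)
    show "integrable lborel (%x::real. indicat_real {- 1..<1} x *\<^sub>R (M * B^2))"
     by (intro integrable_real_indicator integrable_scaleR_left) auto
    fix x :: real
    show "norm (indicat_real {- 1..<1} x *\<^sub>R F (Complex (- x) b)) <= indicat_real {- 1..<1} x *\<^sub>R (M * B^2)"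
    proof (cases "x \<in> {-1..<1}")
     case True
     then have "cmod (F (Complex (- x) b)) <= M * (B^2 * exp (- 2 * \<bar>- x\<bar>))"
      using eta by (intro Gb near M B(1)) auto
     also have "... <= M * (B^2 * 1)" using Mnn by (intro mult_left_mono) auto
     finally show ?thesis using True by simp
    qed simp
   qed
   also have "... = 2 * (M * B^2)" by (simp add: set_lebesgue_integral_def)
   finally show ?thesis .
  qed
  have M1: "cmod (F (Complex x y)) <= M * B1^2" if "b <= y" "y <= eta" "\<bar>x\<bar> = 1" for x y
  proof -
   have "cmod (F (Complex x y)) <= M * (B1^2 * exp (- 2 * \<bar>x\<bar>))" using that by (intro Gb far M B1(1)) auto
   also have "... <= M * (B1^2 * 1)" using Mnn by (intro mult_left_mono) auto
   finally show ?thesis by simp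
  qed
  have bnd1r: "cmod (F (Complex x y)) <= Q * B1^2 * exp (- x)" "cmod (F (Complex (- x) y)) <= Q * B1^2 * exp (- x)"
   if "x >= 1" "b <= y" "y <= eta" for x y
   using bnd1[of y x] bnd1[of y "- x"] that by auto
  note right = half_line_shift[OF holR S1, of 1 b eta "Q * B1^2" "M * B1^2", unfolded seg1]
  have r1: "set_integrable lborel {1..} (%x. F (Complex x eta))"
   by (rule right(2)) (use bnd1r M1 in \<open>auto simp: S1_def\<close>)
  have r2: "cmod (I1 eta - I1 b) <= M * B1^2 * \<bar>eta - b\<bar>"
   unfolding I1_def by (rule right(3)) (use bnd1r M1 in \<open>auto simp: S1_def\<close>)
  have neg: "- Complex x y = Complex (- x) (- y)" for x y by (simp add: complex_eq_iff)
  note left = half_line_shift[OF holL S1, of 1 "- b" "- eta" "Q * B1^2" "M * B1^2", unfolded seg2 neg minus_minus]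
  have l1: "set_integrable lborel {1..} (%x. F (Complex (- x) eta))"
   by (rule left(2)) (use bnd1r M1 in \<open>auto simp: S1_def\<close>)
  have "cmod (I2 eta - I2 b) <= M * B1^2 * \<bar>- eta - - b\<bar>"
   unfolding I2_def by (rule left(3)) (use bnd1r M1 in \<open>auto simp: S1_def\<close>)
  then have l2: "cmod (I2 eta - I2 b) <= M * B1^2 * \<bar>eta - b\<bar>" by (simp add: abs_minus_commute)
  let ?h = "%x. poly q (Complex x eta) * bes_W nu x"
  have hi: "integrable lborel ?h" using integrable_poly_bes_W[OF nu, of q "of_real eta * \<i>"] unfolding Cx .
  have him: "integrable lborel (%x. ?h (- x))" using lborel_integrable_real_affine[OF hi, of "-1" 0] by simp
  have lam: "bes_Lam nu q = (LBINT x:{1..}. ?h x) + (LBINT x:{1..}. ?h (- x)) + (LBINT x:{-1..<1}. ?h (- x))"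
   unfolding bes_Lam_def eta_def[symmetric] Cx by (rule integral_split_three[OF hi])
  have si: "set_integrable lborel A f" if "integrable lborel f" "A \<in> sets lborel" for A and f :: "real => complex"
   using that by (simp add: integrable_mult_indicator set_integrable_def)
  have d1: "cmod ((LBINT x:{1..}. ?h x) - of_real c * I1 eta) <= D * (LBINT x. g x)"
  proof -
   have "(LBINT x:{1..}. ?h x) - of_real c * I1 eta = (LBINT x:{1..}. ?h x - of_real c * F (Complex x eta))"
    unfolding I1_def set_integral_mult_right[symmetric] by (rule set_integral_diff(2)[OF si[OF hi] set_integrable_mult_right[OF r1], symmetric]) auto
   also have "cmod ... <= (LBINT x. D * g x)"
    unfolding set_lebesgue_integral_def
   proof (rule norm_lebesgue_integral_le)
    fix x :: real
    show "norm (indicat_real {1..} x *\<^sub>R (?h x - of_real c * F (Complex x eta))) <= D * g x"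
    proof (cases "x >= 1")
     case True
     have "?h x - of_real c * F (Complex x eta) = poly q (Complex x eta) * (bes_W nu x - of_real c * (Gamma (Complex (1/4 - eta) x) * Gamma (Complex (1/4 + eta) (- x))))"
      unfolding FC by (simp add: algebra_simps)
     then have "cmod (?h x - of_real c * F (Complex x eta)) <= cmod (poly q (Complex x eta)) * (D * bes_wt x)"
      using D(2)[OF True] by (simp only: norm_mult) (intro mult_left_mono, auto)
     then show ?thesis using True by (simp add: g_def mult_ac)
    qed (use g0 D(1) in simp)
   qed (use ig in auto)
   finally show ?thesis by simp
  qed
  have d2: "cmod ((LBINT x:{1..}. ?h (- x)) - of_real c * I2 eta) <= D * (LBINT x. g x)"
  proof -
   have "(LBINT x:{1..}. ?h (- x)) - of_real c * I2 eta = (LBINT x:{1..}. ?h (- x) - of_real c * F (Complex (- x) eta))"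
    unfolding I2_def set_integral_mult_right[symmetric] by (rule set_integral_diff(2)[OF si[OF him] set_integrable_mult_right[OF l1], symmetric]) auto
   also have "cmod ... <= (LBINT x. D * g (- x))"
    unfolding set_lebesgue_integral_def
   proof (rule norm_lebesgue_integral_le)
    fix x :: real
    show "norm (indicat_real {1..} x *\<^sub>R (?h (- x) - of_real c * F (Complex (- x) eta))) <= D * g (- x)"
    proof (cases "x >= 1")
     case True
     have "?h (- x) - of_real c * F (Complex (- x) eta) = poly q (Complex (- x) eta) * (bes_W nu (- x) - of_real c * (Gamma (Complex (1/4 - eta) (- x)) * Gamma (Complex (1/4 + eta) x)))"
      unfolding FC by (simp add: algebra_simps)
     then have "cmod (?h (- x) - of_real c * F (Complex (- x) eta)) <= cmod (poly q (Complex (- x) eta)) * (D * bes_wt x)"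
      using D(3)[OF True] by (simp only: norm_mult) (intro mult_left_mono, auto)
     then show ?thesis using True by (simp add: g_def mult_ac)
    qed (use g0 D(1) in simp)
   qed (use igm in auto)
   finally show ?thesis using gm by simp
  qed
  have d3: "cmod (LBINT x:{-1..<1}. ?h (- x)) <= M * KK"
  proof -
   have "cmod (LBINT x:{-1..<1}. ?h (- x)) <= (LBINT x. M * cmod (bes_W nu x))"
    unfolding set_lebesgue_integral_def
   proof (rule norm_lebesgue_integral_le)
    fix x :: real
    show "norm (indicat_real {-1..<1} x *\<^sub>R ?h (- x)) <= M * cmod (bes_W nu x)"
    proof (cases "x \<in> {-1..<1}")
     case True
     have "cmod (?h (- x)) <= M * cmod (bes_W nu (- x))" unfolding norm_mult using True eta by (intro mult_right_mono M) auto
     then show ?thesis using True by (simp add: cmod_bes_W)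
    qed (use Mnn in simp)
   qed (use iW in auto)
   then show ?thesis by (simp add: KK_def)
  qed
  have tri: "cmod (u1 + u2 + u3 - of_real c * (v1 + v2 + v3)) <= e1 + e2 + e3 + (f1 + f2 + f3)"
   if "cmod (u1 - of_real c * w1) <= e1" "cmod (u2 - of_real c * w2) <= e2" "cmod u3 <= e3"
    "cmod (w1 - v1) <= f1" "cmod (w2 - v2) <= f2" "cmod v3 <= f3" for u1 u2 u3 v1 v2 v3 w1 w2 :: complex and e1 e2 e3 f1 f2 f3
  proof -
   have cc: "cmod (of_real c * z) <= cmod z" for z using c mult_right_mono[of c 1 "cmod z"] by (simp add: norm_mult)
   have "u1 + u2 + u3 - of_real c * (v1 + v2 + v3) = (u1 - of_real c * w1) + (u2 - of_real c * w2) + u3 + (of_real c * (w1 - v1) + of_real c * (w2 - v2) + of_real c * (- v3))"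
    by (simp add: algebra_simps)
   also have "cmod ... <= e1 + e2 + e3 + (f1 + f2 + f3)"
    by (intro norm_triangle_mono that order_trans[OF cc]) (use that in auto)
   finally show ?thesis .
  qed
  have "cmod (bes_Lam nu q - of_real c * mpI (1/4) q) <= D * (LBINT x. g x) + D * (LBINT x. g x) + M * KK + (M * B1^2 * \<bar>eta - b\<bar> + M * B1^2 * \<bar>eta - b\<bar> + 2 * (M * B^2))"
   unfolding lam split by (rule tri[OF d1 d2 d3 r2 l2 mid])
  also have "... = (2 * D) * (LBINT x. g x) + (KK + 2 * B^2 + 2 * (B1^2 * kappa)) * M"
   using eta kap by (simp add: algebra_simps)
  also have "... <= C * (LBINT x. g x) + C * M"
   using D(1) KK kap Mnn g0 by (intro add_mono mult_right_mono) (auto simp: C_def intro!: add_nonneg_nonneg)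
  finally show "cmod (bes_Lam nu q - of_real (1 / (2 * sqrt 2 * pi)) * mpI (1/4) q)
    <= C * ((LBINT x. cmod (poly q (of_real x + of_real (nu / 2) * \<i>)) * bes_wt x) + M)"
   unfolding c_def[symmetric] eta_def[symmetric] Cx g_def by (simp only: distrib_left)
 qed
qed

section \<open>The norm on the line Im X = nu/2, coercivity and the error functional\<close>

definition bes_sn :: "real => complex poly => real" where
 "bes_sn nu q = (LBINT x. (cmod (poly q (of_real x + of_real (nu / 2) * \<i>)))^2 * mpw (1/4) x)"

lemma integrable_cmod_poly_sq:
 assumes "0 < l" "l <= 3"
 shows "integrable lborel (%x. (cmod (poly q (of_real x + c)))^2 * mpw l x)"
 using integrable_cmod_poly_mpw[OF assms, of "q * q" c] by (simp add: norm_mult power2_eq_square)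

lemma bes_sn_nonneg: "bes_sn nu q >= 0"
 unfolding bes_sn_def by simp

text \<open>The translate X -> q(X + i nu/2) is expanded, so Parseval on the real line applies; the
  coefficients are not those of q itself.\<close>

lemma bes_sn_expand:
 assumes "degree q < n"
 obtains c where "!!X. poly q (X + of_real (nu / 2) * \<i>) = (\<Sum>k<n. c k * mp (1/4) k X)"
  and "bes_sn nu q = mpN (1/4) * (\<Sum>k<n. (cmod (c k))^2 * rbin (1/2) k)"
proof -
 have "degree (pcompose q [:of_real (nu / 2) * \<i>, 1:]) < n" using assms degree_pcompose_le[of q "[:of_real (nu / 2) * \<i>, 1:]"] by simp
 then obtain c where c: "!!X. poly (pcompose q [:of_real (nu / 2) * \<i>, 1:]) X = (\<Sum>k<n. c k * mp (1/4) k X)"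
  by (rule mp_span[where l = "1/4"]) blast
 then have c': "poly q (X + of_real (nu / 2) * \<i>) = (\<Sum>k<n. c k * mp (1/4) k X)" for X
  by (simp add: poly_pcompose add.commute)
 show ?thesis
  by (rule that[of c, OF c'], unfold bes_sn_def c') (use mp_parseval(2)[of "1/4" c n] in simp)
qed

lemma bes_sn_eq_0:
 assumes "bes_sn nu q = 0"
 shows "q = 0"
proof -
 obtain c where c: "!!X. poly q (X + of_real (nu / 2) * \<i>) = (\<Sum>k<Suc (degree q). c k * mp (1/4) k X)"
  "bes_sn nu q = mpN (1/4) * (\<Sum>k<Suc (degree q). (cmod (c k))^2 * rbin (1/2) k)"
  using bes_sn_expand[of q "Suc (degree q)" nu] by auto
 have "(\<Sum>k<Suc (degree q). (cmod (c k))^2 * rbin (1/2) k) = 0" using c(2) assms mpN_pos[of "1/4"] by simp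
 then have "\<forall>k\<in>{..<Suc (degree q)}. (cmod (c k))^2 * rbin (1/2) k = 0"
  by (subst (asm) sum_nonneg_eq_0_iff) (auto intro!: mult_nonneg_nonneg rbin_nonneg)
 then have "\<forall>k<Suc (degree q). c k = 0" using rbin_pos[of "1/2"] by (auto simp: less_imp_neq[symmetric])
 then have "poly q (X + of_real (nu / 2) * \<i>) = 0" for X using c(1)[of X] by simp
 from this[of "Y - of_real (nu / 2) * \<i>" for Y] have "poly q Y = 0" for Y by simp
 then show ?thesis by (simp add: poly_eq_poly_eq_iff[symmetric] fun_eq_iff)
qed

lemma bes_sup_bound:
 assumes "0 < kappa" "kappa <= 1"
 obtains C where "C > 0" "!!n q X. degree q < n ==> \<bar>Re X\<bar> <= 1 ==> \<bar>Im X - nu / 2\<bar> <= kappa ==>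
  cmod (poly q X) <= C * (real n + 1) powr (3 * kappa) * sqrt (bes_sn nu q)"
proof -
 obtain C where C: "C > 0" "!!n c x. \<bar>Re x\<bar> <= 1 ==> \<bar>Im x\<bar> <= kappa ==>
  cmod (\<Sum>k<n. c k * mp (1/4) k x) <= C * (real n + 1) powr (3 * kappa) * sqrt (\<Sum>k<n. (cmod (c k))^2 * rbin (1/2) k)"
  by (rule mp_eval_bound[OF assms]) blast
 have N: "mpN (1/4) > 0" by (rule mpN_pos) auto
 show ?thesis
 proof (rule that[of "C / sqrt (mpN (1/4))"])
  show "C / sqrt (mpN (1/4)) > 0" using C N by simp
  fix n :: nat and q :: "complex poly" and X assume a: "degree q < n" "\<bar>Re X\<bar> <= 1" "\<bar>Im X - nu / 2\<bar> <= kappa"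
  obtain c where c: "!!X. poly q (X + of_real (nu / 2) * \<i>) = (\<Sum>k<n. c k * mp (1/4) k X)"
   "bes_sn nu q = mpN (1/4) * (\<Sum>k<n. (cmod (c k))^2 * rbin (1/2) k)"
   using bes_sn_expand[OF a(1)] by metis
  have "poly q X = (\<Sum>k<n. c k * mp (1/4) k (X - of_real (nu / 2) * \<i>))" using c(1)[of "X - of_real (nu / 2) * \<i>"] by simp
  then have "cmod (poly q X) <= C * (real n + 1) powr (3 * kappa) * sqrt (\<Sum>k<n. (cmod (c k))^2 * rbin (1/2) k)"
   using C(2)[where x = "X - of_real (nu / 2) * \<i>" and n = n and c = c] a by simp
  also have "sqrt (\<Sum>k<n. (cmod (c k))^2 * rbin (1/2) k) = sqrt (bes_sn nu q) / sqrt (mpN (1/4))"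
   unfolding c(2) using N by (simp add: real_sqrt_mult)
  finally show "cmod (poly q X) <= C / sqrt (mpN (1/4)) * (real n + 1) powr (3 * kappa) * sqrt (bes_sn nu q)" by simp
 qed
qed

text \<open>Pointwise 2 H \<le> t U + V / t for every t > 0, optimized after integration. If one of
  the two integrals vanishes, t is taken very large or very small.\<close>

lemma integral_Cauchy_Schwarz:
 fixes U V H :: "'a => real"
 assumes "integrable M U" "integrable M V" "integrable M H"
  and "!!x. U x >= 0" "!!x. V x >= 0" "!!x. H x <= sqrt (U x) * sqrt (V x)"
 shows "integral\<^sup>L M H <= sqrt (integral\<^sup>L M U) * sqrt (integral\<^sup>L M V)"
proof -
 define A B where "A = integral\<^sup>L M U" and "B = integral\<^sup>L M V"
 have AB: "A >= 0" "B >= 0" using assms by (auto simp: A_def B_def)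
 have I: "integral\<^sup>L M H <= (t * A + B / t) / 2" if t: "t > 0" for t
 proof -
  have "integral\<^sup>L M H <= integral\<^sup>L M (%x. (t * U x + V x / t) / 2)"
  proof (rule integral_mono[OF assms(3)])
   show "integrable M (%x. (t * U x + V x / t) / 2)" using assms by auto
   fix x
   have "0 <= (sqrt t * sqrt (U x) - sqrt (V x) / sqrt t)^2" by simp
   also have "... = t * U x + V x / t - 2 * (sqrt (U x) * sqrt (V x))"
    using t assms(4,5)[of x] by (simp add: power2_diff power_mult_distrib power_divide)
   finally show "H x <= (t * U x + V x / t) / 2" using assms(6)[of x] by simp
  qed
  also have "... = (t * A + B / t) / 2" using assms by (simp add: A_def B_def)
  finally show ?thesis .
 qed
 have "integral\<^sup>L M H <= sqrt A * sqrt B"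
 proof (cases "A > 0 \<and> B > 0")
  case True
  define t where "t = sqrt B / sqrt A"
  have t: "t > 0" using True by (simp add: t_def)
  have "t * A = sqrt A * sqrt B" using True real_div_sqrt[of A] by (simp add: t_def field_simps)
  moreover have "B / t = sqrt A * sqrt B" using True by (simp add: t_def field_simps)
  ultimately show ?thesis using I[OF t] by simp
 next
  case False
  have "integral\<^sup>L M H <= 0"
  proof (rule field_le_epsilon)
   fix e :: real assume e: "e > 0"
   show "integral\<^sup>L M H <= 0 + e"
   proof (cases "A = 0")
    case True
    have "B / ((B + 1) / e) / 2 <= e" using AB e by (simp add: field_simps)
    moreover have "(B + 1) / e > 0" using AB e by simp
    ultimately show ?thesis using I[of "(B + 1) / e"] True by simp
   next
    case nz: False
    then have B: "B = 0" using False AB by auto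
    have "e / (A + 1) * A <= e" using AB e by (simp add: field_simps)
    moreover have "e / (A + 1) > 0" using AB e by simp
    moreover have "integral\<^sup>L M H <= (e / (A + 1) * A + 0) / 2"
     using I[of "e / (A + 1)"] calculation(2) unfolding B by (simp only: div_0 simp_thms)
    moreover have "(u + 0) / 2 <= 0 + e" if "u <= e" for u using that e by simp
    ultimately show ?thesis by (blast intro: order_trans)
   qed
  qed
  then show ?thesis using AB by (simp add: order_trans)
 qed
 then show ?thesis unfolding A_def B_def .
qed

text \<open>Schwarz reflection in the line Im X = nu/2: a polynomial whose values on that line are
  the conjugates of those of q.\<close>

definition bes_star :: "real => complex poly => complex poly" where
 "bes_star nu q = pcompose (map_poly cnj q) [:- of_real nu * \<i>, 1:]"

lemma poly_map_cnj: "poly (map_poly cnj q) (cnj x) = cnj (poly q x)"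
 by (induction q) (simp_all add: map_poly_pCons)

lemma poly_bes_star: "poly (bes_star nu q) X = cnj (poly q (cnj X + of_real nu * \<i>))"
proof -
 have "poly (bes_star nu q) X = poly (map_poly cnj q) (cnj (cnj X + of_real nu * \<i>))"
  by (simp add: bes_star_def poly_pcompose add.commute)
 then show ?thesis by (simp only: poly_map_cnj)
qed

lemma poly_bes_star_line: "poly (bes_star nu q) (of_real x + of_real (nu / 2) * \<i>) = cnj (poly q (of_real x + of_real (nu / 2) * \<i>))"
proof -
 have "cnj (of_real x + of_real (nu / 2) * \<i>) + of_real nu * \<i> = of_real x + of_real (nu / 2) * \<i>"
  by (simp add: complex_eq_iff)
 then show ?thesis by (simp only: poly_bes_star)
qed

lemma bes_star_props: "degree (bes_star nu q) <= degree q" "bes_sn nu (bes_star nu q) = bes_sn nu q"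
proof -
 have "degree (map_poly cnj q) <= degree q" by (intro degree_le) (simp add: coeff_map_poly coeff_eq_0)
 then show "degree (bes_star nu q) <= degree q"
  unfolding bes_star_def using degree_pcompose_le[of "map_poly cnj q" "[:- of_real nu * \<i>, 1:]"] by simp
 show "bes_sn nu (bes_star nu q) = bes_sn nu q" unfolding bes_sn_def poly_bes_star_line by simp
qed

text \<open>On the line, q times its reflection is |q|^2, and the weight has the argument nu pi/2 or
  -nu pi/2; the real part keeps the factor cos(nu pi/2) > 0.\<close>

lemma bes_Lam_coercive:
 assumes "0 < nu" "nu <= 1/2"
 obtains c where "c > 0" "!!q. c * bes_sn nu q <= cmod (bes_Lam nu (q * bes_star nu q))"
proof -
 obtain c where c: "c > 0" "!!x. x \<noteq> 0 ==> c * mpw (1/4) x <= bessel_K nu (pi * \<bar>x\<bar>)" using mpw_le_bessel_K[OF assms] by metis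
 have th: "0 < nu * pi / 2" "nu * pi / 2 < pi / 2" using assms by auto
 have co: "cos (nu * pi / 2) > 0" using th by (intro cos_gt_zero) auto
 show ?thesis
 proof (rule that[of "cos (nu * pi / 2) * c"])
  show "cos (nu * pi / 2) * c > 0" using co c by simp
  fix q
  let ?L = "%x. of_real x + of_real (nu / 2) * \<i>"
  let ?F = "%x. poly (q * bes_star nu q) (?L x) * bes_W nu x"
  have i: "integrable lborel ?F" by (rule integrable_poly_bes_W[OF assms])
  have ReF: "Re (?F x) = (cmod (poly q (?L x)))^2 * (cos (nu * pi / 2 * sgn x) * bessel_K nu (pi * \<bar>x\<bar>))" for x
  proof -
   have "?F x = of_real ((cmod (poly q (?L x)))^2) * bes_W nu x"
    unfolding poly_mult poly_bes_star_line by (simp only: complex_norm_square)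
   then have "Re (?F x) = Re (of_real ((cmod (poly q (?L x)))^2) * bes_W nu x)" by (simp only:)
   also have "... = (cmod (poly q (?L x)))^2 * (cos (nu * pi / 2 * sgn x) * bessel_K nu (pi * \<bar>x\<bar>))"
    unfolding times_complex.simps Re_complex_of_real Im_complex_of_real by (simp add: bes_W_def)
   finally show ?thesis .
  qed
  have "cos (nu * pi / 2) * c * bes_sn nu q = (LBINT x. cos (nu * pi / 2) * c * ((cmod (poly q (?L x)))^2 * mpw (1/4) x))"
   unfolding bes_sn_def by simp
  also have "... <= (LBINT x. Re (?F x))"
  proof (rule integral_mono_AE)
   show "integrable lborel (%x. cos (nu * pi / 2) * c * ((cmod (poly q (?L x)))^2 * mpw (1/4) x))"
    by (intro integrable_mult_right integrable_cmod_poly_sq) auto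
   show "integrable lborel (%x. Re (?F x))" by (rule integrable_Re[OF i])
   show "AE x in lborel. cos (nu * pi / 2) * c * ((cmod (poly q (?L x)))^2 * mpw (1/4) x) <= Re (?F x)"
    using AE_lborel_singleton[of "0::real"]
   proof eventually_elim
    case (elim x)
    have cs: "cos (nu * pi / 2 * sgn x) = cos (nu * pi / 2)" using elim by (cases "x > 0") auto
    have "cos (nu * pi / 2) * (cmod (poly q (?L x)))^2 * (c * mpw (1/4) x) <= cos (nu * pi / 2) * (cmod (poly q (?L x)))^2 * bessel_K nu (pi * \<bar>x\<bar>)"
     using c(2)[OF elim] co by (intro mult_left_mono) auto
    then show ?case unfolding ReF cs by (simp only: mult_ac)
   qed
  qed
  also have "... = Re (bes_Lam nu (q * bes_star nu q))" unfolding bes_Lam_def by (rule integral_Re[OF i])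
  also have "... <= cmod (bes_Lam nu (q * bes_star nu q))" by (rule complex_Re_le_cmod)
  finally show "cos (nu * pi / 2) * c * bes_sn nu q <= cmod (bes_Lam nu (q * bes_star nu q))" .
 qed
qed

lemma bes_Lam_add: "0 < nu ==> nu <= 1/2 ==> bes_Lam nu (p + q) = bes_Lam nu p + bes_Lam nu q"
 unfolding bes_Lam_def by (simp add: distrib_right Bochner_Integration.integral_add integrable_poly_bes_W)

lemma bes_Lam_smult: "bes_Lam nu (smult a p) = a * bes_Lam nu p"
 unfolding bes_Lam_def by (simp add: mult.assoc)

lemma bes_Lam_sum:
 assumes "0 < nu" "nu <= 1/2" "finite A"
 shows "bes_Lam nu (\<Sum>i\<in>A. f i) = (\<Sum>i\<in>A. bes_Lam nu (f i))"
 using assms(3) by (induction A rule: finite_induct) (simp_all add: bes_Lam_add[OF assms(1,2)], simp add: bes_Lam_def)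

text \<open>Normalized so that \<open>bes_Lam\<close> is a constant multiple of mpI / mpN + bes_E;
  in this scale the squared norm of \<open>mpp (1/4) k\<close> is \<open>rbin (1/2) k\<close>
  without a further constant.\<close>

definition bes_E :: "real => complex poly => complex" where
 "bes_E nu q = (bes_Lam nu q - of_real (1 / (2 * sqrt 2 * pi)) * mpI (1/4) q) / of_real (1 / (2 * sqrt 2 * pi) * mpN (1/4))"

lemma bes_E_add: "0 < nu ==> nu <= 1/2 ==> bes_E nu (p + q) = bes_E nu p + bes_E nu q"
 unfolding bes_E_def by (simp add: bes_Lam_add mpI_add algebra_simps add_divide_distrib diff_divide_distrib)

lemma bes_E_smult: "bes_E nu (smult a p) = a * bes_E nu p"
 unfolding bes_E_def by (simp add: bes_Lam_smult mpI_smult algebra_simps diff_divide_distrib)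

lemma bes_E_sum:
 assumes "0 < nu" "nu <= 1/2" "finite A"
 shows "bes_E nu (\<Sum>i\<in>A. f i) = (\<Sum>i\<in>A. bes_E nu (f i))"
 using assms(3)
proof (induction A rule: finite_induct)
 case empty
 show ?case using bes_E_smult[of nu 0 0] by simp
next
 case (insert x A)
 then show ?case by (simp add: bes_E_add[OF assms(1,2)])
qed

lemma bes_E_bound:
 assumes "0 < nu" "nu <= 1/2" "0 < kappa" "kappa <= nu / 2"
 obtains C where "C > 0"
  "!!q M. (!!X. \<bar>Re X\<bar> <= 1 ==> \<bar>Im X - nu / 2\<bar> <= kappa ==> cmod (poly q X) <= M) ==>
   cmod (bes_E nu q) <= C * ((LBINT x. cmod (poly q (of_real x + of_real (nu / 2) * \<i>)) * bes_wt x) + M)"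
proof (rule bes_Lam_mpI[OF assms])
 fix C :: real
 assume C: "C > 0"
  "!!q M. (!!X. \<bar>Re X\<bar> <= 1 ==> \<bar>Im X - nu / 2\<bar> <= kappa ==> cmod (poly q X) <= M) ==>
   cmod (bes_Lam nu q - of_real (1 / (2 * sqrt 2 * pi)) * mpI (1/4) q)
    <= C * ((LBINT x. cmod (poly q (of_real x + of_real (nu / 2) * \<i>)) * bes_wt x) + M)"
 define K where "K = 1 / (2 * sqrt 2 * pi) * mpN (1/4)"
 have K: "K > 0" using mpN_pos[of "1/4"] by (simp add: K_def)
 show ?thesis
 proof (rule that[of "C / K"])
  show "C / K > 0" using C K by simp
  fix q M assume M: "!!X. \<bar>Re X\<bar> <= 1 ==> \<bar>Im X - nu / 2\<bar> <= kappa ==> cmod (poly q X) <= M"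
  have "cmod (bes_E nu q) = cmod (bes_Lam nu q - of_real (1 / (2 * sqrt 2 * pi)) * mpI (1/4) q) / K"
   unfolding bes_E_def K_def[symmetric] norm_divide norm_of_real using K by simp
  also have "... <= C * ((LBINT x. cmod (poly q (of_real x + of_real (nu / 2) * \<i>)) * bes_wt x) + M) / K"
   using C(2)[OF M] K by (intro divide_right_mono) auto
  finally show "cmod (bes_E nu q) <= C / K * ((LBINT x. cmod (poly q (of_real x + of_real (nu / 2) * \<i>)) * bes_wt x) + M)" by simp
 qed
qed

lemma wt_integral_CS:
 assumes "!!x. a x * bes_wt x <= sqrt (u x) * sqrt (v x)" "!!x. a x >= 0" "!!x. u x >= 0" "!!x. v x >= 0"
  and "integrable lborel (%x. (cmod (poly f (of_real x + c)))^2 * u x)" "integrable lborel (%x. (cmod (poly g (of_real x + c)))^2 * v x)"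
  and "integrable lborel (%x. a x * cmod (poly (f * g) (of_real x + c)) * bes_wt x)"
 shows "(LBINT x. a x * cmod (poly (f * g) (of_real x + c)) * bes_wt x)
  <= sqrt (LBINT x. (cmod (poly f (of_real x + c)))^2 * u x) * sqrt (LBINT x. (cmod (poly g (of_real x + c)))^2 * v x)"
proof (rule integral_Cauchy_Schwarz[OF assms(5,6,7)])
 fix x
 let ?f = "cmod (poly f (of_real x + c))" and ?g = "cmod (poly g (of_real x + c))"
 have "a x * cmod (poly (f * g) (of_real x + c)) * bes_wt x = (?f * ?g) * (a x * bes_wt x)" by (simp add: norm_mult mult_ac)
 also have "... <= (?f * ?g) * (sqrt (u x) * sqrt (v x))" by (intro mult_left_mono assms) auto
 also have "... = sqrt (?f^2 * u x) * sqrt (?g^2 * v x)" by (simp add: real_sqrt_mult mult_ac)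
 finally show "a x * cmod (poly (f * g) (of_real x + c)) * bes_wt x <= sqrt (?f^2 * u x) * sqrt (?g^2 * v x)" .
qed (use assms in auto)

text \<open>Each factor \<open>mpp (1/4) m\<close> contributes (m + 1)^(-1/2) under the error
  functional, up to powers of \<open>kappa\<close>. In the third bound multiplication by X uses up
  the factor 1 / (1 + |x|), and two full norms remain. The last bound passes from coefficients on
  the real line to the norm on Im X = nu/2 and costs n^(nu/2).\<close>

lemma bes_key_bounds:
 assumes nu: "0 < nu" "nu <= 1/2" and kap: "0 < kappa" "kappa <= nu / 2"
 obtains C where "C > 0"
  "!!m k. cmod (bes_E nu (mpp (1/4) m * mpp (1/4) k)) <= C * (real m + 1) powr (3 * kappa - 1/2) * (real k + 1) powr (3 * kappa - 1/2)"
  "!!m n f. degree f < n ==> cmod (bes_E nu (mpp (1/4) m * f)) <= C * (real m + 1) powr (3 * kappa - 1/2) * (real n + 1) powr (3 * kappa) * sqrt (bes_sn nu f)"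
  "!!n f g. degree f < n ==> degree g < n ==> cmod (bes_E nu ([:0, 1:] * f * g)) <= C * (real n + 1) powr (6 * kappa) * sqrt (bes_sn nu f) * sqrt (bes_sn nu g)"
  "!!n. sqrt (bes_sn nu (mpp (1/4) n)) <= C * (real n + 1) powr (kappa / 2 - 1/4)"
  "!!n beta. sqrt (bes_sn nu (\<Sum>k<n. smult (beta k) (mpp (1/4) k))) <= C * (real n + 1) powr (nu / 2 + kappa) * sqrt (\<Sum>k<n. (cmod (beta k))^2 * rbin (1/2) k)"
proof -
 let ?L = "%x. of_real x + of_real (nu / 2) * \<i>"
 have k1: "kappa <= 1/4" "kappa <= 1" "nu / 2 <= 1/4" "0 < nu / 2" "nu / 2 <= 1" using assms by auto
 obtain CE where CE: "CE > 0" "!!q M. (!!X. \<bar>Re X\<bar> <= 1 ==> \<bar>Im X - nu / 2\<bar> <= kappa ==> cmod (poly q X) <= M) ==>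
   cmod (bes_E nu q) <= CE * ((LBINT x. cmod (poly q (?L x)) * bes_wt x) + M)"
  by (rule bes_E_bound[OF assms]) blast
 obtain CS where CS: "CS > 0" "!!n q X. degree q < n ==> \<bar>Re X\<bar> <= 1 ==> \<bar>Im X - nu / 2\<bar> <= kappa ==>
  cmod (poly q X) <= CS * (real n + 1) powr (3 * kappa) * sqrt (bes_sn nu q)"
  by (rule bes_sup_bound[OF kap(1) k1(2)]) blast
 obtain CN where CN: "CN > 0" "!!n. (LBINT x. (cmod (mp (1/4) n (?L x)))^2 * mpw kappa x) <= CN * (real n + 1) powr (4 * kappa - 1)"
  by (rule mp_shift_norm_near[OF k1(4,3) kap(1) k1(1)]) blast
 obtain CF where CF: "CF > 0" "!!n. (LBINT x. (cmod (mp (1/4) n (?L x)))^2 * mpw (1/4) x) <= CF * (real n + 1) powr (kappa - 1/2)"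
  by (rule mp_shift_norm_full[OF k1(4,3) kap(1)]) blast
 obtain CT where CT: "CT > 0" "!!n beta. (LBINT x. (cmod (\<Sum>k<n. beta k * mp (1/4) k (?L x)))^2 * mpw (1/4) x)
   <= CT * (real n + 1) powr (2 * (nu / 2 + kappa)) * (\<Sum>k<n. (cmod (beta k))^2 * rbin (1/2) k)"
  by (rule mp_shift_transfer[OF k1(4,5) kap(1)]) blast
 obtain D where D: "D > 0" "!!x. bes_wt x <= D * mpw kappa x"
  by (rule mpw_decay_compare[OF kap(1) k1(2)]) (auto simp: bes_wt_def)
 \<comment> \<open>Pointwise growth of the \<open>mpp\<close> on the box: the exponent is nu/2 + 3
   kappa - 3/4, at most 3 kappa - 1/2 because nu \<le> 1/2.\<close>
 have al: "0 < 1/4 - nu/2 + kappa" "0 < nu + 2 * kappa" "0 < (1/4 - nu/2 + kappa) + (nu + 2 * kappa)" using k1 kap by linarith+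
 obtain CP where CP: "CP > 0" "!!X n. cmod X <= 2 ==> 1/4 - Im X <= 1/4 - nu/2 + kappa ==> 2 * Im X <= nu + 2 * kappa ==>
   cmod (mp (1/4) n X) <= CP * rbin ((1/4 - nu/2 + kappa) + (nu + 2 * kappa)) n"
  by (rule mp_pointwise_bound[OF al(1,2), of 2 "1/4"]) auto
 obtain CR where CR: "CR > 0" "!!k. rbin ((1/4 - nu/2 + kappa) + (nu + 2 * kappa)) k <= CR * (real k + 1) powr ((1/4 - nu/2 + kappa) + (nu + 2 * kappa) - 1)"
  by (rule rbin_le_powr[OF al(3)]) blast
 have X2: "cmod X <= 2" if "\<bar>Re X\<bar> <= 1" "\<bar>Im X - nu / 2\<bar> <= kappa" for X
  using cmod_le[of X] that k1 by linarith
 have pw: "(real n + 1) powr a <= (real n + 1) powr b" if "a <= b" for n a b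
  using that by (intro powr_mono) auto
 have pp: "cmod (poly (mpp (1/4) n) X) <= CP * CR * (real n + 1) powr (3 * kappa - 1/2)" if "\<bar>Re X\<bar> <= 1" "\<bar>Im X - nu / 2\<bar> <= kappa" for n X
 proof -
  have "cmod (mp (1/4) n X) <= CP * rbin ((1/4 - nu/2 + kappa) + (nu + 2 * kappa)) n"
   by (rule CP(2)) (use that X2[OF that] in linarith)+
  also have "... <= CP * (CR * (real n + 1) powr ((1/4 - nu/2 + kappa) + (nu + 2 * kappa) - 1))" using CP(1) CR(2) by (intro mult_left_mono) auto
  also have "... <= CP * (CR * (real n + 1) powr (3 * kappa - 1/2))" using CP(1) CR(1) k1 by (intro mult_left_mono pw) auto
  finally show ?thesis by (simp add: mpp(3))
 qed
 have wle: "bes_wt x <= mpw (1/4) x" for x unfolding bes_wt_def by (simp add: divide_le_eq distrib_left)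
 have sn: "(LBINT x. (cmod (poly (mpp (1/4) n) (?L x)))^2 * (D * mpw kappa x)) <= D * CN * (real n + 1) powr (4 * kappa - 1)" for n
 proof -
  have "(LBINT x. (cmod (poly (mpp (1/4) n) (?L x)))^2 * (D * mpw kappa x)) = D * (LBINT x. (cmod (mp (1/4) n (?L x)))^2 * mpw kappa x)"
   unfolding mpp(3) mult.left_commute[of _ D] by simp
  also have "... <= D * (CN * (real n + 1) powr (4 * kappa - 1))" using D(1) CN(2) by (intro mult_left_mono) auto
  finally show ?thesis by simp
 qed
 have sn': "sqrt (LBINT x. (cmod (poly (mpp (1/4) n) (?L x)))^2 * (D * mpw kappa x)) <= sqrt (D * CN) * (real n + 1) powr (3 * kappa - 1/2)" for n
 proof -
  have "sqrt (LBINT x. (cmod (poly (mpp (1/4) n) (?L x)))^2 * (D * mpw kappa x)) <= sqrt (D * CN * (real n + 1) powr (4 * kappa - 1))"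
   by (intro real_sqrt_le_mono sn)
  also have "... = sqrt (D * CN) * (real n + 1) powr ((4 * kappa - 1) / 2)" by (simp add: real_sqrt_mult powr_half_sqrt_powr)
  also have "... <= sqrt (D * CN) * (real n + 1) powr (3 * kappa - 1/2)" using D CN kap by (intro mult_left_mono pw) auto
  finally show ?thesis .
 qed
 have iD: "integrable lborel (%x. (cmod (poly q (?L x)))^2 * (D * mpw kappa x))" for q
  unfolding mult.left_commute[of _ D] using kap k1 by (intro integrable_mult_right integrable_cmod_poly_sq) auto
 have iq: "integrable lborel (%x. (cmod (poly q (?L x)))^2 * mpw (1/4) x)" for q by (rule integrable_cmod_poly_sq) auto
 have dk0: "D * mpw kappa x >= 0" for x using D(1) by simp
 define C where "C = CE * (D * CN + (CP * CR)^2) + CE * (sqrt (D * CN) + CP * CR * CS) + CE * (1 + 2 * CS^2) + sqrt CF + sqrt CT"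
 have parts: "0 < CE * (D * CN + (CP * CR)^2)" "0 < CE * (sqrt (D * CN) + CP * CR * CS)" "0 < CE * (1 + 2 * CS^2)" "0 < sqrt CF" "0 < sqrt CT"
  using CE(1) D(1) CN(1) CP(1) CR(1) CS(1) CF(1) CT(1) by (auto intro!: mult_pos_pos add_pos_pos add_pos_nonneg)
 have le: "CE * (D * CN + (CP * CR)^2) <= C" "CE * (sqrt (D * CN) + CP * CR * CS) <= C" "CE * (1 + 2 * CS^2) <= C" "sqrt CF <= C" "sqrt CT <= C" and C0: "C > 0"
  using parts unfolding C_def by linarith+
 show ?thesis
 proof (rule that[OF C0])
  fix m k
  let ?P = "(real m + 1) powr (3 * kappa - 1/2) * (real k + 1) powr (3 * kappa - 1/2)"
  have "(LBINT x. 1 * cmod (poly (mpp (1/4) m * mpp (1/4) k) (?L x)) * bes_wt x)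
    <= sqrt (LBINT x. (cmod (poly (mpp (1/4) m) (?L x)))^2 * (D * mpw kappa x)) * sqrt (LBINT x. (cmod (poly (mpp (1/4) k) (?L x)))^2 * (D * mpw kappa x))"
  proof (rule wt_integral_CS)
   show "1 * bes_wt x <= sqrt (D * mpw kappa x) * sqrt (D * mpw kappa x)" for x using D(2)[of x] dk0[of x] by simp
   show "integrable lborel (%x. 1 * cmod (poly (mpp (1/4) m * mpp (1/4) k) (?L x)) * bes_wt x)"
    using integrable_cmod_poly_wt[of "mpp (1/4) m * mpp (1/4) k"] by simp
  qed (use dk0 iD in auto)
  also have "... <= (sqrt (D * CN) * (real m + 1) powr (3 * kappa - 1/2)) * (sqrt (D * CN) * (real k + 1) powr (3 * kappa - 1/2))"
   using D CN by (intro mult_mono sn') (auto intro!: integral_nonneg_AE)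
  also have "... = (sqrt (D * CN) * sqrt (D * CN)) * ?P" by simp
  also have "sqrt (D * CN) * sqrt (D * CN) = D * CN" using D CN by simp
  finally have 1: "(LBINT x. cmod (poly (mpp (1/4) m * mpp (1/4) k) (?L x)) * bes_wt x) <= D * CN * ?P" by simp
  have 2: "cmod (poly (mpp (1/4) m * mpp (1/4) k) X) <= (CP * CR)^2 * ?P" if "\<bar>Re X\<bar> <= 1" "\<bar>Im X - nu / 2\<bar> <= kappa" for X
  proof -
   have "cmod (poly (mpp (1/4) m * mpp (1/4) k) X) <= (CP * CR * (real m + 1) powr (3 * kappa - 1/2)) * (CP * CR * (real k + 1) powr (3 * kappa - 1/2))"
    unfolding poly_mult norm_mult using CP CR by (intro mult_mono pp that) auto
   then show ?thesis by (simp add: power2_eq_square mult_ac)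
  qed
  have "cmod (bes_E nu (mpp (1/4) m * mpp (1/4) k)) <= CE * ((LBINT x. cmod (poly (mpp (1/4) m * mpp (1/4) k) (?L x)) * bes_wt x) + (CP * CR)^2 * ?P)"
   by (rule CE(2)[OF 2])
  also have "... <= CE * (D * CN * ?P + (CP * CR)^2 * ?P)" using 1 CE(1) by (intro mult_left_mono add_right_mono) auto
  also have "... = CE * (D * CN + (CP * CR)^2) * ?P" by (simp add: algebra_simps)
  also have "... <= C * ?P" by (intro mult_right_mono le) auto
  finally show "cmod (bes_E nu (mpp (1/4) m * mpp (1/4) k)) <= C * (real m + 1) powr (3 * kappa - 1/2) * (real k + 1) powr (3 * kappa - 1/2)" by (simp only: mult.assoc)
 next
  fix m n :: nat and f :: "complex poly" assume f: "degree f < n"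
  let ?s = "sqrt (bes_sn nu f)" and ?A = "(real m + 1) powr (3 * kappa - 1/2)" and ?B = "(real n + 1) powr (3 * kappa)"
  have s0: "?s >= 0" by (simp add: bes_sn_nonneg)
  have B1: "1 <= ?B" using kap by (intro ge_one_powr_ge_zero) auto
  have "(LBINT x. 1 * cmod (poly (mpp (1/4) m * f) (?L x)) * bes_wt x)
    <= sqrt (LBINT x. (cmod (poly (mpp (1/4) m) (?L x)))^2 * (D * mpw kappa x)) * sqrt (LBINT x. (cmod (poly f (?L x)))^2 * mpw (1/4) x)"
  proof (rule wt_integral_CS)
   fix x
   \<comment> \<open>Geometric mean of the two bounds of the weight: only \<open>mpp (1/4) m\<close>
     profits from the smaller one, while \<open>f\<close> keeps its norm
     \<open>bes_sn\<close>.\<close>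
   have "(bes_wt x)^2 <= (D * mpw kappa x) * mpw (1/4) x"
    unfolding power2_eq_square using D(2) wle dk0 by (intro mult_mono) auto
   then have "bes_wt x <= sqrt ((D * mpw kappa x) * mpw (1/4) x)" by (rule real_le_rsqrt)
   then show "1 * bes_wt x <= sqrt (D * mpw kappa x) * sqrt (mpw (1/4) x)" by (simp only: real_sqrt_mult mult_1_left)
  next
   show "integrable lborel (%x. 1 * cmod (poly (mpp (1/4) m * f) (?L x)) * bes_wt x)"
    using integrable_cmod_poly_wt[of "mpp (1/4) m * f"] by simp
  qed (use dk0 iD iq in auto)
  also have "... <= (sqrt (D * CN) * ?A) * ?s"
   unfolding bes_sn_def by (intro mult_right_mono sn') auto
  also have "... <= (sqrt (D * CN) * ?A) * (?B * ?s)"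
   using D CN mult_right_mono[OF B1 s0] by (intro mult_left_mono) auto
  finally have 1: "(LBINT x. cmod (poly (mpp (1/4) m * f) (?L x)) * bes_wt x) <= (sqrt (D * CN) * ?A) * (?B * ?s)" by simp
  have 2: "cmod (poly (mpp (1/4) m * f) X) <= (CP * CR * ?A) * (CS * ?B * ?s)" if "\<bar>Re X\<bar> <= 1" "\<bar>Im X - nu / 2\<bar> <= kappa" for X
   unfolding poly_mult norm_mult using CP CR by (intro mult_mono pp that CS(2)[OF f]) auto
  have "cmod (bes_E nu (mpp (1/4) m * f)) <= CE * ((LBINT x. cmod (poly (mpp (1/4) m * f) (?L x)) * bes_wt x) + (CP * CR * ?A) * (CS * ?B * ?s))"
   by (rule CE(2)[OF 2])
  also have "... <= CE * ((sqrt (D * CN) * ?A) * (?B * ?s) + (CP * CR * ?A) * (CS * ?B * ?s))" using 1 CE(1) by (intro mult_left_mono add_right_mono) auto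
  also have "... = CE * (sqrt (D * CN) + CP * CR * CS) * (?A * ?B * ?s)" by (simp add: algebra_simps)
  also have "... <= C * (?A * ?B * ?s)" using s0 by (intro mult_right_mono le) auto
  finally show "cmod (bes_E nu (mpp (1/4) m * f)) <= C * ?A * ?B * ?s" by (simp only: mult.assoc)
 next
  fix n :: nat and f g :: "complex poly" assume f: "degree f < n" and g: "degree g < n"
  let ?s = "sqrt (bes_sn nu f)" and ?t = "sqrt (bes_sn nu g)" and ?B = "(real n + 1) powr (3 * kappa)"
  have s0: "?s >= 0" "?t >= 0" by (simp_all add: bes_sn_nonneg)
  have BB: "?B * ?B = (real n + 1) powr (6 * kappa)" by (simp flip: powr_add)
  have B1: "1 <= (real n + 1) powr (6 * kappa)" using kap by (intro ge_one_powr_ge_zero) auto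
  have Y: "cmod (poly ([:0, 1:] * f * g) X) = cmod X * cmod (poly (f * g) X)" for X by (simp add: norm_mult)
  have "(LBINT x. cmod (?L x) * cmod (poly (f * g) (?L x)) * bes_wt x)
    <= sqrt (LBINT x. (cmod (poly f (?L x)))^2 * mpw (1/4) x) * sqrt (LBINT x. (cmod (poly g (?L x)))^2 * mpw (1/4) x)"
  proof (rule wt_integral_CS)
   fix x
   have "cmod (?L x) <= 1 + \<bar>x\<bar>" using cmod_le[of "?L x"] k1 by simp
   then have "cmod (?L x) * bes_wt x <= (1 + \<bar>x\<bar>) * bes_wt x" by (rule mult_right_mono) simp
   also have "... = mpw (1/4) x" by (simp add: bes_wt_def)
   finally show "cmod (?L x) * bes_wt x <= sqrt (mpw (1/4) x) * sqrt (mpw (1/4) x)" by simp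
  next
   show "integrable lborel (%x. cmod (?L x) * cmod (poly (f * g) (?L x)) * bes_wt x)"
    using integrable_cmod_poly_wt[of "[:0, 1:] * f * g" "of_real (nu / 2) * \<i>"] unfolding Y .
  qed (use iq in auto)
  then have 1: "(LBINT x. cmod (poly ([:0, 1:] * f * g) (?L x)) * bes_wt x) <= ?s * ?t" unfolding Y bes_sn_def .
  have 2: "cmod (poly ([:0, 1:] * f * g) X) <= 2 * ((CS * ?B * ?s) * (CS * ?B * ?t))" if "\<bar>Re X\<bar> <= 1" "\<bar>Im X - nu / 2\<bar> <= kappa" for X
  proof -
   have "cmod (poly (f * g) X) <= (CS * ?B * ?s) * (CS * ?B * ?t)"
    unfolding poly_mult norm_mult using CS(1) s0 by (intro mult_mono that CS(2)[OF f] CS(2)[OF g] mult_nonneg_nonneg) auto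
   then show ?thesis unfolding Y by (intro mult_mono X2 that) auto
  qed
  have "cmod (bes_E nu ([:0, 1:] * f * g)) <= CE * ((LBINT x. cmod (poly ([:0, 1:] * f * g) (?L x)) * bes_wt x) + 2 * ((CS * ?B * ?s) * (CS * ?B * ?t)))"
   by (rule CE(2)[OF 2])
  also have "... <= CE * ((real n + 1) powr (6 * kappa) * (?s * ?t) + 2 * ((CS * ?B * ?s) * (CS * ?B * ?t)))"
   using order_trans[OF 1, of "(real n + 1) powr (6 * kappa) * (?s * ?t)"] mult_right_mono[OF B1 mult_nonneg_nonneg[OF s0]] CE(1)
   by (intro mult_left_mono add_right_mono) auto
  also have "... = CE * (1 + 2 * CS^2) * ((real n + 1) powr (6 * kappa) * ?s * ?t)"
   unfolding BB[symmetric] by (simp add: algebra_simps power2_eq_square)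
  also have "... <= C * ((real n + 1) powr (6 * kappa) * ?s * ?t)" using s0 by (intro mult_right_mono le) auto
  finally show "cmod (bes_E nu ([:0, 1:] * f * g)) <= C * (real n + 1) powr (6 * kappa) * ?s * ?t" by (simp only: mult.assoc)
 next
  fix n
  have "sqrt (bes_sn nu (mpp (1/4) n)) <= sqrt (CF * (real n + 1) powr (kappa - 1/2))"
   unfolding bes_sn_def mpp(3) by (intro real_sqrt_le_mono CF(2))
  also have "... = sqrt CF * (real n + 1) powr ((kappa - 1/2) / 2)" by (simp add: real_sqrt_mult powr_half_sqrt_powr)
  also have "(kappa - 1/2) / 2 = kappa / 2 - 1/4" by simp
  also have "sqrt CF * (real n + 1) powr (kappa / 2 - 1/4) <= C * (real n + 1) powr (kappa / 2 - 1/4)" by (intro mult_right_mono le) auto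
  finally show "sqrt (bes_sn nu (mpp (1/4) n)) <= C * (real n + 1) powr (kappa / 2 - 1/4)" .
 next
  fix n beta
  let ?N = "\<Sum>k<n. (cmod (beta k))^2 * rbin (1/2) k"
  have N0: "?N >= 0" by (intro sum_nonneg mult_nonneg_nonneg rbin_nonneg) auto
  have "sqrt (bes_sn nu (\<Sum>k<n. smult (beta k) (mpp (1/4) k))) <= sqrt (CT * (real n + 1) powr (2 * (nu / 2 + kappa)) * ?N)"
   unfolding bes_sn_def poly_sum poly_smult mpp(3) by (intro real_sqrt_le_mono CT(2))
  also have "... = sqrt CT * (real n + 1) powr (nu / 2 + kappa) * sqrt ?N"
  proof -
   have "sqrt ((real n + 1) powr (2 * (nu / 2 + kappa))) = (real n + 1) powr (2 * (nu / 2 + kappa) / 2)"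
    by (rule powr_half_sqrt_powr[symmetric]) simp
   moreover have "2 * (nu / 2 + kappa) / 2 = nu / 2 + kappa" by simp
   ultimately show ?thesis by (simp only: real_sqrt_mult)
  qed
  also have "... <= C * (real n + 1) powr (nu / 2 + kappa) * sqrt ?N" using N0 by (intro mult_right_mono le) auto
  finally show "sqrt (bes_sn nu (\<Sum>k<n. smult (beta k) (mpp (1/4) k))) <= C * (real n + 1) powr (nu / 2 + kappa) * sqrt ?N" .
 qed
qed

section \<open>Zeros of perturbed polynomials\<close>

definition bes_orth :: "real => nat => complex poly => bool" where
 "bes_orth nu n Q \<longleftrightarrow> (\<forall>g. degree g < n \<longrightarrow> bes_Lam nu (Q * g) = 0)"

lemma mpp_span:
 assumes "degree g < n"
 obtains c where "g = (\<Sum>k<n. smult (c k) (mpp l k))"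
proof -
 obtain c where c: "!!X. poly g X = (\<Sum>k<n. c k * mp l k X)" by (rule mp_span[OF assms, where l = l]) blast
 have "poly g = poly (\<Sum>k<n. smult (c k) (mpp l k))"
  unfolding fun_eq_iff poly_sum poly_smult mpp(3) using c by blast
 then show ?thesis using that by (simp only: poly_eq_poly_eq_iff)
qed

lemma mpI_mpp_sum:
 "mpI (1/4) (mpp (1/4) m * (\<Sum>k<n. smult (c k) (mpp (1/4) k))) = (if m < n then c m * of_real (mpN (1/4) * rbin (1/2) m) else 0)"
proof -
 have "mpI (1/4) (mpp (1/4) m * (\<Sum>k<n. smult (c k) (mpp (1/4) k))) = (\<Sum>k<n. c k * mpI (1/4) (mpp (1/4) m * mpp (1/4) k))"
  unfolding sum_distrib_left mult_smult_right by (simp add: mpI_sum mpI_smult)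
 also have "... = (\<Sum>k<n. if k = m then c m * of_real (mpN (1/4) * rbin (1/2) m) else 0)"
 proof (intro sum.cong refl)
  fix k
  show "c k * mpI (1/4) (mpp (1/4) m * mpp (1/4) k) = (if k = m then c m * of_real (mpN (1/4) * rbin (1/2) m) else 0)"
   using mp_orth[of "1/4" m k] mp_norm[of "1/4" m] by auto
 qed
 also have "... = (if m < n then c m * of_real (mpN (1/4) * rbin (1/2) m) else 0)" by (simp add: sum.delta)
 finally show ?thesis .
qed

definition bes_c0 :: real where
 "bes_c0 = 1 / (2 * sqrt 2 * pi) * mpN (1/4)"

lemma bes_c0_pos: "bes_c0 > 0"
 using mpN_pos[of "1/4"] by (simp add: bes_c0_def)

lemma bes_Lam_E: "bes_Lam nu q = of_real (1 / (2 * sqrt 2 * pi)) * mpI (1/4) q + of_real bes_c0 * bes_E nu q"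
 using bes_c0_pos unfolding bes_E_def bes_c0_def[symmetric] by simp

text \<open>A Galerkin argument: orthogonality is tested with the reflection of R. As
  \<open>mpp (1/4) n\<close> is mpI-orthogonal to lower degrees, bes_Lam of R times its reflection
  equals, up to sign, a multiple of the error functional with \<open>mpp (1/4) n\<close> in place of
  R. Coercivity bounds the former below by the squared norm, and one power of the norm
  cancels.\<close>

lemma bes_remainder_norm:
 assumes nu: "0 < nu" "nu <= 1/2" and kap: "0 < kappa" "kappa <= nu / 2"
 obtains C where "C > 0" "!!n R. degree R < n ==> bes_orth nu n (mpp (1/4) n + R) ==> sqrt (bes_sn nu R) <= C * (real n + 1) powr (6 * kappa - 1/2)"
proof -
 obtain CK where CK: "CK > 0" "!!m n f. degree f < n ==> cmod (bes_E nu (mpp (1/4) m * f)) <= CK * (real m + 1) powr (3 * kappa - 1/2) * (real n + 1) powr (3 * kappa) * sqrt (bes_sn nu f)"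
  by (rule bes_key_bounds[OF assms]) blast
 obtain c where c: "c > 0" "!!q. c * bes_sn nu q <= cmod (bes_Lam nu (q * bes_star nu q))" by (rule bes_Lam_coercive[OF nu]) blast
 show ?thesis
 proof (rule that[of "bes_c0 * CK / c"])
  show "bes_c0 * CK / c > 0" using bes_c0_pos CK c by simp
  fix n and R :: "complex poly" assume R: "degree R < n" and o: "bes_orth nu n (mpp (1/4) n + R)"
  define S where "S = bes_star nu R"
  define r where "r = sqrt (bes_sn nu R)"
  have r0: "r >= 0" and r2: "bes_sn nu R = r * r" by (simp_all add: r_def bes_sn_nonneg)
  have S: "degree S < n" "sqrt (bes_sn nu S) = r" using bes_star_props[of nu R] R by (auto simp: S_def r_def)
  have "bes_Lam nu ((mpp (1/4) n + R) * S) = 0" using o S unfolding bes_orth_def by blast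
  then have "bes_Lam nu (mpp (1/4) n * S) + bes_Lam nu (R * S) = 0" by (simp only: distrib_right bes_Lam_add[OF nu])
  then have 1: "cmod (bes_Lam nu (R * S)) = cmod (bes_Lam nu (mpp (1/4) n * S))" by (metis add_eq_0_iff norm_minus_cancel)
  obtain e where e: "S = (\<Sum>k<n. smult (e k) (mpp (1/4) k))" using mpp_span[OF S(1)] by metis
  have "mpI (1/4) (mpp (1/4) n * S) = 0" unfolding e mpI_mpp_sum by simp
  then have 2: "cmod (bes_Lam nu (mpp (1/4) n * S)) = bes_c0 * cmod (bes_E nu (mpp (1/4) n * S))"
   using bes_c0_pos unfolding bes_Lam_E by (simp add: norm_mult)
  have "c * (r * r) <= bes_c0 * cmod (bes_E nu (mpp (1/4) n * S))" using c(2)[of R] unfolding r2 S_def[symmetric] 1 2 .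
  also have "... <= bes_c0 * (CK * (real n + 1) powr (3 * kappa - 1/2) * (real n + 1) powr (3 * kappa) * r)"
   using CK(2)[OF S(1), of n] bes_c0_pos unfolding S(2) by (intro mult_left_mono) auto
  also have "... = (bes_c0 * CK * (real n + 1) powr (6 * kappa - 1/2)) * r"
  proof -
   have "(real n + 1) powr (6 * kappa - 1/2) = (real n + 1) powr (3 * kappa - 1/2) * (real n + 1) powr (3 * kappa)" by (simp flip: powr_add)
   then show ?thesis by simp
  qed
  finally have "(c * r) * r <= (bes_c0 * CK * (real n + 1) powr (6 * kappa - 1/2)) * r" by simp
  then have "c * r <= bes_c0 * CK * (real n + 1) powr (6 * kappa - 1/2) \<or> r = 0" using r0 by (auto simp: mult_le_cancel_right)
  then have "r <= bes_c0 * CK / c * (real n + 1) powr (6 * kappa - 1/2)"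
   using c(1) CK(1) bes_c0_pos by (auto simp: pos_le_divide_eq mult_ac)
  then show "sqrt (bes_sn nu R) <= bes_c0 * CK / c * (real n + 1) powr (6 * kappa - 1/2)" unfolding r_def .
 qed
qed

text \<open>Only m = n - 1 and m = n occur, as in the two boundary terms of Christoffel-Darboux. The
  leading term and the remainder both contribute n^(-1) up to powers of
  \<open>kappa\<close>.\<close>

lemma bes_E_mpp_bound:
 assumes nu: "0 < nu" "nu <= 1/2" and kap: "0 < kappa" "kappa <= nu / 2" "kappa <= 1/6"
 obtains C where "C > 0" "!!m n R. degree R < n ==> bes_orth nu n (mpp (1/4) n + R) ==> m <= n ==> n <= m + 1 ==>
  cmod (bes_E nu ((mpp (1/4) n + R) * mpp (1/4) m)) <= C * (real n + 1) powr (12 * kappa - 1)"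
proof -
 obtain CK where CK: "CK > 0"
  "!!m k. cmod (bes_E nu (mpp (1/4) m * mpp (1/4) k)) <= CK * (real m + 1) powr (3 * kappa - 1/2) * (real k + 1) powr (3 * kappa - 1/2)"
  "!!m n f. degree f < n ==> cmod (bes_E nu (mpp (1/4) m * f)) <= CK * (real m + 1) powr (3 * kappa - 1/2) * (real n + 1) powr (3 * kappa) * sqrt (bes_sn nu f)"
  by (rule bes_key_bounds[OF nu kap(1,2)]) blast
 obtain C1 where C1: "C1 > 0" "!!n R. degree R < n ==> bes_orth nu n (mpp (1/4) n + R) ==> sqrt (bes_sn nu R) <= C1 * (real n + 1) powr (6 * kappa - 1/2)"
  by (rule bes_remainder_norm[OF nu kap(1,2)]) blast
 show ?thesis
 proof (rule that[of "2 * CK + 2 * CK * C1"])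
  show "2 * CK + 2 * CK * C1 > 0" using CK C1 by (simp add: add_pos_pos)
  fix m n and R :: "complex poly"
  assume R: "degree R < n" and o: "bes_orth nu n (mpp (1/4) n + R)" and mn: "m <= n" "n <= m + 1"
  define P where "P a = (real n + 1) powr a" for a
  have P0: "P a >= 0" and PP: "P a * P b = P (a + b)" for a b by (simp_all add: P_def powr_add)
  have Pm: "P a <= P b" if "a <= b" for a b using that by (auto simp: P_def intro!: powr_mono)
  \<comment> \<open>Since m + 1 \<ge> (n + 1) / 2 and the exponent lies between -1/2 and 0, the
    comparison costs at most a factor 2.\<close>
  have m2: "(real m + 1) powr (3 * kappa - 1/2) <= 2 * P (3 * kappa - 1/2)"
  proof -
   have "(x / 2) powr a = x powr a * 2 powr (- a)" if "x >= 0" for x a :: real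
    using that by (simp add: powr_divide powr_minus inverse_eq_divide)
   from this[of "real n + 1"] have half: "((real n + 1) / 2) powr a = P a * 2 powr (- a)" for a unfolding P_def by simp
   have "(real m + 1) powr (3 * kappa - 1/2) <= ((real n + 1) / 2) powr (3 * kappa - 1/2)"
    using mn kap by (intro powr_mono2') auto
   also have "... = P (3 * kappa - 1/2) * 2 powr (- (3 * kappa - 1/2))" by (rule half)
   also have "... <= P (3 * kappa - 1/2) * 2 powr 1" using kap P0 by (intro mult_left_mono powr_mono) auto
   finally show ?thesis by simp
  qed
  have "bes_E nu ((mpp (1/4) n + R) * mpp (1/4) m) = bes_E nu (mpp (1/4) n * mpp (1/4) m) + bes_E nu (mpp (1/4) m * R)"
   by (simp only: distrib_right bes_E_add[OF nu] mult.commute[of R])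
  then have "cmod (bes_E nu ((mpp (1/4) n + R) * mpp (1/4) m)) <= cmod (bes_E nu (mpp (1/4) n * mpp (1/4) m)) + cmod (bes_E nu (mpp (1/4) m * R))"
   using norm_triangle_ineq by metis
  also have "... <= CK * P (3 * kappa - 1/2) * (2 * P (3 * kappa - 1/2)) + CK * (2 * P (3 * kappa - 1/2)) * P (3 * kappa) * (C1 * P (6 * kappa - 1/2))"
  proof (rule add_mono)
   show "cmod (bes_E nu (mpp (1/4) n * mpp (1/4) m)) <= CK * P (3 * kappa - 1/2) * (2 * P (3 * kappa - 1/2))"
    using CK(1) P0 by (intro order_trans[OF CK(2)] mult_mono m2) (auto simp: P_def)
   show "cmod (bes_E nu (mpp (1/4) m * R)) <= CK * (2 * P (3 * kappa - 1/2)) * P (3 * kappa) * (C1 * P (6 * kappa - 1/2))"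
    using CK(1) P0 C1(2)[OF R o] m2
    by (intro order_trans[OF CK(3)[OF R]] mult_mono mult_nonneg_nonneg) (auto simp: P_def bes_sn_nonneg)
  qed
  also have "... = 2 * CK * (P (3 * kappa - 1/2) * P (3 * kappa - 1/2)) + 2 * CK * C1 * (P (3 * kappa - 1/2) * P (3 * kappa) * P (6 * kappa - 1/2))"
   by (simp only: mult_ac)
  also have "... <= 2 * CK * P (12 * kappa - 1) + 2 * CK * C1 * P (12 * kappa - 1)"
   unfolding PP using CK(1) C1(1) kap by (intro add_mono mult_left_mono Pm) auto
  finally show "cmod (bes_E nu ((mpp (1/4) n + R) * mpp (1/4) m)) <= (2 * CK + 2 * CK * C1) * (real n + 1) powr (12 * kappa - 1)"
   unfolding P_def by (simp only: distrib_right)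
 qed
qed

lemma bes_sn_add: "sqrt (bes_sn nu (p + q)) <= 2 * (sqrt (bes_sn nu p) + sqrt (bes_sn nu q))"
proof -
 let ?L = "%x. of_real x + of_real (nu / 2) * \<i>"
 have i: "integrable lborel (%x. (cmod (poly f (?L x)))^2 * mpw (1/4) x)" for f by (rule integrable_cmod_poly_sq) auto
 have "bes_sn nu (p + q) <= (LBINT x. 2 * ((cmod (poly p (?L x)))^2 * mpw (1/4) x) + 2 * ((cmod (poly q (?L x)))^2 * mpw (1/4) x))"
  unfolding bes_sn_def
 proof (rule integral_mono[OF i])
  fix x
  have "(cmod (poly (p + q) (?L x)))^2 <= (cmod (poly p (?L x)) + cmod (poly q (?L x)))^2"
   unfolding poly_add by (intro power_mono norm_triangle_ineq) auto
  also have "... <= 2 * (cmod (poly p (?L x)))^2 + 2 * (cmod (poly q (?L x)))^2"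
   using sum_squares_bound[of "cmod (poly p (?L x))" "cmod (poly q (?L x))"] by (simp add: power2_sum)
  finally have "(cmod (poly (p + q) (?L x)))^2 * mpw (1/4) x <= (2 * (cmod (poly p (?L x)))^2 + 2 * (cmod (poly q (?L x)))^2) * mpw (1/4) x"
   by (rule mult_right_mono) simp
  then show "(cmod (poly (p + q) (?L x)))^2 * mpw (1/4) x <= 2 * ((cmod (poly p (?L x)))^2 * mpw (1/4) x) + 2 * ((cmod (poly q (?L x)))^2 * mpw (1/4) x)"
   by (simp only: distrib_right mult.assoc)
 qed (use i in auto)
 also have "... = 2 * bes_sn nu p + 2 * bes_sn nu q" unfolding bes_sn_def using i by simp
 also have "... <= (2 * (sqrt (bes_sn nu p) + sqrt (bes_sn nu q)))^2"
  by (simp add: power2_eq_square algebra_simps bes_sn_nonneg add_increasing2)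
 finally show ?thesis by (intro real_le_lsqrt) (auto simp: bes_sn_nonneg)
qed

text \<open>Duality: for S with the coefficients cnj (e k), the value bes_E(X Q S) is the squared
  norm t^2 of e, while the bilinear bound is linear in t. The norm of S costs n^(nu/2 + kappa) =
  n^(17 kappa); with 6 kappa and kappa/2 from the other factors the total stays below 24
  kappa.\<close>

lemma bes_E_shift_bound:
 assumes nu: "0 < nu" "nu <= 1/2" and kap: "kappa = nu / 32"
 obtains C where "C > 0" "!!n R e. degree R < n ==> bes_orth nu n (mpp (1/4) n + R) ==>
  (!!k. e k = bes_E nu ([:0, 1:] * (mpp (1/4) n + R) * mpp (1/4) k) / of_real (rbin (1/2) k)) ==>
  sqrt (\<Sum>k<n. (cmod (e k))^2 * rbin (1/2) k) <= C * (real n + 1) powr (24 * kappa - 1/4)"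
proof -
 have k: "0 < kappa" "kappa <= nu / 2" "kappa <= 1/64" "nu / 2 = 16 * kappa" using assms by auto
 obtain CK where CK: "CK > 0"
  "!!n f g. degree f < n ==> degree g < n ==> cmod (bes_E nu ([:0, 1:] * f * g)) <= CK * (real n + 1) powr (6 * kappa) * sqrt (bes_sn nu f) * sqrt (bes_sn nu g)"
  "!!n. sqrt (bes_sn nu (mpp (1/4) n)) <= CK * (real n + 1) powr (kappa / 2 - 1/4)"
  "!!n beta. sqrt (bes_sn nu (\<Sum>k<n. smult (beta k) (mpp (1/4) k))) <= CK * (real n + 1) powr (nu / 2 + kappa) * sqrt (\<Sum>k<n. (cmod (beta k))^2 * rbin (1/2) k)"
  by (rule bes_key_bounds[OF nu k(1,2)]) blast
 obtain C1 where C1: "C1 > 0" "!!n R. degree R < n ==> bes_orth nu n (mpp (1/4) n + R) ==> sqrt (bes_sn nu R) <= C1 * (real n + 1) powr (6 * kappa - 1/2)"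
  by (rule bes_remainder_norm[OF nu k(1,2)]) blast
 define C where "C = CK * 2 * (2 * (CK + C1)) * CK"
 show ?thesis
 proof (rule that[of C])
  show "C > 0" using CK C1 by (simp add: C_def add_pos_pos)
  fix n and R :: "complex poly" and e
  assume R: "degree R < n" and o: "bes_orth nu n (mpp (1/4) n + R)"
   and e: "!!k. e k = bes_E nu ([:0, 1:] * (mpp (1/4) n + R) * mpp (1/4) k) / of_real (rbin (1/2) k)"
  define Q where "Q = mpp (1/4) n + R"
  define P where "P a = (real n + 1) powr a" for a
  have P0: "P a >= 0" and PP: "P a * P b = P (a + b)" for a b by (simp_all add: P_def powr_add)
  have Pm: "P a <= P b" if "a <= b" for a b using that by (auto simp: P_def intro!: powr_mono)
  have h: "rbin (1/2) k > 0" for k by (rule rbin_pos) simp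
  define N2 where "N2 = (\<Sum>k<n. (cmod (e k))^2 * rbin (1/2) k)"
  define t where "t = sqrt N2"
  have N0: "N2 >= 0" unfolding N2_def using h by (intro sum_nonneg mult_nonneg_nonneg) (auto intro: less_imp_le)
  then have t: "t >= 0" "t * t = N2" by (auto simp: t_def)
  define S where "S = (\<Sum>k<n. smult (cnj (e k)) (mpp (1/4) k))"
  have dS: "degree S < Suc n"
   unfolding S_def by (intro le_imp_less_Suc degree_sum_le) (auto intro: order_trans[OF degree_smult_le] simp: mpp(1))
  have dQ: "degree Q < Suc n" unfolding Q_def using R by (intro le_imp_less_Suc degree_add_le) (auto simp: mpp(1))
  have "bes_E nu ([:0, 1:] * Q * S) = (\<Sum>k<n. cnj (e k) * bes_E nu ([:0, 1:] * Q * mpp (1/4) k))"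
   unfolding S_def sum_distrib_left mult_smult_right by (simp only: bes_E_sum[OF nu finite_lessThan] bes_E_smult)
  also have "... = of_real N2"
   unfolding N2_def of_real_sum
  proof (intro sum.cong refl)
   fix k
   have "bes_E nu ([:0, 1:] * Q * mpp (1/4) k) = e k * of_real (rbin (1/2) k)" using h[of k] unfolding e Q_def by simp
   then show "cnj (e k) * bes_E nu ([:0, 1:] * Q * mpp (1/4) k) = of_real ((cmod (e k))^2 * rbin (1/2) k)"
    by (simp only: of_real_mult complex_norm_square mult_ac)
  qed
  finally have "N2 = cmod (bes_E nu ([:0, 1:] * Q * S))" using N0 by simp
  also have "... <= CK * (real (Suc n) + 1) powr (6 * kappa) * sqrt (bes_sn nu Q) * sqrt (bes_sn nu S)" by (rule CK(2)[OF dQ dS])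
  also have "... <= CK * (2 * P (6 * kappa)) * (2 * (CK + C1) * P (kappa / 2 - 1/4)) * (CK * P (17 * kappa) * t)"
  proof (intro mult_mono)
   have "(real (Suc n) + 1) powr (6 * kappa) <= (2 * (real n + 1)) powr (6 * kappa)" using k by (intro powr_mono2) auto
   also have "... = 2 powr (6 * kappa) * P (6 * kappa)" unfolding P_def by (subst powr_mult) auto
   also have "... <= 2 powr 1 * P (6 * kappa)" using k P0 by (intro mult_right_mono powr_mono) auto
   finally show "(real (Suc n) + 1) powr (6 * kappa) <= 2 * P (6 * kappa)" by simp
   have "sqrt (bes_sn nu Q) <= 2 * (CK * P (kappa / 2 - 1/4) + C1 * P (6 * kappa - 1/2))"
    unfolding Q_def P_def by (rule order_trans[OF bes_sn_add mult_left_mono[OF add_mono[OF CK(3) C1(2)[OF R o]]]]) simp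
   also have "... <= 2 * (CK * P (kappa / 2 - 1/4) + C1 * P (kappa / 2 - 1/4))" using C1(1) k by (intro mult_left_mono add_left_mono Pm) auto
   finally show "sqrt (bes_sn nu Q) <= 2 * (CK + C1) * P (kappa / 2 - 1/4)" by (simp add: algebra_simps)
   have "sqrt (bes_sn nu S) <= CK * P (nu / 2 + kappa) * t"
    using CK(4)[where n = n and beta = "%k. cnj (e k)"] unfolding S_def t_def N2_def P_def by simp
   also have "nu / 2 + kappa = 17 * kappa" using k by simp
   finally show "sqrt (bes_sn nu S) <= CK * P (17 * kappa) * t" .
  qed (use CK C1 P0 in \<open>auto simp: bes_sn_nonneg\<close>)
  also have "... = C * (P (6 * kappa) * P (kappa / 2 - 1/4) * P (17 * kappa)) * t" by (simp add: C_def)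
  also have "P (6 * kappa) * P (kappa / 2 - 1/4) * P (17 * kappa) <= P (24 * kappa - 1/4)" unfolding PP using k by (intro Pm) auto
  finally have "t * t <= C * P (24 * kappa - 1/4) * t" using t CK(1) C1(1) by (simp add: C_def mult_left_mono mult_right_mono)
  then have "t <= C * P (24 * kappa - 1/4) \<or> t = 0" using t(1) by (auto simp: mult_le_cancel_right)
  then have "t <= C * P (24 * kappa - 1/4)" using CK(1) C1(1) P0 by (auto simp: C_def)
  then show "sqrt (\<Sum>k<n. (cmod (e k))^2 * rbin (1/2) k) <= C * (real n + 1) powr (24 * kappa - 1/4)"
   unfolding t_def N2_def P_def .
 qed
qed

text \<open>Since n / rbin is of order n^(3/2), the two boundary terms of the zero equation are
  O(n^(1/2 + 12 kappa)). The norm of e, of order n^(24 kappa - 1/4), is divided by sqrt(n rbin), of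
  order n^(1/4), which gives \<omega> of order n^(24 kappa - 1/2); and 24 kappa = 3 nu / 4.\<close>

lemma bes_zero_bound:
 assumes nu: "0 < nu" "nu <= 1/2" and d: "0 < d" "d <= 1"
 obtains C N where "C > 0" "!!n R X. n >= N ==> degree R < n ==> bes_orth nu n (mpp (1/4) n + R) ==>
  poly (mpp (1/4) n + R) X = 0 ==> d * real n <= cmod X ==> d * real n <= cmod (X - of_nat n) ==> d * real n <= cmod (X + of_nat n) ==>
  \<bar>Im X\<bar> <= C * real n powr (3 * nu / 4 - 1/2)"
proof -
 define kappa where "kappa = nu / 32"
 have k: "0 < kappa" "kappa <= nu / 2" "kappa <= 1/6" "kappa <= 1/64" "3 * nu / 4 = 24 * kappa" using nu by (auto simp: kappa_def)
 obtain C2 where C2: "C2 > 0" "!!m n R. degree R < n ==> bes_orth nu n (mpp (1/4) n + R) ==> m <= n ==> n <= m + 1 ==>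
  cmod (bes_E nu ((mpp (1/4) n + R) * mpp (1/4) m)) <= C2 * (real n + 1) powr (12 * kappa - 1)"
  by (rule bes_E_mpp_bound[OF nu k(1,2,3)]) blast
 obtain C7 where C7: "C7 > 0" "!!n R e. degree R < n ==> bes_orth nu n (mpp (1/4) n + R) ==>
  (!!k. e k = bes_E nu ([:0, 1:] * (mpp (1/4) n + R) * mpp (1/4) k) / of_real (rbin (1/2) k)) ==>
  sqrt (\<Sum>k<n. (cmod (e k))^2 * rbin (1/2) k) <= C7 * (real n + 1) powr (24 * kappa - 1/4)"
  by (rule bes_E_shift_bound[OF nu kappa_def]) blast
 obtain CR where CR: "CR > 0" "!!k. (real k + 1) powr (1/2 - 1) <= CR * rbin (1/2) k"
  by (rule powr_le_rbin[of "1/2"]) auto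
 obtain C1 \<epsilon> N1 where Z: "C1 > 0" "\<epsilon> > 0"
  "!!n X e beta \<gamma> \<omega>. n >= N1 ==>
    mp (1/4) n X * (X - beta) = (\<Sum>k<n. e k * mp (1/4) k X) - \<gamma> * mp (1/4) (n - 1) X ==>
    d * real n <= cmod X ==> d * real n <= cmod (X - of_nat n) ==> d * real n <= cmod (X + of_nat n) ==>
    cmod beta <= \<epsilon> * real n ==> cmod \<gamma> <= \<epsilon> * real n ==> \<omega> >= 0 ==> \<omega> <= \<epsilon> ==>
    (\<Sum>k<n. (cmod (e k))^2 * rbin (1/2) k) <= \<omega>^2 * real n * rbin (1/2) (n - 1) ==>
    \<bar>Im X\<bar> <= C1 * (\<omega> + cmod \<gamma> / real n)"
  by (rule mp_zero_location[OF d]) blast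
 define C5 where "C5 = CR * C2"
 define C8 where "C8 = C7 * sqrt (2 * CR)"
 have C58: "C5 > 0" "C8 > 0" using CR C2 C7 by (auto simp: C5_def C8_def)
 \<comment> \<open>11/16 and -1/8 are the values of 12 kappa + 1/2 and 24 kappa - 1/2 at kappa =
   1/64, the largest possible one.\<close>
 have "(%n. C5 * (real n + 1) powr (11/16) / real n) \<longlonglongrightarrow> 0" by real_asymp
 then have "\<forall>\<^sub>F n in sequentially. C5 * (real n + 1) powr (11/16) / real n < \<epsilon>" using Z(2) by (rule order_tendstoD)
 moreover have "(%n. C8 * (real n + 1) powr (- 1/8)) \<longlonglongrightarrow> 0" by real_asymp
 then have "\<forall>\<^sub>F n in sequentially. C8 * (real n + 1) powr (- 1/8) < \<epsilon>" using Z(2) by (rule order_tendstoD)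
 ultimately have "\<forall>\<^sub>F n in sequentially. C5 * (real n + 1) powr (11/16) / real n < \<epsilon> \<and> C8 * (real n + 1) powr (- 1/8) < \<epsilon>"
  by (rule eventually_conj)
 then obtain N2 where N2: "!!n. n >= N2 ==> C5 * (real n + 1) powr (11/16) / real n < \<epsilon>" "!!n. n >= N2 ==> C8 * (real n + 1) powr (- 1/8) < \<epsilon>"
  unfolding eventually_sequentially by blast
 show ?thesis
 proof (rule that[of "C1 * (C8 + 2 * C5)" "max N1 (max N2 1)"])
  show "C1 * (C8 + 2 * C5) > 0" using Z C58 by simp
  fix n and R :: "complex poly" and X
  assume nN: "n >= max N1 (max N2 1)" and R: "degree R < n" and o: "bes_orth nu n (mpp (1/4) n + R)"
   and X0: "poly (mpp (1/4) n + R) X = 0"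
   and dist: "d * real n <= cmod X" "d * real n <= cmod (X - of_nat n)" "d * real n <= cmod (X + of_nat n)"
  define Q where "Q = mpp (1/4) n + R"
  define P where "P a = (real n + 1) powr a" for a
  have P0: "P a >= 0" and PP: "P a * P b = P (a + b)" for a b by (simp_all add: P_def powr_add)
  have Pm: "P a <= P b" if "a <= b" for a b using that by (auto simp: P_def intro!: powr_mono)
  have P1: "P 1 = real n + 1" by (simp add: P_def)
  have n1: "n >= 1" "real n >= 1" using nN by auto
  obtain m where m: "n = Suc m" using n1 by (cases n) auto
  have h: "rbin (1/2) j > 0" for j by (rule rbin_pos) simp
  obtain c where c: "R = (\<Sum>j<n. smult (c j) (mpp (1/4) j))" using mpp_span[OF R] by metis
  \<comment> \<open>Orthogonality to \<open>mpp (1/4) j\<close>, split into its Meixner-Pollaczek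
    part and its error part, makes the coefficients of \<open>R\<close> minus error values: the
    relation from which the zero equation was derived.\<close>
  have cE: "c j * of_real (rbin (2 * (1/4)) j) = - bes_E nu (Q * mpp (1/4) j)" if j: "j < n" for j
  proof -
   have "bes_Lam nu (Q * mpp (1/4) j) = 0" using o j unfolding bes_orth_def Q_def by (simp add: mpp(1))
   moreover have "mpI (1/4) (Q * mpp (1/4) j) = c j * of_real (mpN (1/4) * rbin (1/2) j)"
   proof -
    have "mpI (1/4) (mpp (1/4) n * mpp (1/4) j) = 0" using mp_orth[of "1/4" n j] j by simp
    moreover have "mpI (1/4) (mpp (1/4) j * R) = c j * of_real (mpN (1/4) * rbin (1/2) j)" unfolding c mpI_mpp_sum using j by simp
    ultimately show ?thesis unfolding Q_def distrib_right by (simp add: mpI_add mult.commute[of R])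
   qed
   ultimately have "of_real (1 / (2 * sqrt 2 * pi)) * (c j * of_real (mpN (1/4) * rbin (1/2) j)) + of_real bes_c0 * bes_E nu (Q * mpp (1/4) j) = 0"
    unfolding bes_Lam_E by simp
   moreover have "of_real (1 / (2 * sqrt 2 * pi)) * (c j * of_real (mpN (1/4) * rbin (1/2) j)) = of_real bes_c0 * (c j * of_real (rbin (1/2) j))"
    unfolding bes_c0_def by simp
   ultimately have "of_real bes_c0 * (c j * of_real (rbin (1/2) j) + bes_E nu (Q * mpp (1/4) j)) = 0" by (simp only: distrib_left)
   then have "c j * of_real (rbin (1/2) j) + bes_E nu (Q * mpp (1/4) j) = 0" using bes_c0_pos by simp
   then show ?thesis by (simp add: eq_neg_iff_add_eq_0)
  qed
  define b where "b j = of_nat (Suc m) / of_real (2 * rbin (2 * (1/4)) m) * bes_E nu (Q * mpp (1/4) j)" for j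
  define e where "e j = bes_E nu ([:0, 1:] * (mpp (1/4) n + R) * mpp (1/4) j) / of_real (rbin (1/2) j)" for j
  have eq: "mp (1/4) n X * (X - b m) = (\<Sum>j<n. e j * mp (1/4) j X) - b n * mp (1/4) (n - 1) X"
  proof -
   have "mp (1/4) (Suc m) X * (X - of_nat (Suc m) / of_real (2 * rbin (2 * (1/4)) m) * bes_E nu (Q * mpp (1/4) m))
    = (\<Sum>k<Suc m. bes_E nu ([:0, 1:] * Q * mpp (1/4) k) / of_real (rbin (2 * (1/4)) k) * mp (1/4) k X)
     - of_nat (Suc m) / of_real (2 * rbin (2 * (1/4)) m) * bes_E nu (Q * mpp (1/4) (Suc m)) * mp (1/4) m X"
   proof (rule zero_equation[where c = c])
    show "Q = mpp (1/4) (Suc m) + (\<Sum>k<Suc m. smult (c k) (mpp (1/4) k))" unfolding Q_def c m ..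
    show "c k * of_real (rbin (2 * (1/4)) k) = - bes_E nu (Q * mpp (1/4) k)" if "k < Suc m" for k using cE[of k] that m by simp
    show "poly Q X = 0" using X0 by (simp add: Q_def)
   qed (rule bes_E_add[OF nu] bes_E_smult | simp)+
   moreover have "2 * (1/4) = (1/2 :: real)" by simp
   ultimately show ?thesis unfolding b_def e_def Q_def[symmetric] unfolding m diff_Suc_1 by (simp only:)
  qed
  have hm: "1 / rbin (1/2) m <= CR * P (1/2)"
  proof -
   have 1: "(real m + 1) powr (1/2 - 1) * (real m + 1) powr (1/2) <= CR * rbin (1/2) m * (real m + 1) powr (1/2)"
    using CR(2) by (intro mult_right_mono) auto
   have 2: "(real m + 1) powr (1/2 - 1) * (real m + 1) powr (1/2) = 1" by (simp flip: powr_add)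
   have "1 <= CR * (real m + 1) powr (1/2) * rbin (1/2) m" using 1 unfolding 2 by (simp only: mult_ac)
   then have "1 / rbin (1/2) m <= CR * (real m + 1) powr (1/2)" using h[of m] by (simp add: pos_divide_le_eq)
   also have "... <= CR * P (1/2)" unfolding P_def using CR(1) m by (intro mult_left_mono powr_mono2) auto
   finally show ?thesis .
  qed
  have bb: "cmod (b j) <= C5 * P (12 * kappa + 1/2)" if j: "j = m \<or> j = n" for j
  proof -
   have "cmod (b j) = real n / 2 * (1 / rbin (1/2) m) * cmod (bes_E nu (Q * mpp (1/4) j))"
    using h[of m] unfolding b_def m by (simp add: norm_mult norm_divide del: of_nat_Suc)
   also have "... <= P 1 * (CR * P (1/2)) * (C2 * P (12 * kappa - 1))"
   proof (intro mult_mono hm)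
    show "real n / 2 <= P 1" unfolding P1 by simp
    show "cmod (bes_E nu (Q * mpp (1/4) j)) <= C2 * P (12 * kappa - 1)"
     unfolding Q_def P_def using j m by (intro C2(2)[OF R o]) auto
   qed (use P0 CR(1) C2(1) h[of m] in \<open>auto intro: less_imp_le\<close>)
   also have "... = C5 * (P 1 * P (1/2) * P (12 * kappa - 1))" by (simp add: C5_def mult_ac)
   also have "P 1 * P (1/2) * P (12 * kappa - 1) = P (12 * kappa + 1/2)" unfolding PP by (simp add: algebra_simps)
   finally show ?thesis .
  qed
  have be: "cmod (b j) <= \<epsilon> * real n" if j: "j = m \<or> j = n" for j
  proof -
   have "cmod (b j) <= C5 * P (12 * kappa + 1/2)" by (rule bb[OF j])
   also have "... <= C5 * P (11/16)" using C58 k by (intro mult_left_mono Pm) auto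
   also have "... <= \<epsilon> * real n" using N2(1)[of n] nN n1 unfolding P_def by (simp add: pos_divide_less_eq)
   finally show ?thesis .
  qed
  define \<omega> where "\<omega> = C8 * P (24 * kappa - 1/2)"
  have om: "\<omega> >= 0" "\<omega> <= \<epsilon>"
  proof -
   show "\<omega> >= 0" using C58 P0 by (simp add: \<omega>_def)
   have "\<omega> <= C8 * P (- 1/8)" unfolding \<omega>_def using C58 k by (intro mult_left_mono Pm) auto
   also have "... <= \<epsilon>" using N2(2)[of n] nN unfolding P_def by simp
   finally show "\<omega> <= \<epsilon>" .
  qed
  have es: "(\<Sum>j<n. (cmod (e j))^2 * rbin (1/2) j) <= \<omega>^2 * real n * rbin (1/2) (n - 1)"
  proof -
   define M where "M = (\<Sum>j<n. (cmod (e j))^2 * rbin (1/2) j)"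
   have M0: "M >= 0" unfolding M_def using h by (intro sum_nonneg mult_nonneg_nonneg) (auto intro: less_imp_le)
   have "sqrt M <= C7 * P (24 * kappa - 1/4)" unfolding M_def P_def by (rule C7(2)[OF R o]) (simp add: e_def)
   then have "(sqrt M)^2 <= (C7 * P (24 * kappa - 1/4))^2" using M0 by (intro power_mono) auto
   then have "M <= C7^2 * (P (24 * kappa - 1/4) * P (24 * kappa - 1/4))" using M0 by (simp add: power2_eq_square mult_ac)
   also have "... = C7^2 * (P (24 * kappa - 1/2) * P (24 * kappa - 1/2) * P (1/2))" unfolding PP by (simp add: algebra_simps)
   also have "P (1/2) <= 2 * CR * (real n * rbin (1/2) m)"
   proof -
    have "P (1/2) = P 1 * P (- 1/2)" unfolding PP by simp
    also have "... <= (2 * real n) * (CR * rbin (1/2) m)"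
    proof (intro mult_mono)
     show "P 1 <= 2 * real n" unfolding P1 using n1 by simp
     have "P (- 1/2) <= (real m + 1) powr (1/2 - 1)" unfolding P_def using m by (simp, intro powr_mono2') auto
     then show "P (- 1/2) <= CR * rbin (1/2) m" using CR(2)[of m] by linarith
    qed (use P0 n1 in auto)
    finally show ?thesis by (simp only: mult_ac)
   qed
   then have "C7^2 * (P (24 * kappa - 1/2) * P (24 * kappa - 1/2) * P (1/2)) <= C7^2 * (P (24 * kappa - 1/2) * P (24 * kappa - 1/2) * (2 * CR * (real n * rbin (1/2) m)))"
    using P0 by (intro mult_left_mono) auto
   also have "... = \<omega>^2 * real n * rbin (1/2) m" using CR(1) by (simp add: \<omega>_def C8_def power2_eq_square mult_ac)
   finally show ?thesis unfolding M_def m by simp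
  qed
  have "\<bar>Im X\<bar> <= C1 * (\<omega> + cmod (b n) / real n)"
   by (rule Z(3)[OF _ eq dist be be om es]) (use nN in auto)
  also have "... <= C1 * (C8 * P (24 * kappa - 1/2) + 2 * C5 * P (24 * kappa - 1/2))"
  proof (intro mult_left_mono add_mono)
   show "\<omega> <= C8 * P (24 * kappa - 1/2)" by (simp add: \<omega>_def)
   have "cmod (b n) <= C5 * (P (12 * kappa - 1/2) * P 1)" using bb[of n] unfolding PP by (simp add: algebra_simps)
   also have "... <= C5 * (P (24 * kappa - 1/2) * (2 * real n))"
    using C58 k n1 P0 by (intro mult_left_mono mult_mono Pm) (auto simp: P1)
   finally have "cmod (b n) / real n <= C5 * (P (24 * kappa - 1/2) * (2 * real n)) / real n" by (rule divide_right_mono) simp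
   then show "cmod (b n) / real n <= 2 * C5 * P (24 * kappa - 1/2)" using n1 by simp
  qed (use Z(1) in auto)
  also have "... = C1 * (C8 + 2 * C5) * P (24 * kappa - 1/2)" by (simp add: algebra_simps)
  also have "P (24 * kappa - 1/2) <= real n powr (24 * kappa - 1/2)" unfolding P_def using k n1 by (intro powr_mono2') auto
  finally show "\<bar>Im X\<bar> <= C1 * (C8 + 2 * C5) * real n powr (3 * nu / 4 - 1/2)"
   unfolding k(5) using Z(1) C58 by (simp add: mult_left_mono)
 qed
qed

section \<open>The orthogonal polynomials\<close>

text \<open>The substitution z = pi nu/2 + i pi X, under which the line Im X = nu/2 becomes the
  imaginary axis z = i pi x.\<close>

definition bes_T :: "real => complex poly => complex poly" where
 "bes_T nu q = pcompose q [:of_real (pi * nu / 2), \<i> * of_real pi:]"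

lemma poly_bes_T: "poly (bes_T nu q) X = poly q (of_real (pi * nu / 2) + X * (\<i> * of_real pi))"
 by (simp add: bes_T_def poly_pcompose)

lemma poly_bes_T_line: "poly (bes_T nu q) (of_real x + of_real (nu / 2) * \<i>) = poly q (of_real pi * \<i> * of_real x)"
proof -
 have "of_real (pi * nu / 2) + (of_real x + of_real (nu / 2) * \<i>) * (\<i> * of_real pi) = of_real pi * \<i> * of_real x"
  by (simp add: complex_eq_iff)
 then show ?thesis unfolding poly_bes_T by (simp only:)
qed

lemma bes_Lam_T:
 assumes nu: "0 < nu" "nu <= 1/2"
 shows "bes_Lam nu (bes_T nu (p * monom 1 j)) = (\<Sum>i\<le>degree p. coeff p i * of_real (bes_mom nu (i + j)))"
proof -
 have i: "integrable lborel (%x. (of_real pi * \<i> * of_real x) ^ k * bes_W nu x)" for k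
  using integrable_mult_right[OF integrable_pow_bes_W[OF nu, of k], of "(of_real pi * \<i>) ^ k"]
  by (simp only: power_mult_distrib mult.assoc)
 have "poly (p * monom 1 j) z * w = (\<Sum>i\<le>degree p. coeff p i * (z ^ (i + j) * w))" for z w
  by (simp add: poly_altdef[of p] poly_monom sum_distrib_left sum_distrib_right power_add mult_ac)
 then have "bes_Lam nu (bes_T nu (p * monom 1 j)) = (LBINT x. (\<Sum>i\<le>degree p. coeff p i * ((of_real pi * \<i> * of_real x) ^ (i + j) * bes_W nu x)))"
  unfolding bes_Lam_def poly_bes_T_line by (simp only:)
 also have "... = (\<Sum>i\<le>degree p. LBINT x. coeff p i * ((of_real pi * \<i> * of_real x) ^ (i + j) * bes_W nu x))"
  by (intro Bochner_Integration.integral_sum integrable_mult_right i)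
 also have "... = (\<Sum>i\<le>degree p. coeff p i * of_real (bes_mom nu (i + j)))"
  by (simp only: integral_mult_right_zero bes_W_moment[OF nu])
 finally show ?thesis .
qed

text \<open>The substitution is affine and invertible, so test polynomials of degree below n in X
  are those in z, and the monomials z^j suffice.\<close>

lemma bes_orth_T:
 assumes nu: "0 < nu" "nu <= 1/2"
  and p: "!!j. j < n ==> (\<Sum>i\<le>degree p. coeff p i * of_real (bes_mom nu (i + j))) = 0"
 shows "bes_orth nu n (bes_T nu p)"
 unfolding bes_orth_def
proof (intro allI impI)
 fix g :: "complex poly" assume g: "degree g < n"
 define g' where "g' = pcompose g [:of_real (nu / 2) * \<i>, - \<i> / of_real pi:]"
 have g'deg: "degree g' < n" using degree_pcompose_le[of g "[:of_real (nu / 2) * \<i>, - \<i> / of_real pi:]"] g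
  by (auto simp: g'_def)
 have "poly g = poly (bes_T nu g')"
 proof
  fix X
  have "of_real (nu / 2) * \<i> + (of_real (pi * nu / 2) + X * (\<i> * of_real pi)) * (- \<i> / of_real pi) = X"
   by (simp add: field_simps)
  then show "poly g X = poly (bes_T nu g') X" unfolding poly_bes_T g'_def poly_pcompose by simp
 qed
 then have gT: "g = bes_T nu g'" by (simp only: poly_eq_poly_eq_iff)
 have "p * g' = (\<Sum>j\<le>degree g'. smult (coeff g' j) (p * monom 1 j))"
 proof -
  have "p * g' = p * (\<Sum>j\<le>degree g'. monom (coeff g' j) j)" by (simp only: poly_as_sum_of_monoms)
  also have "... = (\<Sum>j\<le>degree g'. p * monom (coeff g' j) j)" by (rule sum_distrib_left)
  also have "... = (\<Sum>j\<le>degree g'. smult (coeff g' j) (p * monom 1 j))"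
   by (intro sum.cong refl) (simp add: mult_smult_right[symmetric] smult_monom)
  finally show ?thesis .
 qed
 then have "bes_T nu p * g = (\<Sum>j\<le>degree g'. smult (coeff g' j) (bes_T nu (p * monom 1 j)))"
  unfolding gT by (simp only: bes_T_def pcompose_mult[symmetric] pcompose_sum pcompose_smult)
 then have "bes_Lam nu (bes_T nu p * g) = (\<Sum>j\<le>degree g'. coeff g' j * bes_Lam nu (bes_T nu (p * monom 1 j)))"
  by (simp only: bes_Lam_sum[OF nu finite_atMost] bes_Lam_smult)
 also have "... = 0" unfolding bes_Lam_T[OF nu] using p g'deg by (intro sum.neutral) auto
 finally show "bes_Lam nu (bes_T nu p * g) = 0" .
qed

text \<open>Testing with the reflection of f, coercivity forces its norm to vanish.\<close>

lemma bes_orth_imp_0: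
 assumes nu: "0 < nu" "nu <= 1/2" and f: "degree f < n" "bes_orth nu n f"
 shows "f = 0"
proof -
 obtain c where c: "c > 0" "!!q. c * bes_sn nu q <= cmod (bes_Lam nu (q * bes_star nu q))" by (rule bes_Lam_coercive[OF nu]) blast
 have "degree (bes_star nu f) < n" using bes_star_props(1)[of nu f] f(1) by simp
 then have "c * bes_sn nu f <= 0" using c(2)[of f] f(2) by (simp add: bes_orth_def)
 then have "bes_sn nu f = 0" using c(1) bes_sn_nonneg[of nu f] by (simp add: mult_le_0_iff)
 then show ?thesis by (rule bes_sn_eq_0)
qed

text \<open>A kernel vector of the Hankel matrix is a polynomial of degree below n that is
  orthogonal to all such polynomials. This is the nonvanishing of the Hankel determinant, for every
  n.\<close>

lemma bes_mom_Hankel_inj: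
 assumes nu: "0 < nu" "nu <= 1/2" and v: "!!i. i < n ==> (\<Sum>j<n. bes_mom nu (i + j) * v j) = 0"
 shows "\<forall>j<n. v j = 0"
proof (cases "n = 0")
 case False
 define f where "f = (\<Sum>j<n. monom (complex_of_real (v j)) j)"
 have cf: "coeff f i = (if i < n then of_real (v i) else 0)" for i
  unfolding f_def coeff_sum by (simp add: if_distrib sum.delta cong: if_cong)
 have df: "degree f < n" using False unfolding f_def by (intro degree_sum_less) (auto intro: le_less_trans[OF degree_monom_le])
 have "(\<Sum>i\<le>degree f. coeff f i * of_real (bes_mom nu (i + j))) = 0" if j: "j < n" for j
 proof -
  have "(\<Sum>i\<le>degree f. coeff f i * of_real (bes_mom nu (i + j))) = (\<Sum>i<n. coeff f i * of_real (bes_mom nu (i + j)))"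
   using df by (intro sum.mono_neutral_left) (auto simp: coeff_eq_0)
  also have "... = of_real (\<Sum>i<n. bes_mom nu (j + i) * v i)" by (simp add: cf mult.commute add.commute)
  finally show ?thesis using v[OF j] by simp
 qed
 then have o: "bes_orth nu n (bes_T nu f)" by (rule bes_orth_T[OF nu])
 have "degree (bes_T nu f) < n" using df degree_pcompose_le[of f "[:of_real (pi * nu / 2), \<i> * of_real pi:]"] by (simp add: bes_T_def)
 then have T0: "bes_T nu f = 0" using o by (rule bes_orth_imp_0[OF nu])
 have "f = 0" using T0 unfolding bes_T_def by (simp add: pcompose_eq_0_iff)
 then show ?thesis using cf by (metis coeff_0 of_real_eq_0_iff)
qed simp

lemma poly_mom_J_integral:
 assumes "0 < nu" "nu <= 1" "s > 0"
 shows "((%x. poly p x * x ^ j * Bessel_J nu x * exp (- (s * x))) has_integral (\<Sum>i\<le>degree p. coeff p i * mom_J nu (i + j) s)) {0..}"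
proof -
 have i: "((%x. x ^ k * Bessel_J nu x * exp (- (s * x))) has_integral mom_J nu k s) {0..}" for k
  using set_borel_integral_eq_integral[OF set_borel_integrable_Bessel(1)[OF assms, of k]]
  unfolding mom_J_def by (simp add: integrable_integral)
 have "poly p x * x ^ j * Bessel_J nu x * exp (- (s * x)) = (\<Sum>i\<le>degree p. coeff p i * (x ^ (i + j) * Bessel_J nu x * exp (- (s * x))))" for x
  by (simp add: poly_altdef[of p] sum_distrib_left sum_distrib_right power_add mult_ac)
 then show ?thesis by (simp only:) (intro has_integral_sum has_integral_mult_right i finite_atMost)
qed

text \<open>Orthogonality of a monic polynomial is the Hankel system for its lower coefficients. As
  s tends to 0 the entries tend to B times \<open>bes_mom\<close>; the factor B cancels, and the
  limiting system is nonsingular for every n.\<close>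

lemma Bessel_OP_exists:
 assumes nu: "0 < nu" "nu <= 1/2"
 obtains P where "Bessel_OP nu n P" "degree P = n" "lead_coeff P = 1"
  "!!j. j < n ==> (\<Sum>i\<le>n. coeff P i * bes_mom nu (i + j)) = 0"
proof -
 have nu1: "0 < nu" "nu <= 1" using nu by auto
 obtain B where B: "B \<noteq> 0" "!!j. (mom_J nu j \<longlongrightarrow> B * bes_mom nu j) (at_right 0)" by (rule mom_J_limit[OF nu1]) blast
 define A where "A s i j = mom_J nu (i + j) s" for s i j
 show ?thesis
 proof (rule lin_sys_limit[of n A "%i j. B * bes_mom nu (i + j)" "at_right 0" "%s i. - mom_J nu (i + n) s" "%i. - (B * bes_mom nu (i + n))"])
  show "((%s. A s i j) \<longlongrightarrow> B * bes_mom nu (i + j)) (at_right 0)" for i j unfolding A_def by (rule B(2))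
  show "((%s. - mom_J nu (i + n) s) \<longlongrightarrow> - (B * bes_mom nu (i + n))) (at_right 0)" for i by (intro tendsto_minus B(2))
  show "\<forall>j<n. v j = 0" if v: "!!i. i < n ==> (\<Sum>j<n. (B * bes_mom nu (i + j)) * v j) = 0" for v
  proof (rule bes_mom_Hankel_inj[OF nu])
   fix i assume "i < n"
   then have "B * (\<Sum>j<n. bes_mom nu (i + j) * v j) = 0" using v[of i] by (simp only: sum_distrib_left mult.assoc)
   then show "(\<Sum>j<n. bes_mom nu (i + j) * v j) = 0" using B(1) by simp
  qed
 next
 fix c C
 assume c: "!!i. i < n ==> (\<Sum>j<n. (B * bes_mom nu (i + j)) * c j) = - (B * bes_mom nu (i + n))"
  and lim: "!!j. j < n ==> ((%s. C s j) \<longlongrightarrow> c j) (at_right 0)"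
  and sol: "\<forall>\<^sub>F s in at_right 0. \<forall>v. (\<forall>i<n. (\<Sum>j<n. A s i j * v j) = - mom_J nu (i + n) s) \<longleftrightarrow> (\<forall>j<n. v j = C s j)"
 define mk :: "(nat => real) => real poly" where "mk v = monom 1 n + (\<Sum>j<n. monom (v j) j)" for v
 have cmk: "coeff (mk v) i = (if i = n then 1 else if i < n then v i else 0)" for v i
 proof -
  have "(\<Sum>j<n. coeff (monom (v j) j) i) = (if i < n then v i else 0)" by simp
  then show ?thesis unfolding mk_def coeff_add coeff_sum by simp
 qed
 have dmk: "degree (mk v) = n" for v
 proof (rule antisym)
  show "degree (mk v) <= n" by (rule degree_le) (simp add: cmk)
  show "n <= degree (mk v)" by (rule le_degree) (simp add: cmk)
 qed
 have mk_eq: "p = mk v" if "degree p = n" "lead_coeff p = 1" "\<forall>j<n. coeff p j = v j" for p v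
 proof (rule poly_eqI)
  fix i
  show "coeff p i = coeff (mk v) i" unfolding cmk using that coeff_eq_0[of p i] by (cases "i < n") auto
 qed
 have sumn: "(\<Sum>i\<le>n. coeff p i * M i) = M n + (\<Sum>i<n. M i * coeff p i)" if "degree p = n" "lead_coeff p = 1" for p and M :: "nat => real"
  using that by (simp add: lessThan_Suc_atMost[symmetric] mult.commute)
 have monic: "monic_OP nu s n p \<longleftrightarrow> p = mk (C s)"
  if s: "s > 0" and sol: "\<forall>v. (\<forall>i<n. (\<Sum>j<n. A s i j * v j) = - mom_J nu (i + n) s) \<longleftrightarrow> (\<forall>j<n. v j = C s j)" for s p
 proof -
  have hi: "((%x. poly p x * x ^ i * Bessel_J nu x * exp (- (s * x))) has_integral 0) {0..} \<longleftrightarrow> (\<Sum>j<n. A s i j * coeff p j) = - mom_J nu (i + n) s"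
   if p: "degree p = n" "lead_coeff p = 1" for p i
  proof -
   have v: "(\<Sum>j\<le>degree p. coeff p j * mom_J nu (j + i) s) = mom_J nu (n + i) s + (\<Sum>j<n. mom_J nu (j + i) s * coeff p j)"
    using sumn[OF p, of "%j. mom_J nu (j + i) s"] p(1) by simp
   have "((%x. poly p x * x ^ i * Bessel_J nu x * exp (- (s * x))) has_integral 0) {0..} \<longleftrightarrow> (\<Sum>j\<le>degree p. coeff p j * mom_J nu (j + i) s) = 0"
    using poly_mom_J_integral[OF nu1 s, of p i] has_integral_unique by metis
   moreover have "a + x = 0 \<longleftrightarrow> x = - a" for a x :: real by auto
   ultimately show ?thesis unfolding v A_def by (simp only: add.commute[of _ i])
  qed
  show ?thesis
  proof
   assume "monic_OP nu s n p"
   then have p: "degree p = n" "lead_coeff p = 1"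
    and "\<forall>j<n. ((%x. poly p x * x ^ j * Bessel_J nu x * exp (- (s * x))) has_integral 0) {0..}"
    unfolding monic_OP_def by blast+
   then have "\<forall>i<n. (\<Sum>j<n. A s i j * coeff p j) = - mom_J nu (i + n) s" by (simp only: hi[OF p])
   then have "\<forall>j<n. coeff p j = C s j" using spec[OF sol, of "coeff p"] by blast
   then show "p = mk (C s)" by (rule mk_eq[OF p(1,2)])
  next
   assume p: "p = mk (C s)"
   have d: "degree p = n" "lead_coeff p = 1" by (simp_all add: p dmk cmk)
   have "\<forall>j<n. coeff p j = C s j" by (simp add: p cmk)
   then have "\<forall>i<n. (\<Sum>j<n. A s i j * coeff p j) = - mom_J nu (i + n) s" using spec[OF sol, of "coeff p"] by blast
   then show "monic_OP nu s n p" unfolding monic_OP_def using d by (simp only: hi[OF d] simp_thms)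
  qed
 qed
 have ev: "\<forall>\<^sub>F s in at_right 0. \<forall>p. monic_OP nu s n p \<longleftrightarrow> p = mk (C s)"
  using sol eventually_at_right_less[of 0]
 proof eventually_elim
  case (elim s)
  show ?case using monic[OF elim(2,1)] by blast
 qed
 show ?thesis
 proof (rule that[of "mk c"])
  show "degree (mk c) = n" by (rule dmk)
  show "lead_coeff (mk c) = 1" by (simp add: dmk cmk)
  show "(\<Sum>i\<le>n. coeff (mk c) i * bes_mom nu (i + j)) = 0" if j: "j < n" for j
  proof -
   have e: "(\<Sum>i<n. bes_mom nu (i + j) * coeff (mk c) i) = (\<Sum>i<n. bes_mom nu (j + i) * c i)"
    by (intro sum.cong refl) (simp add: cmk add.commute)
   have s: "(\<Sum>i\<le>n. coeff (mk c) i * bes_mom nu (i + j)) = bes_mom nu (n + j) + (\<Sum>i<n. bes_mom nu (i + j) * coeff (mk c) i)"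
    by (rule sumn[OF dmk]) (simp add: dmk cmk)
   have "B * (\<Sum>i<n. bes_mom nu (j + i) * c i) = - (B * bes_mom nu (j + n))"
    using c[OF j] by (simp only: sum_distrib_left mult.assoc)
   then have "B * (bes_mom nu (j + n) + (\<Sum>i<n. bes_mom nu (j + i) * c i)) = 0" by (simp only: distrib_left add.right_inverse)
   then show ?thesis unfolding s e add.commute[of n j] using B(1) by simp
  qed
  show "Bessel_OP nu n (mk c)" unfolding Bessel_OP_def
  proof (intro conjI allI)
   show "\<forall>\<^sub>F s in at_right 0. \<exists>!p. monic_OP nu s n p" using ev by eventually_elim simp
   fix x
   have pm: "poly (mk v) x = x ^ n + (\<Sum>j<n. v j * x ^ j)" for v by (simp add: mk_def poly_sum poly_monom)
   have "((%s. poly (mk (C s)) x) \<longlongrightarrow> poly (mk c) x) (at_right 0)"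
    unfolding pm by (intro tendsto_intros lim) auto
   moreover have "\<forall>\<^sub>F s in at_right 0. poly (mk (C s)) x = poly (THE p. monic_OP nu s n p) x"
    using ev by eventually_elim simp
   ultimately show "((%s. poly (THE p. monic_OP nu s n p) x) \<longlongrightarrow> poly (mk c) x) (at_right 0)"
    by (rule Lim_transform_eventually)
  qed
 qed
qed
qed

text \<open>The exponent falls short of nu - 1/2 by nu/4, and n^(nu/4) outgrows the power of the
  logarithm.\<close>

lemma powr_le_zero_rate:
 assumes "0 < nu"
 obtains N where "!!n. n >= N ==> real n powr (3 * nu / 4 - 1/2) <= zero_rate nu n"
proof -
 have "((%n. ln (real n) powr (nu + 1/2) / real n powr (nu / 4)) \<longlongrightarrow> 0) sequentially" using assms by real_asymp
 then have "\<forall>\<^sub>F n in sequentially. ln (real n) powr (nu + 1/2) / real n powr (nu / 4) < 1" by (rule order_tendstoD) simp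
 then obtain N where N: "!!n. n >= N ==> ln (real n) powr (nu + 1/2) / real n powr (nu / 4) < 1" unfolding eventually_sequentially by blast
 show ?thesis
 proof (rule that[of "max N 2"])
  fix n assume n: "n >= max N 2"
  then have n0: "real n > 0" "ln (real n) > 0" by auto
  have "ln (real n) powr (nu + 1/2) <= real n powr (nu / 4)" using N[of n] n n0 by (simp add: pos_divide_less_eq less_imp_le)
  then have "real n powr (nu - 1/2) / real n powr (nu / 4) <= real n powr (nu - 1/2) / ln (real n) powr (nu + 1/2)"
   using n0 by (intro divide_left_mono) auto
  moreover have "real n powr (nu - 1/2) / real n powr (nu / 4) = real n powr (nu - 1/2 - nu / 4)" by (rule powr_diff[symmetric])
  moreover have "nu - 1/2 - nu / 4 = 3 * nu / 4 - 1/2" by simp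
  ultimately show "real n powr (3 * nu / 4 - 1/2) <= zero_rate nu n" unfolding zero_rate_def by simp
 qed
qed

theorem theorem2p2:
  fixes \<nu> \<delta> :: real
  assumes "0 < \<nu>" and "\<nu> \<le> 1/2" and "\<delta> > 0"
  shows "\<exists>(n0::nat) (C::real). C > 0 \<and>
    (\<forall>n\<ge>n0. \<exists>P. Bessel_OP \<nu> n P \<and>
      (\<forall>z::complex.
         poly (map_poly complex_of_real P) z = 0 \<longrightarrow>
         z \<notin> ball 0 (real n * \<delta>) \<longrightarrow>
         z \<notin> ball (complex_of_real (real n * pi) * \<i>) (real n * \<delta>) \<longrightarrow>
         z \<notin> ball (- (complex_of_real (real n * pi) * \<i>)) (real n * \<delta>) \<longrightarrow>
         \<bar>Re z - \<nu> * pi / 2\<bar> \<le> C * zero_rate \<nu> n))"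
proof -
 note nu = assms(1,2)
 \<comment> \<open>A radius n \<delta> in z is n \<delta> / pi in X. Half of it is kept as d n, the
   other half absorbs the translation by nu/2; the cap at 1 is a condition of the zero
   bound.\<close>
 define d where "d = min 1 (\<delta> / (2 * pi))"
 have d: "0 < d" "d <= 1" "d <= \<delta> / (2 * pi)" using assms(3) by (auto simp: d_def)
 obtain C N where C: "C > 0" "!!n R X. n >= N ==> degree R < n ==> bes_orth \<nu> n (mpp (1/4) n + R) ==>
  poly (mpp (1/4) n + R) X = 0 ==> d * real n <= cmod X ==> d * real n <= cmod (X - of_nat n) ==> d * real n <= cmod (X + of_nat n) ==>
  \<bar>Im X\<bar> <= C * real n powr (3 * \<nu> / 4 - 1/2)"
  by (rule bes_zero_bound[OF nu d(1,2)]) blast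
 obtain N2 where N2: "!!n. n >= N2 ==> real n powr (3 * \<nu> / 4 - 1/2) <= zero_rate \<nu> n" by (rule powr_le_zero_rate[OF nu(1)]) blast
 \<comment> \<open>From this index on, half the radius n \<delta> / (2 pi) is at least 1/4, hence at
   least \<nu>/2.\<close>
 define N3 where "N3 = nat \<lceil>pi / (2 * \<delta>)\<rceil>"
 show ?thesis
 proof (intro exI[of _ "max 1 (max N (max N2 N3))"] exI[of _ "pi * C"] conjI allI impI)
  show "pi * C > 0" using C(1) by simp
  fix n assume n: "n >= max 1 (max N (max N2 N3))"
  then have n1: "n >= 1" "n >= N" "n >= N2" "n >= N3" by auto
  have "pi / (2 * \<delta>) <= real n" using n1(4) unfolding N3_def by linarith
  then have n4: "1/4 <= real n * (\<delta> / (2 * pi))" using assms(3) by (simp add: field_simps)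
  obtain P where P: "Bessel_OP \<nu> n P" "degree P = n" "lead_coeff P = 1"
   "!!j. j < n ==> (\<Sum>i\<le>n. coeff P i * bes_mom \<nu> (i + j)) = 0"
   by (rule Bessel_OP_exists[OF nu, of n]) blast
  show "\<exists>P. Bessel_OP \<nu> n P \<and>
   (\<forall>z::complex.
     poly (map_poly complex_of_real P) z = 0 \<longrightarrow>
     z \<notin> ball 0 (real n * \<delta>) \<longrightarrow>
     z \<notin> ball (complex_of_real (real n * pi) * \<i>) (real n * \<delta>) \<longrightarrow>
     z \<notin> ball (- (complex_of_real (real n * pi) * \<i>)) (real n * \<delta>) \<longrightarrow>
     \<bar>Re z - \<nu> * pi / 2\<bar> <= pi * C * zero_rate \<nu> n)"
  proof (intro exI[of _ P] conjI allI impI P(1))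
   fix z :: complex
   assume z0: "poly (map_poly complex_of_real P) z = 0" and z1: "z \<notin> ball 0 (real n * \<delta>)"
    "z \<notin> ball (complex_of_real (real n * pi) * \<i>) (real n * \<delta>)" "z \<notin> ball (- (complex_of_real (real n * pi) * \<i>)) (real n * \<delta>)"
   define p where "p = map_poly complex_of_real P"
   have cp: "coeff p i = of_real (coeff P i)" for i by (simp add: p_def coeff_map_poly)
   have dp: "degree p = n" unfolding p_def using P(2) by (simp add: degree_map_poly)
   \<comment> \<open>Adjusts the leading coefficient to 2^n / n!, that of
     \<open>mpp (1/4) n\<close>; the substitution has contributed (i pi)^n.\<close>
   define a where "a = (2 ^ n / fact n) / (\<i> * of_real pi) ^ n"
   define R where "R = smult a (bes_T \<nu> p) - mpp (1/4) n"
   have QR: "mpp (1/4) n + R = smult a (bes_T \<nu> p)" by (simp add: R_def)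
   have dT: "degree (bes_T \<nu> p) = n" by (simp add: bes_T_def degree_pcompose dp)
   have lT: "coeff (bes_T \<nu> p) n = (\<i> * of_real pi) ^ n"
   proof -
    have "lead_coeff (bes_T \<nu> p) = lead_coeff p * (\<i> * of_real pi) ^ degree p"
     unfolding bes_T_def by (subst lead_coeff_comp) auto
    then show ?thesis using P(2,3) unfolding dT dp cp by simp
   qed
   have R: "degree R < n"
   proof -
    have "degree R <= n" unfolding R_def by (intro degree_diff_le order_trans[OF degree_smult_le]) (auto simp: dT mpp(1))
    moreover have "coeff R n = 0" using mpp(1,2)[of "1/4" n] by (simp add: R_def lT a_def)
    ultimately have "R = 0 \<or> degree R < n" by (rule eq_zero_or_degree_less)
    then show ?thesis using n1(1) by auto
   qed
   have "(\<Sum>i\<le>degree p. coeff p i * of_real (bes_mom \<nu> (i + j))) = 0" if "j < n" for j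
   proof -
    have "(\<Sum>i\<le>degree p. coeff p i * of_real (bes_mom \<nu> (i + j))) = of_real (\<Sum>i\<le>n. coeff P i * bes_mom \<nu> (i + j))" by (simp add: dp cp)
    then show ?thesis using P(4)[OF that] by simp
   qed
   then have "bes_orth \<nu> n (bes_T \<nu> p)" by (rule bes_orth_T[OF nu])
   then have o: "bes_orth \<nu> n (mpp (1/4) n + R)" unfolding QR by (simp add: bes_orth_def bes_Lam_smult)
   \<comment> \<open>The inverse substitution. The centers 0, i pi n and -i pi n go to 0, n and -n,
     up to the translation by i \<nu>/2.\<close>
   define X where "X = - \<i> * z / of_real pi + of_real (\<nu> / 2) * \<i>"
   have "of_real (pi * \<nu> / 2) + X * (\<i> * of_real pi) = z" by (simp add: X_def field_simps)
   then have X0: "poly (mpp (1/4) n + R) X = 0" unfolding QR using z0 by (simp add: poly_bes_T p_def)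
   have dist: "d * real n <= cmod (X - w)" if "real n * \<delta> <= cmod (z - \<i> * of_real pi * w)" for w
   proof -
    have "X - w = - \<i> * (z - \<i> * of_real pi * w) / of_real pi + of_real (\<nu> / 2) * \<i>" by (simp add: X_def field_simps)
    then have "cmod (- \<i> * (z - \<i> * of_real pi * w) / of_real pi) <= cmod (X - w) + cmod (of_real (\<nu> / 2) * \<i>)"
     using norm_triangle_ineq4[of "X - w" "of_real (\<nu> / 2) * \<i>"] by simp
    then have "cmod (z - \<i> * of_real pi * w) / pi <= cmod (X - w) + \<nu> / 2" using nu by (simp add: norm_mult norm_divide)
    moreover have "real n * \<delta> / pi <= cmod (z - \<i> * of_real pi * w) / pi" using that by (intro divide_right_mono) auto
    moreover have "real n * \<delta> / pi = real n * (\<delta> / (2 * pi)) + real n * (\<delta> / (2 * pi))" by simp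
    moreover have "d * real n <= real n * (\<delta> / (2 * pi))" using d(3) mult_right_mono[of d "\<delta> / (2 * pi)" "real n"] by (simp add: mult.commute)
    ultimately show ?thesis using n4 nu by linarith
   qed
   have "\<bar>Im X\<bar> <= C * real n powr (3 * \<nu> / 4 - 1/2)"
   proof (rule C(2)[OF n1(2) R o X0])
    show "d * real n <= cmod X" using dist[of 0] z1(1) by (simp add: not_less)
    show "d * real n <= cmod (X - of_nat n)" using dist[of "of_nat n"] z1(2) by (simp add: not_less dist_norm norm_minus_commute mult_ac)
    show "d * real n <= cmod (X + of_nat n)" using dist[of "- of_nat n"] z1(3)
     by (simp add: not_less dist_norm norm_minus_commute[of "- _" z] mult_ac)
   qed
   also have "... <= C * zero_rate \<nu> n" using C(1) N2[OF n1(3)] by (intro mult_left_mono) auto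
   finally have "pi * \<bar>Im X\<bar> <= pi * (C * zero_rate \<nu> n)" by (intro mult_left_mono) auto
   moreover have "Im X = \<nu> / 2 - Re z / pi" by (simp add: X_def)
   then have "\<bar>Re z - \<nu> * pi / 2\<bar> = \<bar>pi * Im X\<bar>" by (simp add: right_diff_distrib abs_minus_commute mult.commute)
   then have "\<bar>Re z - \<nu> * pi / 2\<bar> = pi * \<bar>Im X\<bar>" by (simp add: abs_mult)
   ultimately show "\<bar>Re z - \<nu> * pi / 2\<bar> <= pi * C * zero_rate \<nu> n" by simp
  qed
 qed
qed

end
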